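(* Let $(X,J)$ be an almost complex surface with Lipschitz-continuous structure $J$ and let $u:\Delta\to X$ be a primitive $J$-holomorphic map with a singularity at $z=0$ of the type $(p_0,\dots,p_l)$. Then the cusp index of $u(\Delta)$ at $u(0)$ (of the branch of $u$ at $z=0$) is given by the formula $$\varkappa=\frac12\sum_{i=1}^l(d_{i-1}-d_i)(p_i-1),\qquad d_i:=\gcd(p_0,\dots,p_i).$$
   Context: $\Delta_r=\{z\in\mathbb C:|z|<r\}$, $\Delta=\Delta_1$. An almost complex surface is a real 4-manifold with $J\in\mathrm{End}(TX)$, $J^2=-\mathrm{id}$, oriented by $J$. A $J$-holomorphic map is a $\mathcal C^1$-map with $\partial_xu+J(u)\partial_yu=0$; it is primitive if there are no disjoint non-empty open $U_1,U_2$ in its domain with $u(U_1)=u(U_2)$. $O(|z|^{k+\alpha})$ means: for every $0<\alpha<1$, as $z\to0$. Choose local coordinates near $u(0)$ identifying it with $0$ in the unit ball $B\subset\mathbb C^2$ and with $J(0)=J_{st}$ (multiplication by $i$). Singularity type. If $u(z)=v_0z^\mu+O(|z|^{\mu+\alpha})$ with $v_0\ne0$, $\mu\geq2$, the singularity type of $u$ at $0$ is the uniquely determined sequence $p_0=\mu<p_1<\dots<p_l$ for which $d_i=\gcd(p_0,\dots,p_i)$ is strictly decreasing with $d_l=1$, and there exist non-zero vectors $v_1,\dots,v_l$ orthogonal to $v_0$, primitive $J$-holomorphic maps $u_i:\Delta_r\to B$ ($i=0,\dots,l$, some $r>0$) and a polynomial $\phi(z)=z+O(z^2)$ with $u_0(z)=v_0z+O(|z|^{1+\alpha})$,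 $u_i(z)=u_{i-1}(z^{d_{i-1}/d_i})+v_iz^{p_i/d_i}+O(|z|^{p_i/d_i+\alpha})$ for $1\le i\le l$, $u(\phi(z))-u_i(z^{d_i})=v_{i+1}z^{p_{i+1}}+O(|z|^{p_{i+1}+\alpha})$ for $0\le i\le l-1$, and $u_l=u\circ\phi$. Cusp index. For small $r>0$ let $D$ be the component of $u^{-1}(B_r)$ containing $0$ and $\gamma_r=u(D)\cap S^3_r$, $S^3_r=\partial B_r$; it is an embedded curve transverse to the plane field $F_r=TS^3_r\cap J(TS^3_r)$. Moving $\gamma_r$ slightly along a non-vanishing section of $F_r$ gives a disjoint curve $\gamma_r'$, and the Bennequin index $b$ is the linking number of $\gamma_r$ and $\gamma'_r$ in $S^3_r$ (independent of small $r$ and of the section). The cusp index is $\varkappa=(b+1)/2$; equivalently, the sum of intersection indices of the self-intersection points of a small cusp-free $J$-holomorphic perturbation $u(z)+z\,w(z)$ of the branch ($w(0)$ small and not collinear to $v_0$). *)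

theory Defs
  imports
    "HOL-Analysis.Analysis"
    "HOL-Homology.Homology"
    "HOL-Computational_Algebra.Polynomial"
    "HOL-Library.Landau_Symbols"
begin

section \<open>Real 4-manifolds and almost complex structures\<close>

text \<open>Charts take values in \<^typ>\<open>complex^2\<close>, regarded as a real 4-dimensional vector space.\<close>

type_synonym 'a chart = "'a set \<times> ('a \<Rightarrow> complex^2)"

definition chart_inv :: "'a chart \<Rightarrow> complex^2 \<Rightarrow> 'a" where
  "chart_inv c = inv_into (fst c) (snd c)"

definition is_chart :: "'a::topological_space chart \<Rightarrow> bool" where
  "is_chart c \<longleftrightarrow> open (fst c) \<and> open (snd c ` fst c) \<and>
     homeomorphism (fst c) (snd c ` fst c) (snd c) (chart_inv c)"

primrec Ck_on :: "nat \<Rightarrow> ('b::real_normed_vector \<Rightarrow> 'c::real_normed_vector) \<Rightarrow> 'b set \<Rightarrow> bool" where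
  "Ck_on 0 f S \<longleftrightarrow> continuous_on S f"
| "Ck_on (Suc k) f S \<longleftrightarrow>
     (\<exists>f'. (\<forall>x\<in>S. (f has_derivative f' x) (at x)) \<and> (\<forall>v. Ck_on k (\<lambda>x. f' x v) S))"

definition transition :: "'a chart \<Rightarrow> 'a chart \<Rightarrow> complex^2 \<Rightarrow> complex^2" where
  "transition c d = snd d \<circ> chart_inv c"

definition compatible :: "'a chart \<Rightarrow> 'a chart \<Rightarrow> bool" where
  "compatible c d \<longleftrightarrow>
     (\<forall>k. Ck_on k (transition c d) (snd c ` (fst c \<inter> fst d))) \<and>
     (\<forall>k. Ck_on k (transition d c) (snd d ` (fst c \<inter> fst d)))"

text \<open>A smooth structure is a maximal smooth atlas; its members are all the local coordinate systems.\<close>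

definition smooth_structure :: "'a::{t2_space,second_countable_topology} chart set \<Rightarrow> bool" where
  "smooth_structure A \<longleftrightarrow>
     (\<forall>c\<in>A. is_chart c) \<and> (\<Union>c\<in>A. fst c) = UNIV \<and>
     (\<forall>c\<in>A. \<forall>d\<in>A. compatible c d) \<and>
     (\<forall>c. is_chart c \<and> (\<forall>d\<in>A. compatible c d) \<longrightarrow> c \<in> A)"

text \<open>An endomorphism field \<open>J\<close> of the tangent bundle is given by its representations \<open>J c x\<close> in the
  charts \<open>c\<close> around \<open>x\<close>, which are intertwined by the differentials of the transition maps. The value
  \<open>J c x\<close> is irrelevant unless \<open>c \<in> A\<close> and \<open>x \<in> fst c\<close>.\<close>

type_synonym 'a endo_field = "'a chart \<Rightarrow> 'a \<Rightarrow> (complex^2) \<Rightarrow>\<^sub>L (complex^2)"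

definition almost_complex :: "'a chart set \<Rightarrow> 'a endo_field \<Rightarrow> bool" where
  "almost_complex A J \<longleftrightarrow>
     (\<forall>c\<in>A. \<forall>x\<in>fst c. \<forall>\<xi>. J c x (J c x \<xi>) = - \<xi>) \<and>
     (\<forall>c\<in>A. \<forall>d\<in>A. \<forall>x\<in>fst c \<inter> fst d. \<forall>\<xi>.
        J d x (frechet_derivative (transition c d) (at (snd c x)) \<xi>) =
        frechet_derivative (transition c d) (at (snd c x)) (J c x \<xi>))"

definition coord_J :: "'a endo_field \<Rightarrow> 'a chart \<Rightarrow> complex^2 \<Rightarrow> (complex^2) \<Rightarrow>\<^sub>L (complex^2)" where
  "coord_J J c y = J c (chart_inv c y)"

text \<open>Lipschitz continuity on a manifold without a distinguished metric is a local condition, in charts.\<close>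

definition lipschitz_field :: "'a chart set \<Rightarrow> 'a endo_field \<Rightarrow> bool" where
  "lipschitz_field A J \<longleftrightarrow>
     (\<forall>c\<in>A. \<forall>y\<in>snd c ` fst c. \<exists>e>0. \<exists>L.
        ball y e \<subseteq> snd c ` fst c \<and> L-lipschitz_on (ball y e) (coord_J J c))"

definition Lipschitz_almost_complex_surface ::
    "'a::{t2_space,second_countable_topology} chart set \<Rightarrow> 'a endo_field \<Rightarrow> bool" where
  "Lipschitz_almost_complex_surface A J \<longleftrightarrow>
     smooth_structure A \<and> almost_complex A J \<and> lipschitz_field A J"


section \<open>Pseudoholomorphic maps\<close>

text \<open>First for maps into (an open part of) \<^typ>\<open>complex^2\<close> with a matrix-valued structure \<open>J\<close>;
  \<open>f' z 1\<close> and \<open>f' z \<i>\<close> are the two partial derivatives.\<close>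

definition J_holomorphic_on ::
    "(complex^2 \<Rightarrow> (complex^2) \<Rightarrow>\<^sub>L (complex^2)) \<Rightarrow> (complex \<Rightarrow> complex^2) \<Rightarrow> complex set \<Rightarrow> bool" where
  "J_holomorphic_on J f S \<longleftrightarrow>
     (\<exists>f' :: complex \<Rightarrow> complex \<Rightarrow>\<^sub>L (complex^2).
        continuous_on S f' \<and>
        (\<forall>z\<in>S. (f has_derivative blinfun_apply (f' z)) (at z) \<and>
               f' z 1 + J (f z) (f' z \<i>) = 0))"

definition pseudoholomorphic_on ::
    "'a::topological_space chart set \<Rightarrow> 'a endo_field \<Rightarrow> (complex \<Rightarrow> 'a) \<Rightarrow> complex set \<Rightarrow> bool" where
  "pseudoholomorphic_on A J u S \<longleftrightarrow> continuous_on S u \<and>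
     (\<forall>c\<in>A. J_holomorphic_on (coord_J J c) (snd c \<circ> u) {z\<in>S. u z \<in> fst c})"

definition primitive_on :: "(complex \<Rightarrow> 'b) \<Rightarrow> complex set \<Rightarrow> bool" where
  "primitive_on u S \<longleftrightarrow>
     \<not> (\<exists>U V. open U \<and> open V \<and> U \<noteq> {} \<and> V \<noteq> {} \<and> U \<subseteq> S \<and> V \<subseteq> S \<and> U \<inter> V = {} \<and> u ` U = u ` V)"

definition adapted_coordinates :: "'a chart set \<Rightarrow> 'a endo_field \<Rightarrow> 'a \<Rightarrow> 'a chart \<Rightarrow> bool" where
  "adapted_coordinates A J q c \<longleftrightarrow> c \<in> A \<and> q \<in> fst c \<and> snd c q = 0 \<and>
     snd c ` fst c = ball 0 1 \<and> (\<forall>\<xi>. J c q \<xi> = \<i> *s \<xi>)"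


section \<open>Singularity type\<close>

definition O_order :: "(complex \<Rightarrow> complex^2) \<Rightarrow> nat \<Rightarrow> bool" where
  "O_order g k \<longleftrightarrow>
     (\<forall>\<alpha>::real. 0 < \<alpha> \<and> \<alpha> < 1 \<longrightarrow> (\<lambda>z. norm (g z)) \<in> O[at 0](\<lambda>z. norm z powr (real k + \<alpha>)))"

definition hermitian_orthogonal :: "complex^2 \<Rightarrow> complex^2 \<Rightarrow> bool" where
  "hermitian_orthogonal v w \<longleftrightarrow> (\<Sum>i\<in>UNIV. v $ i * cnj (w $ i)) = 0"

definition gcd_upto :: "(nat \<Rightarrow> nat) \<Rightarrow> nat \<Rightarrow> nat" where
  "gcd_upto p i = Gcd (p ` {..i})"

text \<open>The type \<open>(p 0, \<dots>, p l)\<close> of the singularity at \<open>0\<close> of \<open>u\<close>, in the coordinates \<open>c\<close>. The values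
  \<open>snd c (u z)\<close> are only meaningful for \<open>z\<close> close to \<open>0\<close>, so the last clause also asks that \<open>u \<circ> \<phi>\<close>
  take values in the coordinate domain.\<close>

definition has_singularity_type ::
    "'a endo_field \<Rightarrow> (complex \<Rightarrow> 'a) \<Rightarrow> 'a chart \<Rightarrow> (nat \<Rightarrow> nat) \<Rightarrow> nat \<Rightarrow> bool" where
  "has_singularity_type J u c p l \<longleftrightarrow>
     p 0 \<ge> 2 \<and> (\<forall>i<l. p i < p (Suc i)) \<and>
     (\<forall>i<l. gcd_upto p (Suc i) < gcd_upto p i) \<and> gcd_upto p l = 1 \<and>
     (\<exists>(v :: nat \<Rightarrow> complex^2) (w :: nat \<Rightarrow> complex \<Rightarrow> complex^2) (\<phi> :: complex poly) (r :: real).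
        v 0 \<noteq> 0 \<and> O_order (\<lambda>z. snd c (u z) - (z ^ p 0) *s v 0) (p 0) \<and>
        (\<forall>i\<in>{1..l}. v i \<noteq> 0 \<and> hermitian_orthogonal (v i) (v 0)) \<and>
        r > 0 \<and>
        (\<forall>i\<le>l. w i ` ball 0 r \<subseteq> ball 0 1 \<and> J_holomorphic_on (coord_J J c) (w i) (ball 0 r) \<and>
                primitive_on (w i) (ball 0 r)) \<and>
        Polynomial.coeff \<phi> 0 = 0 \<and> Polynomial.coeff \<phi> 1 = 1 \<and>
        O_order (\<lambda>z. w 0 z - z *s v 0) 1 \<and>
        (\<forall>i\<in>{1..l}.
           O_order (\<lambda>z. w i z - w (i - 1) (z ^ (gcd_upto p (i - 1) div gcd_upto p i))
                        - (z ^ (p i div gcd_upto p i)) *s v i)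
                   (p i div gcd_upto p i)) \<and>
        (\<forall>i<l.
           O_order (\<lambda>z. snd c (u (poly \<phi> z)) - w i (z ^ gcd_upto p i) - (z ^ p (Suc i)) *s v (Suc i))
                   (p (Suc i))) \<and>
        (\<forall>z\<in>ball 0 r. poly \<phi> z \<in> ball 0 1 \<and> u (poly \<phi> z) \<in> fst c \<and> w l z = snd c (u (poly \<phi> z))))"


section \<open>Linking numbers in the 3-sphere\<close>

definition real_coords :: "complex^2 \<Rightarrow> nat \<Rightarrow> real" where
  "real_coords v i =
     (if i = 0 then Re (v $ 1) else if i = 1 then Im (v $ 1)
      else if i = 2 then Re (v $ 2) else if i = 3 then Im (v $ 2) else 0)"

definition of_real_coords :: "(nat \<Rightarrow> real) \<Rightarrow> complex^2" where
  "of_real_coords x = vector [Complex (x 0) (x 1), Complex (x 2) (x 3)]"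

text \<open>
  Loops are parametrized by the unit circle of \<open>\<complex>\<close>. The linking number of two disjoint loops \<open>\<gamma>\<close>, \<open>\<delta>\<close> in a
  sphere around \<open>0\<close> in \<open>\<complex>\<^sup>2\<close> (oriented as the boundary of the ball) is the intersection number of
  two discs in the ball which they bound. Take the cones \<open>f z = |z| \<gamma> (z/|z|)\<close> and
  \<open>g w = |w| \<delta> (w/|w|)\<close>. They only meet at \<open>0\<close>, and their intersection index there is the local degree at
  \<open>0\<close> of the difference map \<open>(z,w) \<mapsto> f z - g w\<close> from \<open>\<complex>\<^sup>2\<close> to \<open>\<complex>\<^sup>2\<close> (at a transverse point it is the sign of
  \<open>det (df, -dg) = det (df, dg)\<close>), that is, the Brouwer degree of the normalized difference map on
  the unit 3-sphere.
\<close>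

definition linking_map :: "(complex \<Rightarrow> complex^2) \<Rightarrow> (complex \<Rightarrow> complex^2) \<Rightarrow> complex^2 \<Rightarrow> complex^2" where
  "linking_map \<gamma> \<delta> x =
     sgn (norm (x $ 1) *\<^sub>R \<gamma> (sgn (x $ 1)) - norm (x $ 2) *\<^sub>R \<delta> (sgn (x $ 2)))"

definition linking_number :: "(complex \<Rightarrow> complex^2) \<Rightarrow> (complex \<Rightarrow> complex^2) \<Rightarrow> int" where
  "linking_number \<gamma> \<delta> = Brouwer_degree2 3 (real_coords \<circ> linking_map \<gamma> \<delta> \<circ> of_real_coords)"

text \<open>Sign check: two complex lines intersect with index \<open>+1\<close>.\<close>

lemma linking_number_Hopf:
  assumes "r > 0"
  shows "linking_number (\<lambda>z. r *\<^sub>R vector [z, 0]) (\<lambda>w. r *\<^sub>R vector [0, - w]) = 1"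
proof -
  have sgn1: "(norm a * r) *\<^sub>R sgn a = r *\<^sub>R a" for a :: complex
    by (cases "a = 0") (simp_all add: sgn_div_norm)
  have map: "linking_map (\<lambda>z. r *\<^sub>R vector [z, 0]) (\<lambda>w. r *\<^sub>R vector [0, - w]) x = sgn x" for x
  proof -
    have "norm (x $ 1) *\<^sub>R (r *\<^sub>R vector [sgn (x $ 1), 0])
            - norm (x $ 2) *\<^sub>R (r *\<^sub>R vector [0, - sgn (x $ 2)]) = r *\<^sub>R x"
      by (simp add: vec_eq_iff forall_2 sgn1)
    then show ?thesis
      using assms by (simp add: linking_map_def sgn_scaleR)
  qed
  have "Brouwer_degree2 3 (real_coords \<circ> sgn \<circ> of_real_coords) = Brouwer_degree2 3 id"
  proof (rule Brouwer_degree2_eq)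
    fix x assume "x \<in> topspace (nsphere 3)"
    then have s: "(x 0)\<^sup>2 + (x 1)\<^sup>2 + (x 2)\<^sup>2 + (x 3)\<^sup>2 = 1" and z: "\<And>i. i > 3 \<Longrightarrow> x i = 0"
      by (auto simp: nsphere numeral_3_eq_3 numeral_2_eq_2)
    have "norm (of_real_coords x) = 1"
      using s by (simp add: of_real_coords_def norm_vec_def L2_set_def sum_2 cmod_def)
    then have "sgn (of_real_coords x) = of_real_coords x"
      by (simp add: sgn_div_norm)
    then show "(real_coords \<circ> sgn \<circ> of_real_coords) x = id x"
      using z by (auto simp: fun_eq_iff real_coords_def of_real_coords_def)
  qed
  then show ?thesis
    by (simp add: linking_number_def map[abs_def] Brouwer_degree2_id)
qed


section \<open>Bennequin index and cusp index\<close>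

text \<open>\<open>T_w S \<inter> J(T_w S)\<close> for the sphere \<open>S\<close> around \<open>0\<close> through \<open>w\<close>; the tangent space \<open>T_w S\<close> is the real
  orthogonal complement of \<open>w\<close>.\<close>

definition sphere_tangent :: "complex^2 \<Rightarrow> (complex^2) set" where
  "sphere_tangent w = {\<xi>. \<xi> \<bullet> w = 0}"

definition plane_field ::
    "(complex^2 \<Rightarrow> (complex^2) \<Rightarrow>\<^sub>L (complex^2)) \<Rightarrow> complex^2 \<Rightarrow> (complex^2) set" where
  "plane_field J w = sphere_tangent w \<inter> blinfun_apply (J w) ` sphere_tangent w"

definition nonvanishing_section ::
    "(complex^2 \<Rightarrow> (complex^2) \<Rightarrow>\<^sub>L (complex^2)) \<Rightarrow> real \<Rightarrow> (complex^2 \<Rightarrow> complex^2) \<Rightarrow> bool" where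
  "nonvanishing_section J r s \<longleftrightarrow> continuous_on (sphere 0 r) s \<and>
     (\<forall>w\<in>sphere 0 r. s w \<in> plane_field J w \<and> s w \<noteq> 0)"

text \<open>\<open>\<gamma>\<close> is a regular \<open>C\<^sup>1\<close> parametrization of the embedded closed curve \<open>K\<close>, transverse to the plane
  field.\<close>

definition transverse_parametrization ::
    "(complex^2 \<Rightarrow> (complex^2) \<Rightarrow>\<^sub>L (complex^2)) \<Rightarrow> (complex^2) set \<Rightarrow> (complex \<Rightarrow> complex^2) \<Rightarrow> bool" where
  "transverse_parametrization J K \<gamma> \<longleftrightarrow>
     \<gamma> ` sphere 0 1 = K \<and> inj_on \<gamma> (sphere 0 1) \<and>
     (\<exists>\<gamma>'. continuous_on UNIV \<gamma>' \<and>
        (\<forall>t. ((\<lambda>t. \<gamma> (cis t)) has_vector_derivative \<gamma>' t) (at t) \<and>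
             \<gamma>' t \<noteq> 0 \<and> \<gamma>' t \<notin> plane_field J (\<gamma> (cis t))))"

definition pushed :: "real \<Rightarrow> real \<Rightarrow> (complex^2 \<Rightarrow> complex^2) \<Rightarrow> complex^2 \<Rightarrow> complex^2" where
  "pushed r \<epsilon> s w = r *\<^sub>R sgn (w + \<epsilon> *\<^sub>R s w)"

text \<open>The curve \<open>\<gamma>\<^sub>r\<close>: the closed ball is used, so that the component reaches the sphere.\<close>

definition branch_curve :: "(complex \<Rightarrow> 'a) \<Rightarrow> 'a chart \<Rightarrow> real \<Rightarrow> (complex^2) set" where
  "branch_curve u c r =
     (snd c \<circ> u) ` connected_component_set
        {z \<in> ball 0 1. u z \<in> fst c \<and> snd c (u z) \<in> cball 0 r} 0 \<inter> sphere 0 r"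

text \<open>Besides the value \<open>b\<close> of the linking numbers, the definition records what makes it well-defined: for
  all small radii \<open>\<gamma>\<^sub>r\<close> is an embedded transverse curve, there are non-vanishing sections over the
  whole sphere, and the value does not depend on the choices.\<close>

definition has_bennequin_index :: "'a endo_field \<Rightarrow> (complex \<Rightarrow> 'a) \<Rightarrow> 'a chart \<Rightarrow> int \<Rightarrow> bool" where
  "has_bennequin_index J u c b \<longleftrightarrow>
     (\<exists>r\<^sub>0. 0 < r\<^sub>0 \<and> r\<^sub>0 \<le> 1 \<and> (\<forall>r. 0 < r \<and> r < r\<^sub>0 \<longrightarrow>
        (\<exists>\<gamma>. transverse_parametrization (coord_J J c) (branch_curve u c r) \<gamma>) \<and>
        (\<exists>s. nonvanishing_section (coord_J J c) r s) \<and>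
        (\<forall>\<gamma> s. transverse_parametrization (coord_J J c) (branch_curve u c r) \<gamma> \<and>
               nonvanishing_section (coord_J J c) r s \<longrightarrow>
           (\<exists>\<epsilon>\<^sub>0>0. \<forall>\<epsilon>. 0 < \<epsilon> \<and> \<epsilon> < \<epsilon>\<^sub>0 \<longrightarrow>
              \<gamma> ` sphere 0 1 \<inter> (pushed r \<epsilon> s \<circ> \<gamma>) ` sphere 0 1 = {} \<and>
              linking_number \<gamma> (pushed r \<epsilon> s \<circ> \<gamma>) = b))))"

definition has_cusp_index :: "'a endo_field \<Rightarrow> (complex \<Rightarrow> 'a) \<Rightarrow> 'a chart \<Rightarrow> real \<Rightarrow> bool" where
  "has_cusp_index J u c \<kappa> \<longleftrightarrow> (\<exists>b. has_bennequin_index J u c b \<and> \<kappa> = (real_of_int b + 1) / 2)"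

end

theory Submission
  imports Defs
begin

text \<open>
  The linking number of two loops is the degree of a pair \<open>(A, C)\<close> of complex functions on the 3-sphere, and
  this degree is additive under multiplication of \<open>A\<close>: the increments of the logarithm show it for maps into the
  punctured plane, and two suspensions carry it over to the 3-sphere.

  Let \<open>n = p\<^sub>0\<close>. The component along \<open>v\<^sub>0\<close> of the difference of the branch at \<open>x\<close> and of the pushed branch at \<open>y\<close>
  can be deformed to \<open>x ^ n - y ^ n\<close>, which is the product of the factors \<open>x - \<zeta> y\<close> over the \<open>n\<close>-th roots of
  unity \<open>\<zeta>\<close>. Where the factor of \<open>\<zeta> \<noteq> 1\<close> vanishes, the component orthogonal to \<open>v\<^sub>0\<close> is close to a non-zero multiple
  of \<open>y ^ q\<close>, where \<open>q\<close> is the first of the \<open>p\<^sub>i\<close> with \<open>\<zeta> ^ p\<^sub>i \<noteq> 1\<close>; this contributes \<open>q\<close>. The factor of \<open>\<zeta> = 1\<close>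
  only sees the displacement by the section of the plane field, which rotates like the \<open>n\<close>-th power of the conjugate
  of \<open>y\<close> and contributes \<open>- n\<close>. As \<open>d\<^sub>i\<^sub>-\<^sub>1 - d\<^sub>i\<close> roots of unity belong to \<open>p\<^sub>i\<close>, the Bennequin index is the sum of the
  \<open>(d\<^sub>i\<^sub>-\<^sub>1 - d\<^sub>i) p\<^sub>i\<close> minus \<open>n\<close>.

  The Lipschitz condition on \<open>J\<close> is used to derive an expansion of the differential of the branch from the expansion
  of its values. This makes the branch injective and its intersections with small spheres regular and transverse.
\<close>

section \<open>Homology of the punctured plane and products\<close>

text \<open>The difference of the branch and its push-off does not factor; only its leading part
  does. But the degree of a pair can change only through a common zero, so the second function
  matters only where the first one vanishes. Hence the component orthogonal to \<open>v\<close> is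
  kept as it is while the other one is deformed to a product. The second function is then replaced
  by a monomial for each factor separately, where only the zero set of that factor counts. Nearly
  all deformations are linear, so each reduces to an inequality that excludes common zeros. One
  constant \<eta>, fixed before the radius, pays for all errors.

  The conjugate in the rotation of the section has a topological source: \<open>cdet x (s x)\<close>
  has no zero on a simply connected sphere, hence a logarithm, so the section does not wind against
  the point \<open>x\<close>. Along the branch \<open>x\<close> turns like \<open>y ^ n\<close>,
  which leaves the inverse rotation for \<open>cdet v (s x)\<close>.

  The differences of consecutive gcds sum to \<open>p 0 - 1\<close>; this turns the index plus one
  into a sum with the factors \<open>p i - 1\<close>.\<close>

definition edge :: "real \<Rightarrow> nat \<Rightarrow> real" where
  "edge t = (\<lambda>j. if j = 0 then 1 - t else if j = 1 then t else 0)"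

text \<open>The increment \<open>d\<close> is the integral of \<open>dz / z\<close> along the singular 1-simplex \<open>f\<close>.\<close>

definition has_log_change :: "((nat \<Rightarrow> real) \<Rightarrow> complex) \<Rightarrow> complex \<Rightarrow> bool" where
  "has_log_change f d \<longleftrightarrow>
     (\<exists>g. continuous_on {0..1} g \<and> (\<forall>t\<in>{0..1}. exp (g t) = f (edge t)) \<and> d = g 1 - g (0::real))"

definition log_change :: "((nat \<Rightarrow> real) \<Rightarrow> complex) \<Rightarrow> complex" where
  "log_change f = (SOME d. has_log_change f d)"

text \<open>Two logarithms of one function differ by a continuous function with values in the
  integer multiples of \<open>2 * pi * \<i>\<close>. It is constant on the interval, and the
  constant drops out of the increment.\<close>

lemma has_log_change_unique:
  assumes "has_log_change f d" "has_log_change f d'"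
  shows "d = d'"
proof -
  obtain g g' where g: "continuous_on {0..1} g" "\<And>t. t \<in> {0..1} \<Longrightarrow> exp (g t) = f (edge t)" "d = g 1 - g (0::real)"
    and g': "continuous_on {0..1} g'" "\<And>t. t \<in> {0..1} \<Longrightarrow> exp (g' t) = f (edge t)" "d' = g' 1 - g' (0::real)"
    using assms unfolding has_log_change_def by metis
  have "(\<lambda>t. g t - g' t) constant_on {0..1}"
  proof (rule continuous_discrete_range_constant)
    show "connected {0..1::real}" by simp
    show "continuous_on {0..1} (\<lambda>t. g t - g' t)" using g g' by (intro continuous_intros)
    fix x :: real assume x: "x \<in> {0..1}"
    have "\<exists>n::int. g y - g' y = of_real (of_int n * (2 * pi)) * \<i>" if "y \<in> {0..1}" for y
    proof -
      have "exp (g y) = exp (g' y)" using g(2)[OF that] g'(2)[OF that] by simp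
      then obtain n :: int where "g y = g' y + (of_int (2 * n) * pi) * \<i>"
        using exp_eq[of "g y" "g' y"] by auto
      then show ?thesis by (intro exI[of _ n]) simp
    qed
    then obtain N :: "real \<Rightarrow> int" where N: "g y - g' y = of_real (of_int (N y) * (2 * pi)) * \<i>" if "y \<in> {0..1}" for y
      by metis
    show "\<exists>e>0. \<forall>y. y \<in> {0..1} \<and> g y - g' y \<noteq> g x - g' x \<longrightarrow> e \<le> cmod (g y - g' y - (g x - g' x))"
    proof (intro exI[of _ "2 * pi"] conjI allI impI)
      fix y assume y: "y \<in> {0..1} \<and> g y - g' y \<noteq> g x - g' x"
      then have "N y \<noteq> N x" using N x by auto
      have "g y - g' y - (g x - g' x) = of_real (of_int (N y - N x) * (2 * pi)) * \<i>"
        using N x y by (simp add: algebra_simps)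
      then have "cmod (g y - g' y - (g x - g' x)) = \<bar>of_int (N y - N x)\<bar> * (2 * pi)"
        by (simp add: norm_mult abs_mult del: of_int_diff)
      moreover have "1 \<le> \<bar>of_int (N y - N x) :: real\<bar>"
        using \<open>N y \<noteq> N x\<close> by linarith
      ultimately show "2 * pi \<le> cmod (g y - g' y - (g x - g' x))"
        by simp
    qed simp
  qed
  then have "g 1 - g' 1 = g 0 - g' 0"
    unfolding constant_on_def by auto
  then show ?thesis using g(3) g'(3) by (metis add_diff_eq diff_add_cancel diff_diff_add add.commute diff_diff_eq2)
qed

lemma log_change_eq: "has_log_change f d \<Longrightarrow> log_change f = d"
  unfolding log_change_def using has_log_change_unique by blast

lemma edge_in_simplex [simp]: "t \<in> {0..1} \<Longrightarrow> edge t \<in> standard_simplex (Suc 0)"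
  by (auto simp: standard_simplex_def edge_def)

lemma continuous_on_edge: "continuous_on S (\<lambda>t. edge t k)"
  by (cases "k = 0"; cases "k = 1") (auto simp: edge_def intro!: continuous_intros)

lemma has_log_change_ex:
  assumes "continuous_map (subtopology (powertop_real UNIV) (standard_simplex 1)) (top_of_set (- {0})) f"
  shows "has_log_change f (log_change f)"
proof -
  have "continuous_map (top_of_set {0..1}) (subtopology (powertop_real UNIV) (standard_simplex 1)) edge"
    by (auto simp: continuous_map_in_subtopology continuous_map_componentwise_UNIV continuous_on_edge)
  from continuous_map_compose[OF this assms]
  have c: "continuous_on {0..1} (f \<circ> edge)" "\<And>t. t \<in> {0..1} \<Longrightarrow> f (edge t) \<noteq> 0"
    by (auto simp: image_subset_iff)
  obtain g where "continuous_on {0..1} g" "\<And>t. t \<in> {0..1} \<Longrightarrow> (f \<circ> edge) t = exp (g t)"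
    using continuous_logarithm_on_contractible[OF c(1)] c(2) by (metis comp_apply convex_imp_contractible convex_real_interval(5))
  then have "has_log_change f (g 1 - g 0)"
    unfolding has_log_change_def by (intro exI[of _ g]) auto
  then show ?thesis using log_change_eq by metis
qed

text \<open>The integral of \<open>dz / z\<close> along a singular chain with integer coefficients.
  On cycles in the punctured plane it is \<open>2 * pi * \<i>\<close> times the winding
  number.\<close>

definition chain_log_change :: "complex chain \<Rightarrow> complex" where
  "chain_log_change c = (\<Sum>\<sigma>\<in>Poly_Mapping.keys c. of_int (Poly_Mapping.lookup c \<sigma>) * log_change \<sigma>)"

lemma chain_log_change_superset:
  assumes "finite S" "Poly_Mapping.keys c \<subseteq> S"
  shows "chain_log_change c = (\<Sum>\<sigma>\<in>S. of_int (Poly_Mapping.lookup c \<sigma>) * log_change \<sigma>)"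
  unfolding chain_log_change_def using assms
  by (intro sum.mono_neutral_left) (auto simp: in_keys_iff)

lemma chain_log_change_0 [simp]: "chain_log_change 0 = 0"
  by (simp add: chain_log_change_def)

lemma chain_log_change_add: "chain_log_change (a + b) = chain_log_change a + chain_log_change b"
proof -
  let ?S = "Poly_Mapping.keys a \<union> Poly_Mapping.keys b"
  have "Poly_Mapping.keys (a + b) \<subseteq> ?S" by (rule keys_add)
  then show ?thesis
    by (simp add: chain_log_change_superset[of ?S] lookup_add distrib_right sum.distrib)
qed

lemma chain_log_change_cmul: "chain_log_change (frag_cmul k a) = of_int k * chain_log_change a"
  by (simp add: chain_log_change_superset[of "Poly_Mapping.keys a"] keys_cmul sum_distrib_left mult.assoc)

lemma chain_log_change_of [simp]: "chain_log_change (frag_of \<sigma>) = log_change \<sigma>"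
  by (simp add: chain_log_change_def)

lemma chain_log_change_diff: "chain_log_change (a - b) = chain_log_change a - chain_log_change b"
  using chain_log_change_add[of "a - b" b] by simp

lemma chain_log_change_sum: "chain_log_change (\<Sum>i\<in>I. f i) = (\<Sum>i\<in>I. chain_log_change (f i))"
  by (induction I rule: infinite_finite_induct) (simp_all add: chain_log_change_add)

lemma chain_log_change_extend:
  "chain_log_change (frag_extend b c) = (\<Sum>\<sigma>\<in>Poly_Mapping.keys c. of_int (Poly_Mapping.lookup c \<sigma>) * chain_log_change (b \<sigma>))"
  by (simp add: frag_extend_def chain_log_change_sum chain_log_change_cmul)

text \<open>A logarithm exists on the whole triangle, which is contractible. The increments along
  the three edges are differences of its corner values and cancel with the signs of the boundary.
  This is why log changes pass to homology.\<close>

lemma log_change_boundary: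
  assumes "singular_simplex 2 (top_of_set (- {0::complex})) \<sigma>"
  shows "chain_log_change (\<Sum>k\<le>2. frag_cmul ((-1) ^ k) (frag_of (singular_face 2 k \<sigma>))) = 0"
proof -
  \<comment> \<open>The 2-simplex lives in a function space; \<open>T\<close> is its planar model
    and \<open>e\<close> the affine parametrization, which takes \<open>(0,0)\<close>,
    \<open>(1,0)\<close>, \<open>(0,1)\<close> to the vertices 0, 1, 2.\<close>
  define T where "T = {x :: real \<times> real. fst x \<ge> 0 \<and> snd x \<ge> 0 \<and> fst x + snd x \<le> 1}"
  define e where "e = (\<lambda>x::real \<times> real. \<lambda>j::nat. if j = 0 then 1 - fst x - snd x else if j = 1 then fst x else if j = 2 then snd x else 0)"
  have T: "convex T"
  proof -
    have "T = {x. (1,0) \<bullet> x \<ge> 0} \<inter> {x. (0,1) \<bullet> x \<ge> 0} \<inter> {x. (1,1) \<bullet> x \<le> 1}"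
      by (auto simp: T_def inner_prod_def)
    then show ?thesis
      by (simp add: convex_Int convex_halfspace_ge convex_halfspace_le)
  qed
  have eT: "e x \<in> standard_simplex 2" if "x \<in> T" for x
  proof -
    have "{..2} = {0,1,2::nat}" by auto
    then show ?thesis using that by (auto simp: T_def e_def standard_simplex_def)
  qed
  have cs: "continuous_map (subtopology (powertop_real UNIV) (standard_simplex 2)) (top_of_set (- {0})) \<sigma>"
    using assms by (simp add: singular_simplex_def)
  have "continuous_map (top_of_set T) (subtopology (powertop_real UNIV) (standard_simplex 2)) e"
  proof -
    have "continuous_on T (\<lambda>x. e x k)" for k
      by (cases "k = 0"; cases "k = 1"; cases "k = 2") (auto simp: e_def intro!: continuous_intros)
    then show ?thesis
      using eT by (auto simp: continuous_map_in_subtopology continuous_map_componentwise_UNIV)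
  qed
  from continuous_map_compose[OF this cs]
  have c: "continuous_on T (\<sigma> \<circ> e)" "\<And>t. t \<in> T \<Longrightarrow> \<sigma> (e t) \<noteq> 0"
    by (auto simp: image_subset_iff)
  obtain G where G: "continuous_on T G" "\<And>t. t \<in> T \<Longrightarrow> \<sigma> (e t) = exp (G t)"
    using continuous_logarithm_on_contractible[OF c(1)] c(2) T by (metis comp_apply convex_imp_contractible)
  have 0: "has_log_change (singular_face 2 0 \<sigma>) (G (0,1) - G (1,0))"
    unfolding has_log_change_def
  proof (intro exI[of _ "\<lambda>t. G (1-t,t)"] conjI ballI)
    show "continuous_on {0..1} (\<lambda>t. G (1 - t, t))"
      by (rule continuous_on_compose2[OF G(1)]) (auto intro!: continuous_intros simp: T_def)
    fix t :: real assume t: "t \<in> {0..1}"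
    then have "(1-t,t) \<in> T" by (auto simp: T_def)
    have "simplical_face 0 (edge t) = e (1-t,t)"
      by (auto simp: simplical_face_def edge_def e_def fun_eq_iff)
    then show "exp (G (1 - t, t)) = singular_face 2 0 \<sigma> (edge t)"
      using t G(2)[OF \<open>(1-t,t) \<in> T\<close>] by (simp add: singular_face_def numeral_2_eq_2)
  qed simp
  have 1: "has_log_change (singular_face 2 1 \<sigma>) (G (0,1) - G (0,0))"
    unfolding has_log_change_def
  proof (intro exI[of _ "\<lambda>t. G (0,t)"] conjI ballI)
    show "continuous_on {0..1} (\<lambda>t. G (0, t))"
      by (rule continuous_on_compose2[OF G(1)]) (auto intro!: continuous_intros simp: T_def)
    fix t :: real assume t: "t \<in> {0..1}"
    then have "(0,t) \<in> T" by (auto simp: T_def)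
    have "simplical_face 1 (edge t) = e (0,t)"
      by (auto simp: simplical_face_def edge_def e_def fun_eq_iff)
    then show "exp (G (0, t)) = singular_face 2 1 \<sigma> (edge t)"
      using t G(2)[OF \<open>(0,t) \<in> T\<close>] by (simp add: singular_face_def numeral_2_eq_2)
  qed simp
  have 2: "has_log_change (singular_face 2 2 \<sigma>) (G (1,0) - G (0,0))"
    unfolding has_log_change_def
  proof (intro exI[of _ "\<lambda>t. G (t,0)"] conjI ballI)
    show "continuous_on {0..1} (\<lambda>t. G (t,0))"
      by (rule continuous_on_compose2[OF G(1)]) (auto intro!: continuous_intros simp: T_def)
    fix t :: real assume t: "t \<in> {0..1}"
    then have "(t,0) \<in> T" by (auto simp: T_def)
    have "simplical_face 2 (edge t) = e (t,0)"
      by (auto simp: simplical_face_def edge_def e_def fun_eq_iff)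
    then show "exp (G (t,0)) = singular_face 2 2 \<sigma> (edge t)"
      using t G(2)[OF \<open>(t,0) \<in> T\<close>] by (simp add: singular_face_def numeral_2_eq_2)
  qed simp
  have "{..2} = {0,1,2::nat}" by auto
  then show ?thesis
    by (simp add: chain_log_change_add chain_log_change_cmul chain_log_change_diff log_change_eq[OF 0] log_change_eq[OF 1[unfolded One_nat_def]] log_change_eq[OF 2])
qed

lemma chain_log_change_boundary:
  assumes "singular_relboundary 1 (top_of_set (- {0::complex})) {} c"
  shows "chain_log_change c = 0"
proof -
  obtain d where d: "singular_chain 2 (top_of_set (- {0})) d" "c = chain_boundary 2 d"
    using assms by (auto simp: singular_boundary numeral_2_eq_2)
  have "chain_log_change (\<Sum>k\<le>2. frag_cmul ((-1) ^ k) (frag_of (singular_face 2 k \<sigma>))) = 0"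
    if "\<sigma> \<in> Poly_Mapping.keys d" for \<sigma>
    using d(1) that by (intro log_change_boundary) (auto simp: singular_chain_def)
  then show ?thesis
    by (simp add: d(2) chain_boundary_def chain_log_change_extend)
qed

text \<open>On each simplex a sum of logarithms is a logarithm of the product.\<close>

lemma chain_log_change_mult:
  assumes A: "continuous_map X (top_of_set (- {0})) A" and B: "continuous_map X (top_of_set (- {0})) B"
    and c: "singular_chain 1 X c"
  shows "chain_log_change (chain_map 1 (\<lambda>x. A x * B x) c) = chain_log_change (chain_map 1 A c) + chain_log_change (chain_map 1 B c)"
proof -
  have "log_change (simplex_map 1 (\<lambda>x. A x * B x) \<sigma>) = log_change (simplex_map 1 A \<sigma>) + log_change (simplex_map 1 B \<sigma>)"
    if "\<sigma> \<in> Poly_Mapping.keys c" for \<sigma>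
  proof -
    have \<sigma>: "singular_simplex 1 X \<sigma>" using c that by (auto simp: singular_chain_def)
    have "has_log_change (simplex_map 1 C \<sigma>) (log_change (simplex_map 1 C \<sigma>))"
      if "continuous_map X (top_of_set (- {0})) C" for C
      using singular_simplex_simplex_map[OF \<sigma> that] by (intro has_log_change_ex) (simp add: singular_simplex_def)
    from this[OF A] this[OF B] obtain g g' where
      g: "continuous_on {0..1} g" "\<And>t. t \<in> {0..1} \<Longrightarrow> exp (g t) = simplex_map 1 A \<sigma> (edge t)" "log_change (simplex_map 1 A \<sigma>) = g 1 - g (0::real)"
      and g': "continuous_on {0..1} g'" "\<And>t. t \<in> {0..1} \<Longrightarrow> exp (g' t) = simplex_map 1 B \<sigma> (edge t)" "log_change (simplex_map 1 B \<sigma>) = g' 1 - g' (0::real)"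
      unfolding has_log_change_def by metis
    have "has_log_change (simplex_map 1 (\<lambda>x. A x * B x) \<sigma>) ((g 1 + g' 1) - (g 0 + g' 0))"
      unfolding has_log_change_def
      using g(1,2) g'(1,2) by (intro exI[of _ "\<lambda>t. g t + g' t"]) (auto intro!: continuous_intros simp: exp_add simplex_map_def)
    from log_change_eq[OF this] g(3) g'(3) show ?thesis by simp
  qed
  then show ?thesis
    by (simp add: chain_map_def chain_log_change_extend distrib_left sum.distrib)
qed

section \<open>The first homology group of the punctured plane\<close>

lemma continuous_map_euclidean_Pair:
  assumes "continuous_map X euclidean f" "continuous_map X euclidean g"
  shows "continuous_map X euclidean (\<lambda>x. (f x, g x))"
  using assms by (simp add: continuous_map_pairwise o_def flip: prod_topology_euclidean)

lemma continuous_map_complex_mult: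
  assumes "continuous_map X euclidean f" "continuous_map X euclidean (g :: _ \<Rightarrow> complex)"
  shows "continuous_map X euclidean (\<lambda>x. f x * g x)"
proof -
  have "continuous_map euclidean euclidean (\<lambda>x::complex \<times> complex. fst x * snd x)"
    by (auto intro!: continuous_intros)
  from continuous_map_compose[OF continuous_map_euclidean_Pair[OF assms] this]
  show ?thesis by (simp add: o_def)
qed

lemma homologous_rel_set_add:
  "homologous_rel_set p X {} a \<otimes>\<^bsub>homology_group (int p) X\<^esub> homologous_rel_set p X {} b = homologous_rel_set p X {} (a + b)"
proof (intro equalityI subsetI)
  fix x assume "x \<in> homologous_rel_set p X {} a \<otimes>\<^bsub>homology_group (int p) X\<^esub> homologous_rel_set p X {} b"
  then show "x \<in> homologous_rel_set p X {} (a + b)"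
    by (auto simp: mult_relative_homology_group intro: homologous_rel_add)
next
  fix x assume x: "x \<in> homologous_rel_set p X {} (a + b)"
  then have "homologous_rel p X {} b (x - a)"
    by (simp add: homologous_rel_def algebra_simps)
  then show "x \<in> homologous_rel_set p X {} a \<otimes>\<^bsub>homology_group (int p) X\<^esub> homologous_rel_set p X {} b"
    by (simp add: mult_relative_homology_group) (metis add_diff_cancel_left' homologous_rel_refl add_diff_eq)
qed

lemma homologous_frag_cmul:
  "homologous_rel_set p X {} c [^]\<^bsub>homology_group (int p) X\<^esub> (n::nat) = homologous_rel_set p X {} (frag_cmul (int n) c)"
proof (induction n)
  case 0
  have "homologous_rel_set p X {} 0 = singular_relboundary_set p X {}"
    by (auto simp: homologous_rel_def) (metis minus_minus singular_relboundary_minus)+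
  then show ?case by simp
next
  case (Suc n)
  then show ?case
    by (simp add: homologous_rel_set_add frag_cmul_distrib add.commute)
qed

text \<open>The normalization \<open>f\<close> is a homotopy equivalence onto the circle, with the
  inclusion \<open>g\<close> as its inverse, and the homology of the circle is cyclic.\<close>

lemma homology_group_punctured_plane_cyclic: "cyclic_group (homology_group 1 (top_of_set (- {0::complex})))"
proof -
  define f :: "complex \<Rightarrow> nat \<Rightarrow> real" where "f = (\<lambda>z i. if i = 0 then Re (sgn z) else if i = 1 then Im (sgn z) else 0)"
  define g :: "(nat \<Rightarrow> real) \<Rightarrow> complex" where "g = (\<lambda>x. Complex (x 0) (x 1))"
  have s: "{..Suc 0} = {0,1}" by auto
  have cf: "continuous_map (top_of_set (- {0})) (nsphere 1) f"
  proof -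
    have "continuous_on (- {0}) (\<lambda>z. f z k)" for k
      by (cases "k = 0"; cases "k = 1") (auto simp: f_def intro!: continuous_intros)
    moreover have "(Re (sgn z))\<^sup>2 + (Im (sgn z))\<^sup>2 = 1" if "z \<noteq> 0" for z
      using that by (metis norm_sgn cmod_power2 one_power2)
    ultimately show ?thesis
      unfolding nsphere
      by (simp add: continuous_map_in_subtopology continuous_map_componentwise_UNIV image_subset_iff) (auto simp: f_def s)
  qed
  have cg: "continuous_map (nsphere 1) (top_of_set (- {0})) g"
  proof -
    have "continuous_map euclidean euclidean (\<lambda>p. Complex (fst p) (snd p))"
      by (auto simp: Complex_eq intro!: continuous_intros)
    from continuous_map_compose[OF continuous_map_euclidean_Pair[OF continuous_map_nsphere_projection[of 1 0]
          continuous_map_nsphere_projection[of 1 1]] this]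
    have "continuous_map (nsphere 1) euclidean g"
      by (simp add: o_def g_def)
    moreover have "g x \<noteq> 0" if "x \<in> topspace (nsphere 1)" for x
      using that by (auto simp: nsphere s g_def complex_eq_iff)
    ultimately show ?thesis
      by (auto simp: continuous_map_in_subtopology)
  qed
  have fg: "f (g x) = x" if "x \<in> topspace (nsphere 1)" for x
  proof -
    have "(x 0)\<^sup>2 + (x 1)\<^sup>2 = 1" "\<And>i. i > 1 \<Longrightarrow> x i = 0" using that by (auto simp: nsphere s)
    then have "cmod (g x) = 1" by (simp add: g_def cmod_def)
    then have "sgn (g x) = g x" by (simp add: sgn_div_norm)
    then show ?thesis using \<open>\<And>i. i > 1 \<Longrightarrow> x i = 0\<close> by (auto simp: f_def g_def fun_eq_iff)
  qed
  have gf: "g (f z) = sgn z" for z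
    by (simp add: f_def g_def complex_eq_iff)
  have "homotopic_with_canon (\<lambda>h. True) (- {0}) (- {0::complex}) (g \<circ> f) id"
  proof (rule homotopic_with_linear)
    show "continuous_on (- {0}) (g \<circ> f)"
      by (simp add: o_def gf) (intro continuous_intros; auto)
    show "continuous_on (- {0}) (id :: complex \<Rightarrow> complex)" by simp
    fix z :: complex assume z: "z \<in> - {0}"
    show "closed_segment ((g \<circ> f) z) (id z) \<subseteq> - {0}"
    proof
      fix y assume "y \<in> closed_segment ((g \<circ> f) z) (id z)"
      then obtain u where u: "0 \<le> u" "u \<le> 1" "y = (1 - u) *\<^sub>R sgn z + u *\<^sub>R z"
        by (auto simp: in_segment gf)
      then have "y = ((1 - u) * inverse (cmod z) + u) *\<^sub>R z"
        by (simp add: sgn_div_norm scaleR_conv_of_real distrib_right mult.assoc)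
      moreover have "(1 - u) * inverse (cmod z) + u > 0"
        using u z by (cases "u = 0") (auto intro: add_nonneg_pos)
      ultimately show "y \<in> - {0}" using z by auto
    qed
  qed
  then have "nsphere 1 homotopy_equivalent_space top_of_set (- {0::complex})"
    unfolding homotopy_equivalent_space_def
  proof (intro exI[of _ g] exI[of _ f] conjI cf cg)
    show "homotopic_with (\<lambda>x. True) (nsphere 1) (nsphere 1) (f \<circ> g) id"
      using fg by (intro homotopic_with_equal continuous_map_compose[OF cg cf]) auto
  qed auto
  then have iso: "homology_group 1 (nsphere 1) \<cong> homology_group 1 (top_of_set (- {0::complex}))"
    by (rule homotopy_equivalent_space_imp_isomorphic_homology_groups)
  have "cyclic_group (homology_group 1 (nsphere 1))"
    using cyclic_reduced_homology_group_nsphere[of 1 1] by (simp add: un_reduced_homology_group)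
  with iso show ?thesis
    by (meson group_relative_homology_group isomorphic_group_cyclicity)
qed

text \<open>Injectivity of the winding number on homology. Every cycle is homologous to a multiple
  of one generator \<open>c0\<close>. The standard loop has non-zero log change, so
  \<open>c0\<close> has one too, and a cycle of log change 0 must be the zero multiple.\<close>

lemma singular_boundary_punctured_plane:
  assumes c: "singular_relcycle 1 (top_of_set (- {0::complex})) {} c" and "chain_log_change c = 0"
  shows "singular_relboundary 1 (top_of_set (- {0})) {} c"
proof -
  let ?P = "top_of_set (- {0::complex})"
  let ?G = "homology_group 1 ?P"
  let ?H = "homologous_rel_set 1 ?P {}"
  interpret G: group ?G by simp
  have carr: "carrier ?G = ?H ` singular_relcycle_set 1 ?P {}"
    using carrier_relative_homology_group[of 1 ?P "{}"] by simp
  have one: "\<one>\<^bsub>?G\<^esub> = singular_relboundary_set 1 ?P {}"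
    using one_relative_homology_group[of 1 ?P "{}"] by simp
  obtain a where a: "a \<in> carrier ?G" "carrier ?G = range (\<lambda>n::int. a [^]\<^bsub>?G\<^esub> n)"
    using homology_group_punctured_plane_cyclic G.cyclic_group by auto
  obtain c0 where c0: "singular_relcycle 1 ?P {} c0" "a = ?H c0"
    using a(1) carr by auto
  have ex: "\<exists>k::int. ?H d = ?H (frag_cmul k c0)" if "singular_relcycle 1 ?P {} d" for d
  proof -
    have "?H d \<in> carrier ?G" using that carr by auto
    then obtain n :: int where n: "?H d = a [^]\<^bsub>?G\<^esub> n" using a by auto
    have p: "a [^]\<^bsub>?G\<^esub> (m::nat) = ?H (frag_cmul (int m) c0)" for m
      using homologous_frag_cmul[of 1 ?P c0 m] c0(2) by simp
    \<comment> \<open>Integer powers in the group become multiples of the chain \<open>c0\<close>;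
      negative ones pass through the inverse, which is the negated coset.\<close>
    show ?thesis
    proof (cases "n \<ge> 0")
      case True
      then have "a [^]\<^bsub>?G\<^esub> n = ?H (frag_cmul (int (nat n)) c0)"
        using p[of "nat n"] by (metis int_nat_eq int_pow_int)
      with n show ?thesis by metis
    next
      case False
      then obtain m where m: "n = - int m" by (metis int_cases2 of_nat_0_le_iff)
      have mc: "singular_relcycle 1 ?P {} (frag_cmul (int m) c0)" using c0(1) by (rule singular_relcycle_cmul)
      have "a [^]\<^bsub>?G\<^esub> n = inv\<^bsub>?G\<^esub> (?H (frag_cmul (int m) c0))"
        using a(1) p by (simp add: m G.int_pow_neg int_pow_int)
      also have "\<dots> = uminus ` ?H (frag_cmul (int m) c0)"
        using inv_relative_homology_group[of "?H (frag_cmul (int m) c0)" 1 ?P "{}"] mc carr by auto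
      also have "\<dots> = ?H (frag_cmul (- int m) c0)"
      proof -
        have "x \<in> uminus ` ?H (frag_cmul (int m) c0) \<longleftrightarrow> x \<in> ?H (frag_cmul (- int m) c0)" for x
        proof -
          have "x \<in> uminus ` ?H (frag_cmul (int m) c0) \<longleftrightarrow> - x \<in> ?H (frag_cmul (int m) c0)"
            by (metis (no_types, lifting) image_iff minus_minus)
          also have "\<dots> \<longleftrightarrow> singular_relboundary 1 ?P {} (- (frag_cmul (- int m) c0 - x))"
          proof -
            have "frag_cmul (int m) c0 - - x = - (frag_cmul (- int m) c0 - x)"
              by (rule poly_mapping_eqI) (simp add: lookup_minus lookup_add lookup_uminus)
            then show ?thesis unfolding homologous_rel_def mem_Collect_eq by (simp only:)
          qed
          also have "\<dots> \<longleftrightarrow> x \<in> ?H (frag_cmul (- int m) c0)"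
            by (metis homologous_rel_def mem_Collect_eq minus_minus singular_relboundary_minus)
          finally show ?thesis .
        qed
        then show ?thesis by auto
      qed
      finally show ?thesis using n by metis
    qed
  qed
  have W: "\<exists>k::int. ?H d = ?H (frag_cmul k c0) \<and> chain_log_change d = of_int k * chain_log_change c0" if "singular_relcycle 1 ?P {} d" for d
  proof -
    from ex[OF that] obtain k where k: "?H d = ?H (frag_cmul k c0)" by auto
    then have "homologous_rel 1 ?P {} d (frag_cmul k c0)"
      by (simp add: homologous_rel_set_eq)
    then have "chain_log_change (d - frag_cmul k c0) = 0"
      by (intro chain_log_change_boundary) (simp add: homologous_rel_def)
    with k show ?thesis by (auto simp: chain_log_change_diff chain_log_change_cmul)
  qed
  \<comment> \<open>The unit circle as a singular 1-simplex, with the barycentric coordinate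
    \<open>x 1\<close> as parameter. It is cut off by \<open>restrict\<close> because singular
    simplices are extensional.\<close>
  define e :: "(nat \<Rightarrow> real) \<Rightarrow> complex" where "e = restrict (\<lambda>x. exp (2 * of_real pi * \<i> * of_real (x 1))) (standard_simplex 1)"
  have se: "singular_simplex 1 ?P e"
  proof -
    have "continuous_map euclidean euclidean (complex_of_real)"
      by (auto intro!: continuous_intros)
    from continuous_map_compose[OF continuous_map_product_projection[of 1 UNIV "\<lambda>_. euclidean", OF UNIV_I] this]
    have "continuous_map (powertop_real UNIV) euclidean (\<lambda>x::nat \<Rightarrow> real. of_real (x 1) :: complex)"
      by (simp only: o_def)
    then have "continuous_map (powertop_real UNIV) (top_of_set (-{0})) ((\<lambda>z. exp (2 * of_real pi * \<i> * z)) \<circ> (\<lambda>x::nat \<Rightarrow> real. of_real (x 1) :: complex))"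
      by (rule continuous_map_compose) (auto intro!: continuous_intros simp: continuous_map_in_subtopology)
    then show ?thesis
      unfolding singular_simplex_def e_def
      by (auto simp: o_def continuous_map_from_subtopology simp del: One_nat_def)
  qed
  have el: "log_change e = 2 * of_real pi * \<i>"
    by (rule log_change_eq) (auto simp: has_log_change_def e_def edge_def intro!: exI[of _ "\<lambda>t. 2 * of_real pi * \<i> * of_real t"] continuous_intros edge_in_simplex[unfolded edge_def])
  have "chain_boundary 1 (frag_of e) = 0"
  proof -
    have "singular_face 1 0 e = singular_face 1 1 e"
      by (auto simp: singular_face_def e_def standard_simplex_0 simplical_face_def fun_eq_iff restrict_def standard_simplex_def)
    then show ?thesis by (simp add: chain_boundary_of)
  qed
  then have "singular_relcycle 1 ?P {} (frag_of e)"
    using se by (simp add: singular_cycle singular_chain_of)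
  from W[OF this] el have n0: "chain_log_change c0 \<noteq> 0" by auto
  obtain k where k: "?H c = ?H (frag_cmul k c0)" "chain_log_change c = of_int k * chain_log_change c0"
    using W[OF c] by auto
  then have "k = 0" using n0 assms(2) by simp
  then have "homologous_rel 1 ?P {} c 0" using k(1) by (simp add: homologous_rel_set_eq)
  then show ?thesis by (simp add: homologous_rel_def)
qed

text \<open>Both sides are represented by cycles with the same log change, and the log change
  determines the homology class.\<close>

lemma hom_induced_mult:
  assumes A: "continuous_map X (top_of_set (- {0::complex})) A" and B: "continuous_map X (top_of_set (- {0})) B"
    and \<xi>: "\<xi> \<in> carrier (homology_group 1 X)"
  shows "hom_induced 1 X {} (top_of_set (- {0})) {} (\<lambda>x. A x * B x) \<xi> =
     hom_induced 1 X {} (top_of_set (- {0})) {} A \<xi> \<otimes>\<^bsub>homology_group 1 (top_of_set (- {0}))\<^esub>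
     hom_induced 1 X {} (top_of_set (- {0})) {} B \<xi>"
proof -
  let ?P = "top_of_set (- {0::complex})"
  let ?H = "homologous_rel_set 1 ?P {}"
  obtain c where c: "singular_relcycle 1 X {} c" "\<xi> = homologous_rel_set 1 X {} c"
    using \<xi> carrier_relative_homology_group[of 1 X "{}"] by auto
  have AB: "continuous_map X ?P (\<lambda>x. A x * B x)"
    using A B by (auto simp: continuous_map_in_subtopology intro!: continuous_map_complex_mult)
  have ind: "hom_induced 1 X {} ?P {} C \<xi> = ?H (chain_map 1 C c)" if "continuous_map X ?P C" for C
    using hom_induced_chain_map[OF that _ c(1), of "{}" ] c by simp
  have cyc: "singular_relcycle 1 ?P {} (chain_map 1 C c)" if "continuous_map X ?P C" for C
    using singular_relcycle_chain_map[OF c(1) that] by simp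
  have "chain_log_change (chain_map 1 (\<lambda>x. A x * B x) c - (chain_map 1 A c + chain_map 1 B c)) = 0"
    using chain_log_change_mult[OF A B, of c] c(1)
    by (simp add: chain_log_change_diff chain_log_change_add singular_cycle)
  then have "homologous_rel 1 ?P {} (chain_map 1 (\<lambda>x. A x * B x) c) (chain_map 1 A c + chain_map 1 B c)"
    unfolding homologous_rel_def
    by (intro singular_boundary_punctured_plane singular_relcycle_diff singular_relcycle_add cyc A B AB)
  then have eq: "?H (chain_map 1 (\<lambda>x. A x * B x) c) = ?H (chain_map 1 A c + chain_map 1 B c)"
    by (simp add: homologous_rel_set_eq)
  show ?thesis
    unfolding ind[OF AB] ind[OF A] ind[OF B] eq
    using homologous_rel_set_add[of 1 ?P "chain_map 1 A c" "chain_map 1 B c"] by simp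
qed

text \<open>The connecting homomorphism of the target is injective because both halves are acyclic, so additivity may
  be checked on the intersection of the halves, one degree lower.\<close>

lemma Mayer_Vietoris_additive:
  fixes X :: "'a topology" and Y :: "'b topology"
  assumes Xp: "openin X Xp" and Xm: "openin X Xm" and XU: "Xp \<union> Xm = topspace X"
    and cont: "\<And>i. i \<in> {f,g,h} \<Longrightarrow> continuous_map X Y i"
    and imp: "\<And>i. i \<in> {f,g,h} \<Longrightarrow> i ` Xp \<subseteq> Yp"
    and imm: "\<And>i. i \<in> {f,g,h} \<Longrightarrow> i ` Xm \<subseteq> Ym"
    and Yp: "trivial_group (homology_group (p + 1) (subtopology Y Yp))"
    and Ym: "trivial_group (homology_group (p + 1) (subtopology Y Ym))"
    and add: "\<And>\<eta>. \<eta> \<in> carrier (homology_group p (subtopology X (Xp \<inter> Xm))) \<Longrightarrow>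
       hom_induced p (subtopology X (Xp \<inter> Xm)) {} (subtopology Y (Yp \<inter> Ym)) {} f \<eta> =
       hom_induced p (subtopology X (Xp \<inter> Xm)) {} (subtopology Y (Yp \<inter> Ym)) {} g \<eta>
       \<otimes>\<^bsub>homology_group p (subtopology Y (Yp \<inter> Ym))\<^esub>
       hom_induced p (subtopology X (Xp \<inter> Xm)) {} (subtopology Y (Yp \<inter> Ym)) {} h \<eta>"
    and \<xi>: "\<xi> \<in> carrier (homology_group (p + 1) X)"
  shows "hom_induced (p + 1) X {} Y {} f \<xi> =
         hom_induced (p + 1) X {} Y {} g \<xi> \<otimes>\<^bsub>homology_group (p + 1) Y\<^esub> hom_induced (p + 1) X {} Y {} h \<xi>"
proof -
  let ?q = "p + 1"
  let ?X = "subtopology X Xp" and ?Y = "subtopology Y Yp"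
  have sub: "subtopology ?X (Xp \<inter> Xm) = subtopology X (Xp \<inter> Xm)"
    "subtopology ?Y (Yp \<inter> Ym) = subtopology Y (Yp \<inter> Ym)"
    by (simp_all add: subtopology_subtopology Int_left_absorb)
  \<comment> \<open>The complement of \<open>Xp\<close> is closed and contained in the open set
    \<open>Xm\<close>; excising it leaves the pair of \<open>Xp\<close> and
    \<open>Xp \<inter> Xm\<close>.\<close>
  have exc: "hom_induced ?q ?X (Xp \<inter> Xm) X Xm id
      \<in> iso (relative_homology_group ?q ?X (Xp \<inter> Xm)) (relative_homology_group ?q X Xm)"
  proof -
    have cl: "X closure_of (topspace X - Xp) = topspace X - Xp"
      using Xp by (simp add: closure_of_closedin openin_closedin_eq)
    have it: "X interior_of Xm = Xm"
      using Xm by (simp add: interior_of_openin)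
    have "topspace X - Xp \<subseteq> Xm" "Xm \<subseteq> topspace X" "Xp \<subseteq> topspace X"
      using XU by auto
    then have e: "topspace X - (topspace X - Xp) = Xp" "Xm - (topspace X - Xp) = Xp \<inter> Xm"
      by auto
    show ?thesis
      using homology_excision_axiom[of X "topspace X - Xp" Xm "topspace X" ?q] \<open>topspace X - Xp \<subseteq> Xm\<close> \<open>Xm \<subseteq> topspace X\<close>
      by (simp add: cl it e)
  qed
  define iX where "iX = hom_induced ?q X {} X Xm id"
  define iY where "iY = hom_induced ?q Y {} Y Ym id"
  define jX where "jX = hom_induced ?q ?X (Xp \<inter> Xm) X Xm id"
  define jY where "jY = hom_induced ?q ?Y (Yp \<inter> Ym) Y Ym id"
  define bX where "bX = hom_boundary ?q ?X (Xp \<inter> Xm)"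
  define bY where "bY = hom_boundary ?q ?Y (Yp \<inter> Ym)"
  define R where "R k = hom_induced ?q ?X (Xp \<inter> Xm) ?Y (Yp \<inter> Ym) k" for k
  define H where "H k = hom_induced ?q X {} Y {} k" for k
  define B where "B k = hom_induced p (subtopology X (Xp \<inter> Xm)) {} (subtopology Y (Yp \<inter> Ym)) {} k" for k
  have "iX \<xi> \<in> carrier (relative_homology_group ?q X Xm)"
    unfolding iX_def by (rule hom_induced_carrier)
  then obtain \<zeta> where \<zeta>: "\<zeta> \<in> carrier (relative_homology_group ?q ?X (Xp \<inter> Xm))" "jX \<zeta> = iX \<xi>"
  proof -
    have "jX ` carrier (relative_homology_group ?q ?X (Xp \<inter> Xm)) = carrier (relative_homology_group ?q X Xm)"
      using exc by (simp add: iso_def bij_betw_def jX_def)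
    with \<open>iX \<xi> \<in> _\<close> show thesis using that by (metis imageE)
  qed
  have mem: "f \<in> {f,g,h}" "g \<in> {f,g,h}" "h \<in> {f,g,h}" by auto
  have contsub: "continuous_map ?X ?Y k" if "k \<in> {f,g,h}" for k
    using cont[OF that] imp[OF that]
    by (simp add: continuous_map_in_subtopology continuous_map_from_subtopology image_subset_iff Pi_iff)
  have fun1: "k \<in> Xm \<rightarrow> Ym" "k \<in> Xp \<rightarrow> Yp" "k \<in> Xp \<inter> Xm \<rightarrow> Yp \<inter> Ym" if "k \<in> {f,g,h}" for k
    using imp[OF that] imm[OF that] by (auto simp: image_subset_iff)
  \<comment> \<open>Together with \<open>sq2\<close> this carries the classes of \<open>f\<close>,
    \<open>g\<close> and \<open>h\<close> through the relative group of the half \<open>Yp\<close>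
    down to the intersection, where additivity is assumed.\<close>
  have sq1: "iY (H k \<xi>) = jY (R k \<zeta>)" if k: "k \<in> {f,g,h}" for k
  proof -
    have "iY (H k \<xi>) = hom_induced ?q X {} Y Ym (id \<circ> k) \<xi>"
      unfolding iY_def H_def using cont[OF k] by (intro hom_induced_compose') auto
    also have "\<dots> = hom_induced ?q X {} Y Ym (k \<circ> id) \<xi>" by simp
    also have "\<dots> = hom_induced ?q X Xm Y Ym k (iX \<xi>)"
      unfolding iX_def using cont[OF k] fun1[OF k] by (intro hom_induced_compose'[symmetric]) auto
    also have "\<dots> = hom_induced ?q X Xm Y Ym k (jX \<zeta>)" using \<zeta> by simp
    also have "\<dots> = hom_induced ?q ?X (Xp \<inter> Xm) Y Ym (k \<circ> id) \<zeta>"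
      unfolding jX_def using cont[OF k] fun1[OF k] by (intro hom_induced_compose') (auto simp: continuous_map_from_subtopology)
    also have "\<dots> = hom_induced ?q ?X (Xp \<inter> Xm) Y Ym (id \<circ> k) \<zeta>" by simp
    also have "\<dots> = jY (R k \<zeta>)"
      unfolding jY_def R_def using contsub[OF k] fun1[OF k] by (intro hom_induced_compose'[symmetric]) (auto simp: continuous_map_from_subtopology)
    finally show ?thesis .
  qed
  have sq2: "bY (R k \<zeta>) = B k (bX \<zeta>)" if k: "k \<in> {f,g,h}" for k
    using naturality_hom_induced[OF contsub[OF k] fun1(3)[OF k], of ?q]
    by (auto simp: bY_def R_def B_def bX_def sub fun_eq_iff)
  have bX: "bX \<zeta> \<in> carrier (homology_group p (subtopology X (Xp \<inter> Xm)))"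
    using hom_boundary_carrier[of ?q ?X "Xp \<inter> Xm" \<zeta>] by (simp add: bX_def sub)
  interpret GY: comm_group "homology_group ?q Y" by simp
  interpret GR: comm_group "relative_homology_group ?q ?Y (Yp \<inter> Ym)" by simp
  interpret GM: comm_group "relative_homology_group ?q Y Ym" by simp
  interpret GB: comm_group "homology_group p (subtopology Y (Yp \<inter> Ym))" by simp
  have Hc: "H k \<xi> \<in> carrier (homology_group ?q Y)" for k
    unfolding H_def by (rule hom_induced_carrier)
  have Rc: "R k \<zeta> \<in> carrier (relative_homology_group ?q ?Y (Yp \<inter> Ym))" for k
    unfolding R_def by (rule hom_induced_carrier)
  interpret iY: group_hom "homology_group ?q Y" "relative_homology_group ?q Y Ym" iY
    by (simp add: group_hom_def group_hom_axioms_def iY_def hom_induced_hom)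
  interpret jY: group_hom "relative_homology_group ?q ?Y (Yp \<inter> Ym)" "relative_homology_group ?q Y Ym" jY
    by (simp add: group_hom_def group_hom_axioms_def jY_def hom_induced_hom)
  have bYhom: "bY \<in> hom (relative_homology_group ?q ?Y (Yp \<inter> Ym)) (homology_group p (subtopology Y (Yp \<inter> Ym)))"
    using hom_boundary_hom[of ?q ?Y "Yp \<inter> Ym"] by (simp add: bY_def sub)
  interpret bY: group_hom "relative_homology_group ?q ?Y (Yp \<inter> Ym)" "homology_group p (subtopology Y (Yp \<inter> Ym))" bY
    by (simp add: group_hom_def group_hom_axioms_def bYhom)
  \<comment> \<open>By exactness the kernel comes from the homology of \<open>Yp\<close>, which is
    trivial in this degree.\<close>
  have injb: "inj_on bY (carrier (relative_homology_group ?q ?Y (Yp \<inter> Ym)))"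
  proof -
    have "exact_seq ([homology_group p (subtopology Y (Yp \<inter> Ym)), relative_homology_group ?q ?Y (Yp \<inter> Ym), homology_group ?q ?Y],
              [bY, hom_induced ?q ?Y {} ?Y (Yp \<inter> Ym) id])"
      using homology_exactness_axiom_1[of ?q ?Y "Yp \<inter> Ym"] by (simp add: bY_def sub)
    then have ker: "kernel (relative_homology_group ?q ?Y (Yp \<inter> Ym)) (homology_group p (subtopology Y (Yp \<inter> Ym))) bY
       = hom_induced ?q ?Y {} ?Y (Yp \<inter> Ym) id ` carrier (homology_group ?q ?Y)"
      by simp
    have "hom_induced ?q ?Y {} ?Y (Yp \<inter> Ym) id ` carrier (homology_group ?q ?Y)
       = {\<one>\<^bsub>relative_homology_group ?q ?Y (Yp \<inter> Ym)\<^esub>}"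
      using Yp hom_one[OF hom_induced_hom[of ?q ?Y "{}" ?Y "Yp \<inter> Ym" id]]
      by (simp add: trivial_group_def)
    with ker show ?thesis by (simp add: bY.inj_iff_trivial_ker)
  qed
  have inji: "inj_on iY (carrier (homology_group ?q Y))"
  proof -
    have "exact_seq ([relative_homology_group ?q Y Ym, homology_group ?q Y, homology_group ?q (subtopology Y Ym)],
              [iY, hom_induced ?q (subtopology Y Ym) {} Y {} id])"
      using homology_exactness_axiom_3[of ?q Y Ym] by (simp add: iY_def)
    then have ker: "kernel (homology_group ?q Y) (relative_homology_group ?q Y Ym) iY
       = hom_induced ?q (subtopology Y Ym) {} Y {} id ` carrier (homology_group ?q (subtopology Y Ym))"
      by simp
    have "hom_induced ?q (subtopology Y Ym) {} Y {} id ` carrier (homology_group ?q (subtopology Y Ym))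
       = {\<one>\<^bsub>homology_group ?q Y\<^esub>}"
      using Ym hom_one[OF hom_induced_hom[of ?q "subtopology Y Ym" "{}" Y "{}" id]]
      by (simp add: trivial_group_def)
    with ker show ?thesis by (simp add: iY.inj_iff_trivial_ker)
  qed
  have "bY (R f \<zeta>) = bY (R g \<zeta> \<otimes>\<^bsub>relative_homology_group ?q ?Y (Yp \<inter> Ym)\<^esub> R h \<zeta>)"
    using add[OF bX] by (simp add: bY.hom_mult[OF Rc Rc] sq2 mem B_def)
  then have "R f \<zeta> = R g \<zeta> \<otimes>\<^bsub>relative_homology_group ?q ?Y (Yp \<inter> Ym)\<^esub> R h \<zeta>"
    using injb Rc by (simp add: inj_on_def)
  then have "iY (H f \<xi>) = iY (H g \<xi> \<otimes>\<^bsub>homology_group ?q Y\<^esub> H h \<xi>)"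
    using Hc Rc by (simp add: sq1 iY.hom_mult)
  then have "H f \<xi> = H g \<xi> \<otimes>\<^bsub>homology_group ?q Y\<^esub> H h \<xi>"
    using inji Hc by (simp add: inj_on_def)
  then show ?thesis by (simp add: H_def)
qed

section \<open>Suspension: carrying additivity up by one degree\<close>

lemma contractible_half_space:
  fixes e :: real
  assumes "e \<noteq> 0"
  shows "contractible {x :: 'b::real_normed_vector \<times> real. fst x \<noteq> 0 \<or> e * snd x > 0}" (is "contractible ?S")
proof (rule starlike_imp_contractible)
  \<comment> \<open>What the set omits is the closed half of the axis \<open>fst x = 0\<close> on
    which \<open>e * snd x \<le> 0\<close>; the centre \<open>(0, e)\<close> lies on the opposite
    side.\<close>
  have "\<forall>x\<in>?S. closed_segment (0, e) x \<subseteq> ?S"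
  proof (intro ballI subsetI)
    fix x y assume x: "x \<in> ?S" and "y \<in> closed_segment (0, e) x"
    then obtain u where u: "0 \<le> u" "u \<le> 1" "y = (1 - u) *\<^sub>R (0, e) + u *\<^sub>R x"
      by (auto simp: in_segment)
    have ee: "e * e > 0" using assms by (metis not_real_square_gt_zero)
    show "y \<in> ?S"
    proof (cases "u = 0")
      case True then show ?thesis using u ee by simp
    next
      case False
      show ?thesis
      proof (cases "fst x = 0")
        case True
        then have "e * snd x > 0" using x by auto
        then have "(1 - u) * (e * e) + u * (e * snd x) > 0"
          using u False ee by (intro add_nonneg_pos) auto
        then show ?thesis using u by (simp add: algebra_simps)
      qed (use u False in auto)
    qed
  qed
  moreover have "(0, e) \<in> ?S" using assms by (auto simp: zero_less_mult_iff neq_iff)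
  ultimately show "starlike ?S" unfolding starlike_def by blast
qed

lemma trivial_homology_group_contractible:
  "contractible S \<Longrightarrow> p \<noteq> 0 \<Longrightarrow> trivial_group (homology_group p (top_of_set S))"
  using trivial_reduced_homology_group_contractible_space[of "top_of_set S" p] by (simp add: un_reduced_homology_group)

text \<open>The real function \<open>k\<close> is the suspension coordinate.\<close>

lemma suspension_additive:
  fixes f g h :: "'a \<Rightarrow> 'b::real_normed_vector" and k :: "'a \<Rightarrow> real"
  assumes f: "continuous_map X euclidean f" and g: "continuous_map X euclidean g"
    and h: "continuous_map X euclidean h" and k: "continuous_map X euclidean k"
    and nz: "\<And>x. x \<in> topspace X \<Longrightarrow> f x = 0 \<or> g x = 0 \<or> h x = 0 \<Longrightarrow> k x \<noteq> 0"
    and p: "p + 1 \<noteq> 0"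
    and U: "U = {x \<in> topspace X. f x \<noteq> 0 \<and> g x \<noteq> 0 \<and> h x \<noteq> 0}"
    and add: "\<And>\<eta>. \<eta> \<in> carrier (homology_group p (subtopology X U)) \<Longrightarrow>
       hom_induced p (subtopology X U) {} (top_of_set (- {0})) {} f \<eta> =
       hom_induced p (subtopology X U) {} (top_of_set (- {0})) {} g \<eta>
       \<otimes>\<^bsub>homology_group p (top_of_set (- {0}))\<^esub> hom_induced p (subtopology X U) {} (top_of_set (- {0})) {} h \<eta>"
    and \<xi>: "\<xi> \<in> carrier (homology_group (p + 1) X)"
  shows "hom_induced (p + 1) X {} (top_of_set (- {0})) {} (\<lambda>x. (f x, k x)) \<xi> =
     hom_induced (p + 1) X {} (top_of_set (- {0})) {} (\<lambda>x. (g x, k x)) \<xi>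
     \<otimes>\<^bsub>homology_group (p + 1) (top_of_set (- {0}))\<^esub> hom_induced (p + 1) X {} (top_of_set (- {0})) {} (\<lambda>x. (h x, k x)) \<xi>"
proof -
  let ?V = "top_of_set (- {0::'b})"
  let ?Y = "top_of_set (- {0::'b \<times> real})"
  \<comment> \<open>The target is covered by the complements of two opposite closed half-axes. Both
    are contractible, and they meet in the complement of the axis.\<close>
  define Yp where "Yp = {x :: 'b \<times> real. fst x \<noteq> 0 \<or> 1 * snd x > 0}"
  define Ym where "Ym = {x :: 'b \<times> real. fst x \<noteq> 0 \<or> (-1) * snd x > 0}"
  define Y0 where "Y0 = {x :: 'b \<times> real. fst x \<noteq> 0}"
  have int: "Yp \<inter> Ym = Y0" by (auto simp: Yp_def Ym_def Y0_def)
  have sub: "subtopology ?Y Yp = top_of_set Yp" "subtopology ?Y Ym = top_of_set Ym" "subtopology ?Y Y0 = top_of_set Y0"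
    by (auto simp: subtopology_subtopology Yp_def Ym_def Y0_def intro!: arg_cong[where f = "subtopology euclidean"])
  have oU: "openin X U"
  proof -
    have "openin X {x \<in> topspace X. q x \<in> - {0}}" if "continuous_map X euclidean q" for q :: "'a \<Rightarrow> 'b"
      using that by (rule openin_continuous_map_preimage) auto
    from this[OF f] this[OF g] this[OF h]
    have "openin X ({x \<in> topspace X. f x \<in> - {0}} \<inter> {x \<in> topspace X. g x \<in> - {0}} \<inter> {x \<in> topspace X. h x \<in> - {0}})"
      by (intro openin_Int)
    also have "({x \<in> topspace X. f x \<in> - {0}} \<inter> {x \<in> topspace X. g x \<in> - {0}} \<inter> {x \<in> topspace X. h x \<in> - {0}}) = U"
      by (auto simp: U)
    finally show ?thesis .
  qed
  \<comment> \<open>Outside \<open>U\<close> one of the three maps vanishes, so \<open>k\<close> is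
    non-zero there. Hence the two sets cover \<open>X\<close>, and their intersection is exactly
    \<open>U\<close>.\<close>
  define Xp where "Xp = U \<union> {x \<in> topspace X. k x \<in> {0<..}}"
  define Xm where "Xm = U \<union> {x \<in> topspace X. k x \<in> {..<0}}"
  have oX: "openin X Xp" "openin X Xm"
    unfolding Xp_def Xm_def by (intro openin_Un oU openin_continuous_map_preimage[OF k]; simp)+
  have UX: "Xp \<union> Xm = topspace X" "Xp \<inter> Xm = U"
    using nz by (force simp: Xp_def Xm_def U)+
  define F where "F q = (\<lambda>x. (q x :: 'b, k x))" for q
  have cF: "continuous_map X ?Y (F q)" if "q \<in> {f, g, h}" for q
    using that f g h k nz unfolding F_def
    by (auto simp: continuous_map_in_subtopology zero_prod_def intro!: continuous_map_euclidean_Pair)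
  \<comment> \<open>Dropping the suspension coordinate is a homotopy equivalence on the complement
    of the axis, so the assumed additivity can be pulled back along \<open>fst\<close>.\<close>
  have proj: "inj_on (hom_induced p (top_of_set Y0) {} ?V {} fst) (carrier (homology_group p (top_of_set Y0)))"
  proof -
    define s where "s = (\<lambda>v::'b. (v, 0::real))"
    have cfst: "continuous_map (top_of_set Y0) ?V fst"
      by (auto simp: Y0_def continuous_map_in_subtopology intro!: continuous_intros)
    have cs: "continuous_map ?V (top_of_set Y0) s"
      by (auto simp: Y0_def s_def continuous_map_in_subtopology intro!: continuous_intros)
    have "homotopic_with_canon (\<lambda>h. True) Y0 Y0 (s \<circ> fst) id"
    proof (rule homotopic_with_linear)
      show "continuous_on Y0 (s \<circ> fst)" "continuous_on Y0 id"
        by (auto simp: s_def o_def intro!: continuous_intros)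
      show "closed_segment ((s \<circ> fst) x) (id x) \<subseteq> Y0" if "x \<in> Y0" for x
      proof
        fix y assume "y \<in> closed_segment ((s \<circ> fst) x) (id x)"
        then obtain u where "y = (1 - u) *\<^sub>R s (fst x) + u *\<^sub>R x" by (auto simp: in_segment)
        then have "fst y = fst x" by (simp add: s_def flip: scaleR_add_left)
        with that show "y \<in> Y0" by (simp add: Y0_def)
      qed
    qed
    then have "hom_induced p (top_of_set Y0) {} (top_of_set Y0) {} (s \<circ> fst) = hom_induced p (top_of_set Y0) {} (top_of_set Y0) {} id"
      by (rule homology_homotopy_empty)
    then have "hom_induced p ?V {} (top_of_set Y0) {} s (hom_induced p (top_of_set Y0) {} ?V {} fst c) = c"
      if "c \<in> carrier (homology_group p (top_of_set Y0))" for c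
      using that hom_induced_compose_empty[OF cfst cs, of p] by (metis comp_apply hom_induced_id)
    then show ?thesis by (rule inj_on_inverseI)
  qed
  have cY0: "continuous_map (top_of_set Y0) ?V fst"
    by (auto simp: Y0_def continuous_map_in_subtopology intro!: continuous_intros)
  have cU: "continuous_map (subtopology X U) (top_of_set Y0) (F q)" if "q \<in> {f, g, h}" for q
    using that f g h k nz unfolding F_def
    by (auto simp: continuous_map_in_subtopology Y0_def U continuous_map_from_subtopology intro!: continuous_map_euclidean_Pair)
  let ?R = "\<lambda>q. hom_induced p (subtopology X U) {} (top_of_set Y0) {} (F q)"
  have addU: "?R f \<eta> = ?R g \<eta> \<otimes>\<^bsub>homology_group p (top_of_set Y0)\<^esub> ?R h \<eta>"
    if \<eta>: "\<eta> \<in> carrier (homology_group p (subtopology X U))" for \<eta>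
  proof -
    interpret group "homology_group p (top_of_set Y0)" by simp
    interpret P: group_hom "homology_group p (top_of_set Y0)" "homology_group p ?V" "hom_induced p (top_of_set Y0) {} ?V {} fst"
      by (simp add: group_hom_def group_hom_axioms_def hom_induced_hom)
    have comp: "hom_induced p (top_of_set Y0) {} ?V {} fst (?R q \<eta>) = hom_induced p (subtopology X U) {} ?V {} q \<eta>"
      if "q \<in> {f, g, h}" for q
    proof -
      have "fst \<circ> F q = q" by (auto simp: F_def)
      with hom_induced_compose_empty[OF cU[OF that] cY0, of p] show ?thesis by simp
    qed
    have c: "?R q \<eta> \<in> carrier (homology_group p (top_of_set Y0))" for q
      by (rule hom_induced_carrier)
    have "hom_induced p (top_of_set Y0) {} ?V {} fst (?R f \<eta>) =
      hom_induced p (top_of_set Y0) {} ?V {} fst (?R g \<eta> \<otimes>\<^bsub>homology_group p (top_of_set Y0)\<^esub> ?R h \<eta>)"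
      using add[OF \<eta>] by (simp add: P.hom_mult c comp)
    then show ?thesis
      using proj c by (auto simp: inj_on_def)
  qed
  have "hom_induced (p + 1) X {} ?Y {} (F f) \<xi> =
     hom_induced (p + 1) X {} ?Y {} (F g) \<xi> \<otimes>\<^bsub>homology_group (p + 1) ?Y\<^esub> hom_induced (p + 1) X {} ?Y {} (F h) \<xi>"
  proof (rule Mayer_Vietoris_additive[where Xp = Xp and Xm = Xm and Yp = Yp and Ym = Ym, OF oX UX(1) _ _ _ _ _ _ \<xi>])
    show "continuous_map X ?Y i" if "i \<in> {F f, F g, F h}" for i using that cF by auto
    show "i ` Xp \<subseteq> Yp" if "i \<in> {F f, F g, F h}" for i using that by (auto simp: F_def Xp_def Yp_def U)
    show "i ` Xm \<subseteq> Ym" if "i \<in> {F f, F g, F h}" for i using that by (auto simp: F_def Xm_def Ym_def U)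
    show "trivial_group (homology_group (p + 1) (subtopology ?Y Yp))"
      unfolding sub using p unfolding Yp_def by (intro trivial_homology_group_contractible contractible_half_space) auto
    show "trivial_group (homology_group (p + 1) (subtopology ?Y Ym))"
      unfolding sub using p unfolding Ym_def by (intro trivial_homology_group_contractible contractible_half_space) auto
  qed (use addU in \<open>simp add: int UX(2) sub\<close>)
  then show ?thesis by (simp add: F_def)
qed

text \<open>Two suspensions of the product rule in the punctured plane, with coordinates
  \<open>k\<close> and \<open>l\<close>. Each step uses the identity one degree lower only where all
  three maps are non-zero, which is what \<open>W\<close> and \<open>U\<close> record; elsewhere the
  next coordinate is non-zero.\<close>

lemma hom_induced_mult3:
  assumes A: "continuous_map X euclidean (A :: 'a \<Rightarrow> complex)" and B: "continuous_map X euclidean B"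
    and k: "continuous_map X euclidean (k :: 'a \<Rightarrow> real)" and l: "continuous_map X euclidean (l :: 'a \<Rightarrow> real)"
    and nz: "\<And>x. x \<in> topspace X \<Longrightarrow> A x * B x = 0 \<Longrightarrow> k x \<noteq> 0 \<or> l x \<noteq> 0"
    and \<xi>: "\<xi> \<in> carrier (homology_group 3 X)"
  shows "hom_induced 3 X {} (top_of_set (- {0})) {} (\<lambda>x. ((A x * B x, k x), l x)) \<xi> =
     hom_induced 3 X {} (top_of_set (- {0})) {} (\<lambda>x. ((A x, k x), l x)) \<xi>
     \<otimes>\<^bsub>homology_group 3 (top_of_set (- {0}))\<^esub> hom_induced 3 X {} (top_of_set (- {0})) {} (\<lambda>x. ((B x, k x), l x)) \<xi>"
proof -
  let ?AB = "\<lambda>x. A x * B x"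
  have AB: "continuous_map X euclidean ?AB" by (rule continuous_map_complex_mult[OF A B])
  define U where "U = {x \<in> topspace X. (?AB x, k x) \<noteq> 0 \<and> (A x, k x) \<noteq> 0 \<and> (B x, k x) \<noteq> 0}"
  define W where "W = {x \<in> topspace (subtopology X U). ?AB x \<noteq> 0 \<and> A x \<noteq> 0 \<and> B x \<noteq> 0}"
  have 1: "hom_induced 1 (subtopology (subtopology X U) W) {} (top_of_set (- {0})) {} ?AB \<eta> =
     hom_induced 1 (subtopology (subtopology X U) W) {} (top_of_set (- {0})) {} A \<eta> \<otimes>\<^bsub>homology_group 1 (top_of_set (- {0}))\<^esub>
     hom_induced 1 (subtopology (subtopology X U) W) {} (top_of_set (- {0})) {} B \<eta>"
    if "\<eta> \<in> carrier (homology_group 1 (subtopology (subtopology X U) W))" for \<eta>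
  proof (rule hom_induced_mult[OF _ _ that])
    show "continuous_map (subtopology (subtopology X U) W) (top_of_set (- {0})) A"
      "continuous_map (subtopology (subtopology X U) W) (top_of_set (- {0})) B"
      using A B by (auto simp: continuous_map_in_subtopology W_def continuous_map_from_subtopology)
  qed
  have 2: "hom_induced 2 (subtopology X U) {} (top_of_set (- {0})) {} (\<lambda>x. (?AB x, k x)) \<eta> =
     hom_induced 2 (subtopology X U) {} (top_of_set (- {0})) {} (\<lambda>x. (A x, k x)) \<eta> \<otimes>\<^bsub>homology_group 2 (top_of_set (- {0}))\<^esub>
     hom_induced 2 (subtopology X U) {} (top_of_set (- {0})) {} (\<lambda>x. (B x, k x)) \<eta>"
    if "\<eta> \<in> carrier (homology_group 2 (subtopology X U))" for \<eta>
  proof -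
    have "\<eta> \<in> carrier (homology_group (1 + 1) (subtopology X U))" using that by simp
    then have "hom_induced (1 + 1) (subtopology X U) {} (top_of_set (- {0})) {} (\<lambda>x. (?AB x, k x)) \<eta> =
     hom_induced (1 + 1) (subtopology X U) {} (top_of_set (- {0})) {} (\<lambda>x. (A x, k x)) \<eta> \<otimes>\<^bsub>homology_group (1 + 1) (top_of_set (- {0}))\<^esub>
     hom_induced (1 + 1) (subtopology X U) {} (top_of_set (- {0})) {} (\<lambda>x. (B x, k x)) \<eta>"
      by (rule suspension_additive[where U = W, rotated -1])
        (use A B AB k 1 in \<open>auto simp: continuous_map_from_subtopology W_def U_def zero_prod_def simp del: one_add_one\<close>)
    then show ?thesis by simp
  qed
  have "\<xi> \<in> carrier (homology_group (2 + 1) X)" using \<xi> by simp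
  then have "hom_induced (2 + 1) X {} (top_of_set (- {0})) {} (\<lambda>x. ((?AB x, k x), l x)) \<xi> =
     hom_induced (2 + 1) X {} (top_of_set (- {0})) {} (\<lambda>x. ((A x, k x), l x)) \<xi>
     \<otimes>\<^bsub>homology_group (2 + 1) (top_of_set (- {0}))\<^esub> hom_induced (2 + 1) X {} (top_of_set (- {0})) {} (\<lambda>x. ((B x, k x), l x)) \<xi>"
  proof (rule suspension_additive[where U = U, rotated -1])
    show "l x \<noteq> 0" if "x \<in> topspace X" "(?AB x, k x) = 0 \<or> (A x, k x) = 0 \<or> (B x, k x) = 0" for x
      using nz[OF that(1)] that(2) by (auto simp: zero_prod_def)
    show "U = {x \<in> topspace X. (?AB x, k x) \<noteq> 0 \<and> (A x, k x) \<noteq> 0 \<and> (B x, k x) \<noteq> 0}" by (fact U_def)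
  qed (use A B AB k l 2 in \<open>simp_all add: continuous_map_euclidean_Pair\<close>)
  then show ?thesis by simp
qed

section \<open>Degrees of pairs of complex functions on the 3-sphere\<close>

definition S3 :: "(complex^2) set" where "S3 = sphere 0 1"

text \<open>The normalized pair is a self-map of the 3-sphere, encoded in real coordinates exactly
  as in \<open>linking_number\<close>. The value is meaningful when \<open>A\<close> and
  \<open>C\<close> have no common zero on \<open>S3\<close>, since \<open>sgn\<close> maps 0 to 0,
  off the sphere.\<close>

definition deg2 :: "(complex^2 \<Rightarrow> complex) \<Rightarrow> (complex^2 \<Rightarrow> complex) \<Rightarrow> int" where
  "deg2 A C = Brouwer_degree2 3 (real_coords \<circ> (\<lambda>x. sgn (vector [A x, C x])) \<circ> of_real_coords)"

lemma topspace_nsphere_3: "x \<in> topspace (nsphere 3) \<longleftrightarrow> (x 0)\<^sup>2 + (x 1)\<^sup>2 + (x 2)\<^sup>2 + (x 3)\<^sup>2 = 1 \<and> (\<forall>i>3. x i = 0)"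
  by (auto simp: nsphere numeral_3_eq_3 numeral_2_eq_2)

lemma norm_complex2: "(norm (v :: complex^2))\<^sup>2 = (cmod (v $ 1))\<^sup>2 + (cmod (v $ 2))\<^sup>2"
  by (simp add: norm_vec_def L2_set_def sum_2)

lemma vector2_eta [simp]: "vector [v $ 1, v $ 2] = (v :: complex^2)"
  by (simp add: vec_eq_iff forall_2)

lemma vector2_eq_0_iff [simp]: "vector [a, b] = (0 :: complex^2) \<longleftrightarrow> a = 0 \<and> b = 0"
  by (simp add: vec_eq_iff forall_2)

lemma of_real_coords_S3: "x \<in> topspace (nsphere 3) \<Longrightarrow> of_real_coords x \<in> S3"
proof -
  assume "x \<in> topspace (nsphere 3)"
  then have "(norm (of_real_coords x))\<^sup>2 = 1"
    unfolding norm_complex2 by (simp add: topspace_nsphere_3 of_real_coords_def cmod_power2)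
  then show ?thesis
    by (simp add: S3_def power2_eq_1_iff) (metis norm_not_less_zero neg_less_0_iff_less zero_less_one)
qed

lemma real_coords_S3: "v \<in> S3 \<Longrightarrow> real_coords v \<in> topspace (nsphere 3)"
  using norm_complex2[of v]
  by (auto simp: topspace_nsphere_3 S3_def real_coords_def cmod_power2)

lemma of_real_coords_real_coords [simp]: "of_real_coords (real_coords v) = v"
  by (simp add: of_real_coords_def real_coords_def vec_eq_iff forall_2)

lemma continuous_on_vector2 [continuous_intros]:
  assumes "continuous_on S f" "continuous_on S g"
  shows "continuous_on S (\<lambda>x. vector [f x, g x] :: complex^2)"
proof -
  have "continuous_on S (\<lambda>x. (\<chi> i. if i = 1 then f x else g x) :: complex^2)"
  proof (rule continuous_on_vec_lambda)
    show "continuous_on S (\<lambda>x. if i = 1 then f x else g x)" for i :: 2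
      using assms by (cases "i = 1") simp_all
  qed
  moreover have "(\<chi> i. if i = 1 then f x else g x) = (vector [f x, g x] :: complex^2)" for x
    by (simp add: vec_eq_iff forall_2)
  ultimately show ?thesis by simp
qed

lemma continuous_map_of_real_coords: "continuous_map (nsphere 3) (top_of_set S3) of_real_coords"
proof -
  have c: "continuous_map euclidean euclidean (\<lambda>p::(real \<times> real) \<times> (real \<times> real). vector [Complex (fst (fst p)) (snd (fst p)), Complex (fst (snd p)) (snd (snd p))] :: complex^2)"
    by (auto simp: Complex_eq intro!: continuous_intros)
  have "continuous_map (nsphere 3) euclidean of_real_coords"
    using continuous_map_compose[OF continuous_map_euclidean_Pair[OF
      continuous_map_euclidean_Pair[OF continuous_map_nsphere_projection[of 3 0] continuous_map_nsphere_projection[of 3 1]]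
      continuous_map_euclidean_Pair[OF continuous_map_nsphere_projection[of 3 2] continuous_map_nsphere_projection[of 3 3]]] c]
    by (simp add: o_def of_real_coords_def[abs_def])
  then show ?thesis
    using of_real_coords_S3 by (auto simp: continuous_map_in_subtopology)
qed

lemma continuous_map_real_coords: "continuous_map (top_of_set S3) (nsphere 3) real_coords"
proof -
  have "continuous_on S3 (\<lambda>v. real_coords v k)" for k
    by (cases "k = 0"; cases "k = 1"; cases "k = 2"; cases "k = 3") (auto simp: real_coords_def intro!: continuous_intros)
  moreover have "real_coords ` S3 \<subseteq> topspace (nsphere 3)" using real_coords_S3 by auto
  ultimately show ?thesis
    by (auto simp: nsphere continuous_map_in_subtopology continuous_map_componentwise_UNIV)
qed

section \<open>Homotopy invariance and additivity of the degree\<close>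

lemma deg2_homotopy:
  fixes A C :: "real \<Rightarrow> complex^2 \<Rightarrow> complex"
  assumes A: "continuous_on ({0..1} \<times> S3) (\<lambda>p. A (fst p) (snd p))"
    and C: "continuous_on ({0..1} \<times> S3) (\<lambda>p. C (fst p) (snd p))"
    and nz: "\<And>t x. 0 \<le> t \<Longrightarrow> t \<le> 1 \<Longrightarrow> x \<in> S3 \<Longrightarrow> A t x \<noteq> 0 \<or> C t x \<noteq> 0"
  shows "deg2 (A 0) (C 0) = deg2 (A 1) (C 1)"
proof -
  define h where "h = (\<lambda>p. sgn (vector [A (fst p) (snd p), C (fst p) (snd p)]) :: complex^2)"
  have "continuous_on ({0..1} \<times> S3) h"
    unfolding h_def using nz by (intro continuous_intros A C) auto
  moreover have "h ` ({0..1} \<times> S3) \<subseteq> S3"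
    using nz by (auto simp: h_def S3_def norm_sgn)
  ultimately have "homotopic_with_canon (\<lambda>_. True) S3 S3 (\<lambda>x. h (0, x)) (\<lambda>x. h (1, x))"
    unfolding homotopic_with_def
    by (intro exI[of _ h]) (auto simp: prod_topology_subtopology_eu image_subset_iff)
  then have "homotopic_with (\<lambda>_. True) (nsphere 3) (nsphere 3)
     (real_coords \<circ> (\<lambda>x. h (0, x)) \<circ> of_real_coords) (real_coords \<circ> (\<lambda>x. h (1, x)) \<circ> of_real_coords)"
    by (intro homotopic_with_compose_continuous_map_right[where p = "\<lambda>_. True", OF _ continuous_map_of_real_coords]
       homotopic_with_compose_continuous_map_left[where p = "\<lambda>_. True", OF _ continuous_map_real_coords]) auto
  from Brouwer_degree2_homotopic[OF this] show ?thesis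
    by (simp add: deg2_def h_def)
qed

text \<open>The tool behind most comparisons below: along a linear deformation the second component
  has to be controlled only at the points where the first one vanishes.\<close>

lemma deg2_linear:
  fixes A A' C C' :: "complex^2 \<Rightarrow> complex"
  assumes "continuous_on S3 A" "continuous_on S3 A'" "continuous_on S3 C" "continuous_on S3 C'"
    and nz: "\<And>t x. 0 \<le> t \<Longrightarrow> t \<le> 1 \<Longrightarrow> x \<in> S3 \<Longrightarrow>
       (1 - of_real t) * A x + of_real t * A' x = 0 \<Longrightarrow> (1 - of_real t) * C x + of_real t * C' x \<noteq> 0"
  shows "deg2 A C = deg2 A' C'"
proof -
  have c: "continuous_on ({0..1::real} \<times> S3) (\<lambda>p. (1 - of_real (fst p)) * f (snd p) + of_real (fst p) * g (snd p))"
    if "continuous_on S3 f" "continuous_on S3 g" for f g :: "complex^2 \<Rightarrow> complex"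
    by (intro continuous_intros continuous_on_compose2[OF that(1)] continuous_on_compose2[OF that(2)]) auto
  have "deg2 (\<lambda>x. (1 - of_real 0) * A x + of_real 0 * A' x) (\<lambda>x. (1 - of_real 0) * C x + of_real 0 * C' x)
      = deg2 (\<lambda>x. (1 - of_real 1) * A x + of_real 1 * A' x) (\<lambda>x. (1 - of_real 1) * C x + of_real 1 * C' x)"
    using nz by (intro deg2_homotopy c assms) blast+
  then show ?thesis by simp
qed

lemma deg2_fst_snd: "deg2 (\<lambda>x. x $ 1) (\<lambda>x. x $ 2) = 1"
proof -
  have "Brouwer_degree2 3 (real_coords \<circ> (\<lambda>x. sgn (vector [x $ 1, x $ 2])) \<circ> of_real_coords) = Brouwer_degree2 3 id"
  proof (rule Brouwer_degree2_eq)
    fix x assume x: "x \<in> topspace (nsphere 3)"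
    then have "norm (of_real_coords x) = 1" using of_real_coords_S3 by (auto simp: S3_def)
    then have "sgn (of_real_coords x) = of_real_coords x" by (simp add: sgn_div_norm)
    then show "(real_coords \<circ> (\<lambda>x. sgn (vector [x $ 1, x $ 2])) \<circ> of_real_coords) x = id x"
      using x by (auto simp: topspace_nsphere_3 fun_eq_iff real_coords_def of_real_coords_def)
  qed
  then show ?thesis by (simp add: deg2_def Brouwer_degree2_id)
qed

text \<open>The real and imaginary parts of \<open>C\<close> serve as the two suspension
  coordinates. \<open>M\<close> is the pair in this splitting before normalization and
  \<open>N\<close> normalizes back to the sphere, so the product rule on the third homology group
  becomes an identity of degrees.\<close>

lemma deg2_mult:
  assumes A: "continuous_on S3 A" and B: "continuous_on S3 B" and C: "continuous_on S3 C"
    and nz: "\<And>x. x \<in> S3 \<Longrightarrow> A x * B x = 0 \<Longrightarrow> C x \<noteq> 0"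
  shows "deg2 (\<lambda>x. A x * B x) C = deg2 A C + deg2 B C"
proof -
  define N where "N = (\<lambda>p::(complex \<times> real) \<times> real. real_coords (sgn (vector [fst (fst p), Complex (snd (fst p)) (snd p)])))"
  define M where "M D = (\<lambda>x. ((D (of_real_coords x) :: complex, Re (C (of_real_coords x))), Im (C (of_real_coords x))))" for D
  let ?Y = "top_of_set (- {0 :: (complex \<times> real) \<times> real})"
  let ?N3 = "nsphere 3"
  have cN: "continuous_map ?Y ?N3 N"
  proof -
    have nz: "vector [fst (fst p), Complex (snd (fst p)) (snd p)] \<noteq> (0 :: complex^2)" if "p \<noteq> 0" for p :: "(complex \<times> real) \<times> real"
      using that by (cases p) (auto simp: zero_prod_def complex_eq_iff)
    have "continuous_map ?Y (top_of_set S3) (\<lambda>p. sgn (vector [fst (fst p), Complex (snd (fst p)) (snd p)]))"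
      using nz by (auto simp: continuous_map_in_subtopology S3_def norm_sgn Complex_eq simp del: vector2_eq_0_iff intro!: continuous_intros)
    from continuous_map_compose[OF this continuous_map_real_coords] show ?thesis
      by (simp add: N_def o_def)
  qed
  have AB: "continuous_on S3 (\<lambda>x. A x * B x)" using A B by (intro continuous_intros)
  have eu: "continuous_map ?N3 euclidean (\<lambda>x. D (of_real_coords x))" if "continuous_on S3 D" for D :: "complex^2 \<Rightarrow> 'b::topological_space"
  proof -
    have "continuous_map (top_of_set S3) euclidean D" using that by simp
    from continuous_map_compose[OF continuous_map_of_real_coords this] show ?thesis by (simp add: o_def)
  qed
  have cM: "continuous_map ?N3 ?Y (M D)" if "continuous_on S3 D" "\<And>x. x \<in> S3 \<Longrightarrow> D x = 0 \<Longrightarrow> C x \<noteq> 0" for D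
  proof -
    have "continuous_map ?N3 euclidean (M D)"
      unfolding M_def using that(1) C by (intro continuous_map_euclidean_Pair eu continuous_intros)
    moreover have "M D x \<noteq> 0" if "x \<in> topspace ?N3" for x
      using \<open>\<And>x. x \<in> S3 \<Longrightarrow> D x = 0 \<Longrightarrow> C x \<noteq> 0\<close> of_real_coords_S3[OF that]
      by (auto simp: M_def zero_prod_def complex_eq_iff)
    ultimately show ?thesis by (auto simp: continuous_map_in_subtopology)
  qed
  define d where "d D = (real_coords \<circ> (\<lambda>x. sgn (vector [D x, C x])) \<circ> of_real_coords)" for D
  have NM: "N \<circ> M D = d D" for D
    by (auto simp: N_def M_def d_def)
  let ?G = "reduced_homology_group 3 ?N3"
  interpret G: group ?G by simp
  have red: "?G = homology_group 3 ?N3" by (simp add: un_reduced_homology_group)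
  interpret NH: group_hom "homology_group 3 ?Y" ?G "hom_induced 3 ?Y {} ?N3 {} N"
    by (simp add: group_hom_def group_hom_axioms_def hom_induced_hom red)
  have nzA: "C x \<noteq> 0" if "x \<in> S3" "A x = 0" for x using nz that by auto
  have nzB: "C x \<noteq> 0" if "x \<in> S3" "B x = 0" for x using nz that by auto
  have "Brouwer_degree2 3 (d (\<lambda>x. A x * B x)) = Brouwer_degree2 3 (d A) + Brouwer_degree2 3 (d B)"
  proof (rule Brouwer_degree2_unique)
    show "continuous_map ?N3 ?N3 (d (\<lambda>x. A x * B x))"
      using continuous_map_compose[OF cM[OF AB nz] cN] by (simp add: NM)
    fix x assume x: "x \<in> carrier (reduced_homology_group (int 3) ?N3)"
    have comp: "hom_induced 3 ?N3 {} ?N3 {} (d D) x = hom_induced 3 ?Y {} ?N3 {} N (hom_induced 3 ?N3 {} ?Y {} (M D) x)"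
      if "continuous_on S3 D" "\<And>x. x \<in> S3 \<Longrightarrow> D x = 0 \<Longrightarrow> C x \<noteq> 0" for D
      using hom_induced_compose_empty[OF cM[OF that] cN, of 3] by (simp add: NM)
    have pw: "hom_induced 3 ?N3 {} ?N3 {} (d D) x = x [^]\<^bsub>?G\<^esub> Brouwer_degree2 3 (d D)" for D
      using Brouwer_degree2[of x 3 "d D"] x by simp
    have "hom_induced 3 ?N3 {} ?Y {} (M (\<lambda>x. A x * B x)) x =
       hom_induced 3 ?N3 {} ?Y {} (M A) x \<otimes>\<^bsub>homology_group 3 ?Y\<^esub> hom_induced 3 ?N3 {} ?Y {} (M B) x"
      unfolding M_def
    proof (rule hom_induced_mult3)
      fix y assume "y \<in> topspace ?N3" "A (of_real_coords y) * B (of_real_coords y) = 0"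
      then show "Re (C (of_real_coords y)) \<noteq> 0 \<or> Im (C (of_real_coords y)) \<noteq> 0"
        using nz[OF of_real_coords_S3] by (auto simp: complex_eq_iff)
    qed (use x A B C red in \<open>auto intro!: eu continuous_intros\<close>)
    then have "hom_induced 3 ?N3 {} ?N3 {} (d (\<lambda>x. A x * B x)) x
       = hom_induced 3 ?N3 {} ?N3 {} (d A) x \<otimes>\<^bsub>?G\<^esub> hom_induced 3 ?N3 {} ?N3 {} (d B) x"
      by (simp only: comp[OF AB nz] comp[OF A nzA] comp[OF B nzB]) (simp add: NH.hom_mult hom_induced_carrier)
    also have "\<dots> = x [^]\<^bsub>?G\<^esub> (Brouwer_degree2 3 (d A) + Brouwer_degree2 3 (d B))"
      using x by (simp add: pw G.int_pow_mult)
    finally show "hom_induced (int 3) ?N3 {} ?N3 {} (d (\<lambda>x. A x * B x)) x =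
      x [^]\<^bsub>reduced_homology_group (int 3) ?N3\<^esub> (Brouwer_degree2 3 (d A) + Brouwer_degree2 3 (d B))"
      by simp
  qed
  then show ?thesis by (simp add: deg2_def d_def)
qed

lemma S3_nonzero: "x \<in> S3 \<Longrightarrow> x $ 1 = 0 \<Longrightarrow> x $ 2 \<noteq> 0"
  using norm_complex2[of x] by (auto simp: S3_def)

text \<open>Rotating the pair through a right angle is a homotopy without common zeros, because
  rotations are invertible. This brings the second function into the first slot, where additivity is
  available.\<close>

lemma deg2_swap:
  assumes A: "continuous_on S3 A" and C: "continuous_on S3 C"
    and nz: "\<And>x. x \<in> S3 \<Longrightarrow> A x = 0 \<Longrightarrow> C x \<noteq> 0"
  shows "deg2 C (\<lambda>x. - A x) = deg2 A C"
proof -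
  have c: "continuous_on ({0..1::real} \<times> S3) (\<lambda>p. of_real (a (fst p)) * f (snd p) + of_real (b (fst p)) * g (snd p))"
    if "continuous_on S3 f" "continuous_on S3 g" "continuous_on {0..1} a" "continuous_on {0..1} b" for f g :: "complex^2 \<Rightarrow> complex" and a b :: "real \<Rightarrow> real"
    by (intro continuous_intros continuous_on_compose2[OF that(1)] continuous_on_compose2[OF that(2)]
        continuous_on_compose2[OF that(3)] continuous_on_compose2[OF that(4)]) auto
  have "deg2 (\<lambda>x. of_real (cos (0 * pi / 2)) * A x + of_real (sin (0 * pi / 2)) * C x)
         (\<lambda>x. of_real (- sin (0 * pi / 2)) * A x + of_real (cos (0 * pi / 2)) * C x) =
        deg2 (\<lambda>x. of_real (cos (1 * pi / 2)) * A x + of_real (sin (1 * pi / 2)) * C x)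
         (\<lambda>x. of_real (- sin (1 * pi / 2)) * A x + of_real (cos (1 * pi / 2)) * C x)"
  proof (rule deg2_homotopy)
    fix t :: real and x assume x: "x \<in> S3"
    define s k where "s = complex_of_real (sin (t * pi / 2))" and "k = complex_of_real (cos (t * pi / 2))"
    have sk: "k * k + s * s = 1"
      unfolding s_def k_def by (metis of_real_1 of_real_add of_real_mult power2_eq_square sin_cos_squared_add2 add.commute sin_cos_squared_add)
    show "of_real (cos (t * pi / 2)) * A x + of_real (sin (t * pi / 2)) * C x \<noteq> 0 \<or>
       of_real (- sin (t * pi / 2)) * A x + of_real (cos (t * pi / 2)) * C x \<noteq> 0"
    proof (rule ccontr)
      assume "\<not> ?thesis"
      then have e: "k * A x + s * C x = 0" "k * C x - s * A x = 0"
        by (simp_all add: s_def k_def)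
      have "A x = (k * k + s * s) * A x" using sk by simp
      also have "\<dots> = k * (k * A x + s * C x) - s * (k * C x - s * A x)" by (simp add: algebra_simps)
      finally have "A x = 0" using e by simp
      have "C x = (k * k + s * s) * C x" using sk by simp
      also have "\<dots> = s * (k * A x + s * C x) + k * (k * C x - s * A x)" by (simp add: algebra_simps)
      finally have "C x = 0" using e by simp
      with nz[OF x \<open>A x = 0\<close>] show False by simp
    qed
  qed (intro c A C continuous_intros; simp)+
  then show ?thesis by simp
qed

text \<open>Additivity for \<open>1 = 1 * 1\<close> makes the degree equal to its double.\<close>

lemma deg2_const_left:
  assumes "continuous_on S3 C"
  shows "deg2 (\<lambda>x. 1) C = 0"
  using deg2_mult[of "\<lambda>x. 1" "\<lambda>x. 1" C] assms by simp

lemma deg2_prod: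
  assumes "finite I" "\<And>i. i \<in> I \<Longrightarrow> continuous_on S3 (A i)" "continuous_on S3 C"
    "\<And>i x. i \<in> I \<Longrightarrow> x \<in> S3 \<Longrightarrow> A i x = 0 \<Longrightarrow> C x \<noteq> 0"
  shows "deg2 (\<lambda>x. \<Prod>i\<in>I. A i x) C = (\<Sum>i\<in>I. deg2 (A i) C)"
  using assms(1,2,4)
proof (induction I)
  case empty
  then show ?case using deg2_const_left[OF assms(3)] by simp
next
  case (insert i I)
  have "deg2 (\<lambda>x. A i x * (\<Prod>i\<in>I. A i x)) C = deg2 (A i) C + deg2 (\<lambda>x. \<Prod>i\<in>I. A i x) C"
    using insert assms(3) by (intro deg2_mult continuous_on_prod) auto
  moreover have "deg2 (\<lambda>x. \<Prod>i\<in>I. A i x) C = (\<Sum>i\<in>I. deg2 (A i) C)"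
    by (rule insert.IH) (use insert.prems in blast)+
  ultimately show ?case using insert.hyps by simp
qed

lemma deg2_power:
  assumes "continuous_on S3 A" "continuous_on S3 C" "\<And>x. x \<in> S3 \<Longrightarrow> A x = 0 \<Longrightarrow> C x \<noteq> 0"
  shows "deg2 (\<lambda>x. A x ^ q) C = int q * deg2 A C"
  using deg2_prod[of "{..<q}" "\<lambda>_. A" C] assms by simp

text \<open>The product of \<open>A\<close> with its conjugate is real and non-negative. Moving it
  linearly to the constant 1 creates no new zeros, so the two degrees add up to 0.\<close>

lemma deg2_cnj:
  assumes A: "continuous_on S3 A" and C: "continuous_on S3 C" and nz: "\<And>x. x \<in> S3 \<Longrightarrow> A x = 0 \<Longrightarrow> C x \<noteq> 0"
  shows "deg2 (\<lambda>x. cnj (A x)) C = - deg2 A C"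
proof -
  have "deg2 (\<lambda>x. A x * cnj (A x)) C = deg2 (\<lambda>x. 1) C"
  proof (rule deg2_linear)
    fix t :: real and x assume t: "0 \<le> t" "t \<le> 1" and x: "x \<in> S3"
      and 0: "(1 - of_real t) * (A x * cnj (A x)) + of_real t * 1 = 0"
    have "complex_of_real ((1 - t) * (cmod (A x))\<^sup>2 + t) = 0"
      using 0 by (simp add: complex_norm_square[symmetric])
    then have "(1 - t) * (cmod (A x))\<^sup>2 + t = 0" by (simp only: of_real_eq_0_iff)
    then have "A x = 0"
      using t by (cases "t = 0") (auto simp: add_nonneg_eq_0_iff)
    with nz[OF x] show "(1 - of_real t) * C x + of_real t * C x \<noteq> 0" by (simp add: algebra_simps)
  qed (use A C in \<open>auto intro!: continuous_intros\<close>)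
  moreover have "deg2 (\<lambda>x. A x * cnj (A x)) C = deg2 A C + deg2 (\<lambda>x. cnj (A x)) C"
    using assms by (intro deg2_mult continuous_intros) auto
  ultimately show ?thesis using deg2_const_left[OF C] by simp
qed

section \<open>Degrees of the model maps\<close>

lemma continuous_on_nth [continuous_intros]: "continuous_on S (\<lambda>x::'a::topological_space^'n. x $ i)"
  by (intro continuous_intros)

text \<open>On the zeros of the intermediate linear forms \<open>x $ 1\<close> is a multiple of
  \<open>x $ 2\<close>, so \<open>x $ 2\<close> cannot vanish on the sphere.\<close>

lemma deg2_line:
  assumes f: "continuous_on S3 f" and nz: "\<And>x. x \<in> S3 \<Longrightarrow> x $ 2 \<noteq> 0 \<Longrightarrow> f x \<noteq> 0"
  shows "deg2 (\<lambda>x. x $ 1 - a * x $ 2) f = deg2 (\<lambda>x. x $ 1) f"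
proof (rule deg2_linear)
  fix t :: real and x assume x: "x \<in> S3" and 0: "(1 - of_real t) * (x $ 1 - a * x $ 2) + of_real t * x $ 1 = 0"
  then have "x $ 2 \<noteq> 0" using S3_nonzero[OF x] by (auto simp: algebra_simps)
  with nz[OF x] show "(1 - of_real t) * f x + of_real t * f x \<noteq> 0" by (simp add: algebra_simps)
qed (use f in \<open>auto intro!: continuous_intros\<close>)

text \<open>Additivity acts on the first slot, so the power is moved there by
  \<open>deg2_swap\<close>, resolved, and the remaining pair is moved back.\<close>

lemma deg2_fst_power: "deg2 (\<lambda>x. x $ 1) (\<lambda>x. (x $ 2) ^ q) = int q"
proof (cases "q = 0")
  case True
  have "deg2 (\<lambda>x. 1) (\<lambda>x. - x $ 1) = deg2 (\<lambda>x. x $ 1) (\<lambda>x. 1)"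
    by (intro deg2_swap continuous_intros) auto
  with True show ?thesis using deg2_const_left[of "\<lambda>x. - x $ 1"] by (simp add: continuous_intros)
next
  case False
  have "deg2 (\<lambda>x. x $ 1) (\<lambda>x. (x $ 2) ^ q) = deg2 (\<lambda>x. (x $ 2) ^ q) (\<lambda>x. - x $ 1)"
    using S3_nonzero by (intro deg2_swap[symmetric] continuous_intros) auto
  also have "\<dots> = int q * deg2 (\<lambda>x. x $ 2) (\<lambda>x. - x $ 1)"
    using S3_nonzero by (intro deg2_power continuous_intros) auto
  also have "deg2 (\<lambda>x. x $ 2) (\<lambda>x. - x $ 1) = deg2 (\<lambda>x. x $ 1) (\<lambda>x. x $ 2)"
    using S3_nonzero by (intro deg2_swap continuous_intros) auto
  finally show ?thesis by (simp add: deg2_fst_snd)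
qed

lemma deg2_fst_cnj_power: "deg2 (\<lambda>x. x $ 1) (\<lambda>x. cnj (x $ 2) ^ q) = - int q"
proof (cases "q = 0")
  case True
  then show ?thesis using deg2_fst_power[of 0] by simp
next
  case False
  have "deg2 (\<lambda>x. x $ 1) (\<lambda>x. cnj (x $ 2) ^ q) = deg2 (\<lambda>x. cnj (x $ 2) ^ q) (\<lambda>x. - x $ 1)"
    using S3_nonzero by (intro deg2_swap[symmetric] continuous_intros) auto
  also have "\<dots> = deg2 (\<lambda>x. cnj ((x $ 2) ^ q)) (\<lambda>x. - x $ 1)" by simp
  also have "\<dots> = - deg2 (\<lambda>x. (x $ 2) ^ q) (\<lambda>x. - x $ 1)"
    using S3_nonzero False by (intro deg2_cnj continuous_intros) auto
  also have "deg2 (\<lambda>x. (x $ 2) ^ q) (\<lambda>x. - x $ 1) = deg2 (\<lambda>x. x $ 1) (\<lambda>x. (x $ 2) ^ q)"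
    using S3_nonzero by (intro deg2_swap continuous_intros) auto
  finally show ?thesis by (simp add: deg2_fst_power)
qed

text \<open>The path \<open>exp (t * Ln c)\<close> joins 1 to \<open>c\<close> through non-zero
  constants; the straight segment could pass through 0.\<close>

lemma deg2_const_mult_right:
  assumes A: "continuous_on S3 A" and C: "continuous_on S3 C" and nz: "\<And>x. x \<in> S3 \<Longrightarrow> A x = 0 \<Longrightarrow> C x \<noteq> 0" and "c \<noteq> 0"
  shows "deg2 A (\<lambda>x. c * C x) = deg2 A C"
proof -
  have "deg2 A (\<lambda>x. exp (of_real 0 * Ln c) * C x) = deg2 A (\<lambda>x. exp (of_real 1 * Ln c) * C x)"
    by (rule deg2_homotopy) (use nz in \<open>auto intro!: continuous_intros continuous_on_compose2[OF A] continuous_on_compose2[OF C]\<close>)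
  then show ?thesis using \<open>c \<noteq> 0\<close> by simp
qed

text \<open>Up to the factor \<open>norm v\<close>, these are the coordinates along \<open>v\<close> and along its Hermitian orthogonal complement.\<close>

definition herm :: "complex^2 \<Rightarrow> complex^2 \<Rightarrow> complex" where
  "herm v x = x $ 1 * cnj (v $ 1) + x $ 2 * cnj (v $ 2)"

definition cdet :: "complex^2 \<Rightarrow> complex^2 \<Rightarrow> complex" where
  "cdet v x = v $ 1 * x $ 2 - v $ 2 * x $ 1"

lemma continuous_on_herm [continuous_intros]:
  "continuous_on S f \<Longrightarrow> continuous_on S g \<Longrightarrow> continuous_on S (\<lambda>x. herm (f x) (g x))"
  unfolding herm_def by (intro continuous_intros)

lemma continuous_on_cdet [continuous_intros]:
  "continuous_on S f \<Longrightarrow> continuous_on S g \<Longrightarrow> continuous_on S (\<lambda>x. cdet (f x) (g x))"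
  unfolding cdet_def by (intro continuous_intros)

text \<open>Lagrange's identity: sending \<open>x\<close> to the pair of \<open>herm v x\<close> and
  \<open>cdet v x\<close> is \<open>norm v\<close> times a unitary map.\<close>

lemma norm_herm_cdet: "(cmod (herm v x))\<^sup>2 + (cmod (cdet v x))\<^sup>2 = (norm v)\<^sup>2 * (norm x)\<^sup>2"
proof -
  have "complex_of_real ((cmod (herm v x))\<^sup>2 + (cmod (cdet v x))\<^sup>2) = complex_of_real ((norm v)\<^sup>2 * (norm x)\<^sup>2)"
    by (simp only: norm_complex2 of_real_add of_real_mult complex_norm_square herm_def cdet_def)
      (simp add: algebra_simps)
  then show ?thesis by (simp only: of_real_eq_iff)
qed

lemma herm_cdet_eq_0: "v \<noteq> 0 \<Longrightarrow> herm v x = 0 \<Longrightarrow> cdet v x = 0 \<Longrightarrow> x = 0"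
  using norm_herm_cdet[of v x] by simp

text \<open>The change of coordinates is invertible for every non-zero \<open>v\<close>, and
  \<open>v\<close> can be joined to \<open>(1, 0)\<close> by segments that avoid 0.\<close>

lemma deg2_herm_cdet:
  assumes v: "v \<noteq> 0" and F: "continuous_on S3 F" and nz: "\<And>x. x \<in> S3 \<Longrightarrow> F x \<noteq> 0"
  shows "deg2 (\<lambda>x. herm v (F x)) (\<lambda>x. cdet v (F x)) = deg2 (\<lambda>x. F x $ 1) (\<lambda>x. F x $ 2)"
proof -
  have step: "deg2 (\<lambda>x. herm a (F x)) (\<lambda>x. cdet a (F x)) = deg2 (\<lambda>x. herm b (F x)) (\<lambda>x. cdet b (F x))"
    if ab: "\<And>t. 0 \<le> t \<Longrightarrow> t \<le> 1 \<Longrightarrow> (1 - t) *\<^sub>R a + t *\<^sub>R b \<noteq> 0" for a b :: "complex^2"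
  proof -
    have "deg2 (\<lambda>x. herm ((1 - 0) *\<^sub>R a + 0 *\<^sub>R b) (F x)) (\<lambda>x. cdet ((1 - 0) *\<^sub>R a + 0 *\<^sub>R b) (F x)) =
      deg2 (\<lambda>x. herm ((1 - 1) *\<^sub>R a + 1 *\<^sub>R b) (F x)) (\<lambda>x. cdet ((1 - 1) *\<^sub>R a + 1 *\<^sub>R b) (F x))"
    proof (rule deg2_homotopy)
      show "herm ((1 - t) *\<^sub>R a + t *\<^sub>R b) (F x) \<noteq> 0 \<or> cdet ((1 - t) *\<^sub>R a + t *\<^sub>R b) (F x) \<noteq> 0"
        if "0 \<le> t" "t \<le> 1" "x \<in> S3" for t x
        using herm_cdet_eq_0[OF ab[OF that(1,2)]] nz[OF that(3)] by blast
    qed (auto intro!: continuous_intros continuous_on_compose2[OF F])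
    then show ?thesis by simp
  qed
  have e: "deg2 (\<lambda>x. F x $ 1) (\<lambda>x. F x $ 2) = deg2 (\<lambda>x. herm (vector [1, 0]) (F x)) (\<lambda>x. cdet (vector [1, 0]) (F x))"
    by (simp add: herm_def cdet_def)
  show ?thesis
  proof (cases "v $ 2 = 0")
    case False
    have "(1 - t) *\<^sub>R vector [1, 0] + t *\<^sub>R v \<noteq> 0" for t :: real
      using False by (auto simp: vec_eq_iff forall_2)
    from step[OF this] e show ?thesis by simp
  next
    \<comment> \<open>The segment from \<open>(1, 0)\<close> to \<open>v\<close> might pass through
      0 here, hence the detour over \<open>(0, 1)\<close>.\<close>
    case True
    then have v1: "v $ 1 \<noteq> 0" using v by (auto simp: vec_eq_iff forall_2)
    have "(1 - t) *\<^sub>R vector [1, 0] + t *\<^sub>R vector [0, 1] \<noteq> (0 :: complex^2)" for t :: real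
      by (auto simp: vec_eq_iff forall_2)
    from step[OF this] have "deg2 (\<lambda>x. herm (vector [1, 0]) (F x)) (\<lambda>x. cdet (vector [1, 0]) (F x)) =
       deg2 (\<lambda>x. herm (vector [0, 1]) (F x)) (\<lambda>x. cdet (vector [0, 1]) (F x))" by simp
    also have "(1 - t) *\<^sub>R vector [0, 1] + t *\<^sub>R v \<noteq> 0" for t :: real
      using True v1 by (auto simp: vec_eq_iff forall_2)
    from step[OF this] have "deg2 (\<lambda>x. herm (vector [0, 1]) (F x)) (\<lambda>x. cdet (vector [0, 1]) (F x)) =
       deg2 (\<lambda>x. herm v (F x)) (\<lambda>x. cdet v (F x))" by simp
    finally show ?thesis using e by simp
  qed
qed

section \<open>Composition and change of scale\<close>

lemma deg2_compose:
  assumes A: "continuous_on S3 A" and C: "continuous_on S3 C" and nz: "\<And>x. x \<in> S3 \<Longrightarrow> A x = 0 \<Longrightarrow> C x \<noteq> 0"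
    and G: "continuous_on S3 G" "G ` S3 \<subseteq> S3"
  shows "deg2 (\<lambda>x. A (G x)) (\<lambda>x. C (G x)) = deg2 A C * deg2 (\<lambda>x. G x $ 1) (\<lambda>x. G x $ 2)"
proof -
  define F where "F = (\<lambda>x. sgn (vector [A x, C x]) :: complex^2)"
  have "continuous_map (top_of_set S3) (top_of_set S3) F"
    using A C nz by (auto simp: F_def S3_def norm_sgn intro!: continuous_intros)
  then have cF: "continuous_map (nsphere 3) (nsphere 3) (real_coords \<circ> F \<circ> of_real_coords)"
    by (intro continuous_map_compose[OF _ continuous_map_real_coords] continuous_map_compose[OF continuous_map_of_real_coords])
  have "continuous_map (top_of_set S3) (top_of_set S3) G"
    using G by auto
  then have cG: "continuous_map (nsphere 3) (nsphere 3) (real_coords \<circ> G \<circ> of_real_coords)"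
    by (intro continuous_map_compose[OF _ continuous_map_real_coords] continuous_map_compose[OF continuous_map_of_real_coords])
  have 1: "deg2 (\<lambda>x. A (G x)) (\<lambda>x. C (G x)) = Brouwer_degree2 3 ((real_coords \<circ> F \<circ> of_real_coords) \<circ> (real_coords \<circ> G \<circ> of_real_coords))"
    unfolding deg2_def F_def by (rule arg_cong[where f = "Brouwer_degree2 3"]) (simp add: fun_eq_iff)
  have 2: "Brouwer_degree2 3 (real_coords \<circ> G \<circ> of_real_coords) = deg2 (\<lambda>x. G x $ 1) (\<lambda>x. G x $ 2)"
    unfolding deg2_def
  proof (rule Brouwer_degree2_eq)
    fix x assume "x \<in> topspace (nsphere 3)"
    then have "norm (G (of_real_coords x)) = 1" using G(2) of_real_coords_S3 by (force simp: S3_def)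
    then show "(real_coords \<circ> G \<circ> of_real_coords) x = (real_coords \<circ> (\<lambda>x. sgn (vector [G x $ 1, G x $ 2])) \<circ> of_real_coords) x"
      by (simp add: sgn_div_norm)
  qed
  show ?thesis
    unfolding 1 Brouwer_degree2_compose[OF cG cF] 2[symmetric]
    by (simp add: deg2_def F_def)
qed

lemma deg2_linear_vec:
  fixes \<Phi> \<Psi> :: "complex^2 \<Rightarrow> complex^2"
  assumes \<Phi>: "continuous_on S3 \<Phi>" and \<Psi>: "continuous_on S3 \<Psi>"
    and nz: "\<And>t x. 0 \<le> t \<Longrightarrow> t \<le> 1 \<Longrightarrow> x \<in> S3 \<Longrightarrow> (1 - t) *\<^sub>R \<Phi> x + t *\<^sub>R \<Psi> x \<noteq> 0"
  shows "deg2 (\<lambda>x. \<Phi> x $ 1) (\<lambda>x. \<Phi> x $ 2) = deg2 (\<lambda>x. \<Psi> x $ 1) (\<lambda>x. \<Psi> x $ 2)"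
proof (rule deg2_linear)
  fix t :: real and x assume t: "0 \<le> t" "t \<le> 1" "x \<in> S3" and 0: "(1 - of_real t) * \<Phi> x $ 1 + of_real t * \<Psi> x $ 1 = 0"
  have c: "((1 - t) *\<^sub>R \<Phi> x + t *\<^sub>R \<Psi> x) $ i = (1 - of_real t) * \<Phi> x $ i + of_real t * \<Psi> x $ i" for i
    by (simp add: scaleR_conv_of_real[of _ "_ :: complex"])
  show "(1 - of_real t) * \<Phi> x $ 2 + of_real t * \<Psi> x $ 2 \<noteq> 0"
  proof
    assume "(1 - of_real t) * \<Phi> x $ 2 + of_real t * \<Psi> x $ 2 = 0"
    then have "(1 - t) *\<^sub>R \<Phi> x + t *\<^sub>R \<Psi> x = 0"
      unfolding vec_eq_iff forall_2 c using 0 by simp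
    with nz[OF t] show False by simp
  qed
qed (intro continuous_intros \<Phi> \<Psi>)+

text \<open>\<open>X\<close> and \<open>Y\<close> are positive multiples of the coordinates, with
  factors that depend on the point. The condition \<open>nz\<close> says that \<open>f\<close> has
  no zero on an open ray from 0 and never takes opposite directions along it; this allows the
  factors to be deformed to 1.\<close>

lemma deg2_rescale:
  assumes X: "continuous_on S3 X" "\<And>x. x \<in> S3 \<Longrightarrow> \<exists>l>0. X x = of_real l * x $ 1"
    and Y: "continuous_on S3 Y" "\<And>x. x \<in> S3 \<Longrightarrow> \<exists>l>0. Y x = of_real l * x $ 2"
    and f: "continuous_on UNIV f"
    and nz: "\<And>y l t. y \<noteq> 0 \<Longrightarrow> l > 0 \<Longrightarrow> 0 \<le> t \<Longrightarrow> t \<le> 1 \<Longrightarrow> (1 - of_real t) * f (of_real l * y) + of_real t * f y \<noteq> 0"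
  shows "deg2 (\<lambda>x. X x - a * Y x) (\<lambda>x. f (Y x)) = deg2 (\<lambda>x. x $ 1) (\<lambda>x. f (x $ 2))"
proof -
  have fY: "continuous_on S3 (\<lambda>x. f (g x))" if "continuous_on S3 g" for g
    by (rule continuous_on_compose2[OF f that]) auto
  have "deg2 (\<lambda>x. X x - a * Y x) (\<lambda>x. f (Y x)) = deg2 (\<lambda>x. x $ 1 - a * x $ 2) (\<lambda>x. f (x $ 2))"
  proof (rule deg2_linear)
    fix t :: real and x assume t: "0 \<le> t" "t \<le> 1" and x: "x \<in> S3"
      and 0: "(1 - of_real t) * (X x - a * Y x) + of_real t * (x $ 1 - a * x $ 2) = 0"
    obtain l l' where l: "l > 0" "X x = of_real l * x $ 1" "l' > 0" "Y x = of_real l' * x $ 2"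
      using X(2)[OF x] Y(2)[OF x] by blast
    have "of_real ((1 - t) * l + t) * x $ 1 = a * of_real ((1 - t) * l' + t) * x $ 2"
      using 0 by (simp add: l algebra_simps)
    moreover have "(1 - t) * l + t > 0" using l t by (cases "t = 0") (auto intro: add_nonneg_pos)
    ultimately have "x $ 2 \<noteq> 0" using S3_nonzero[OF x] by (auto simp del: of_real_add of_real_mult of_real_diff)
    then show "(1 - of_real t) * f (Y x) + of_real t * f (x $ 2) \<noteq> 0"
      unfolding l(4) by (rule nz[OF _ l(3) t])
  qed (intro continuous_intros X Y fY)+
  also have "\<dots> = deg2 (\<lambda>x. x $ 1) (\<lambda>x. f (x $ 2))"
    using nz[of _ 1 0] by (intro deg2_line fY continuous_intros) simp
  finally show ?thesis .
qed

text \<open>Both terms are non-negative multiples of \<open>c * y ^ k\<close>, and not both vanish.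
  This is the ray condition of \<open>deg2_rescale\<close> for monomials.\<close>

lemma exp_scale_nonzero: "c \<noteq> 0 \<Longrightarrow> y \<noteq> 0 \<Longrightarrow> l > 0 \<Longrightarrow> 0 \<le> t \<Longrightarrow> t \<le> 1 \<Longrightarrow>
    (1 - of_real t) * (c * (of_real l * y) ^ k) + of_real t * (c * y ^ k) \<noteq> (0::complex)"
proof -
  assume a: "c \<noteq> 0" "y \<noteq> 0" "l > 0" "0 \<le> t" "t \<le> 1"
  have "(1 - of_real t) * (c * (of_real l * y) ^ k) + of_real t * (c * y ^ k) = of_real ((1 - t) * l ^ k + t) * (c * y ^ k)"
    by (simp add: power_mult_distrib algebra_simps)
  moreover have "(1 - t) * l ^ k + t > 0" using a by (cases "t = 0") (auto intro: add_nonneg_pos)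
  ultimately show ?thesis using a by (auto simp del: of_real_add of_real_mult of_real_diff of_real_power)
qed

section \<open>Linking numbers as degrees\<close>

text \<open>The extension of a map on the sphere of radius \<open>r\<close> that is homogeneous of
  degree one under positive scaling; for \<open>r = 1\<close> it gives the cones in
  \<open>linking_map\<close>.\<close>

definition radial :: "real \<Rightarrow> ('a::real_normed_vector \<Rightarrow> 'b::real_normed_vector) \<Rightarrow> 'a \<Rightarrow> 'b" where
  "radial r f x = (norm x / r) *\<^sub>R f (r *\<^sub>R sgn x)"

lemma radial_0 [simp]: "radial r f 0 = 0"
  by (simp add: radial_def)

lemma radial_sphere: "r > 0 \<Longrightarrow> norm x = r \<Longrightarrow> radial r f x = f x"
  unfolding radial_def sgn_div_norm by (metis divide_self less_irrefl right_inverse scaleR_one scaleR_scaleR)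

lemma continuous_on_radial:
  fixes f :: "'a::euclidean_space \<Rightarrow> 'b::real_normed_vector"
  assumes r: "r > 0" and f: "continuous_on (sphere 0 r) f"
  shows "continuous_on S (radial r f)"
proof -
  have "isCont (radial r f) x" for x
  proof (cases "x = 0")
    case False
    have "continuous_on (- {0}) (radial r f)"
      unfolding radial_def
      by (intro continuous_intros continuous_on_compose2[OF f]) (use r in \<open>auto simp: norm_sgn split: if_splits\<close>)
    then show ?thesis using False
      by (auto simp: continuous_on_eq_continuous_at open_Compl)
  next
    case True
    \<comment> \<open>Continuity at the tip of the cone comes from the boundedness of
      \<open>f\<close> on the compact sphere.\<close>
    have "bounded (f ` sphere 0 r)"
      using f by (intro compact_imp_bounded compact_continuous_image) auto
    then obtain B where B: "\<And>y. y \<in> sphere 0 r \<Longrightarrow> norm (f y) \<le> B" unfolding bounded_iff by blast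
    have "norm (radial r f y) \<le> norm y * (B / r)" for y
    proof (cases "y = 0")
      case False
      then have "norm (f (r *\<^sub>R sgn y)) \<le> B" using r by (intro B) (simp add: norm_sgn)
      then have "norm y * norm (f (r *\<^sub>R sgn y)) \<le> norm y * B" by (intro mult_left_mono) auto
      then show ?thesis using r by (simp add: radial_def divide_right_mono)
    qed simp
    note le = this
    have "((\<lambda>y. norm y * (B / r)) \<longlongrightarrow> norm (0::'a) * (B / r)) (at (0::'a))"
      by (rule tendsto_mult[OF tendsto_norm[OF tendsto_ident_at] tendsto_const])
    then have "((\<lambda>y. norm y * (B / r)) \<longlongrightarrow> 0) (at (0::'a))" by simp
    then have "(radial r f \<longlongrightarrow> 0) (at 0)"
      by (rule Lim_null_comparison[rotated]) (rule always_eventually, rule allI, rule le)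
    then show ?thesis using True by (simp add: isCont_def)
  qed
  then show ?thesis by (simp add: continuous_at_imp_continuous_on)
qed

lemma norm_vector2_eq:
  "(cmod a)\<^sup>2 + (cmod b)\<^sup>2 = (norm x)\<^sup>2 \<Longrightarrow> norm (vector [a, b] :: complex^2) = norm x"
  by (rule power2_eq_imp_eq) (simp_all add: norm_complex2)

lemma linking_number_deg2:
  "linking_number \<gamma> \<delta> = deg2 (\<lambda>x. (radial 1 \<gamma> (x $ 1) - radial 1 \<delta> (x $ 2)) $ 1) (\<lambda>x. (radial 1 \<gamma> (x $ 1) - radial 1 \<delta> (x $ 2)) $ 2)"
  unfolding linking_number_def deg2_def linking_map_def[abs_def] radial_def vector2_eta by simp

section \<open>Invariance under reparametrization of the loops\<close>

lemma norm_radial_circle: "\<tau> ` sphere 0 1 \<subseteq> sphere 0 1 \<Longrightarrow> norm (radial 1 \<tau> (z::complex)) = norm z"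
  for \<tau> :: "complex \<Rightarrow> complex"
  by (cases "z = 0") (auto simp: radial_def norm_sgn image_subset_iff)

lemma radial_radial:
  fixes \<tau> :: "complex \<Rightarrow> complex"
  assumes "\<tau> ` sphere 0 1 \<subseteq> sphere 0 1"
  shows "radial 1 \<gamma> (radial 1 \<tau> z) = radial 1 (\<gamma> \<circ> \<tau>) z"
proof (cases "z = 0")
  case False
  then have "norm (\<tau> (sgn z)) = 1" using assms by (auto simp: norm_sgn image_subset_iff)
  then have "sgn (radial 1 \<tau> z) = \<tau> (sgn z)"
    using False by (simp add: radial_def sgn_scaleR sgn_div_norm)
  then show ?thesis using norm_radial_circle[OF assms] by (simp add: radial_def[of 1 \<gamma>] radial_def[of 1 "\<gamma> \<circ> \<tau>"])
qed simp

text \<open>A homeomorphism of the circle may reverse orientation. Applied in both coordinates,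
  however, it has the square of the degree it has when applied in one, and the latter is a unit
  because the inverse map supplies an integer inverse.\<close>

lemma deg2_circle_homeomorphism:
  fixes \<tau> \<tau>' :: "complex \<Rightarrow> complex"
  assumes \<tau>: "homeomorphism (sphere 0 1) (sphere 0 1) \<tau> \<tau>'"
  shows "deg2 (\<lambda>x. radial 1 \<tau> (x $ 1)) (\<lambda>x. radial 1 \<tau> (x $ 2)) = 1"
proof -
  have im: "\<tau> ` sphere 0 1 \<subseteq> sphere 0 1" "\<tau>' ` sphere 0 1 \<subseteq> sphere 0 1"
    using \<tau> by (auto simp: homeomorphism_def)
  have c: "continuous_on S (radial 1 \<tau>)" "continuous_on S (radial 1 \<tau>')" for S
    using \<tau> by (auto simp: homeomorphism_def intro!: continuous_on_radial)
  note n = norm_radial_circle[OF im(1)] norm_radial_circle[OF im(2)]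
  have inv: "radial 1 \<tau> (radial 1 \<tau>' z) = z" for z
  proof (cases "z = 0")
    case False
    then have "\<tau> (\<tau>' (sgn z)) = sgn z" using \<tau> by (auto simp: homeomorphism_def norm_sgn)
    then show ?thesis using False
      unfolding radial_radial[OF im(2)] by (simp add: radial_def sgn_div_norm)
  qed simp
  have r0: "radial 1 \<tau> z = 0 \<longleftrightarrow> z = 0" "radial 1 \<tau>' z = 0 \<longleftrightarrow> z = 0" for z using n by (metis norm_eq_zero)+
  define P where "P = (\<lambda>x::complex^2. vector [x $ 2, x $ 1] :: complex^2)"
  define T where "T = (\<lambda>x::complex^2. vector [radial 1 \<tau> (x $ 1), x $ 2] :: complex^2)"
  define T' where "T' = (\<lambda>x::complex^2. vector [radial 1 \<tau>' (x $ 1), x $ 2] :: complex^2)"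
  define R where "R = (\<lambda>x::complex^2. vector [x $ 1, radial 1 \<tau> (x $ 2)] :: complex^2)"
  have nn: "norm (P x) = norm x" "norm (T x) = norm x" "norm (T' x) = norm x" "norm (R x) = norm x" for x
    unfolding P_def T_def T'_def R_def by (rule norm_vector2_eq; simp add: n norm_complex2)+
  then have S: "P ` S3 \<subseteq> S3" "T ` S3 \<subseteq> S3" "T' ` S3 \<subseteq> S3" "R ` S3 \<subseteq> S3" by (auto simp: S3_def)
  have C: "continuous_on S3 P" "continuous_on S3 T" "continuous_on S3 T'" "continuous_on S3 R"
    unfolding P_def T_def T'_def R_def
    by (intro continuous_intros continuous_on_compose2[OF c(1)] continuous_on_compose2[OF c(2)]; auto)+
  define D where "D F = deg2 (\<lambda>x. F x $ 1) (\<lambda>x. F x $ 2)" for F :: "complex^2 \<Rightarrow> complex^2"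
  have comp: "D (\<lambda>x. F (G x)) = D F * D G" if "continuous_on S3 F" "continuous_on S3 G" "F ` S3 \<subseteq> S3" "G ` S3 \<subseteq> S3" for F G
    unfolding D_def
    by (rule deg2_compose) (use that S3_nonzero in \<open>auto intro!: continuous_intros simp: image_subset_iff\<close>)
  have id: "D (\<lambda>x. x) = 1" by (simp add: D_def deg2_fst_snd)
  have PP: "D P * D P = 1"
    using comp[OF C(1) C(1) S(1) S(1)] id by (simp add: P_def)
  have TT: "D T * D T' = 1"
    using comp[OF C(2) C(3) S(2) S(3)] id by (simp add: T_def T'_def inv)
  have c2: "continuous_on S3 (\<lambda>x. T (P x))" using C S by (intro continuous_on_compose2[OF C(2) C(1)])
  have s2: "(\<lambda>x. T (P x)) ` S3 \<subseteq> S3" using S by auto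
  \<comment> \<open>\<open>R\<close> is \<open>T\<close> conjugated by the exchange \<open>P\<close>
    of the coordinates, whose degree squares to 1, so \<open>R\<close> and \<open>T\<close> have
    equal degree.\<close>
  have "R = (\<lambda>x. P (T (P x)))" by (simp add: R_def P_def T_def fun_eq_iff)
  then have "D R = D P * (D T * D P)" using comp[OF C(1) c2 S(1) s2] comp[OF C(2) C(1) S(2) S(1)] by simp
  then have "D R = D T" using PP by (simp add: algebra_simps)
  moreover have "D (\<lambda>x. T (R x)) = D T * D R" by (rule comp[OF C(2) C(4) S(2) S(4)])
  moreover have "D T * D T = 1" using TT by (auto simp: zmult_eq_1_iff)
  ultimately have "D (\<lambda>x. T (R x)) = 1" by simp
  then show ?thesis by (simp add: D_def T_def R_def)
qed

text \<open>Both loops are composed with the same \<tau>, so the difference map is composed with a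
  self-map of the 3-sphere of degree 1, even if \<tau> reverses orientation.\<close>

lemma linking_number_reparametrize:
  assumes \<tau>: "homeomorphism (sphere 0 1) (sphere 0 1) \<tau> \<tau>'"
    and \<gamma>: "continuous_on (sphere 0 1) \<gamma>" and \<delta>: "continuous_on (sphere 0 1) \<delta>"
    and nz: "\<And>x. x \<in> S3 \<Longrightarrow> radial 1 \<gamma> (x $ 1) \<noteq> radial 1 \<delta> (x $ 2)"
  shows "linking_number (\<gamma> \<circ> \<tau>) (\<delta> \<circ> \<tau>) = linking_number \<gamma> \<delta>"
proof -
  have im: "\<tau> ` sphere 0 1 \<subseteq> sphere 0 1"
    using \<tau> by (auto simp: homeomorphism_def)
  have c: "continuous_on S (radial 1 \<tau>)" "continuous_on S (radial 1 \<gamma>)" "continuous_on S (radial 1 \<delta>)" for S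
    using continuous_on_radial[of 1 \<tau> S] continuous_on_radial[of 1 \<gamma> S] continuous_on_radial[of 1 \<delta> S] \<tau> \<gamma> \<delta>
    by (simp_all add: homeomorphism_def)
  define G where "G = (\<lambda>x::complex^2. vector [radial 1 \<tau> (x $ 1), radial 1 \<tau> (x $ 2)] :: complex^2)"
  have "norm (G x) = norm x" for x
    unfolding G_def by (rule norm_vector2_eq) (simp add: norm_radial_circle[OF im] norm_complex2)
  then have S: "G ` S3 \<subseteq> S3" by (auto simp: S3_def)
  have cG: "continuous_on S3 G"
    unfolding G_def by (intro continuous_intros continuous_on_compose2[OF c(1)]; auto)
  define F where "F = (\<lambda>x::complex^2. radial 1 \<gamma> (x $ 1) - radial 1 \<delta> (x $ 2))"
  have cF: "continuous_on S3 F"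
    unfolding F_def by (intro continuous_intros continuous_on_compose2[OF c(2)] continuous_on_compose2[OF c(3)]; auto)
  have "deg2 (\<lambda>x. F (G x) $ 1) (\<lambda>x. F (G x) $ 2) = deg2 (\<lambda>x. F x $ 1) (\<lambda>x. F x $ 2) * deg2 (\<lambda>x. G x $ 1) (\<lambda>x. G x $ 2)"
  proof (rule deg2_compose[OF _ _ _ cG S])
    fix x assume "x \<in> S3" "F x $ 1 = 0"
    moreover have "F x \<noteq> 0" using nz[OF \<open>x \<in> S3\<close>] by (simp add: F_def)
    ultimately show "F x $ 2 \<noteq> 0" by (auto simp: vec_eq_iff forall_2)
  qed (use cF in \<open>auto intro!: continuous_intros\<close>)
  then show ?thesis
    using deg2_circle_homeomorphism[OF \<tau>] by (simp add: linking_number_deg2 F_def G_def radial_radial[OF im])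
qed

text \<open>Near \<open>z = cis s\<close> the parameter is recovered continuously as
  \<open>s + Arg (w / z)\<close>: the quotient stays near 1, away from the branch cut.\<close>

lemma continuous_on_circle_cis:
  assumes c: "continuous_on UNIV (\<lambda>t. \<gamma> (cis t))"
  shows "continuous_on (sphere 0 1) \<gamma>"
  unfolding continuous_on_eq_continuous_within
proof
  fix z :: complex assume z: "z \<in> sphere 0 1"
  then obtain s where s: "z = cis s" using cis_Arg[of z] by (metis dist_0_norm mem_sphere norm_zero sgn_div_norm inverse_1 scaleR_one zero_neq_one)
  define g where "g w = \<gamma> (cis (s + Arg (w / z)))" for w
  have "isCont Arg (z / z)" using s by (intro continuous_at_Arg) simp
  moreover have "isCont (\<lambda>w. w / z) z" using s by (intro continuous_intros) simp
  ultimately have "isCont (\<lambda>w. Arg (w / z)) z" by (rule isCont_o2[rotated])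
  then have "isCont (\<lambda>w. s + Arg (w / z)) z" by (intro continuous_intros)
  moreover have "isCont (\<lambda>t. \<gamma> (cis t)) t" for t using c by (simp add: continuous_on_eq_continuous_at)
  ultimately have "isCont g z" unfolding g_def by (rule isCont_o2)
  then have gc: "continuous (at z within sphere 0 1) g" by (rule continuous_at_imp_continuous_within)
  have eq: "g w = \<gamma> w" if "w \<in> sphere 0 1" for w
  proof -
    have "w / z \<noteq> 0" "cmod (w / z) = 1" using that s by (auto simp: norm_divide)
    then have "cis (Arg (w / z)) = w / z" using cis_Arg by (simp add: sgn_div_norm)
    then have "cis (s + Arg (w / z)) = z * (w / z)" using s by (simp add: cis_mult[symmetric])
    then show ?thesis using s by (simp add: g_def)
  qed
  show "continuous (at z within sphere 0 1) \<gamma>"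
    by (rule continuous_transform_within[OF gc zero_less_one z eq])
qed

lemma linking_number_cong:
  assumes "\<And>z. cmod z = 1 \<Longrightarrow> \<gamma> z = \<gamma>' z" "\<And>z. cmod z = 1 \<Longrightarrow> \<delta> z = \<delta>' z"
  shows "linking_number \<gamma> \<delta> = linking_number \<gamma>' \<delta>'"
proof -
  have "norm (z::complex) *\<^sub>R \<gamma> (sgn z) = norm z *\<^sub>R \<gamma>' (sgn z)" "norm (z::complex) *\<^sub>R \<delta> (sgn z) = norm z *\<^sub>R \<delta>' (sgn z)" for z
    by (cases "z = 0"; simp add: assms norm_sgn)+
  then have "linking_map \<gamma> \<delta> = linking_map \<gamma>' \<delta>'"
    unfolding linking_map_def fun_eq_iff by (simp only: simp_thms)
  then show ?thesis by (simp add: linking_number_def)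
qed

section \<open>Derivatives of pseudoholomorphic maps\<close>

lemma has_vector_derivative_cis:
  "((\<lambda>t. cis (a * t)) has_vector_derivative \<i> * of_real a * cis (a * t)) (at t within S)"
proof -
  have "((\<lambda>z. exp (\<i> * of_real a * z)) has_field_derivative exp (\<i> * of_real a * of_real t) * (\<i> * of_real a)) (at (of_real t))"
    by (auto intro!: derivative_eq_intros)
  from has_vector_derivative_real_field[OF this]
  show ?thesis by (simp add: cis_conv_exp ac_simps)
qed

text \<open>Cauchy's formula for the derivative at the centre. The error caused by the antiholomorphic derivative is found
  by differentiating the mean over the circle with respect to the radius.\<close>

lemma circle_mean_derivative_estimate:
  fixes g :: "complex \<Rightarrow> complex" and g' :: "complex \<Rightarrow> complex \<Rightarrow>\<^sub>L complex"
  assumes s: "s > 0"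
    and der: "\<And>z. z \<in> cball 0 s \<Longrightarrow> (g has_derivative blinfun_apply (g' z)) (at z)"
    and cont: "continuous_on (cball 0 s) g'"
    and K: "\<And>z. z \<in> cball 0 s \<Longrightarrow> cmod (g' z 1 + \<i> * g' z \<i>) \<le> K * cmod z"
  shows "cmod (of_real (2 * pi) * g' 0 1 - integral {0..2*pi} (\<lambda>t. g (of_real s * cis t) * cis (- t) / of_real s)) \<le> 2 * pi * K * s"
proof -
  define h where "h \<rho> t = g (of_real \<rho> * cis t) * cis (- t) / of_real \<rho>" for \<rho> t :: real
  define E where "E z = g' z 1 + \<i> * g' z \<i>" for z
  define hr where "hr \<rho> t = g' (of_real \<rho> * cis t) (cis t) * cis (- t) / of_real \<rho> - g (of_real \<rho> * cis t) * cis (- t) / (of_real \<rho>)\<^sup>2" for \<rho> t :: real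
  define I where "I \<rho> = integral {0..2*pi} (h \<rho>)" for \<rho>
  have gc: "continuous_on (cball 0 s) g"
    by (rule has_derivative_continuous_on) (rule has_derivative_at_withinI[OF der])
  have inb: "of_real \<rho> * cis t \<in> cball 0 s" if "\<rho> \<in> {0..s}" for \<rho> t
    using that by (simp add: norm_mult)
  have K0: "K \<ge> 0"
    using K[of "of_real s"] s by (auto simp: norm_mult) (metis (no_types) norm_ge_zero order_trans zero_le_mult_iff less_le_not_le)
  have bd: "norm i \<le> B * (2 * pi)" if "0 \<le> B" "(f has_integral i) {0..2*pi}" "\<And>t. norm (f t) \<le> B"
    for f :: "real \<Rightarrow> complex" and i B
    using has_integral_bound[of B f i 0 "2 * pi"] that by (simp add: cbox_interval)
  have cis2pi: "cis (2 * pi) = 1" "cis (- (2 * pi)) = 1" by (auto simp: complex_eq_iff)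
  have ccis: "continuous_on S (\<lambda>x. cis (f x))" if "continuous_on S f" for S :: "'z::topological_space set" and f
    using that by (simp add: cis_conv_exp continuous_intros)
  have dI: "((\<lambda>\<rho>. I \<rho>) has_vector_derivative integral {0..2*pi} (hr \<rho>)) (at \<rho> within {\<rho>0..s})"
    if r: "0 < \<rho>0" "\<rho> \<in> {\<rho>0..s}" for \<rho>0 \<rho>
  proof -
    have "((\<lambda>\<rho>. integral (cbox 0 (2*pi)) (h \<rho>)) has_vector_derivative integral (cbox 0 (2*pi)) (hr \<rho>)) (at \<rho> within {\<rho>0..s})"
    proof (rule leibniz_rule_vector_derivative)
      fix x t :: real assume x: "x \<in> {\<rho>0..s}" and t: "t \<in> cbox 0 (2*pi)"
      have x0: "x > 0" "x \<in> {0..s}" using x r by auto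
      have "((\<lambda>\<rho>. g (of_real \<rho> * cis t)) has_vector_derivative g' (of_real x * cis t) (cis t)) (at x)"
      proof -
        have "((\<lambda>\<rho>. of_real \<rho> * cis t) has_vector_derivative cis t) (at x)"
          by (auto intro!: derivative_eq_intros simp: has_vector_derivative_def scaleR_conv_of_real fun_eq_iff)
        then have "((g \<circ> (\<lambda>\<rho>. of_real \<rho> * cis t)) has_derivative (blinfun_apply (g' (of_real x * cis t)) \<circ> (\<lambda>h. h *\<^sub>R cis t))) (at x)"
          unfolding has_vector_derivative_def
          using der[OF inb[OF x0(2)]] by (rule diff_chain_at)
        then show ?thesis by (simp add: has_vector_derivative_def o_def blinfun.scaleR_right)
      qed
      then have "((\<lambda>\<rho>. g (of_real \<rho> * cis t) * (cis (- t) * of_real (inverse \<rho>))) has_vector_derivative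
          g (of_real x * cis t) * (cis (-t) * of_real (- (inverse x)\<^sup>2)) + g' (of_real x * cis t) (cis t) * (cis (- t) * of_real (inverse x))) (at x)"
      proof (rule has_vector_derivative_mult)
        have "(inverse has_real_derivative - (inverse x)\<^sup>2) (at x)"
          using x0 by (auto intro!: derivative_eq_intros simp: power2_eq_square)
        then have "((\<lambda>\<rho>. complex_of_real (inverse \<rho>)) has_vector_derivative of_real (- (inverse x)\<^sup>2)) (at x)"
          by (rule has_vector_derivative_of_real)
        then show "((\<lambda>\<rho>. cis (- t) * of_real (inverse \<rho>)) has_vector_derivative cis (- t) * of_real (- (inverse x)\<^sup>2)) (at x)"
          by (rule has_vector_derivative_mult_right)
      qed
      then have "((\<lambda>\<rho>. h \<rho> t) has_vector_derivative hr x t) (at x)"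
      proof -
        have alg: "G * (c * (- i\<^sup>2)) + D * (c * i) = D * c * i - G * c * i\<^sup>2" for G c i D :: complex
          by (simp add: algebra_simps)
        have "hr x t = g (of_real x * cis t) * (cis (-t) * of_real (- (inverse x)\<^sup>2)) + g' (of_real x * cis t) (cis t) * (cis (- t) * of_real (inverse x))"
          unfolding of_real_minus of_real_power of_real_inverse alg by (simp add: hr_def divide_inverse power_inverse)
        moreover have "(\<lambda>\<rho>. h \<rho> t) = (\<lambda>\<rho>. g (of_real \<rho> * cis t) * (cis (- t) * of_real (inverse \<rho>)))"
          by (simp add: h_def divide_inverse mult.assoc)
        ultimately show "((\<lambda>\<rho>. g (of_real \<rho> * cis t) * (cis (- t) * of_real (inverse \<rho>))) has_vector_derivative
          g (of_real x * cis t) * (cis (-t) * of_real (- (inverse x)\<^sup>2)) + g' (of_real x * cis t) (cis t) * (cis (- t) * of_real (inverse x))) (at x)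
          \<Longrightarrow> ((\<lambda>\<rho>. h \<rho> t) has_vector_derivative hr x t) (at x)" by simp
      qed
      then show "((\<lambda>\<rho>. h \<rho> t) has_vector_derivative hr x t) (at x within {\<rho>0..s})"
        by (rule has_vector_derivative_at_within)
    next
      fix x assume "x \<in> {\<rho>0..s}"
      then have x0: "x > 0" "x \<in> {0..s}" using r by auto
      show "h x integrable_on cbox 0 (2 * pi)"
        unfolding h_def
        by (intro integrable_continuous continuous_intros ccis continuous_on_compose2[OF gc]) (use x0 inb[OF x0(2)] in auto)
    next
      show "continuous_on ({\<rho>0..s} \<times> cbox 0 (2 * pi)) (\<lambda>(x, t). hr x t)"
        unfolding hr_def case_prod_unfold
        by (intro continuous_intros ccis blinfun.continuous_on continuous_on_compose2[OF gc] continuous_on_compose2[OF cont])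
          (use r inb in auto)
    qed (use r in auto)
    then show ?thesis by (simp add: I_def[abs_def])
  qed
  have bI: "norm (integral {0..2*pi} (hr \<rho>)) \<le> 2 * pi * K" if r: "\<rho> \<in> {0<..s}" for \<rho>
  proof -
    have r0: "\<rho> > 0" "\<rho> \<in> {0..s}" using r by auto
    have "((\<lambda>t. (\<lambda>t. g (of_real \<rho> * cis t) * cis (- t)) t) has_vector_derivative
       (g (of_real \<rho> * cis t) * (- \<i> * cis (- t)) + g' (of_real \<rho> * cis t) (of_real \<rho> * (\<i> * cis t)) * cis (- t))) (at t)" for t
    proof (rule has_vector_derivative_mult)
      have "((\<lambda>t. of_real \<rho> * cis t) has_vector_derivative of_real \<rho> * (\<i> * cis t)) (at t)"
        using has_vector_derivative_cis[of 1] by (intro has_vector_derivative_mult_right) simp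
      then have "((g \<circ> (\<lambda>t. of_real \<rho> * cis t)) has_derivative (blinfun_apply (g' (of_real \<rho> * cis t)) \<circ> (\<lambda>h. h *\<^sub>R (of_real \<rho> * (\<i> * cis t))))) (at t)"
        unfolding has_vector_derivative_def
        using der[OF inb[OF r0(2)]] by (rule diff_chain_at)
      then show "((\<lambda>t. g (of_real \<rho> * cis t)) has_vector_derivative g' (of_real \<rho> * cis t) (of_real \<rho> * (\<i> * cis t))) (at t)"
        by (simp add: has_vector_derivative_def o_def blinfun.scaleR_right)
      show "((\<lambda>t. cis (- t)) has_vector_derivative - \<i> * cis (- t)) (at t)"
        using has_vector_derivative_cis[of "-1" t UNIV] by simp
    qed
    then have "((\<lambda>t. g (of_real \<rho> * cis t) * (- \<i> * cis (- t)) + g' (of_real \<rho> * cis t) (of_real \<rho> * (\<i> * cis t)) * cis (- t)) has_integral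
       (g (of_real \<rho> * cis (2*pi)) * cis (- (2*pi)) - g (of_real \<rho> * cis 0) * cis (- 0))) {0..2*pi}"
      by (intro fundamental_theorem_of_calculus) (auto intro: has_vector_derivative_at_within)
    then have i0: "((\<lambda>t. g (of_real \<rho> * cis t) * (- \<i> * cis (- t)) + g' (of_real \<rho> * cis t) (of_real \<rho> * (\<i> * cis t)) * cis (- t)) has_integral 0) {0..2*pi}"
      using cis2pi by simp
    \<comment> \<open>In polar coordinates \<open>E\<close> is \<open>cis t\<close> times the sum of
      the radial derivative and \<open>\<i> / \<rho>\<close> times the angular one. Weighted as
      here, it equals the radial derivative \<open>hr\<close> of the integrand up to a multiple of
      the total angular derivative in \<open>i0\<close>, whose integral is 0.\<close>
    have E_eq: "E (of_real \<rho> * cis t) * cis (- t) * cis (- t) / of_real \<rho> =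
        hr \<rho> t - (1 / (\<i> * (of_real \<rho>)\<^sup>2)) * (g (of_real \<rho> * cis t) * (- \<i> * cis (- t)) + g' (of_real \<rho> * cis t) (of_real \<rho> * (\<i> * cis t)) * cis (- t))" for t
    proof -
      define z where "z = of_real \<rho> * cis t"
      define a b where "a = g' z 1" and "b = g' z \<i>"
      have lin: "g' z (Complex x y) = of_real x * a + of_real y * b" for x y
      proof -
        have "Complex x y = x *\<^sub>R 1 + y *\<^sub>R \<i>" by (simp add: complex_eq_iff)
        then show ?thesis by (simp only: blinfun.add_right blinfun.scaleR_right a_def b_def) (simp add: scaleR_conv_of_real)
      qed
      define c d where "c = complex_of_real (cos t)" and "d = complex_of_real (sin t)"
      have cis: "cis t = c + \<i> * d" "cis (- t) = c - \<i> * d"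
        by (auto simp: complex_eq_iff c_def d_def)
      have cd: "c * c + d * d = 1"
        unfolding c_def d_def by (metis of_real_1 of_real_add of_real_mult power2_eq_square sin_cos_squared_add2 add.commute sin_cos_squared_add)
      have g1: "g' z (cis t) = c * a + d * b"
        using lin[of "cos t" "sin t"] by (simp add: c_def d_def cis.code)
      have "of_real \<rho> * (\<i> * cis t) = Complex (- \<rho> * sin t) (\<rho> * cos t)"
        by (simp add: complex_eq_iff)
      then have g2: "g' z (of_real \<rho> * (\<i> * cis t)) = of_real \<rho> * (c * b - d * a)"
        using lin[of "- \<rho> * sin t" "\<rho> * cos t"] by (simp add: c_def d_def algebra_simps)
      have "(a + \<i> * b) * (c - \<i> * d) = (c * a + d * b) + \<i> * (c * b - d * a)"
        by (simp add: algebra_simps)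
      then have ab: "(a + \<i> * b) * (c - \<i> * d) * w = (c * a + d * b) * w + \<i> * ((c * b - d * a) * w)" for w
        by (simp add: distrib_right mult.assoc)
      define k w G where "k = inverse (complex_of_real \<rho>)" and "w = c - \<i> * d" and "G = g z"
      have k: "k * k * (complex_of_real \<rho> * q) = k * q" for q
        using r0 by (simp add: k_def)
      have "(1 / (\<i> * (of_real \<rho>)\<^sup>2)) = - \<i> * (k * k)"
        by (simp add: k_def divide_inverse power2_eq_square)
      moreover have "- \<i> * (k * k) * (G * (- \<i> * w) + of_real \<rho> * (c * b - d * a) * w) =
          - (G * w * (k * k)) - \<i> * ((c * b - d * a) * w) * k"
      proof -
        have "- \<i> * (k * k) * (G * (- \<i> * w) + of_real \<rho> * (c * b - d * a) * w) =
          (\<i> * \<i>) * (G * w * (k * k)) - \<i> * (k * k * (of_real \<rho> * ((c * b - d * a) * w)))"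
          by (simp add: algebra_simps)
        moreover have "k * of_real \<rho> = 1" using r0 by (simp add: k_def)
        ultimately show ?thesis by (simp add: mult.assoc mult.commute mult.left_commute)
      qed
      ultimately have "hr \<rho> t - (1 / (\<i> * (of_real \<rho>)\<^sup>2)) * (g (of_real \<rho> * cis t) * (- \<i> * cis (- t)) + g' (of_real \<rho> * cis t) (of_real \<rho> * (\<i> * cis t)) * cis (- t))
        = ((c * a + d * b) * w * k - G * w * (k * k)) - (- (G * w * (k * k)) - \<i> * ((c * b - d * a) * w) * k)"
        unfolding hr_def z_def[symmetric]
        unfolding g1 g2
        unfolding cis w_def[symmetric] G_def[symmetric]
        by (simp add: divide_inverse k_def power2_eq_square)
      also have "\<dots> = ((c * a + d * b) * w + \<i> * ((c * b - d * a) * w)) * k"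
        by (simp add: distrib_right)
      also have "\<dots> = (a + \<i> * b) * w * w * k"
        using ab[of w] by (simp add: w_def)
      also have "\<dots> = E (of_real \<rho> * cis t) * cis (- t) * cis (- t) / of_real \<rho>"
        unfolding E_def z_def[symmetric]
        unfolding a_def[symmetric] b_def[symmetric] cis w_def[symmetric]
        by (simp add: k_def divide_inverse)
      finally show ?thesis by simp
    qed
    have hri: "hr \<rho> integrable_on {0..2*pi}"
      unfolding hr_def
      by (intro integrable_continuous_interval continuous_intros ccis blinfun.continuous_on continuous_on_compose2[OF gc] continuous_on_compose2[OF cont])
        (use r0 inb[OF r0(2)] in auto)
    have "((\<lambda>t. E (of_real \<rho> * cis t) * cis (- t) * cis (- t) / of_real \<rho>) has_integral integral {0..2*pi} (hr \<rho>) - (1 / (\<i> * (of_real \<rho>)\<^sup>2)) * 0) {0..2*pi}"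
      unfolding E_eq by (intro has_integral_diff integrable_integral hri has_integral_mult_right i0)
    then have "norm (integral {0..2*pi} (hr \<rho>) - (1 / (\<i> * (of_real \<rho>)\<^sup>2)) * 0) \<le> K * (2 * pi)"
    proof (rule bd[OF K0])
      fix t :: real
      have "cmod (E (of_real \<rho> * cis t)) \<le> K * \<rho>"
        using K[OF inb[OF r0(2)], of t] r0 by (simp add: E_def norm_mult)
      then show "norm (E (of_real \<rho> * cis t) * cis (- t) * cis (- t) / of_real \<rho>) \<le> K"
        using r0 by (simp add: norm_mult norm_divide field_simps)
    qed
    then show ?thesis by (simp add: mult.commute)
  qed
  have lip: "cmod (I s - I \<rho>) \<le> 2 * pi * K * s" if "0 < \<rho>" "\<rho> \<le> s" for \<rho>
  proof -
    have "cmod (I s - I \<rho>) \<le> 2 * pi * K * norm (s - \<rho>)"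
    proof (rule differentiable_bound)
      show "convex {\<rho>..s}" by simp
      fix x assume "x \<in> {\<rho>..s}"
      then show "(I has_derivative (\<lambda>h. h *\<^sub>R integral {0..2*pi} (hr x))) (at x within {\<rho>..s})"
        using dI[OF that(1)] by (simp add: has_vector_derivative_def)
      show "onorm (\<lambda>h. h *\<^sub>R integral {0..2*pi} (hr x)) \<le> 2 * pi * K"
        using bI[of x] \<open>x \<in> _\<close> that by (intro onorm_le) (auto simp: mult.commute mult_left_mono)
    qed (use that in auto)
    also have "\<dots> \<le> 2 * pi * K * s" using that K0 by (intro mult_left_mono) auto
    finally show ?thesis .
  qed
  \<comment> \<open>As the radius shrinks, the integral tends to \<open>2 * pi\<close> times the
    derivative at the centre: the bound \<open>K\<close> forces \<open>E 0 = 0\<close>, so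
    \<open>g' 0\<close> is complex linear, and the constant \<open>g 0\<close> is killed by the
    factor \<open>cis (- t)\<close>.\<close>
  have lim: "\<exists>\<rho>. 0 < \<rho> \<and> \<rho> \<le> s \<and> cmod (I \<rho> - of_real (2 * pi) * g' 0 1) \<le> 2 * pi * e" if e: "e > 0" for e
  proof -
    have "(g has_derivative g' 0) (at 0)" using der[of 0] s by simp
    then obtain d where d: "d > 0" "\<And>y. cmod y < d \<Longrightarrow> cmod (g y - g 0 - g' 0 y) \<le> e * cmod y"
      using e unfolding has_derivative_at_alt by (auto)
    define \<rho> where "\<rho> = min s (d / 2)"
    have \<rho>: "\<rho> > 0" "\<rho> \<in> {0..s}" "\<rho> < d" using s d by (auto simp: \<rho>_def)
    have E0: "E 0 = 0" using K[of 0] s by (simp add: E_def)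
    have lin: "g' 0 (of_real \<rho> * cis t) = of_real \<rho> * cis t * g' 0 1" for t
    proof -
      have "of_real \<rho> * cis t = (\<rho> * cos t) *\<^sub>R 1 + (\<rho> * sin t) *\<^sub>R \<i>" by (simp add: complex_eq_iff)
      then have "g' 0 (of_real \<rho> * cis t) = of_real (\<rho> * cos t) * g' 0 1 + of_real (\<rho> * sin t) * g' 0 \<i>"
        by (simp only: blinfun.add_right blinfun.scaleR_right) (simp add: scaleR_conv_of_real)
      also have "g' 0 \<i> = \<i> * g' 0 1" using E0 by (simp add: E_def complex_eq_iff)
      finally show ?thesis by (simp add: complex_eq_iff algebra_simps)
    qed
    have ic: "((\<lambda>t. g 0 * cis (- t) / of_real \<rho>) has_integral 0) {0..2*pi}"
    proof -
      have "((\<lambda>t. cis (- t)) has_integral (\<i> * cis (- (2 * pi)) - \<i> * cis (- 0))) {0..2*pi}"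
      proof (rule fundamental_theorem_of_calculus)
        fix t :: real
        show "((\<lambda>t. \<i> * cis (- t)) has_vector_derivative cis (- t)) (at t within {0..2*pi})"
          using has_vector_derivative_mult_right[OF has_vector_derivative_cis[of "-1" t], of \<i>] by (simp add: mult.assoc[symmetric])
      qed simp
      then have "((\<lambda>t. cis (- t)) has_integral 0) {0..2*pi}" by (simp add: cis2pi)
      from has_integral_mult_right[OF this, of "g 0 / of_real \<rho>"] show ?thesis by simp
    qed
    have ih: "(h \<rho> has_integral I \<rho>) {0..2*pi}"
      unfolding I_def
    proof (rule integrable_integral)
      show "h \<rho> integrable_on {0..2*pi}"
        unfolding h_def
        by (intro integrable_continuous_interval continuous_intros ccis continuous_on_compose2[OF gc]) (use \<rho> inb[OF \<rho>(2)] in auto)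
    qed
    have "((\<lambda>t. h \<rho> t - g 0 * cis (- t) / of_real \<rho> - g' 0 1) has_integral (I \<rho> - 0 - of_real (2 * pi) * g' 0 1)) {0..2*pi}"
      using has_integral_const_real[of "g' 0 1" 0 "2*pi"] by (intro has_integral_diff ih ic) (simp add: scaleR_conv_of_real)
    then have "norm (I \<rho> - 0 - of_real (2 * pi) * g' 0 1) \<le> e * (2 * pi)"
    proof (rule bd[OF less_imp_le[OF e]])
      fix t :: real
      have eq: "h \<rho> t - g 0 * cis (- t) / of_real \<rho> - g' 0 1 = (g (of_real \<rho> * cis t) - g 0 - g' 0 (of_real \<rho> * cis t)) * cis (- t) / of_real \<rho>"
      proof -
        have "of_real \<rho> * cis t * g' 0 1 * cis (- t) / of_real \<rho> = g' 0 1 * (cis t * cis (- t))"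
          using \<rho> by simp
        also have "cis t * cis (- t) = 1" by (simp add: cis_mult)
        finally show ?thesis by (simp only: h_def lin left_diff_distrib diff_divide_distrib mult_1_right)
      qed
      have "cmod (g (of_real \<rho> * cis t) - g 0 - g' 0 (of_real \<rho> * cis t)) \<le> e * \<rho>"
        using d(2)[of "of_real \<rho> * cis t"] \<rho> by (simp add: norm_mult)
      then show "norm (h \<rho> t - g 0 * cis (- t) / of_real \<rho> - g' 0 1) \<le> e"
        unfolding eq norm_mult norm_divide norm_cis using \<rho> by (simp add: pos_divide_le_eq del: of_real_mult)
    qed
    then show ?thesis using \<rho> by (intro exI[of _ \<rho>]) (auto simp: mult.commute)
  qed
  have "cmod (of_real (2 * pi) * g' 0 1 - I s) \<le> 2 * pi * K * s + e" if e: "e > 0" for e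
  proof -
    obtain \<rho> where \<rho>: "0 < \<rho>" "\<rho> \<le> s" "cmod (I \<rho> - of_real (2 * pi) * g' 0 1) \<le> 2 * pi * (e / (2 * pi))"
    proof -
      have "e / (2 * pi) > 0" using e by simp
      from lim[OF this] show thesis using that by blast
    qed
    have "cmod (of_real (2 * pi) * g' 0 1 - I s) \<le> cmod (I \<rho> - of_real (2 * pi) * g' 0 1) + cmod (I s - I \<rho>)"
      by (metis norm_minus_commute norm_triangle_ineq add.commute diff_add_cancel add_diff_eq)
    then show ?thesis using \<rho> lip[OF \<rho>(1,2)] by simp
  qed
  then have "cmod (of_real (2 * pi) * g' 0 1 - I s) \<le> 2 * pi * K * s"
    by (rule field_le_epsilon)
  then show ?thesis by (simp add: I_def h_def[abs_def])
qed

section \<open>Derivative estimates in two complex dimensions\<close>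

lemma norm_complex2_le: "norm (v :: complex^2) \<le> cmod (v $ 1) + cmod (v $ 2)"
  by (rule power2_le_imp_le) (simp_all add: norm_complex2 power2_sum)

lemma norm_smult_complex2 [simp]: "norm (c *s v :: complex^2) = cmod c * norm v"
proof (rule power2_eq_imp_eq)
  show "(norm (c *s v))\<^sup>2 = (cmod c * norm v)\<^sup>2"
    by (simp add: norm_complex2 norm_mult power_mult_distrib distrib_left)
qed simp_all

lemma bounded_bilinear_smult_complex2: "bounded_bilinear (\<lambda>c (v :: complex^2). c *s v)"
proof
  show "\<exists>K. \<forall>a (b :: complex^2). norm (a *s b) \<le> norm a * norm b * K"
    by (rule exI[of _ 1]) simp
qed (simp_all add: vec_eq_iff algebra_simps)

definition smult_blinfun :: "complex \<Rightarrow> (complex^2) \<Rightarrow>\<^sub>L (complex^2)" where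
  "smult_blinfun c = Blinfun (\<lambda>v. c *s v)"

lemma smult_blinfun_apply [simp]: "smult_blinfun c v = c *s v"
  unfolding smult_blinfun_def
  by (simp add: bounded_linear_Blinfun_apply bounded_bilinear.bounded_linear_right[OF bounded_bilinear_smult_complex2])

text \<open>The scalar estimate is applied to each coordinate of the map recentred at
  \<open>z0\<close>; the factor 2 comes from adding the two coordinates.\<close>

lemma center_derivative_bound:
  fixes G :: "complex \<Rightarrow> complex^2" and G' :: "complex \<Rightarrow> complex \<Rightarrow>\<^sub>L (complex^2)"
  assumes s: "s > 0"
    and der: "\<And>z. z \<in> cball z0 s \<Longrightarrow> (G has_derivative blinfun_apply (G' z)) (at z)"
    and cont: "continuous_on (cball z0 s) G'"
    and K: "\<And>z. z \<in> cball z0 s \<Longrightarrow> norm (G' z 1 + \<i> *s G' z \<i>) \<le> K * norm (z - z0)"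
    and \<omega>: "\<And>z. z \<in> sphere z0 s \<Longrightarrow> norm (G z) \<le> \<omega>"
  shows "norm (G' z0 1) \<le> 2 * (\<omega> / s + K * s)"
proof -
  have "cmod (G' z0 1 $ j) \<le> \<omega> / s + K * s" for j
  proof -
    define P :: "(complex^2) \<Rightarrow>\<^sub>L complex" where "P = Blinfun (\<lambda>v. v $ j)"
    have P [simp]: "P v = v $ j" for v by (simp add: P_def bounded_linear_Blinfun_apply bounded_linear_vec_nth)
    define g where "g z = G (z0 + z) $ j" for z
    define g' where "g' z = P o\<^sub>L G' (z0 + z)" for z
    have in1: "z0 + z \<in> cball z0 s" if "z \<in> cball 0 s" for z
      using that by (simp add: dist_norm)
    have "\<omega> \<ge> 0"
    proof -
      have "z0 + of_real s \<in> sphere z0 s" using s by (simp add: dist_norm)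
      then show ?thesis using \<omega> norm_ge_zero order_trans by blast
    qed
    have "cmod (of_real (2 * pi) * g' 0 1 - integral {0..2*pi} (\<lambda>t. g (of_real s * cis t) * cis (- t) / of_real s)) \<le> 2 * pi * K * s"
    proof (rule circle_mean_derivative_estimate[OF s])
      fix z :: complex assume z: "z \<in> cball 0 s"
      have "((\<lambda>z. z0 + z) has_derivative (\<lambda>h. h)) (at z)" by (auto intro!: derivative_eq_intros)
      from diff_chain_at[OF this der[OF in1[OF z]]]
      have "((\<lambda>z. G (z0 + z)) has_derivative blinfun_apply (G' (z0 + z))) (at z)" by (simp add: o_def)
      from bounded_linear.has_derivative[OF bounded_linear_vec_nth[of j] this]
      have "(g has_derivative (\<lambda>h. G' (z0 + z) h $ j)) (at z)" by (simp add: g_def[abs_def])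
      moreover have "blinfun_apply (g' z) = (\<lambda>h. G' (z0 + z) h $ j)" by (simp add: g'_def fun_eq_iff)
      ultimately show "(g has_derivative blinfun_apply (g' z)) (at z)" by simp
      have "cmod (g' z 1 + \<i> * g' z \<i>) = cmod ((G' (z0 + z) 1 + \<i> *s G' (z0 + z) \<i>) $ j)"
        by (simp add: g'_def)
      also have "\<dots> \<le> norm (G' (z0 + z) 1 + \<i> *s G' (z0 + z) \<i>)" by (rule Finite_Cartesian_Product.norm_nth_le)
      also have "\<dots> \<le> K * cmod z" using K[OF in1[OF z]] by simp
      finally show "cmod (g' z 1 + \<i> * g' z \<i>) \<le> K * cmod z" .
    next
      show "continuous_on (cball 0 s) g'"
        unfolding g'_def
        by (intro bounded_bilinear.continuous_on[OF bounded_bilinear_blinfun_compose] continuous_on_compose2[OF cont] continuous_intros)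
          (use in1 in auto)
    qed
    moreover have "cmod (integral {0..2*pi} (\<lambda>t. g (of_real s * cis t) * cis (- t) / of_real s)) \<le> (\<omega> / s) * (2 * pi)"
    proof -
      have gc: "continuous_on (cball z0 s) G"
        by (rule has_derivative_continuous_on) (rule has_derivative_at_withinI[OF der])
      have ccis: "continuous_on S (\<lambda>t. cis (f t))" if "continuous_on S f" for S :: "real set" and f
        using that by (simp add: cis_conv_exp continuous_intros)
      have "(\<lambda>t. g (of_real s * cis t) * cis (- t) / of_real s) integrable_on {0..2*pi}"
        unfolding g_def
        by (intro integrable_continuous_interval continuous_intros ccis continuous_on_compose2[OF gc])
          (use s in \<open>auto simp: dist_norm norm_mult\<close>)
      then have "((\<lambda>t. g (of_real s * cis t) * cis (- t) / of_real s) has_integral integral {0..2*pi} (\<lambda>t. g (of_real s * cis t) * cis (- t) / of_real s)) (cbox 0 (2*pi))"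
        unfolding cbox_interval by (rule integrable_integral)
      then have "cmod (integral {0..2*pi} (\<lambda>t. g (of_real s * cis t) * cis (- t) / of_real s)) \<le> (\<omega> / s) * Henstock_Kurzweil_Integration.content (cbox 0 (2 * pi))"
      proof (rule has_integral_bound[rotated])
        show "0 \<le> \<omega> / s" using s \<open>\<omega> \<ge> 0\<close> by simp
        fix t :: real
        have "cmod (g (of_real s * cis t)) \<le> norm (G (z0 + of_real s * cis t))"
          unfolding g_def by (rule Finite_Cartesian_Product.norm_nth_le)
        also have "\<dots> \<le> \<omega>" using s by (intro \<omega>) (simp add: dist_norm norm_mult)
        finally show "cmod (g (of_real s * cis t) * cis (- t) / of_real s) \<le> \<omega> / s"
          using s by (simp add: norm_mult norm_divide divide_right_mono)
      qed
      then show ?thesis by simp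
    qed
    ultimately have "cmod (of_real (2 * pi) * g' 0 1) \<le> 2 * pi * K * s + (\<omega> / s) * (2 * pi)"
      using norm_triangle_sub[of "of_real (2 * pi) * g' 0 1" "integral {0..2*pi} (\<lambda>t. g (of_real s * cis t) * cis (- t) / of_real s)"]
      by linarith
    then have "2 * pi * cmod (G' z0 1 $ j) \<le> 2 * pi * (\<omega> / s + K * s)"
      by (simp add: g'_def norm_mult algebra_simps)
    then show ?thesis by simp
  qed
  from this[of 1] this[of 2] norm_complex2_le[of "G' z0 1"] show ?thesis by simp
qed

lemma J_derivative_estimate:
  fixes J :: "complex^2 \<Rightarrow> (complex^2) \<Rightarrow>\<^sub>L (complex^2)"
    and F :: "complex \<Rightarrow> complex^2" and F' :: "complex \<Rightarrow> complex \<Rightarrow>\<^sub>L (complex^2)"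
  defines "T \<equiv> \<lambda>z0. (1/2) *\<^sub>R (id_blinfun - (smult_blinfun \<i> o\<^sub>L J (F z0)))"
  assumes s: "s > 0"
    and der: "\<And>z. z \<in> cball z0 s \<Longrightarrow> (F has_derivative blinfun_apply (F' z)) (at z)"
    and cont: "continuous_on (cball z0 s) F'"
    and hol: "\<And>z. z \<in> cball z0 s \<Longrightarrow> F' z 1 + J (F z) (F' z \<i>) = 0"
    and J2: "\<And>\<xi>. J (F z0) (J (F z0) \<xi>) = - \<xi>"
    and Lip: "\<And>z. z \<in> cball z0 s \<Longrightarrow> norm (J (F z) - J (F z0)) \<le> L * norm (F z - F z0)" and L: "L \<ge> 0"
    and N: "\<And>z. z \<in> cball z0 s \<Longrightarrow> norm (F' z) \<le> N"
    and T2: "norm (T z0) \<le> 2"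
    and p: "\<And>z. z \<in> cball z0 s \<Longrightarrow> (p has_derivative (\<lambda>h. h *s p' z)) (at z)" and p': "continuous_on (cball z0 s) p'"
    and \<omega>: "\<And>z. z \<in> sphere z0 s \<Longrightarrow> norm (T z0 (F z) - p z) \<le> \<omega>"
  shows "norm (T z0 (F' z0 1) - p' z0) \<le> 2 * (\<omega> / s + 2 * L * N\<^sup>2 * s)"
proof -
  have T: "T z0 y = (1/2) *\<^sub>R (y - \<i> *s J (F z0) y)" for y
    by (simp add: T_def blinfun.diff_left blinfun.scaleR_left)
  have TJ: "T z0 (J (F z0) y) = \<i> *s T z0 y" for y
    by (simp add: T J2 vec_eq_iff algebra_simps)
  have N0: "N \<ge> 0" using order_trans[OF norm_ge_zero N[of z0]] s by simp
  define S :: "complex^2 \<Rightarrow> complex \<Rightarrow>\<^sub>L (complex^2)" where "S v = Blinfun (\<lambda>h. h *s v)" for v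
  have S [simp]: "S v h = h *s v" for v h
    by (simp add: S_def bounded_linear_Blinfun_apply bounded_bilinear.bounded_linear_left[OF bounded_bilinear_smult_complex2])
  have Slin: "bounded_linear S"
  proof
    show "S (x + y) = S x + S y" for x y by (rule blinfun_eqI) (simp add: blinfun.add_left vec_eq_iff algebra_simps)
    show "S (r *\<^sub>R x) = r *\<^sub>R S x" for r x by (rule blinfun_eqI) (simp add: blinfun.scaleR_left vec_eq_iff algebra_simps)
    have "norm (S x) \<le> norm x * 1" for x
      by (rule norm_blinfun_bound) (simp_all add: mult.commute)
    then show "\<exists>K. \<forall>x. norm (S x) \<le> norm x * K" by blast
  qed
  define G' where "G' z = (T z0 o\<^sub>L F' z) - S (p' z)" for z
  have "norm (G' z0 1) \<le> 2 * (\<omega> / s + 2 * L * N\<^sup>2 * s)"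
  proof (rule center_derivative_bound[OF s, where G = "\<lambda>z. T z0 (F z) - p z"])
    fix z assume z: "z \<in> cball z0 s"
    show "((\<lambda>z. T z0 (F z) - p z) has_derivative blinfun_apply (G' z)) (at z)"
    proof -
      have "((\<lambda>z. T z0 (F z) - p z) has_derivative (\<lambda>h. T z0 (F' z h) - h *s p' z)) (at z)"
        by (intro has_derivative_diff p[OF z] bounded_linear.has_derivative[OF blinfun.bounded_linear_right der[OF z]])
      moreover have "blinfun_apply (G' z) = (\<lambda>h. T z0 (F' z h) - h *s p' z)" by (simp add: G'_def fun_eq_iff blinfun.diff_left)
      ultimately show ?thesis by simp
    qed
    have lipF: "norm (F z - F z0) \<le> N * norm (z - z0)"
    proof (rule differentiable_bound)
      show "convex (cball z0 s)" by simp
      show "(F has_derivative blinfun_apply (F' x)) (at x within cball z0 s)" if "x \<in> cball z0 s" for x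
        using der[OF that] by (rule has_derivative_at_withinI)
      show "onorm (blinfun_apply (F' x)) \<le> N" if "x \<in> cball z0 s" for x
        using N[OF that] by (simp add: norm_blinfun.rep_eq)
    qed (use z s in auto)
    have e1: "F' z 1 = - J (F z) (F' z \<i>)" using hol[OF z] by (simp add: add_eq_0_iff)
    \<comment> \<open>Of the two factors \<open>N\<close>, one comes from the Lipschitz bound for
      \<open>F\<close> inside \<open>J\<close> and the other from the differential
      \<open>F' z\<close> itself.\<close>
    have "G' z 1 + \<i> *s G' z \<i> = T z0 (F' z 1) + \<i> *s T z0 (F' z \<i>)"
      by (simp add: G'_def blinfun.diff_left vec_eq_iff algebra_simps)
    also have "\<dots> = - T z0 ((J (F z) - J (F z0)) (F' z \<i>))"
      by (simp add: e1 TJ[symmetric] blinfun.diff_left blinfun.diff_right blinfun.minus_right)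
    finally have "norm (G' z 1 + \<i> *s G' z \<i>) \<le> norm (T z0) * norm ((J (F z) - J (F z0)) (F' z \<i>))"
      by (simp add: norm_blinfun)
    also have "\<dots> \<le> 2 * (norm (J (F z) - J (F z0)) * (norm (F' z) * norm \<i>))"
      using T2 by (intro mult_mono order_trans[OF norm_blinfun] mult_left_mono norm_blinfun) auto
    also have "\<dots> \<le> 2 * ((L * (N * norm (z - z0))) * (N * 1))"
      using Lip[OF z] lipF N[OF z] N0 L by (intro mult_left_mono mult_mono order_trans[OF Lip[OF z]]) auto
    also have "\<dots> = 2 * L * N\<^sup>2 * norm (z - z0)" by (simp add: power2_eq_square)
    finally show "norm (G' z 1 + \<i> *s G' z \<i>) \<le> 2 * L * N\<^sup>2 * norm (z - z0)" .
  next
    show "continuous_on (cball z0 s) G'"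
      unfolding G'_def
      by (intro continuous_on_diff bounded_linear.continuous_on[OF Slin p'] bounded_bilinear.continuous_on[OF bounded_bilinear_blinfun_compose] continuous_on_const cont)
  qed (use \<omega> in simp)
  then show ?thesis by (simp add: G'_def blinfun.diff_left)
qed

text \<open>The situation in adapted coordinates near the origin. The Lipschitz bound is stated
  along the image of \<open>F\<close>, and \<open>J0\<close> is its comparison with the standard
  structure at the origin.\<close>

locale J_curve =
  fixes J :: "complex^2 \<Rightarrow> (complex^2) \<Rightarrow>\<^sub>L (complex^2)"
    and F :: "complex \<Rightarrow> complex^2" and F' :: "complex \<Rightarrow> complex \<Rightarrow>\<^sub>L (complex^2)"
    and \<delta> L :: real
  assumes \<delta>: "\<delta> > 0" and L: "L \<ge> 0"
    and der: "\<And>z. cmod z < \<delta> \<Longrightarrow> (F has_derivative blinfun_apply (F' z)) (at z)"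
    and cont: "continuous_on (ball 0 \<delta>) F'"
    and hol: "\<And>z. cmod z < \<delta> \<Longrightarrow> F' z 1 + J (F z) (F' z \<i>) = 0"
    and J2: "\<And>z \<xi>. cmod z < \<delta> \<Longrightarrow> J (F z) (J (F z) \<xi>) = - \<xi>"
    and Lip: "\<And>z z'. cmod z < \<delta> \<Longrightarrow> cmod z' < \<delta> \<Longrightarrow> norm (J (F z) - J (F z')) \<le> L * norm (F z - F z')"
    and J0: "\<And>z. cmod z < \<delta> \<Longrightarrow> norm (J (F z) - smult_blinfun \<i>) \<le> L * norm (F z)"
begin

text \<open>\<open>T z\<close> intertwines \<open>J (F z)\<close> with multiplication by \<open>\<i>\<close>, which makes \<open>T z\<close> after \<open>F' z\<close> complex linear.\<close>

definition T :: "complex \<Rightarrow> (complex^2) \<Rightarrow>\<^sub>L (complex^2)" where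
  "T z = (1/2) *\<^sub>R (id_blinfun - (smult_blinfun \<i> o\<^sub>L J (F z)))"

lemma T_apply: "T z y = (1/2) *\<^sub>R (y - \<i> *s J (F z) y)"
  by (simp add: T_def blinfun.diff_left blinfun.scaleR_left)

text \<open>For the standard structure \<open>(y - \<i> *s (\<i> *s y)) / 2\<close> gives back
  \<open>y\<close>, so half the deviation of \<open>J\<close> from it remains.\<close>

lemma T_near_id:
  assumes "cmod z < \<delta>"
  shows "norm (y - T z y) \<le> L * norm (F z) / 2 * norm y"
proof -
  have "y - T z y = (1/2) *\<^sub>R (\<i> *s (J (F z) - smult_blinfun \<i>) y)"
    by (simp add: T_apply blinfun.diff_left vec_eq_iff algebra_simps) (simp add: scaleR_conv_of_real)
  then have "norm (y - T z y) = (1/2) * norm ((J (F z) - smult_blinfun \<i>) y)"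
    by simp
  also have "\<dots> \<le> (1/2) * (L * norm (F z) * norm y)"
    using order_trans[OF norm_blinfun mult_right_mono[OF J0[OF assms]]] by (intro mult_left_mono) auto
  finally show ?thesis by simp
qed

lemma T_le:
  assumes "cmod z < \<delta>" "L * norm (F z) \<le> 1"
  shows "norm (T z y) \<le> 2 * norm y"
proof -
  have "norm (T z y) \<le> norm y + norm (y - T z y)"
    using norm_triangle_sub[of "T z y" y] by (simp add: norm_minus_commute)
  also have "norm (y - T z y) \<le> 1 * norm y"
    using assms L by (intro order_trans[OF T_near_id] mult_right_mono) auto
  finally show ?thesis by simp
qed

lemma T_linear:
  assumes "cmod z < \<delta>"
  shows "T z (F' z h) = h *s T z (F' z 1)"
proof -
  have TJ: "T z (J (F z) y) = \<i> *s T z y" for y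
    by (simp add: T_apply J2[OF assms] vec_eq_iff algebra_simps)
  have "F' z 1 = - J (F z) (F' z \<i>)" using hol[OF assms] by (simp add: add_eq_0_iff)
  then have "T z (F' z 1) = - (\<i> *s T z (F' z \<i>))" by (simp add: TJ blinfun.minus_right)
  then have Ti: "T z (F' z \<i>) = \<i> *s T z (F' z 1)" by (simp add: vec_eq_iff algebra_simps)
  have "h = Re h *\<^sub>R 1 + Im h *\<^sub>R \<i>" by (simp add: complex_eq_iff)
  then have "T z (F' z h) = Re h *\<^sub>R T z (F' z 1) + Im h *\<^sub>R T z (F' z \<i>)"
    by (metis blinfun.add_right blinfun.scaleR_right)
  also have "\<dots> = h *s T z (F' z 1)"
    unfolding Ti by (simp add: vec_eq_iff complex_eq_iff algebra_simps)
  finally show ?thesis .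
qed

text \<open>The differential reappears on the right with a small coefficient and is to be absorbed
  into the left side.\<close>

lemma derivative_bound_T:
  assumes "cmod z < \<delta>"
  shows "norm (F' z) \<le> norm (T z (F' z 1)) + L * norm (F z) / 2 * norm (F' z)"
proof (rule norm_blinfun_bound)
  show "0 \<le> norm (T z (F' z 1)) + L * norm (F z) / 2 * norm (F' z)" using L by simp
  fix h
  have "norm (F' z h) \<le> norm (T z (F' z h)) + norm (F' z h - T z (F' z h))"
    by (metis norm_triangle_sub)
  also have "norm (T z (F' z h)) = cmod h * norm (T z (F' z 1))"
    using T_linear[OF assms, of h] by simp
  also have "norm (F' z h - T z (F' z h)) \<le> L * norm (F z) / 2 * norm (F' z h)"
    by (rule T_near_id[OF assms])
  also have "\<dots> \<le> L * norm (F z) / 2 * (norm (F' z) * norm h)"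
    using L by (intro mult_left_mono norm_blinfun) simp
  finally show "norm (F' z h) \<le> (norm (T z (F' z 1)) + L * norm (F z) / 2 * norm (F' z)) * norm h"
    by (simp add: algebra_simps)
qed

lemma T_derivative_estimate:
  assumes s: "s > 0" and sub: "cball z0 s \<subseteq> ball 0 \<delta>" and small: "L * norm (F z0) \<le> 1"
    and N: "\<And>z. z \<in> cball z0 s \<Longrightarrow> norm (F' z) \<le> N"
    and p: "\<And>z. z \<in> cball z0 s \<Longrightarrow> (p has_derivative (\<lambda>h. h *s p' z)) (at z)" and p': "continuous_on (cball z0 s) p'"
    and \<omega>: "\<And>z. z \<in> sphere z0 s \<Longrightarrow> norm (T z0 (F z) - p z) \<le> \<omega>"
  shows "norm (T z0 (F' z0 1) - p' z0) \<le> 2 * (\<omega> / s + 2 * L * N\<^sup>2 * s)"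
proof -
  have i: "cmod z < \<delta>" if "z \<in> cball z0 s" for z using sub that by auto
  have z0: "cmod z0 < \<delta>" using i s by simp
  have "norm (T z0) \<le> 2" using T_le[OF z0 small] by (intro norm_blinfun_bound) auto
  then have T2: "norm ((1/2) *\<^sub>R (id_blinfun - (smult_blinfun \<i> o\<^sub>L J (F z0)))) \<le> 2"
    by (simp add: T_def)
  show ?thesis
    unfolding T_def
  proof (rule J_derivative_estimate[OF s])
    show "continuous_on (cball z0 s) F'" by (rule continuous_on_subset[OF cont sub])
  qed (use T2 i z0 der hol J2 Lip L N p p' \<omega> in \<open>simp_all add: T_def\<close>)
qed

text \<open>The differential, weighted by the distance to the boundary, is estimated at its maximum point: around it the
  differential at most doubles, so the quadratic error term can be absorbed.\<close>

lemma gradient_bound: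
  assumes R: "R > 0" and sub: "cball z0 R \<subseteq> ball 0 \<delta>"
    and \<omega>: "\<And>z. z \<in> cball z0 R \<Longrightarrow> norm (F z) \<le> \<omega>" and small: "L * \<omega> \<le> 1 / 2048"
  shows "norm (F' z0) * R \<le> 32 * \<omega>"
proof -
  have \<omega>0: "\<omega> \<ge> 0" using order_trans[OF norm_ge_zero \<omega>[of z0]] R by simp
  \<comment> \<open>The maximum point \<open>z1\<close> of this weighted norm has a disc of radius
    \<open>d / 2\<close> around it on which the differential is at most twice as large as at
    \<open>z1\<close>.\<close>
  define m where "m z = (R - cmod (z - z0)) * norm (F' z)" for z
  have "continuous_on (cball z0 R) m"
    unfolding m_def by (intro continuous_intros continuous_on_subset[OF cont sub])
  then obtain z1 where z1: "z1 \<in> cball z0 R" "\<And>z. z \<in> cball z0 R \<Longrightarrow> m z \<le> m z1"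
    using continuous_attains_sup[of "cball z0 R" m] R by auto
  define d N1 where "d = R - cmod (z1 - z0)" and "N1 = norm (F' z1)"
  have m1: "m z1 = d * N1" by (simp add: m_def d_def N1_def)
  have d0: "d \<ge> 0" using z1(1) by (simp add: d_def dist_norm norm_minus_commute)
  have "m z0 \<le> m z1" using R by (intro z1) auto
  then have le: "norm (F' z0) * R \<le> d * N1" using m1 by (simp add: m_def[of z0] mult.commute)
  show ?thesis
  proof (cases "d * N1 = 0")
    case True
    then have "norm (F' z0) * R \<le> 0" using le by (simp only:)
    then show ?thesis using \<omega>0 by linarith
  next
    case False
    then have pos: "d > 0" "N1 > 0" using d0 by (auto simp: N1_def)
    have F1: "norm (F z1) \<le> \<omega>" by (rule \<omega>[OF z1(1)])
    have z1\<delta>: "cmod z1 < \<delta>" using z1(1) sub by auto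
    have L1: "L * norm (F z1) \<le> 1 / 2048" using mult_left_mono[OF F1 L] small by simp
    have key: "N1 \<le> 8 * \<omega> / s + 32 * L * N1\<^sup>2 * s" if s: "0 < s" "s \<le> d / 2" for s
    proof -
      have sub1: "cball z1 s \<subseteq> cball z0 R"
      proof
        fix z assume "z \<in> cball z1 s"
        then have "cmod (z - z1) \<le> d / 2" using s by (simp add: dist_norm norm_minus_commute)
        moreover have "cmod (z - z0) \<le> cmod (z - z1) + cmod (z1 - z0)" by (metis diff_add_cancel norm_triangle_ineq add_diff_eq)
        ultimately show "z \<in> cball z0 R" using pos by (simp add: d_def dist_norm norm_minus_commute)
      qed
      have N: "norm (F' z) \<le> 2 * N1" if z: "z \<in> cball z1 s" for z
      proof -
        have "cmod (z - z1) \<le> d / 2" using z s by (simp add: dist_norm norm_minus_commute)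
        moreover have "cmod (z - z0) \<le> cmod (z - z1) + cmod (z1 - z0)" by (metis diff_add_cancel norm_triangle_ineq add_diff_eq)
        ultimately have "d / 2 \<le> R - cmod (z - z0)" by (simp add: d_def)
        then have "d / 2 * norm (F' z) \<le> m z" unfolding m_def by (intro mult_right_mono) auto
        also have "\<dots> \<le> d * N1" using z1(2)[of z] sub1 z m1 by auto
        finally have "d * norm (F' z) \<le> d * (2 * N1)" by simp
        then show ?thesis using pos by simp
      qed
      have "norm (T z1 (F' z1 1) - 0) \<le> 2 * (2 * \<omega> / s + 2 * L * (2 * N1)\<^sup>2 * s)"
      proof (rule T_derivative_estimate[OF s(1) _ _ N, where p = "\<lambda>_. 0" and p' = "\<lambda>_. 0"])
        show "cball z1 s \<subseteq> ball 0 \<delta>" using sub sub1 by auto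
        show "L * norm (F z1) \<le> 1" using L1 by simp
        fix z assume "z \<in> sphere z1 s"
        then have "norm (F z) \<le> \<omega>" using \<omega> sub1 sphere_cball by blast
        then show "norm (T z1 (F z) - 0) \<le> 2 * \<omega>"
          using T_le[OF z1\<delta>, of "F z"] L1 by simp
      qed auto
      moreover have "N1 \<le> norm (T z1 (F' z1 1)) + 1/2 * N1"
      proof -
        have "L * norm (F z1) / 2 * N1 \<le> 1/2 * N1" using L1 pos by (intro mult_right_mono) auto
        then show ?thesis using derivative_bound_T[OF z1\<delta>] unfolding N1_def by linarith
      qed
      ultimately show ?thesis by (simp add: power_mult_distrib)
    qed
    \<comment> \<open>Either the quadratic term is at most \<open>N1 / 2\<close> already for the
      radius \<open>d / 2\<close>, or a smaller radius \<open>s\<close> makes it exactly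
      \<open>N1 / 2\<close>. In the second case the smallness 1/2048 bounds the other term by
      \<open>N1 / 4\<close>, which is contradictory.\<close>
    have "d * N1 \<le> 32 * \<omega>"
    proof (cases "L * N1 * d \<le> 1 / 32")
      case True
      have "N1 \<le> 8 * \<omega> / (d/2) + 32 * L * N1\<^sup>2 * (d/2)" using key[of "d/2"] pos by simp
      also have "32 * L * N1\<^sup>2 * (d/2) = 16 * (L * N1 * d) * N1" by (simp add: power2_eq_square)
      also have "\<dots> \<le> 16 * (1/32) * N1" using True pos by (intro mult_right_mono mult_left_mono) auto
      finally have "N1 / 2 \<le> 16 * \<omega> / d" by simp
      then show ?thesis using pos by (simp add: field_simps)
    next
      case False
      define s where "s = 1 / (64 * L * N1)"
      have LN: "L * N1 > 0" using False pos L by (metis less_eq_real_def mult_nonneg_nonneg mult_zero_left not_le zero_le_divide_1_iff zero_le_numeral)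
      have s: "0 < s" "s \<le> d / 2" using LN False pos by (simp_all add: s_def field_simps)
      have "N1 \<le> 8 * \<omega> / s + 32 * L * N1\<^sup>2 * s" by (rule key[OF s])
      also have "8 * \<omega> / s = 512 * (L * \<omega>) * N1" by (simp add: s_def)
      also have "32 * L * N1\<^sup>2 * s = N1 / 2" using LN by (cases "L = 0 \<or> N1 = 0") (auto simp: s_def power2_eq_square)
      also have "512 * (L * \<omega>) * N1 \<le> 512 * (1/2048) * N1" using small pos by (intro mult_right_mono mult_left_mono) auto
      finally have "N1 \<le> N1 * (3/4)" by simp
      then show ?thesis using pos by simp
    qed
    with le show ?thesis by simp
  qed
qed

text \<open>Around \<open>z\<close> the branch is compared with the model \<open>y ^ n *s v\<close>
  on a disc of radius \<open>cmod z / 4\<close>. The deviation of the values divided by this radius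
  gives the deviation of the derivative, and the gradient bound makes the quadratic error one of
  higher order in \<open>cmod z\<close>.\<close>

lemma derivative_asymptotics:
  assumes n: "n \<ge> 1" and asym: "\<And>\<eta>. \<eta> > 0 \<Longrightarrow> \<exists>\<delta>'>0. \<forall>z. cmod z < \<delta>' \<longrightarrow> norm (F z - z ^ n *s v) \<le> \<eta> * cmod z ^ n"
    and \<eta>: "\<eta> > 0"
  shows "\<exists>\<delta>'>0. \<delta>' \<le> \<delta> \<and> (\<forall>z h. cmod z < \<delta>' \<longrightarrow> z \<noteq> 0 \<longrightarrow>
     norm (F' z h - (of_nat n * z ^ (n - 1) * h) *s v) \<le> \<eta> * cmod z ^ (n - 1) * cmod h)"
proof -
  \<comment> \<open>\<open>B * \<rho> ^ n\<close> bounds the branch at distance at most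
    \<open>2 * \<rho>\<close> from 0. \<open>C\<close> collects the quadratic terms, 16452 = 64 + 4
    + 16384, and \<open>\<eta>1\<close> is chosen such that
    \<open>8 * 2 ^ n * \<eta>1 = \<eta> / 2\<close>.\<close>
  define B where "B = (norm v + 1) * 2 ^ n"
  have B: "B > 0" by (simp add: B_def add_nonneg_pos)
  define C where "C = 16452 * L * B\<^sup>2"
  have C: "C \<ge> 0" using L by (simp add: C_def)
  define \<eta>1 where "\<eta>1 = \<eta> / (16 * 2 ^ n)"
  have \<eta>1: "\<eta>1 > 0" using \<eta> by (simp add: \<eta>1_def)
  obtain \<delta>1 where \<delta>1: "\<delta>1 > 0" "\<And>z. cmod z < \<delta>1 \<Longrightarrow> norm (F z - z ^ n *s v) \<le> 1 * cmod z ^ n"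
    using asym[of 1] by auto
  obtain \<delta>2 where \<delta>2: "\<delta>2 > 0" "\<And>z. cmod z < \<delta>2 \<Longrightarrow> norm (F z - z ^ n *s v) \<le> \<eta>1 * cmod z ^ n"
    using asym[OF \<eta>1] by auto
  define \<delta>' where "\<delta>' = Min {\<delta> / 2, \<delta>1 / 2, \<delta>2 / 2, 1, 1 / (2048 * (L * B + 1)), \<eta> / (2 * (C + 1))}"
  have LB: "L * B \<ge> 0" using L B by simp
  have d': "\<delta>' > 0"
    using \<delta> \<delta>1 \<delta>2 \<eta> LB C by (simp add: \<delta>'_def add_nonneg_pos)
  have "\<delta>' \<le> \<delta> / 2" "\<delta>' \<le> \<delta>1 / 2" "\<delta>' \<le> \<delta>2 / 2" "\<delta>' \<le> 1" "\<delta>' \<le> 1 / (2048 * (L * B + 1))" "\<delta>' \<le> \<eta> / (2 * (C + 1))"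
    unfolding \<delta>'_def by (intro Min_le; simp)+
  note dle = this
  show ?thesis
  proof (intro exI[of _ \<delta>'] conjI allI impI d')
    show "\<delta>' \<le> \<delta>" using dle \<delta> by simp
    fix z h assume z: "cmod z < \<delta>'" "z \<noteq> 0"
    define \<rho> where "\<rho> = cmod z"
    have \<rho>: "0 < \<rho>" "\<rho> < \<delta>'" "\<rho> \<le> 1" using z dle by (auto simp: \<rho>_def)
    have \<rho>n: "\<rho> ^ n \<le> \<rho>" using power_decreasing[of 1 n \<rho>] \<rho> n by simp
    have LBr: "L * (B * \<rho> ^ n) \<le> 1 / 2048"
    proof -
      have "L * (B * \<rho> ^ n) \<le> L * B * \<rho>" using LB \<rho>n by (simp add: mult.assoc[symmetric] mult_left_mono)
      also have "\<dots> \<le> (L * B + 1) * (1 / (2048 * (L * B + 1)))"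
        using \<rho> dle(5) LB by (intro mult_mono) auto
      also have "\<dots> = 1 / 2048" using LB by (simp add: field_simps)
      finally show ?thesis .
    qed
    have near: "cmod y \<le> 2 * \<rho>" if "cmod (y - z) \<le> \<rho> / 2" for y
      using norm_triangle_sub[of y z] that \<rho>(1) unfolding \<rho>_def by linarith
    have in\<delta>: "cmod y < \<delta>" "cmod y < \<delta>1" "cmod y < \<delta>2" if "cmod (y - z) \<le> \<rho> / 2" for y
      using near[OF that] dle \<rho> by auto
    have FB: "norm (F y) \<le> B * \<rho> ^ n" if "cmod (y - z) \<le> \<rho> / 2" for y
    proof -
      have "norm (F y) \<le> norm (y ^ n *s v) + norm (F y - y ^ n *s v)" by (rule norm_triangle_sub)
      also have "\<dots> \<le> (norm v + 1) * cmod y ^ n" using \<delta>1(2)[OF in\<delta>(2)[OF that]] by (simp add: norm_power algebra_simps)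
      also have "\<dots> \<le> (norm v + 1) * (2 * \<rho>) ^ n" using near[OF that] by (intro mult_left_mono power_mono) auto
      finally show ?thesis by (simp add: B_def power_mult_distrib mult.assoc)
    qed
    \<comment> \<open>The factor 128 is the constant 32 of \<open>gradient_bound\<close> divided by
      the relative radius 1/4.\<close>
    define N where "N = 128 * B * \<rho> ^ (n - 1)"
    have pn: "\<rho> ^ n = \<rho> * \<rho> ^ (n - 1)" using n by (cases n) auto
    have Fd: "norm (F' y) \<le> N" if y: "cmod (y - z) \<le> \<rho> / 4" for y
    proof -
      have t: "cmod (x - z) \<le> \<rho> / 2" if "x \<in> cball y (\<rho> / 4)" for x
      proof -
        have "cmod (x - z) \<le> cmod (x - y) + cmod (y - z)" by (metis diff_add_cancel norm_triangle_ineq add_diff_eq)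
        then show ?thesis using that y by (simp add: dist_norm norm_minus_commute)
      qed
      have "norm (F' y) * (\<rho> / 4) \<le> 32 * (B * \<rho> ^ n)"
      proof (rule gradient_bound)
        show "cball y (\<rho> / 4) \<subseteq> ball 0 \<delta>" using t in\<delta>(1) by auto
        show "norm (F x) \<le> B * \<rho> ^ n" if "x \<in> cball y (\<rho> / 4)" for x using FB t that by blast
      qed (use \<rho> LBr in auto)
      then have "norm (F' y) * \<rho> \<le> N * \<rho>" by (simp add: N_def pn ac_simps)
      then show ?thesis using \<rho> by simp
    qed
    have z\<delta>: "cmod z < \<delta>" using in\<delta>(1)[of z] \<rho> by simp
    have Fz: "L * norm (F z) \<le> L * (B * \<rho> ^ n)" using L FB[of z] \<rho> by (intro mult_left_mono) auto
    define \<omega> where "\<omega> = (L * B\<^sup>2 / 2 * \<rho> ^ n + \<eta>1 * 2 ^ n) * \<rho> ^ n"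
    have E: "norm (T z (F' z 1) - (of_nat n * z ^ (n - 1)) *s v) \<le> 2 * (\<omega> / (\<rho> / 4) + 2 * L * N\<^sup>2 * (\<rho> / 4))"
    proof (rule T_derivative_estimate[where p = "\<lambda>y. y ^ n *s v" and p' = "\<lambda>y. (of_nat n * y ^ (n - 1)) *s v"])
      show "0 < \<rho> / 4" using \<rho> by simp
      show "cball z (\<rho> / 4) \<subseteq> ball 0 \<delta>" using in\<delta>(1) \<rho> by (auto simp: dist_norm norm_minus_commute)
      show "L * norm (F z) \<le> 1" using Fz LBr by simp
      show "norm (F' y) \<le> N" if "y \<in> cball z (\<rho> / 4)" for y
        using that by (intro Fd) (simp add: dist_norm norm_minus_commute)
      show "((\<lambda>y. y ^ n *s v) has_derivative (\<lambda>h. h *s ((of_nat n * y ^ (n - 1)) *s v))) (at y)" for y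
      proof -
        have "((\<lambda>y. y ^ n) has_derivative (\<lambda>h. h * (of_nat n * y ^ (n - 1)))) (at y)"
          by (auto intro!: derivative_eq_intros simp: ac_simps)
        from bounded_linear.has_derivative[OF bounded_bilinear.bounded_linear_left[OF bounded_bilinear_smult_complex2] this, of v]
        show ?thesis by simp
      qed
      show "continuous_on (cball z (\<rho> / 4)) (\<lambda>y. (of_nat n * y ^ (n - 1)) *s v)"
        by (intro bounded_linear.continuous_on[OF bounded_bilinear.bounded_linear_left[OF bounded_bilinear_smult_complex2]] continuous_intros)
      fix y assume "y \<in> sphere z (\<rho> / 4)"
      then have y: "cmod (y - z) \<le> \<rho> / 2" using \<rho> by (simp add: dist_norm norm_minus_commute)
      have "norm (T z (F y) - y ^ n *s v) \<le> norm (F y - T z (F y)) + norm (F y - y ^ n *s v)"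
        using norm_triangle_ineq4[of "F y - y ^ n *s v" "F y - T z (F y)"] by (simp add: add.commute)
      also have "norm (F y - T z (F y)) \<le> L * (B * \<rho> ^ n) / 2 * (B * \<rho> ^ n)"
        using Fz FB[OF y] L B \<rho> by (intro order_trans[OF T_near_id[OF z\<delta>]] mult_mono) auto
      also have "norm (F y - y ^ n *s v) \<le> \<eta>1 * (2 * \<rho>) ^ n"
        using near[OF y] \<eta>1 by (intro order_trans[OF \<delta>2(2)[OF in\<delta>(3)[OF y]]] mult_left_mono power_mono) auto
      finally show "norm (T z (F y) - y ^ n *s v) \<le> \<omega>"
        by (simp add: \<omega>_def power2_eq_square power_mult_distrib algebra_simps)
    qed
    have "norm (F' z h - (of_nat n * z ^ (n - 1) * h) *s v) \<le>
       norm (F' z h - T z (F' z h)) + norm (T z (F' z h) - (of_nat n * z ^ (n - 1) * h) *s v)"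
      using norm_triangle_ineq[of "F' z h - T z (F' z h)" "T z (F' z h) - (of_nat n * z ^ (n - 1) * h) *s v"] by simp
    also have "T z (F' z h) - (of_nat n * z ^ (n - 1) * h) *s v = h *s (T z (F' z 1) - (of_nat n * z ^ (n - 1)) *s v)"
      unfolding T_linear[OF z\<delta>, of h] by (simp add: vec_eq_iff algebra_simps)
    also have "norm \<dots> \<le> cmod h * (2 * (\<omega> / (\<rho> / 4) + 2 * L * N\<^sup>2 * (\<rho> / 4)))"
      unfolding norm_smult_complex2 using E by (rule mult_left_mono) simp
    also have "norm (F' z h - T z (F' z h)) \<le> L * (B * \<rho> ^ n) / 2 * (N * cmod h)"
      using Fz L B \<rho> Fd[of z] by (intro order_trans[OF T_near_id[OF z\<delta>]] mult_mono order_trans[OF norm_blinfun] mult_right_mono) auto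
    also have "L * (B * \<rho> ^ n) / 2 * (N * cmod h) + cmod h * (2 * (\<omega> / (\<rho> / 4) + 2 * L * N\<^sup>2 * (\<rho> / 4)))
       = (C * \<rho> ^ n + 8 * 2 ^ n * \<eta>1) * \<rho> ^ (n - 1) * cmod h"
    proof -
      have w: "\<omega> / (\<rho> / 4) = 4 * (L * B\<^sup>2 / 2 * \<rho> ^ n + \<eta>1 * 2 ^ n) * \<rho> ^ (n - 1)"
        using \<rho> by (simp add: \<omega>_def) (simp add: pn)
      have N2: "2 * L * N\<^sup>2 * (\<rho> / 4) = 8192 * L * B\<^sup>2 * \<rho> ^ (n - 1) * \<rho> ^ n"
        by (simp add: N_def power_mult_distrib) (simp add: pn power2_eq_square)
      show ?thesis
        unfolding w N2 by (simp add: N_def C_def power2_eq_square algebra_simps)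
    qed
    also have "\<dots> \<le> \<eta> * \<rho> ^ (n - 1) * cmod h"
    proof -
      have "C * \<rho> ^ n \<le> (C + 1) * (\<eta> / (2 * (C + 1)))"
        using C \<rho>n \<rho> dle(6) by (intro mult_mono) auto
      also have "\<dots> = \<eta> / 2" using C by (simp add: field_simps)
      finally have "C * \<rho> ^ n + 8 * 2 ^ n * \<eta>1 \<le> \<eta>" by (simp add: \<eta>1_def)
      then show ?thesis using \<rho> by (intro mult_right_mono) auto
    qed
    finally show "norm (F' z h - (of_nat n * z ^ (n - 1) * h) *s v) \<le> \<eta> * cmod z ^ (n - 1) * cmod h"
      by (simp add: \<rho>_def)
  qed
qed

end

section \<open>Roots of unity\<close>

text \<open>The polynomial \<open>x ^ n - 1\<close> and the product of the linear factors are monic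
  of degree \<open>n\<close> and agree at \<open>n\<close> points, so they are equal; homogenizing
  with \<open>w\<close> gives two variables.\<close>

lemma prod_roots_of_unity:
  fixes z w :: complex
  assumes n: "n \<ge> 1"
  shows "(\<Prod>\<zeta>\<in>{\<zeta>. \<zeta> ^ n = 1}. z - \<zeta> * w) = z ^ n - w ^ n"
proof -
  let ?R = "{\<zeta>::complex. \<zeta> ^ n = 1}"
  have fin: "finite ?R" by (rule finite_roots_unity[OF n])
  have card: "card ?R = n" using n by (intro card_roots_unity_eq) simp
  define p where "p = Polynomial.monom (1::complex) n - 1"
  define q where "q = (\<Prod>\<zeta>\<in>?R. [:- \<zeta>, 1:])"
  have dq: "Polynomial.degree q = n" "Polynomial.coeff q n = 1"
  proof -
    show d: "Polynomial.degree q = n" unfolding q_def by (subst degree_prod_eq_sum_degree) (auto simp: card)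
    have "lead_coeff q = 1" unfolding q_def by (simp add: lead_coeff_prod)
    then show "Polynomial.coeff q n = 1" by (simp add: d)
  qed
  have dp: "Polynomial.degree p \<le> n" "Polynomial.coeff p n = 1"
    using n by (auto simp: p_def degree_diff_le degree_monom_le coeff_eq_0)
  have "p - q = 0"
  proof (rule ccontr)
    assume ne: "p - q \<noteq> 0"
    have "Polynomial.degree (p - q) \<le> n" using dp dq by (intro degree_diff_le) auto
    moreover have "Polynomial.coeff (p - q) n = 0" using dp dq by simp
    ultimately have "Polynomial.degree (p - q) < n" using ne by (metis leading_coeff_0_iff le_neq_implies_less)
    moreover have "?R \<subseteq> {x. poly (p - q) x = 0}"
      using fin by (auto simp: p_def q_def poly_monom poly_prod prod_zero_iff)
    then have "n \<le> card {x. poly (p - q) x = 0}"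
      using card_mono[OF poly_roots_finite[OF ne], of ?R] unfolding card by blast
    moreover have "card {x. poly (p - q) x = 0} \<le> Polynomial.degree (p - q)" by (rule card_poly_roots_bound[OF ne])
    ultimately show False by simp
  qed
  then have pq: "poly p x = poly q x" for x by simp
  show ?thesis
  proof (cases "w = 0")
    case True
    then show ?thesis using n by (simp add: card)
  next
    case False
    have "z ^ n - w ^ n = w ^ n * poly p (z / w)"
      using False by (simp add: p_def poly_monom power_divide field_simps)
    also have "\<dots> = (\<Prod>\<zeta>\<in>?R. w) * (\<Prod>\<zeta>\<in>?R. z / w - \<zeta>)"
      by (simp add: pq q_def poly_prod card)
    also have "\<dots> = (\<Prod>\<zeta>\<in>?R. w * (z / w - \<zeta>))" by (simp only: prod.distrib)
    also have "\<dots> = (\<Prod>\<zeta>\<in>?R. z - \<zeta> * w)"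
      using False by (intro prod.cong) (auto simp: field_simps)
    finally show ?thesis by simp
  qed
qed

lemma norm_root_of_unity: "n \<ge> 1 \<Longrightarrow> \<zeta> ^ n = 1 \<Longrightarrow> cmod \<zeta> = 1"
  using power_eq_imp_eq_base[of "cmod \<zeta>" n 1] norm_power[of \<zeta> n] by simp

text \<open>Distinct roots of unity are at least \<sigma> apart. So all factors
  \<open>z - \<zeta>' * w\<close> except the smallest one are at least a fixed fraction of the
  larger modulus.\<close>

lemma power_diff_lower_bound:
  assumes n: "n \<ge> 1"
  shows "\<exists>\<kappa>>0. \<forall>(z::complex) w \<zeta>. \<zeta> ^ n = 1 \<and> (\<forall>\<zeta>'. \<zeta>' ^ n = 1 \<longrightarrow> cmod (z - \<zeta> * w) \<le> cmod (z - \<zeta>' * w)) \<longrightarrow>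
     \<kappa> * max (cmod z) (cmod w) ^ (n - 1) * cmod (z - \<zeta> * w) \<le> cmod (z ^ n - w ^ n)"
proof -
  let ?R = "{\<zeta>::complex. \<zeta> ^ n = 1}"
  have fin: "finite ?R" by (rule finite_roots_unity[OF n])
  have card: "card ?R = n" using n by (intro card_roots_unity_eq) simp
  \<comment> \<open>The element 1 keeps the set non-empty when there is a single root of
    unity.\<close>
  define D where "D = insert 1 ((\<lambda>(a, b). cmod (a - b)) ` {(a, b). a \<in> ?R \<and> b \<in> ?R \<and> a \<noteq> b})"
  have "finite {(a, b). a \<in> ?R \<and> b \<in> ?R \<and> a \<noteq> b}"
    by (rule finite_subset[of _ "?R \<times> ?R"]) (use fin in auto)
  then have finD: "finite D" by (simp add: D_def)
  define \<sigma> where "\<sigma> = Min D"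
  have \<sigma>: "\<sigma> > 0" unfolding \<sigma>_def using finD by (subst Min_gr_iff) (auto simp: D_def)
  have \<sigma>_le: "\<sigma> \<le> cmod (a - b)" if "a \<in> ?R" "b \<in> ?R" "a \<noteq> b" for a b
    unfolding \<sigma>_def using finD that by (intro Min_le) (auto simp: D_def)
  \<comment> \<open>The solution of \<open>\<sigma> * (1 - k) = 2 * k\<close>. If the smallest
    factor is below \<open>k * m\<close>, then \<open>w\<close> has modulus at least
    \<open>(1 - k) * m\<close>, two factors differ by at least \<open>2 * k * m\<close>, and
    \<open>k * m\<close> is left for the other one.\<close>
  define k where "k = \<sigma> / (\<sigma> + 2)"
  have k: "k > 0" "\<sigma> * (1 - k) = 2 * k" "k < 1" using \<sigma> by (auto simp: k_def field_simps)
  show ?thesis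
  proof (intro exI[of _ "k ^ (n - 1)"] conjI allI impI)
    show "k ^ (n - 1) > 0" using k by simp
    fix z w \<zeta> :: complex
    assume A: "\<zeta> ^ n = 1 \<and> (\<forall>\<zeta>'. \<zeta>' ^ n = 1 \<longrightarrow> cmod (z - \<zeta> * w) \<le> cmod (z - \<zeta>' * w))"
    define m where "m = max (cmod z) (cmod w)"
    have m0: "m \<ge> 0" by (simp add: m_def le_max_iff_disj)
    have far: "k * m \<le> cmod (z - \<zeta>' * w)" if \<zeta>': "\<zeta>' \<in> ?R - {\<zeta>}" for \<zeta>'
    proof (cases "k * m \<le> cmod (z - \<zeta> * w)")
      case True
      then show ?thesis using A \<zeta>' by force
    next
      case False
      have n_ge_1: "cmod \<zeta> = 1" using A norm_root_of_unity[OF n] by simp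
      have "cmod z \<le> cmod w + cmod (z - \<zeta> * w)"
        using norm_triangle_sub[of z "\<zeta> * w"] n_ge_1 by (simp add: norm_mult)
      then have wm: "(1 - k) * m \<le> cmod w"
        using False k m0 by (auto simp: m_def max_def algebra_simps split: if_splits)
      have "2 * k * m = \<sigma> * ((1 - k) * m)" using k by simp
      also have "\<dots> \<le> cmod (\<zeta> - \<zeta>') * cmod w"
        using \<sigma>_le[of \<zeta> \<zeta>'] A \<zeta>' wm \<sigma> k m0 by (intro mult_mono) auto
      also have "\<dots> = cmod ((z - \<zeta>' * w) - (z - \<zeta> * w))" by (simp add: norm_mult[symmetric] algebra_simps)
      also have "\<dots> \<le> cmod (z - \<zeta>' * w) + cmod (z - \<zeta> * w)" by (rule norm_triangle_ineq4)
      finally show ?thesis using False by simp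
    qed
    have "k ^ (n - 1) * m ^ (n - 1) = (\<Prod>\<zeta>'\<in>?R - {\<zeta>}. k * m)"
      using A fin card by (simp add: power_mult_distrib)
    also have "\<dots> \<le> (\<Prod>\<zeta>'\<in>?R - {\<zeta>}. cmod (z - \<zeta>' * w))"
      using far k m0 by (intro prod_mono) auto
    finally have "k ^ (n - 1) * m ^ (n - 1) * cmod (z - \<zeta> * w) \<le> (\<Prod>\<zeta>'\<in>?R - {\<zeta>}. cmod (z - \<zeta>' * w)) * cmod (z - \<zeta> * w)"
      by (rule mult_right_mono) simp
    also have "\<dots> = (\<Prod>\<zeta>'\<in>?R. cmod (z - \<zeta>' * w))"
      using A fin by (subst (2) prod.remove[of _ \<zeta>]) (auto simp: mult.commute)
    also have "\<dots> = cmod (z ^ n - w ^ n)"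
      using prod_roots_of_unity[OF n, of z w] by (simp add: prod_norm)
    finally show "k ^ (n - 1) * max (cmod z) (cmod w) ^ (n - 1) * cmod (z - \<zeta> * w) \<le> cmod (z ^ n - w ^ n)"
      by (simp add: m_def)
  qed
qed

lemma closest_root_exists:
  assumes n: "n \<ge> 1"
  obtains \<zeta> :: complex where "\<zeta> ^ n = 1" "\<And>\<zeta>'. \<zeta>' ^ n = 1 \<Longrightarrow> cmod (z - \<zeta> * w) \<le> cmod (z - \<zeta>' * w)"
proof -
  let ?R = "{\<zeta>::complex. \<zeta> ^ n = 1}"
  have "finite ?R" "?R \<noteq> {}" using finite_roots_unity[OF n] by (auto intro: exI[of _ 1])
  note fin = this
  define \<zeta> where "\<zeta> = arg_min_on (\<lambda>\<zeta>. cmod (z - \<zeta> * w)) ?R"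
  have "\<zeta> \<in> ?R" unfolding \<zeta>_def by (rule arg_min_if_finite(1)[OF fin])
  moreover have "cmod (z - \<zeta> * w) \<le> cmod (z - \<zeta>' * w)" if "\<zeta>' \<in> ?R" for \<zeta>'
    unfolding \<zeta>_def by (rule arg_min_least[OF fin that])
  ultimately show thesis using that by blast
qed

lemma root_of_unity_dvd: "a dvd b \<Longrightarrow> \<zeta> ^ a = (1 :: complex) \<Longrightarrow> \<zeta> ^ b = 1"
  by (auto simp: power_mult)

lemma root_of_unity_gcd:
  fixes \<zeta> :: complex
  assumes "\<zeta> ^ a = 1" "\<zeta> ^ b = 1"
  shows "\<zeta> ^ gcd a b = 1"
proof (cases "a = 0")
  case False
  then obtain x y where "a * x = b * y + gcd a b" using bezout_nat by blast
  then have "\<zeta> ^ (a * x) = \<zeta> ^ (b * y) * \<zeta> ^ gcd a b" by (simp add: power_add)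
  then show ?thesis using assms by (simp add: power_mult)
qed (use assms in simp)

section \<open>Self-intersections of a cusp\<close>

text \<open>As the solution \<open>g\<close> is continuous, the linearization of \<open>N\<close> at
  the point first bounds the increment of \<open>g\<close> by \<open>M\<close> times that of the
  argument; with this bound the error becomes small compared with the argument.\<close>

lemma implicit_function_derivative:
  fixes N :: "real \<times> real \<Rightarrow> real"
  assumes N: "(N has_derivative (\<lambda>h. a * fst h + b * snd h)) (at (t, g t))" and b: "b \<noteq> 0"
    and g: "isCont g t" and const: "\<And>x. N (x, g x) = c"
  shows "(g has_real_derivative - a / b) (at t)"
  unfolding has_field_derivative_def has_derivative_at_alt
proof (intro conjI allI impI)
  show "bounded_linear ((*) (- a / b))" by (rule bounded_linear_mult_right)
  fix e :: real assume e: "e > 0"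
  define M where "M = 2 * (\<bar>a\<bar> + \<bar>b\<bar>) / \<bar>b\<bar>"
  have M: "M \<ge> 0" by (simp add: M_def)
  \<comment> \<open>Half of the modulus of \<open>b\<close> serves the first bound, the quotient by
    \<open>1 + M\<close> the second.\<close>
  define e' where "e' = min (\<bar>b\<bar> / 2) (e * \<bar>b\<bar> / (1 + M))"
  have e': "e' > 0" using e b M by (simp add: e'_def)
  have e'b: "e' \<le> \<bar>b\<bar> / 2" unfolding e'_def by (rule min.cobounded1)
  have e'': "e' * (1 + M) \<le> e * \<bar>b\<bar>"
    using M mult_right_mono[of e' "e * \<bar>b\<bar> / (1 + M)" "1 + M"] by (simp add: e'_def)
  obtain d where d: "d > 0" "\<And>y. norm (y - (t, g t)) < d \<Longrightarrow>
      norm (N y - N (t, g t) - (a * fst (y - (t, g t)) + b * snd (y - (t, g t)))) \<le> e' * norm (y - (t, g t))"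
    using N e' unfolding has_derivative_at_alt by meson
  obtain d2 where d2: "d2 > 0" "\<And>x. \<bar>x - t\<bar> < d2 \<Longrightarrow> \<bar>g x - g t\<bar> < d / 2"
    using g d(1) unfolding continuous_at_eps_delta by (metis dist_real_def half_gt_zero)
  show "\<exists>d>0. \<forall>y. norm (y - t) < d \<longrightarrow> norm (g y - g t - - a / b * (y - t)) \<le> e * norm (y - t)"
  proof (intro exI[of _ "min d2 (d / 2)"] conjI allI impI)
    show "min d2 (d / 2) > 0" using d d2 by simp
    fix y assume y: "norm (y - t) < min d2 (d / 2)"
    define u v where "u = y - t" and "v = g y - g t"
    have norm_v_pos: "norm ((y, g y) - (t, g t)) \<le> \<bar>u\<bar> + \<bar>v\<bar>"
      by (simp add: u_def v_def norm_Pair real_sqrt_sum_squares_triangle_ineq sqrt_sum_squares_le_sum_abs)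
    have "\<bar>v\<bar> < d / 2" using d2(2)[of y] y by (simp add: v_def)
    then have "norm ((y, g y) - (t, g t)) < d" using norm_v_pos y by (simp add: u_def)
    from d(2)[OF this] have "\<bar>a * u + b * v\<bar> \<le> e' * norm ((y, g y) - (t, g t))"
      by (simp add: const u_def v_def)
    also have "\<dots> \<le> e' * (\<bar>u\<bar> + \<bar>v\<bar>)" using norm_v_pos e' by (intro mult_left_mono) auto
    finally have 1: "\<bar>a * u + b * v\<bar> \<le> e' * (\<bar>u\<bar> + \<bar>v\<bar>)" .
    have "\<bar>b\<bar> * \<bar>v\<bar> \<le> \<bar>a\<bar> * \<bar>u\<bar> + \<bar>a * u + b * v\<bar>"
      using abs_triangle_ineq4[of "a * u + b * v" "a * u"] by (simp add: abs_mult)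
    also have "\<dots> \<le> \<bar>a\<bar> * \<bar>u\<bar> + \<bar>b\<bar> / 2 * (\<bar>u\<bar> + \<bar>v\<bar>)"
      using 1 mult_right_mono[OF e'b, of "\<bar>u\<bar> + \<bar>v\<bar>"] by (intro add_left_mono) simp
    finally have "\<bar>b\<bar> * \<bar>v\<bar> \<le> \<bar>a\<bar> * \<bar>u\<bar> + \<bar>b\<bar> * \<bar>u\<bar> / 2 + \<bar>b\<bar> * \<bar>v\<bar> / 2"
      by (simp add: distrib_left add_divide_distrib)
    moreover have "0 \<le> \<bar>b\<bar> * \<bar>u\<bar>" by simp
    ultimately have "\<bar>b\<bar> * \<bar>v\<bar> \<le> 2 * (\<bar>a\<bar> * \<bar>u\<bar>) + 2 * (\<bar>b\<bar> * \<bar>u\<bar>)" by linarith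
    then have "\<bar>b\<bar> * \<bar>v\<bar> \<le> 2 * (\<bar>a\<bar> + \<bar>b\<bar>) * \<bar>u\<bar>" by (simp add: algebra_simps)
    then have vM: "\<bar>v\<bar> \<le> M * \<bar>u\<bar>" using b by (simp add: M_def field_simps)
    have "\<bar>b\<bar> * \<bar>v + a / b * u\<bar> = \<bar>a * u + b * v\<bar>"
    proof -
      have "b * (v + a / b * u) = a * u + b * v" using b by (simp add: distrib_left)
      then show ?thesis by (metis abs_mult)
    qed
    also have "\<dots> \<le> e' * ((1 + M) * \<bar>u\<bar>)"
      using vM e' by (intro order_trans[OF 1] mult_left_mono) (auto simp: algebra_simps)
    also have "\<dots> \<le> (e * \<bar>b\<bar>) * \<bar>u\<bar>"
      using mult_right_mono[OF e'', of "\<bar>u\<bar>"] by (simp add: mult.assoc)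
    finally have "\<bar>v + a / b * u\<bar> \<le> e * \<bar>u\<bar>" using b by (simp add: mult.assoc mult.left_commute)
    then show "norm (g y - g t - - a / b * (y - t)) \<le> e * norm (y - t)"
      by (simp add: u_def v_def)
  qed
qed

section \<open>Coordinates along \<open>v\<close> and orthogonal to it\<close>

lemma herm_simps: "herm v (x - y) = herm v x - herm v y" "herm v (x + y) = herm v x + herm v y"
  "herm v (c *s x) = c * herm v x" "herm v (a *\<^sub>R x) = of_real a * herm v x" "herm v 0 = 0"
  unfolding herm_def by (simp_all add: algebra_simps scaleR_conv_of_real[of a "_ :: complex"])

lemma cdet_simps: "cdet v (x - y) = cdet v x - cdet v y" "cdet v (x + y) = cdet v x + cdet v y"
  "cdet v (c *s x) = c * cdet v x" "cdet v (a *\<^sub>R x) = of_real a * cdet v x" "cdet v 0 = 0" "cdet v v = 0"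
  unfolding cdet_def by (simp_all add: algebra_simps scaleR_conv_of_real[of a "_ :: complex"])

lemma norm_herm_le: "cmod (herm v x) \<le> norm v * norm x"
proof (rule power2_le_imp_le)
  have "0 \<le> (cmod (cdet v x))\<^sup>2" by simp
  then show "(cmod (herm v x))\<^sup>2 \<le> (norm v * norm x)\<^sup>2"
    using norm_herm_cdet[of v x] unfolding power_mult_distrib by linarith
qed simp

lemma norm_cdet_le: "cmod (cdet v x) \<le> norm v * norm x"
proof (rule power2_le_imp_le)
  have "0 \<le> (cmod (herm v x))\<^sup>2" by simp
  then show "(cmod (cdet v x))\<^sup>2 \<le> (norm v * norm x)\<^sup>2"
    using norm_herm_cdet[of v x] unfolding power_mult_distrib by linarith
qed simp

lemma herm_self: "herm v v = of_real ((norm v)\<^sup>2)"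
  unfolding herm_def norm_complex2 of_real_add complex_norm_square by simp

lemma Re_herm: "Re (herm w x) = x \<bullet> w"
  by (simp add: herm_def inner_vec_def sum_2 inner_complex_def algebra_simps)

text \<open>The Hermitian product and the determinant of \<open>x\<close> and \<open>s\<close>,
  expanded in the orthogonal frame determined by \<open>v\<close>.\<close>

lemma herm_cdet_identities:
  "of_real ((norm v)\<^sup>2) * herm x s = herm v s * cnj (herm v x) + cdet v s * cnj (cdet v x)"
  "of_real ((norm v)\<^sup>2) * cdet x s = herm v x * cdet v s - cdet v x * herm v s"
  unfolding norm_complex2 of_real_add complex_norm_square
  by (simp_all add: herm_def cdet_def algebra_simps)

text \<open>\<open>F\<close> is a branch with leading term \<open>z ^ n *s v\<close>, and \<open>z ^ q \<zeta> *s u \<zeta>\<close> is the leading term of its difference from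
  the branch rotated by the root of unity \<open>\<zeta>\<close>. The errors are bounded by \<open>\<eta>\<close>, which is small compared with \<open>v\<close>, all
  \<open>u \<zeta>\<close>, and the constant \<open>\<kappa>\<close> that separates the \<open>n\<close> solutions of \<open>z ^ n = w ^ n\<close>.\<close>

locale cusp = J_curve +
  fixes v :: "complex^2" and n :: nat and u :: "complex \<Rightarrow> complex^2" and q :: "complex \<Rightarrow> nat" and \<eta> \<kappa> e :: real
  assumes v: "v \<noteq> 0" and n: "n \<ge> 2" and \<delta>1: "\<delta> \<le> 1" and \<eta>: "\<eta> > 0" "\<eta> \<le> norm v / 16" and \<kappa>: "\<kappa> > 0" "4 * \<eta> \<le> norm v * \<kappa>"
    and e: "e > 0" "L * e \<le> 1 / 8" and Fe: "\<And>z. cmod z < \<delta> \<Longrightarrow> norm (F z) < e"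
    and Je: "\<And>y. norm y < e \<Longrightarrow> norm (J y - smult_blinfun \<i>) \<le> L * norm y"
    and Je2: "\<And>y \<xi>. norm y < e \<Longrightarrow> J y (J y \<xi>) = - \<xi>"
    and contJ: "continuous_on (ball 0 e) J"
    and asym: "\<And>z. cmod z < \<delta> \<Longrightarrow> norm (F z - z ^ n *s v) \<le> \<eta> * cmod z ^ n"
    and asym': "\<And>z h. cmod z < \<delta> \<Longrightarrow> norm (F' z h - (of_nat n * z ^ (n - 1) * h) *s v) \<le> \<eta> * cmod z ^ (n - 1) * cmod h"
    and root: "\<And>\<zeta> z. \<zeta> ^ n = 1 \<Longrightarrow> \<zeta> \<noteq> 1 \<Longrightarrow> cmod z < \<delta> \<Longrightarrow> norm (F (\<zeta> * z) - F z - z ^ q \<zeta> *s u \<zeta>) \<le> \<eta> * cmod z ^ q \<zeta>"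
    and u: "\<And>\<zeta>. \<zeta> ^ n = 1 \<Longrightarrow> \<zeta> \<noteq> 1 \<Longrightarrow> herm v (u \<zeta>) = 0 \<and> 4 * norm v * \<eta> \<le> cmod (cdet v (u \<zeta>))"
    and q: "\<And>\<zeta>. \<zeta> ^ n = 1 \<Longrightarrow> \<zeta> \<noteq> 1 \<Longrightarrow> q \<zeta> \<ge> n"
    and diff_bound: "\<And>(z::complex) w \<zeta>. \<zeta> ^ n = 1 \<Longrightarrow> (\<And>\<zeta>'. \<zeta>' ^ n = 1 \<Longrightarrow> cmod (z - \<zeta> * w) \<le> cmod (z - \<zeta>' * w)) \<Longrightarrow>
         \<kappa> * max (cmod z) (cmod w) ^ (n - 1) * cmod (z - \<zeta> * w) \<le> cmod (z ^ n - w ^ n)"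
begin

lemma norm_v_pos: "norm v > 0" using v by simp

lemma n_ge_1: "n \<ge> 1" using n by simp

text \<open>The derivative estimate is integrated along a segment. The factor
  \<open>cmod (x - y)\<close>, which the estimate of the values cannot provide, controls pairs of
  nearby points.\<close>

lemma mean_value:
  assumes "cmod x \<le> m" "cmod y \<le> m" "m < \<delta>"
  shows "norm (F x - F y - (x ^ n - y ^ n) *s v) \<le> \<eta> * m ^ (n - 1) * cmod (x - y)"
proof -
  define G where "G z = F z - z ^ n *s v" for z :: complex
  have "norm (G x - G y) \<le> \<eta> * m ^ (n - 1) * norm (x - y)"
  proof (rule differentiable_bound[where S = "cball 0 m" and f' = "\<lambda>z h. F' z h - (of_nat n * z ^ (n - 1) * h) *s v"])
    fix z :: complex assume "z \<in> cball 0 m"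
    then have z: "cmod z \<le> m" "cmod z < \<delta>" using assms by auto
    have "((\<lambda>y. y ^ n) has_derivative (\<lambda>h. of_nat n * z ^ (n - 1) * h)) (at z)"
      by (auto intro!: derivative_eq_intros simp: ac_simps)
    from bounded_linear.has_derivative[OF bounded_bilinear.bounded_linear_left[OF bounded_bilinear_smult_complex2] this, of v]
    have "(G has_derivative (\<lambda>h. F' z h - (of_nat n * z ^ (n - 1) * h) *s v)) (at z)"
      unfolding G_def by (intro has_derivative_diff der z)
    then show "(G has_derivative (\<lambda>h. F' z h - (of_nat n * z ^ (n - 1) * h) *s v)) (at z within cball 0 m)"
      by (rule has_derivative_at_withinI)
    show "onorm (\<lambda>h. F' z h - (of_nat n * z ^ (n - 1) * h) *s v) \<le> \<eta> * m ^ (n - 1)"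
    proof (rule onorm_le)
      fix h
      have "norm (F' z h - (of_nat n * z ^ (n - 1) * h) *s v) \<le> \<eta> * cmod z ^ (n - 1) * cmod h"
        by (rule asym'[OF z(2)])
      also have "\<dots> \<le> \<eta> * m ^ (n - 1) * cmod h"
        using \<eta> z by (intro mult_right_mono mult_left_mono power_mono) auto
      finally show "norm (F' z h - (of_nat n * z ^ (n - 1) * h) *s v) \<le> \<eta> * m ^ (n - 1) * norm h" .
    qed
  qed (use assms in auto)
  moreover have "G x - G y = F x - F y - (x ^ n - y ^ n) *s v"
    by (simp add: G_def vec_eq_iff algebra_simps)
  ultimately show ?thesis by simp
qed

text \<open>
  \<open>F z - F w\<close> is compared with \<open>F z - F (\<zeta> w)\<close> for the root of unity \<open>\<zeta>\<close> for which \<open>\<zeta> w\<close> is closest to \<open>z\<close>: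
  this difference is almost parallel to \<open>v\<close>, while \<open>F (\<zeta> w) - F w\<close> is almost orthogonal to it.
\<close>

lemma branch_difference_estimate:
  assumes z: "cmod z < \<delta>" and w: "cmod w < \<delta>"
    and \<zeta>: "\<zeta> ^ n = 1" "\<forall>\<zeta>'. \<zeta>' ^ n = 1 \<longrightarrow> cmod (z - \<zeta> * w) \<le> cmod (z - \<zeta>' * w)"
    and t: "0 \<le> t" "t \<le> 1"
    and h0: "(1 - of_real t) * herm v (F z - F w - p) + of_real t * (of_real ((norm v)\<^sup>2) * (z ^ n - w ^ n)) = 0"
    and d0: "cdet v (F z - F w - p) = 0"
    and \<Delta>_def: "\<Delta> = max (cmod z) (cmod w) ^ (n - 1) * cmod (z - \<zeta> * w)"
  shows "\<zeta> = 1 \<Longrightarrow> 3 * cmod (cdet v p) \<le> cmod (herm v p) \<and> 3 * norm v * \<eta> * \<Delta> \<le> cmod (herm v p)"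
    and "\<zeta> \<noteq> 1 \<Longrightarrow> 2 * \<eta> * \<Delta> \<le> norm p \<and> 2 * \<eta> * cmod w ^ q \<zeta> \<le> norm p"
proof -
  define m where "m = max (cmod z) (cmod w)"
  have m: "cmod z \<le> m" "cmod w \<le> m" "m < \<delta>" "m \<ge> 0" using z w by (auto simp: m_def le_max_iff_disj)
  have n\<zeta>: "cmod \<zeta> = 1" by (rule norm_root_of_unity[OF n_ge_1 \<zeta>(1)])
  have \<Delta>: "\<Delta> = m ^ (n - 1) * cmod (z - \<zeta> * w)" by (simp add: \<Delta>_def m_def)
  have \<Delta>0: "\<Delta> \<ge> 0" using m by (simp add: \<Delta>)
  define D where "D = z ^ n - w ^ n"
  define k where "k = (norm v)\<^sup>2"
  have k: "k > 0" using norm_v_pos by (simp add: k_def)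
  \<comment> \<open>The difference of the powers dominates the mean value error, which is at most
    \<open>\<eta> * \<Delta>\<close>; the assumption on \<kappa> makes the margin a factor
    4.\<close>
  have lb: "\<kappa> * \<Delta> \<le> cmod D"
    using diff_bound[OF \<zeta>(1), of z w] \<zeta>(2) by (simp add: \<Delta>_def D_def mult.assoc)
  have "4 * \<eta> * \<Delta> \<le> norm v * \<kappa> * \<Delta>" using \<kappa> \<Delta>0 by (intro mult_right_mono)
  also have "\<dots> \<le> norm v * cmod D" using mult_left_mono[OF lb, of "norm v"] by (simp add: mult.assoc)
  finally have "norm v * (4 * \<eta> * \<Delta>) \<le> norm v * (norm v * cmod D)" by (rule mult_left_mono) simp
  then have lb': "4 * (norm v * \<eta> * \<Delta>) \<le> k * cmod D" by (simp add: k_def power2_eq_square mult.assoc mult.left_commute)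
  have \<zeta>w: "(\<zeta> * w) ^ n = w ^ n" using \<zeta>(1) by (simp add: power_mult_distrib)
  define A where "A = F z - F (\<zeta> * w) - D *s v"
  have A: "norm A \<le> \<eta> * \<Delta>"
    using mean_value[of z m "\<zeta> * w"] m n\<zeta> by (simp add: A_def D_def \<zeta>w \<Delta> norm_mult mult.assoc)
  \<comment> \<open>Size and leading term of the jump from \<open>F w\<close> to
    \<open>F (\<zeta> * w)\<close>. Both are 0 for \<open>\<zeta> = 1\<close>, where there is no
    jump.\<close>
  define W where "W = (if \<zeta> = 1 then 0 else cmod w ^ q \<zeta>)"
  define U where "U = (if \<zeta> = 1 then 0 else w ^ q \<zeta> *s u \<zeta>)"
  define B where "B = F (\<zeta> * w) - F w - U"
  have B: "norm B \<le> \<eta> * W" using root[OF \<zeta>(1) _ w] by (auto simp: B_def W_def U_def)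
  have hU: "herm v U = 0" using u[OF \<zeta>(1)] by (auto simp: U_def herm_simps)
  have dU: "4 * (norm v * \<eta> * W) \<le> cmod (cdet v U)"
  proof (cases "\<zeta> = 1")
    case False
    then have "W * (4 * norm v * \<eta>) \<le> W * cmod (cdet v (u \<zeta>))"
      using u[OF \<zeta>(1)] by (intro mult_left_mono) (auto simp: W_def)
    then show ?thesis using False by (simp add: U_def W_def cdet_simps norm_mult norm_power algebra_simps)
  qed (simp add: W_def)
  define E where "E = A + B"
  have E: "norm E \<le> \<eta> * \<Delta> + \<eta> * W" using norm_triangle_ineq[of A B] A B by (simp add: E_def)
  have nE: "norm v * norm E \<le> norm v * \<eta> * \<Delta> + norm v * \<eta> * W"
    using mult_left_mono[OF E, of "norm v"] by (simp add: algebra_simps)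
  \<comment> \<open>The component along \<open>v\<close> bounds \<open>D\<close>, and hence
    \<Delta>, by the errors and \<open>p\<close>; the determinant bounds \<open>U\<close>, and hence
    \<open>W\<close>, in the same way. Combining the two inequalities for
    \<open>\<zeta> \<noteq> 1\<close> leaves bounds by \<open>p\<close> alone.\<close>
  have X: "F z - F w - p = D *s v + U + (E - p)" by (simp add: E_def A_def B_def)
  have "of_real k * D + (1 - of_real t) * herm v (E - p) = 0"
    using h0 unfolding X by (simp only: herm_simps herm_self hU k_def D_def) (simp add: algebra_simps)
  then have "of_real k * D = - ((1 - of_real t) * herm v (E - p))" by (simp add: add_eq_0_iff)
  then have "k * cmod D = cmod ((1 - of_real t) * herm v (E - p))"
    using k by (metis norm_minus_cancel norm_mult norm_of_real abs_of_pos)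
  also have "cmod ((1 - of_real t) * herm v (E - p)) = (1 - t) * cmod (herm v (E - p))"
  proof -
    have "1 - complex_of_real t = of_real (1 - t)" by simp
    then have "cmod (1 - complex_of_real t) = 1 - t" using t by (simp only: norm_of_real abs_of_nonneg diff_ge_0_iff_ge)
    then show ?thesis by (simp only: norm_mult)
  qed
  also have "\<dots> \<le> 1 * cmod (herm v (E - p))" using t by (intro mult_right_mono) auto
  also have "cmod (herm v (E - p)) \<le> cmod (herm v E) + cmod (herm v p)"
    unfolding herm_simps by (rule norm_triangle_ineq4)
  also have "cmod (herm v E) \<le> norm v * norm E" by (rule norm_herm_le)
  finally have I: "3 * (norm v * \<eta> * \<Delta>) \<le> norm v * \<eta> * W + cmod (herm v p)" using lb' nE by simp
  have "cdet v U = cdet v p - cdet v E"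
    using d0 unfolding X by (simp add: cdet_simps algebra_simps)
  then have "cmod (cdet v U - cdet v p) \<le> norm v * norm E"
    using norm_cdet_le[of v E] by simp
  then have II: "cmod (cdet v U - cdet v p) \<le> norm v * \<eta> * \<Delta> + norm v * \<eta> * W" using nE by simp
  show "3 * cmod (cdet v p) \<le> cmod (herm v p) \<and> 3 * norm v * \<eta> * \<Delta> \<le> cmod (herm v p)" if "\<zeta> = 1"
    using I II that by (simp add: W_def U_def cdet_simps)
  show "2 * \<eta> * \<Delta> \<le> norm p \<and> 2 * \<eta> * cmod w ^ q \<zeta> \<le> norm p" if "\<zeta> \<noteq> 1"
  proof -
    have "3 * (norm v * \<eta> * W) \<le> norm v * \<eta> * \<Delta> + cmod (cdet v p)"
      using II dU norm_triangle_sub[of "cdet v U" "cdet v p"] by simp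
    then have *: "norm v * (2 * \<eta> * \<Delta>) \<le> norm v * norm p" "norm v * (2 * \<eta> * W) \<le> norm v * norm p"
      using I norm_cdet_le[of v p] norm_herm_le[of v p] by (simp_all add: algebra_simps)
    then show ?thesis using norm_v_pos that by (simp add: W_def)
  qed
qed

text \<open>With displacement \<open>p = 0\<close> the estimate makes \<Delta> vanish and, for
  \<open>\<zeta> \<noteq> 1\<close>, also \<open>w\<close>; distinct points leave no room for
  either.\<close>

lemma F_injective:
  assumes z: "cmod z < \<delta>" and w: "cmod w < \<delta>" and eq: "F z = F w"
  shows "z = w"
proof (rule ccontr)
  assume ne: "z \<noteq> w"
  define m where "m = max (cmod z) (cmod w)"
  have m0: "m > 0" using ne unfolding m_def by (metis less_max_iff_disj zero_less_norm_iff)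
  obtain \<zeta> where \<zeta>: "\<zeta> ^ n = 1" "\<forall>\<zeta>'. \<zeta>' ^ n = 1 \<longrightarrow> cmod (z - \<zeta> * w) \<le> cmod (z - \<zeta>' * w)"
    using closest_root_exists[OF n_ge_1] by blast
  define \<Delta> where "\<Delta> = max (cmod z) (cmod w) ^ (n - 1) * cmod (z - \<zeta> * w)"
  note key = branch_difference_estimate[OF z w \<zeta> _ _ _ _ \<Delta>_def, of 0 0]
  show False
  proof (cases "\<zeta> = 1")
    case True
    then have "norm v * \<eta> * \<Delta> \<le> 0" using key(1) eq by (simp add: herm_simps cdet_simps ac_simps)
    then have "\<Delta> \<le> 0" using norm_v_pos \<eta> by (simp add: mult_le_0_iff)
    moreover have "\<Delta> > 0" unfolding \<Delta>_def m_def[symmetric] using m0 True ne by (intro mult_pos_pos zero_less_power) simp_all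
    ultimately show False by simp
  next
    case False
    then have "\<eta> * \<Delta> \<le> 0 \<and> \<eta> * cmod w ^ q \<zeta> \<le> 0" using key(2) eq by (simp add: herm_simps cdet_simps ac_simps)
    then have *: "\<Delta> \<le> 0" "cmod w ^ q \<zeta> \<le> 0" using \<eta> by (simp_all add: mult_le_0_iff)
    have "w = 0"
    proof (rule ccontr)
      assume "w \<noteq> 0"
      then have "cmod w ^ q \<zeta> > 0" by simp
      with *(2) show False by simp
    qed
    then have "\<Delta> > 0" unfolding \<Delta>_def m_def[symmetric] using m0 ne by (intro mult_pos_pos zero_less_power) simp_all
    with * show False by simp
  qed
qed

section \<open>Growth of the branch, sections of the plane field and push-offs\<close>

lemma F_0: "F 0 = 0"
  using asym[of 0] \<delta> n by (simp add: power_0_left)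

lemma norm_F_lower: "cmod z < \<delta> \<Longrightarrow> norm (F z) \<ge> (15/16) * norm v * cmod z ^ n"
  and norm_F_upper: "cmod z < \<delta> \<Longrightarrow> norm (F z) \<le> (17/16) * norm v * cmod z ^ n"
proof -
  assume z: "cmod z < \<delta>"
  have "norm (F z - z ^ n *s v) \<le> (norm v / 16) * cmod z ^ n"
    using \<eta> by (intro order_trans[OF asym[OF z]] mult_right_mono) auto
  moreover have "norm (z ^ n *s v) = norm v * cmod z ^ n" by (simp add: norm_power mult.commute)
  moreover have "norm (z ^ n *s v - F z) = norm (F z - z ^ n *s v)" by (rule norm_minus_commute)
  ultimately show "norm (F z) \<ge> (15/16) * norm v * cmod z ^ n" "norm (F z) \<le> (17/16) * norm v * cmod z ^ n"
    using norm_triangle_sub[of "F z" "z ^ n *s v"] norm_triangle_sub[of "z ^ n *s v" "F z"] by linarith+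
qed

text \<open>The leading terms of the branch and of its radial derivative are positive multiples of
  the same vector, and the errors are too small to destroy this. So the branch crosses small spheres
  transversally.\<close>

lemma radial_derivative_pos:
  assumes z: "cmod z < \<delta>" "z \<noteq> 0"
  shows "F z \<bullet> F' z (sgn z) > 0"
proof -
  define \<rho> where "\<rho> = cmod z"
  have \<rho>: "\<rho> > 0" using z by (simp add: \<rho>_def)
  define E1 where "E1 = F z - z ^ n *s v"
  define E2 where "E2 = F' z (sgn z) - (of_nat n * z ^ (n - 1) * sgn z) *s v"
  have E1: "norm E1 \<le> \<eta> * \<rho> ^ n" using asym[OF z(1)] by (simp add: E1_def \<rho>_def)
  have E2: "norm E2 \<le> \<eta> * \<rho> ^ (n - 1)" using asym'[OF z(1), of "sgn z"] z by (simp add: E2_def \<rho>_def norm_sgn)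
  have zn: "of_nat n * z ^ (n - 1) * sgn z = of_real (real n / \<rho>) * z ^ n"
    using z n by (cases n) (simp_all add: \<rho>_def sgn_div_norm scaleR_conv_of_real field_simps)
  have pn: "\<rho> ^ n = \<rho> * \<rho> ^ (n - 1)" using n by (cases n) auto
  define a where "a = z ^ n *s v"
  have na: "norm a = norm v * \<rho> ^ n" by (simp add: a_def norm_power \<rho>_def mult.commute)
  have b: "(of_nat n * z ^ (n - 1) * sgn z) *s v = (real n / \<rho>) *\<^sub>R a"
    unfolding zn by (simp add: a_def vec_eq_iff scaleR_conv_of_real[of _ "_ :: complex"])
  have "F z \<bullet> F' z (sgn z) = (a + E1) \<bullet> ((real n / \<rho>) *\<^sub>R a + E2)"
  proof -
    have "F z = a + E1" by (simp add: E1_def a_def)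
    moreover have "F' z (sgn z) = (real n / \<rho>) *\<^sub>R a + E2" unfolding E2_def b by simp
    ultimately show ?thesis by simp
  qed
  also have "\<dots> = (real n / \<rho>) * (norm a)\<^sup>2 + a \<bullet> E2 + (real n / \<rho>) * (E1 \<bullet> a) + E1 \<bullet> E2"
    by (simp add: inner_add_left inner_add_right power2_norm_eq_inner distrib_left add_divide_distrib)
  also have "\<dots> > 0"
  proof -
    \<comment> \<open>The unit for all four terms: the main term is \<open>n * P\<close>, and the
      errors are at most \<open>P / 16\<close>, \<open>n * P / 16\<close> and
      \<open>P / 256\<close>.\<close>
    define P where "P = (norm v)\<^sup>2 * \<rho> ^ n * \<rho> ^ (n - 1)"
    have P: "P > 0" using norm_v_pos \<rho> by (simp add: P_def)
    have 1: "(real n / \<rho>) * (norm a)\<^sup>2 = real n * P"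
      using \<rho> by (simp add: na P_def power2_eq_square pn ac_simps)
    have "\<bar>a \<bullet> E2\<bar> \<le> norm a * norm E2" by (rule Cauchy_Schwarz_ineq2)
    also have "\<dots> \<le> (norm v * \<rho> ^ n) * ((norm v / 16) * \<rho> ^ (n - 1))"
      using \<eta> \<rho> by (intro mult_mono order_trans[OF E2] mult_right_mono) (auto simp: na)
    finally have 2: "\<bar>a \<bullet> E2\<bar> \<le> P / 16" by (simp add: P_def power2_eq_square ac_simps)
    have "\<bar>E1 \<bullet> a\<bar> \<le> norm E1 * norm a" by (rule Cauchy_Schwarz_ineq2)
    also have "\<dots> \<le> ((norm v / 16) * \<rho> ^ n) * (norm v * \<rho> ^ n)"
      using \<eta> \<rho> by (intro mult_mono order_trans[OF E1] mult_right_mono) (auto simp: na)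
    finally have "(real n / \<rho>) * \<bar>E1 \<bullet> a\<bar> \<le> (real n / \<rho>) * (((norm v / 16) * \<rho> ^ n) * (norm v * \<rho> ^ n))"
      using \<rho> by (intro mult_left_mono) auto
    also have "\<dots> = real n * P / 16" using \<rho> by (simp add: P_def power2_eq_square pn ac_simps)
    finally have 3: "\<bar>(real n / \<rho>) * (E1 \<bullet> a)\<bar> \<le> real n * P / 16" using \<rho> by (simp add: abs_mult)
    have "\<bar>E1 \<bullet> E2\<bar> \<le> norm E1 * norm E2" by (rule Cauchy_Schwarz_ineq2)
    also have "\<dots> \<le> ((norm v / 16) * \<rho> ^ n) * ((norm v / 16) * \<rho> ^ (n - 1))"
      using \<eta> \<rho> by (intro mult_mono order_trans[OF E1] order_trans[OF E2] mult_right_mono) auto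
    finally have 4: "\<bar>E1 \<bullet> E2\<bar> \<le> P / 256" by (simp add: P_def power2_eq_square ac_simps)
    have "real n * P \<ge> 2 * P" using n P by (intro mult_right_mono) auto
    then show ?thesis using 1 2 3 4 P by linarith
  qed
  finally show ?thesis .
qed

text \<open>Both \<open>s x\<close> and \<open>J x (s x)\<close> are tangent to the sphere. As
  \<open>J x\<close> is close to multiplication by \<open>\<i>\<close>, the product
  \<open>herm x (s x)\<close> has real part 0 and small imaginary part; the 1/8 is the bound on
  \<open>L * e\<close>.\<close>

lemma section_facts:
  assumes r: "0 < r" "r < e" and s: "nonvanishing_section J r s" and x: "norm x = r"
  shows "s x \<noteq> 0" "s x \<bullet> x = 0" "cmod (herm x (s x)) \<le> norm x * norm (s x) / 8"
proof -
  show s0: "s x \<noteq> 0" using s x by (auto simp: nonvanishing_section_def)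
  have "s x \<in> plane_field J x" using s x by (auto simp: nonvanishing_section_def)
  then obtain \<xi> where \<xi>: "s x \<bullet> x = 0" "\<xi> \<bullet> x = 0" "s x = J x \<xi>"
    by (auto simp: plane_field_def sphere_tangent_def)
  show "s x \<bullet> x = 0" by (rule \<xi>(1))
  have xe: "norm x < e" using x r by simp
  have "J x (s x) = - \<xi>" using \<xi>(3) Je2[OF xe] by simp
  then have Js: "J x (s x) \<bullet> x = 0" using \<xi>(2) by simp
  define h where "h = herm x (s x)"
  have re: "Re h = 0" using \<xi>(1) by (simp add: h_def Re_herm)
  have "Im h = - Re (herm x (\<i> *s s x))" by (simp add: herm_simps h_def)
  also have "\<dots> = ((J x - smult_blinfun \<i>) (s x)) \<bullet> x" by (simp add: Re_herm blinfun.diff_left inner_diff_left Js)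
  finally have "\<bar>Im h\<bar> \<le> norm ((J x - smult_blinfun \<i>) (s x)) * norm x"
    using Cauchy_Schwarz_ineq2 by simp
  also have "\<dots> \<le> ((L * norm x) * norm (s x)) * norm x"
    using Je[OF xe] by (intro mult_right_mono order_trans[OF norm_blinfun] mult_right_mono) auto
  also have "\<dots> \<le> (1/8 * norm (s x)) * norm x"
    using e(2) L x r mult_left_mono[of "norm x" e L] by (intro mult_right_mono) auto
  finally show "cmod (herm x (s x)) \<le> norm x * norm (s x) / 8"
    using re by (simp add: h_def[symmetric] cmod_eq_Im mult.commute)
qed

text \<open>A point in the cone is nearly parallel to \<open>v\<close>, so the section, nearly
  orthogonal to the point, is nearly orthogonal to \<open>v\<close>. The constants come from
  \<open>cmod (herm v x)\<close> being at least 15/16 of \<open>norm v * norm x\<close>.\<close>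

lemma section_cone:
  assumes r: "0 < r" "r < e" and s: "nonvanishing_section J r s" and x: "norm x = r"
    and cone: "cmod (cdet v x) \<le> norm v * norm x / 8"
  shows "cmod (herm v (s x)) \<le> 4/15 * norm v * norm (s x)" "cmod (cdet v (s x)) \<ge> 9/10 * norm v * norm (s x)"
proof -
  define k where "k = (norm v)\<^sup>2"
  define S where "S = norm (s x)"
  have S: "S \<ge> 0" by (simp add: S_def)
  note f = section_facts[OF r s x]
  have hx: "cmod (herm v x) \<ge> 15/16 * norm v * r"
  proof (rule power2_le_imp_le)
    define Q where "Q = (norm v)\<^sup>2 * r\<^sup>2"
    have "(cmod (cdet v x))\<^sup>2 \<le> (norm v * r / 8)\<^sup>2" using cone x by (intro power_mono) auto
    also have "(norm v * r / 8)\<^sup>2 = Q / 64" by (simp add: Q_def power_mult_distrib power_divide)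
    finally have "(cmod (cdet v x))\<^sup>2 \<le> Q / 64" .
    moreover have "(cmod (herm v x))\<^sup>2 + (cmod (cdet v x))\<^sup>2 = Q" using norm_herm_cdet[of v x] x by (simp add: Q_def)
    moreover have "(15/16 * norm v * r)\<^sup>2 = 225/256 * Q" by (simp add: Q_def power_mult_distrib power_divide)
    moreover have "Q \<ge> 0" by (simp add: Q_def)
    ultimately show "(15/16 * norm v * r)\<^sup>2 \<le> (cmod (herm v x))\<^sup>2" by linarith
  qed simp
  have "herm v (s x) * cnj (herm v x) = of_real k * herm x (s x) - cdet v (s x) * cnj (cdet v x)"
    using herm_cdet_identities(1)[of v x "s x"] by (simp add: k_def algebra_simps)
  then have "cmod (herm v (s x)) * cmod (herm v x) = cmod (of_real k * herm x (s x) - cdet v (s x) * cnj (cdet v x))"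
    by (metis complex_mod_cnj norm_mult)
  also have "\<dots> \<le> cmod (of_real k * herm x (s x)) + cmod (cdet v (s x) * cnj (cdet v x))"
    by (rule norm_triangle_ineq4)
  also have "\<dots> \<le> k * (r * S / 8) + (norm v * S) * (norm v * r / 8)"
  proof (rule add_mono)
    have "k \<ge> 0" by (simp add: k_def)
    then show "cmod (of_real k * herm x (s x)) \<le> k * (r * S / 8)"
      using mult_left_mono[OF f(3), of k] x by (simp add: norm_mult S_def mult.assoc)
    show "cmod (cdet v (s x) * cnj (cdet v x)) \<le> (norm v * S) * (norm v * r / 8)"
      using cone x norm_cdet_le[of v "s x"] S unfolding norm_mult complex_mod_cnj by (intro mult_mono) (auto simp: S_def)
  qed
  also have "\<dots> = k * r * S / 4" by (simp add: k_def power2_eq_square)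
  finally have "cmod (herm v (s x)) * cmod (herm v x) \<le> k * r * S / 4" .
  moreover have "cmod (herm v (s x)) * (15/16 * norm v * r) \<le> cmod (herm v (s x)) * cmod (herm v x)"
    using hx by (intro mult_left_mono) auto
  ultimately have "(norm v * r) * (15/16 * cmod (herm v (s x))) \<le> (norm v * r) * (norm v * S / 4)"
    by (simp add: k_def power2_eq_square algebra_simps)
  then have "15/16 * cmod (herm v (s x)) \<le> norm v * S / 4" using norm_v_pos r by (simp only: mult_le_cancel_left_pos mult_pos_pos)
  then show h: "cmod (herm v (s x)) \<le> 4/15 * norm v * norm (s x)" by (simp add: S_def)
  show "cmod (cdet v (s x)) \<ge> 9/10 * norm v * norm (s x)"
  proof (rule power2_le_imp_le)
    define Q where "Q = (norm v)\<^sup>2 * S\<^sup>2"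
    have "(cmod (herm v (s x)))\<^sup>2 \<le> (4/15 * norm v * S)\<^sup>2" using h by (intro power_mono) (auto simp: S_def)
    also have "(4/15 * norm v * S)\<^sup>2 = 16/225 * Q" by (simp add: Q_def power_mult_distrib power_divide)
    finally have "(cmod (herm v (s x)))\<^sup>2 \<le> 16/225 * Q" .
    moreover have "(cmod (herm v (s x)))\<^sup>2 + (cmod (cdet v (s x)))\<^sup>2 = Q" using norm_herm_cdet[of v "s x"] by (simp add: Q_def S_def)
    moreover have "(9/10 * norm v * norm (s x))\<^sup>2 = 81/100 * Q" by (simp add: Q_def S_def power_mult_distrib power_divide)
    moreover have "Q \<ge> 0" by (simp add: Q_def)
    ultimately show "(9/10 * norm v * norm (s x))\<^sup>2 \<le> (cmod (cdet v (s x)))\<^sup>2" by linarith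
  qed simp
qed

text \<open>The section is orthogonal to \<open>x\<close>, so by Pythagoras the push changes the
  norm only to second order. \<beta> is the normalizing factor, and \<xi> is the resulting radial
  correction of the displacement.\<close>

lemma pushed_expansion:
  assumes r: "0 < r" "r < e" and s: "nonvanishing_section J r s" and x: "norm x = r"
    and \<epsilon>: "\<epsilon> > 0" "\<epsilon> * norm (s x) \<le> r / 10"
  obtains \<beta> \<xi> where "0 < \<beta>" "\<beta> \<le> 1" "pushed r \<epsilon> s x - x = (\<beta> * \<epsilon>) *\<^sub>R (s x + \<xi>)" "norm \<xi> \<le> norm (s x) / 20"
proof -
  note f = section_facts[OF r s x]
  define S where "S = norm (s x)"
  define N where "N = norm (x + \<epsilon> *\<^sub>R s x)"
  have N2: "N\<^sup>2 = r\<^sup>2 + (\<epsilon> * S)\<^sup>2"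
    using f(2) by (simp add: N_def S_def x[symmetric] power2_norm_eq_inner inner_add_left inner_add_right inner_commute power_mult_distrib power2_eq_square[of \<epsilon>])
  have "r\<^sup>2 \<le> N\<^sup>2" by (simp add: N2)
  then have N: "N \<ge> r" using power2_le_imp_le[of r N] by (simp add: N_def)
  then have N0: "N > 0" using r by simp
  define \<beta> where "\<beta> = r / N"
  have \<beta>: "0 < \<beta>" "\<beta> \<le> 1" using N N0 r by (auto simp: \<beta>_def)
  define \<xi> where "\<xi> = - ((N - r) / (\<epsilon> * r)) *\<^sub>R x"
  have "pushed r \<epsilon> s x = \<beta> *\<^sub>R (x + \<epsilon> *\<^sub>R s x)"
    by (simp add: pushed_def sgn_div_norm \<beta>_def N_def divide_inverse)
  moreover have "(\<beta> * \<epsilon>) *\<^sub>R \<xi> = (\<beta> - 1) *\<^sub>R x"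
  proof -
    have "(\<beta> * \<epsilon>) * (- ((N - r) / (\<epsilon> * r))) = \<beta> - 1"
      using r N0 \<epsilon> by (simp add: \<beta>_def field_simps)
    then show ?thesis by (simp only: \<xi>_def scaleR_scaleR)
  qed
  ultimately have eq: "pushed r \<epsilon> s x - x = (\<beta> * \<epsilon>) *\<^sub>R (s x + \<xi>)"
    by (simp add: scaleR_add_right scaleR_diff_left)
  have "(N - r) * (2 * r) \<le> (N - r) * (N + r)" using N by (intro mult_left_mono) auto
  also have "\<dots> = (\<epsilon> * S)\<^sup>2" using N2 by (simp add: power2_eq_square algebra_simps)
  also have "\<dots> \<le> (\<epsilon> * S) * (r / 10)" using \<epsilon> by (simp add: power2_eq_square S_def mult_left_mono)
  finally have "r * (N - r) \<le> r * (\<epsilon> * S / 20)" by (simp add: algebra_simps)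
  then have "N - r \<le> \<epsilon> * S / 20" using r by simp
  moreover have "norm \<xi> = (N - r) / \<epsilon>"
    using r \<epsilon> N x by (simp add: \<xi>_def)
  ultimately have "norm \<xi> \<le> S / 20" using \<epsilon> by (simp add: pos_divide_le_eq ac_simps)
  with that[OF \<beta> eq] show thesis by (simp add: S_def)
qed

lemma pushed_norm:
  assumes r: "0 < r" "r < e" and s: "nonvanishing_section J r s" and x: "norm x = r" and \<epsilon>: "\<epsilon> > 0"
  shows "x + \<epsilon> *\<^sub>R s x \<noteq> 0" "norm (pushed r \<epsilon> s x) = r"
proof -
  note f = section_facts[OF r s x]
  have "(x + \<epsilon> *\<^sub>R s x) \<bullet> x = r\<^sup>2" using f(2) x by (simp add: inner_add_left power2_norm_eq_inner[symmetric])
  then show "x + \<epsilon> *\<^sub>R s x \<noteq> 0" using r by auto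
  then show "norm (pushed r \<epsilon> s x) = r" using r by (simp add: pushed_def norm_sgn)
qed

lemma cone_F:
  assumes "cmod Y < \<delta>"
  shows "cmod (cdet v (F Y)) \<le> norm v * norm (F Y) / 8"
proof -
  have "cdet v (F Y) = cdet v (F Y - Y ^ n *s v)" by (simp add: cdet_simps)
  then have "cmod (cdet v (F Y)) \<le> norm v * norm (F Y - Y ^ n *s v)" by (metis norm_cdet_le)
  also have "\<dots> \<le> norm v * ((norm v / 16) * cmod Y ^ n)"
    using \<eta> by (intro mult_left_mono order_trans[OF asym[OF assms]] mult_right_mono) auto
  also have "\<dots> \<le> norm v * (norm (F Y) / 8)"
  proof (intro mult_left_mono)
    define Q where "Q = norm v * cmod Y ^ n"
    have "0 \<le> Q" by (simp add: Q_def)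
    moreover have "15/16 * Q \<le> norm (F Y)" using norm_F_lower[OF assms] by (simp add: Q_def mult.assoc)
    moreover have "norm v / 16 * cmod Y ^ n = Q / 16" by (simp add: Q_def)
    ultimately show "norm v / 16 * cmod Y ^ n \<le> norm (F Y) / 8" by linarith
  qed simp
  finally show ?thesis by simp
qed

text \<open>The homogeneous extension of the push-off, so that it also applies to points
  \<open>F Y\<close> inside the ball.\<close>

definition push :: "real \<Rightarrow> real \<Rightarrow> (complex^2 \<Rightarrow> complex^2) \<Rightarrow> complex^2 \<Rightarrow> complex^2" where
  "push r \<epsilon> s = radial r (pushed r \<epsilon> s)"

lemma push_difference:
  assumes r: "0 < r" "r < e" and s: "nonvanishing_section J r s" and Y: "cmod Y < \<delta>" "F Y \<noteq> 0"
    and \<epsilon>: "\<epsilon> > 0" and small: "\<And>x. norm x = r \<Longrightarrow> \<epsilon> * norm (s x) \<le> r / 10"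
  defines "x \<equiv> r *\<^sub>R sgn (F Y)"
  obtains b \<xi> where "b > 0" "norm \<xi> \<le> norm (s x) / 20" "push r \<epsilon> s (F Y) - F Y = b *\<^sub>R (s x + \<xi>)" "b \<le> norm (F Y) / r * \<epsilon>"
    "cmod (herm v (s x)) \<le> 4/15 * norm v * norm (s x)" "cmod (cdet v (s x)) \<ge> 9/10 * norm v * norm (s x)"
    "cmod (herm v \<xi>) \<le> norm v * norm (s x) / 20" "cmod (cdet v \<xi>) \<le> norm v * norm (s x) / 20" "norm (s x) > 0"
proof -
  have x: "norm x = r" using Y r by (simp add: x_def norm_sgn)
  obtain \<beta> \<xi> where b: "0 < \<beta>" "\<beta> \<le> 1" "pushed r \<epsilon> s x - x = (\<beta> * \<epsilon>) *\<^sub>R (s x + \<xi>)" "norm \<xi> \<le> norm (s x) / 20"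
    using pushed_expansion[OF r s x \<epsilon> small[OF x]] by blast
  have "F Y = (norm (F Y) / r) *\<^sub>R x" using r Y by (simp add: x_def sgn_div_norm)
  then have "push r \<epsilon> s (F Y) - F Y = (norm (F Y) / r) *\<^sub>R (pushed r \<epsilon> s x - x)"
    unfolding push_def radial_def x_def[symmetric] scaleR_diff_right by simp
  also have "\<dots> = (norm (F Y) / r * (\<beta> * \<epsilon>)) *\<^sub>R (s x + \<xi>)" by (simp add: b)
  finally have eq: "push r \<epsilon> s (F Y) - F Y = (norm (F Y) / r * (\<beta> * \<epsilon>)) *\<^sub>R (s x + \<xi>)" .
  have "cmod (cdet v x) = (r / norm (F Y)) * cmod (cdet v (F Y))"
  proof -
    have "x = (r / norm (F Y)) *\<^sub>R F Y" by (simp add: x_def sgn_div_norm divide_inverse)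
    then have "cdet v x = of_real (r / norm (F Y)) * cdet v (F Y)" by (simp only: cdet_simps)
    then have "cmod (cdet v x) = \<bar>r / norm (F Y)\<bar> * cmod (cdet v (F Y))" by (simp only: norm_mult norm_of_real)
    then show ?thesis using r by simp
  qed
  also have "\<dots> \<le> (r / norm (F Y)) * (norm v * norm (F Y) / 8)"
    using cone_F[OF Y(1)] r by (intro mult_left_mono) auto
  also have "\<dots> = norm v * norm x / 8" using Y x by simp
  finally have c: "cmod (cdet v x) \<le> norm v * norm x / 8" .
  show thesis
  proof (rule that[OF _ b(4) eq])
    show "norm (F Y) / r * (\<beta> * \<epsilon>) > 0" using b Y r \<epsilon> by simp
    show "norm (F Y) / r * (\<beta> * \<epsilon>) \<le> norm (F Y) / r * \<epsilon>" using b r \<epsilon> by (intro mult_left_mono) auto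
    show "cmod (herm v \<xi>) \<le> norm v * norm (s x) / 20" "cmod (cdet v \<xi>) \<le> norm v * norm (s x) / 20"
      using order_trans[OF norm_herm_le mult_left_mono[OF b(4)]] order_trans[OF norm_cdet_le mult_left_mono[OF b(4)]] by auto
    show "norm (s x) > 0" using section_facts(1)[OF r s x] by simp
  qed (rule section_cone[OF r s x c])+
qed

text \<open>If 1 is the closest root, \<open>branch_difference_estimate\<close> forces the
  displacement to lie mostly along \<open>v\<close>, whereas the section is mostly orthogonal to
  \<open>v\<close>. If another root is closest, the displacement would have to match the separation
  of the sheets, and \<epsilon> is too small for that.\<close>

lemma pushed_difference_nonzero:
  assumes r: "0 < r" "r < e" and s: "nonvanishing_section J r s"
    and XY: "cmod X < \<delta>" "cmod Y < \<delta>" "max (norm (F X)) (norm (F Y)) = r" and t: "0 \<le> t" "t \<le> 1"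
    and \<epsilon>: "\<epsilon> > 0" and small: "\<And>x. norm x = r \<Longrightarrow> \<epsilon> * norm (s x) \<le> r / 10"
    and \<omega>: "0 < \<omega>" "\<And>Z. cmod Z < \<delta> \<Longrightarrow> norm (F Z) = r \<Longrightarrow> \<omega> \<le> cmod Z"
    and small2: "\<And>x \<zeta>. norm x = r \<Longrightarrow> \<zeta> ^ n = 1 \<Longrightarrow> \<zeta> \<noteq> 1 \<Longrightarrow> 2 * \<epsilon> * norm (s x) \<le> \<eta> * (\<omega> / 3) ^ q \<zeta>"
    and h0: "(1 - of_real t) * herm v (F X - push r \<epsilon> s (F Y)) + of_real t * (of_real ((norm v)\<^sup>2) * (X ^ n - Y ^ n)) = 0"
    and d0: "cdet v (F X - push r \<epsilon> s (F Y)) = 0"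
  shows False
proof -
  define p where "p = push r \<epsilon> s (F Y) - F Y"
  have Xp: "F X - push r \<epsilon> s (F Y) = F X - F Y - p" by (simp add: p_def)
  define m where "m = max (cmod X) (cmod Y)"
  have m\<omega>: "m \<ge> \<omega>"
  proof (cases "norm (F X) = r")
    case True
    then show ?thesis using \<omega>(2)[OF XY(1)] by (simp add: m_def le_max_iff_disj)
  next
    case False
    then have "norm (F Y) = r" using XY(3) by (auto simp: max_def split: if_splits)
    then show ?thesis using \<omega>(2)[OF XY(2)] by (simp add: m_def le_max_iff_disj)
  qed
  have m0: "m > 0" using m\<omega> \<omega> by simp
  have m1: "m \<le> 1" using XY \<delta>1 by (simp add: m_def)
  obtain \<zeta> where \<zeta>: "\<zeta> ^ n = 1" "\<forall>\<zeta>'. \<zeta>' ^ n = 1 \<longrightarrow> cmod (X - \<zeta> * Y) \<le> cmod (X - \<zeta>' * Y)"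
    using closest_root_exists[OF n_ge_1] by blast
  define \<Delta> where "\<Delta> = max (cmod X) (cmod Y) ^ (n - 1) * cmod (X - \<zeta> * Y)"
  note key = branch_difference_estimate[OF XY(1,2) \<zeta> t h0[unfolded Xp] d0[unfolded Xp] \<Delta>_def]
  have n\<zeta>: "cmod \<zeta> = 1" by (rule norm_root_of_unity[OF n_ge_1 \<zeta>(1)])
  have nN: "norm p \<le> \<eta> * (\<omega> / 3) ^ q \<zeta>" if "\<zeta> \<noteq> 1"
  proof (cases "F Y = 0")
    case True
    then show ?thesis using \<eta> \<omega> by (simp add: p_def push_def)
  next
    case False
    define x where "x = r *\<^sub>R sgn (F Y)"
    have x: "norm x = r" using False r by (simp add: x_def norm_sgn)
    obtain b \<xi> where b: "b > 0" "norm \<xi> \<le> norm (s x) / 20" "p = b *\<^sub>R (s x + \<xi>)" "b \<le> norm (F Y) / r * \<epsilon>"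
      using push_difference[OF r s XY(2) False \<epsilon> small] unfolding p_def x_def by metis
    have "norm (F Y) / r \<le> 1" using XY(3) r by simp
    then have "b \<le> \<epsilon>" using b(4) \<epsilon> mult_right_mono[of "norm (F Y) / r" 1 \<epsilon>] by simp
    then have "norm p \<le> \<epsilon> * (norm (s x) + norm \<xi>)"
      using b by (simp add: mult_mono norm_triangle_ineq)
    also have "\<dots> \<le> \<epsilon> * (2 * norm (s x))" using b(2) \<epsilon> by (intro mult_left_mono) (use norm_ge_zero[of "s x"] in linarith)+
    also have "\<dots> \<le> \<eta> * (\<omega> / 3) ^ q \<zeta>" using small2[OF x \<zeta>(1) that] by simp
    finally show ?thesis .
  qed
  show False
  proof (cases "\<zeta> = 1")
    case True
    note k1 = key(1)[OF True]
    show False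
    proof (cases "F Y = 0")
      case True': True
      then have "Y = 0" using F_injective[of Y 0] XY \<delta> F_0 by simp
      have "p = 0" using True' by (simp add: p_def push_def)
      then have "norm v * \<eta> * \<Delta> \<le> 0" using k1 by (simp add: herm_simps ac_simps)
      then have "\<Delta> \<le> 0" using norm_v_pos \<eta> by (simp add: mult_le_0_iff)
      moreover have "\<Delta> = m ^ (n - 1) * m" using True \<open>Y = 0\<close> by (simp add: \<Delta>_def m_def)
      moreover have "m ^ (n - 1) * m > 0" using m0 by simp
      ultimately show False by simp
    next
      case False
      define x where "x = r *\<^sub>R sgn (F Y)"
      obtain b \<xi> where b: "b > 0" "p = b *\<^sub>R (s x + \<xi>)" "cmod (herm v (s x)) \<le> 4/15 * norm v * norm (s x)"
        "cmod (cdet v (s x)) \<ge> 9/10 * norm v * norm (s x)"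
        "cmod (herm v \<xi>) \<le> norm v * norm (s x) / 20" "cmod (cdet v \<xi>) \<le> norm v * norm (s x) / 20" "norm (s x) > 0"
        using push_difference[OF r s XY(2) False \<epsilon> small] unfolding p_def x_def by metis
      have "cmod (herm v p) = b * cmod (herm v (s x) + herm v \<xi>)" "cmod (cdet v p) = b * cmod (cdet v (s x) + cdet v \<xi>)"
        using b(1) unfolding b(2) herm_simps cdet_simps by (simp_all add: norm_mult)
      then have "b * (3 * cmod (cdet v (s x) + cdet v \<xi>)) \<le> b * cmod (herm v (s x) + herm v \<xi>)" using k1 by simp
      then have "3 * cmod (cdet v (s x) + cdet v \<xi>) \<le> cmod (herm v (s x) + herm v \<xi>)" using b(1) by simp
      moreover have "cmod (herm v (s x) + herm v \<xi>) \<le> cmod (herm v (s x)) + cmod (herm v \<xi>)" by (rule norm_triangle_ineq)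
      moreover have "cmod (cdet v (s x)) - cmod (cdet v \<xi>) \<le> cmod (cdet v (s x) + cdet v \<xi>)" by (rule norm_diff_ineq)
      moreover have "norm v * norm (s x) > 0" using norm_v_pos b by simp
      ultimately show False using b(3-6) by simp
    qed
  next
    case False
    note k2 = key(2)[OF False] and p = nN[OF False]
    have "\<eta> * (2 * cmod Y ^ q \<zeta>) \<le> \<eta> * (\<omega> / 3) ^ q \<zeta>" using k2 p by simp
    then have "2 * cmod Y ^ q \<zeta> \<le> (\<omega> / 3) ^ q \<zeta>" using \<eta> by simp
    then have "cmod Y ^ q \<zeta> \<le> (\<omega> / 3) ^ q \<zeta>" using zero_le_power[OF norm_ge_zero, of Y "q \<zeta>"] by linarith
    then have Y: "cmod Y \<le> \<omega> / 3" using q[OF \<zeta>(1) False] n \<omega> by (subst (asm) power_mono_iff) auto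
    \<comment> \<open>So the maximum is attained by \<open>X\<close>, which is far from
      \<open>\<zeta> * Y\<close>. Then \<Delta> is at least \<open>2/3 * m ^ n\<close>, more than
      the displacement permits.\<close>
    then have "cmod Y < m" using m\<omega> \<omega> by simp
    then have Xm: "cmod X = m" by (auto simp: m_def max_def split: if_splits)
    have "cmod X \<le> cmod (X - \<zeta> * Y) + cmod (\<zeta> * Y)" using norm_triangle_sub[of X "\<zeta> * Y"] by simp
    then have D: "cmod (X - \<zeta> * Y) \<ge> 2/3 * m" using Y m\<omega> n\<zeta> Xm by (simp add: norm_mult)
    have pn: "m ^ n = m ^ (n - 1) * m" using n by (cases n) auto
    have "2 * \<eta> * (m ^ (n - 1) * (2/3 * m)) \<le> 2 * \<eta> * \<Delta>"
      unfolding \<Delta>_def m_def[symmetric] using D \<eta> m0 by (intro mult_left_mono) auto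
    also have "\<dots> \<le> \<eta> * (\<omega> / 3) ^ q \<zeta>" using k2 p by simp
    also have "\<dots> \<le> \<eta> * (\<omega> / 3) ^ n"
      using \<omega> m\<omega> m1 q[OF \<zeta>(1) False] \<eta> by (intro mult_left_mono power_decreasing) auto
    also have "\<dots> \<le> \<eta> * m ^ n" using \<omega> m\<omega> \<eta> by (intro mult_left_mono power_mono) auto
    finally have "\<eta> * (4/3 * m ^ n) \<le> \<eta> * m ^ n" by (simp add: pn)
    then have "4/3 * m ^ n \<le> m ^ n" using \<eta> by simp
    moreover have "m ^ n > 0" using m0 by simp
    ultimately show False by simp
  qed
qed

section \<open>The linking number of the branch and its push-off\<close>

lemma contF: "continuous_on (ball 0 \<delta>) F"
  by (rule has_derivative_continuous_on) (auto intro: has_derivative_at_withinI[OF der])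

text \<open>A point and the section at it are linearly independent over the complex numbers, so
  their determinant has no zero, and the 3-sphere is simply connected. The logarithm serves to
  contract the determinant to the constant 1.\<close>

lemma section_log:
  assumes r: "0 < r" "r < e" and s: "nonvanishing_section J r s"
  obtains l where "continuous_on UNIV l" "\<And>x. norm x = r \<Longrightarrow> exp (l x) = cdet x (s x)"
proof -
  let ?S = "sphere (0::complex^2) r"
  have dim: "3 \<le> DIM(complex^2)" by simp
  have cs: "continuous_on ?S s" using s by (simp add: nonvanishing_section_def)
  have "continuous_on ?S (\<lambda>x. cdet x (s x))" by (intro continuous_intros cs)
  moreover have "cdet x (s x) \<noteq> 0" if "norm x = r" for x
  proof
    assume "cdet x (s x) = 0"
    then have "(cmod (herm x (s x)))\<^sup>2 = (norm x)\<^sup>2 * (norm (s x))\<^sup>2" using norm_herm_cdet[of x "s x"] by simp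
    moreover have "(cmod (herm x (s x)))\<^sup>2 \<le> (norm x * norm (s x) / 8)\<^sup>2"
      using section_facts(3)[OF r s that] by (intro power_mono) auto
    moreover have "(norm x)\<^sup>2 * (norm (s x))\<^sup>2 > 0" using section_facts(1)[OF r s that] that r by simp
    ultimately show False by (simp add: power_mult_distrib power_divide)
  qed
  ultimately have f: "continuous_on ?S (\<lambda>x. cdet x (s x))" "(\<lambda>x. cdet x (s x)) \<in> ?S \<rightarrow> - {0}"
    by auto
  have sc: "simply_connected ?S" "locally path_connected ?S"
    by (rule simply_connected_sphere[OF dim]) (rule locally_path_connected_sphere)
  obtain g where g: "continuous_on ?S g" "\<And>x. x \<in> ?S \<Longrightarrow> exp (g x) = cdet x (s x)"
    by (rule covering_space_lift[OF covering_space_exp_punctured_plane sc f]) (rule that)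
  show thesis
  proof (rule that)
    \<comment> \<open>The cone over the logarithm is continuous everywhere, so it can be evaluated
      at points of the branch off the sphere.\<close>
    show "continuous_on UNIV (radial r g)" using g r by (intro continuous_on_radial) auto
    show "exp (radial r g x) = cdet x (s x)" if "norm x = r" for x
      using g(2)[of x] that r by (simp add: radial_sphere)
  qed
qed

lemma push_norm:
  assumes r: "0 < r" "r < e" and s: "nonvanishing_section J r s" and \<epsilon>: "\<epsilon> > 0"
  shows "norm (push r \<epsilon> s y) = norm y"
proof (cases "y = 0")
  case False
  then have "norm (r *\<^sub>R sgn y) = r" using r by (simp add: norm_sgn)
  then show ?thesis using pushed_norm(2)[OF r s _ \<epsilon>] r by (simp add: push_def radial_def)
qed (simp add: push_def)

lemma continuous_on_pushed:
  assumes r: "0 < r" "r < e" and s: "nonvanishing_section J r s" and \<epsilon>: "\<epsilon> > 0"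
  shows "continuous_on (sphere 0 r) (pushed r \<epsilon> s)"
  unfolding pushed_def using s pushed_norm(1)[OF r s _ \<epsilon>]
  by (intro continuous_intros) (auto simp: nonvanishing_section_def)

text \<open>On the diagonal the displacement is a positive multiple of the section up to a small
  error. With \<open>x = F Y\<close>, the value \<open>herm v x\<close> is close to
  \<open>Y ^ n\<close> times the squared norm of \<open>v\<close>, so
  \<open>herm_cdet_identities\<close> makes \<open>Y ^ n * cdet v (s x)\<close> close to
  \<open>cdet x (s x)\<close>. Multiplying by the conjugate of \<open>Y ^ n\<close> moves the power
  to the other side.\<close>

lemma root_degree_1:
  assumes r: "0 < r" "r < e" and s: "nonvanishing_section J r s" and \<epsilon>: "\<epsilon> > 0"
    and small: "\<And>x. norm x = r \<Longrightarrow> \<epsilon> * norm (s x) \<le> r / 10"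
    and Y: "cmod Y < \<delta>" "norm (F Y) = r" and t: "0 \<le> t" "t \<le> 1"
  shows "(1 - of_real t) * cdet v (F Y - push r \<epsilon> s (F Y)) + of_real t * (- (cnj Y ^ n * cdet (F Y) (s (F Y)))) \<noteq> 0"
proof
  assume 0: "(1 - of_real t) * cdet v (F Y - push r \<epsilon> s (F Y)) + of_real t * (- (cnj Y ^ n * cdet (F Y) (s (F Y)))) = 0"
  have F0: "F Y \<noteq> 0" using Y r by auto
  have x: "r *\<^sub>R sgn (F Y) = F Y" using Y r by (simp add: sgn_div_norm)
  define S where "S = s (F Y)"
  obtain b \<xi> where b: "b > 0" "push r \<epsilon> s (F Y) - F Y = b *\<^sub>R (S + \<xi>)"
    "cmod (herm v S) \<le> 4/15 * norm v * norm S" "cmod (cdet v S) \<ge> 9/10 * norm v * norm S"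
    "cmod (cdet v \<xi>) \<le> norm v * norm S / 20" "norm S > 0"
    using push_difference[OF r s Y(1) F0 \<epsilon> small] unfolding x S_def by metis
  define k where "k = (norm v)\<^sup>2"
  define y where "y = cmod Y ^ n"
  have k: "k > 0" using norm_v_pos by (simp add: k_def)
  have y: "y > 0"
  proof -
    have "Y \<noteq> 0" using F0 F_0 by auto
    then show ?thesis by (simp add: y_def)
  qed
  define Q where "Q = of_real k * cdet (F Y) S"
  have Q: "Q = herm v (F Y) * cdet v S - cdet v (F Y) * herm v S"
    unfolding Q_def k_def by (rule herm_cdet_identities(2))
  \<comment> \<open>\<open>C\<close> and \<open>Q\<close> are the two sides of this comparison,
    scaled by \<open>k\<close>. Their distance is at most \<open>M / 5\<close> while
    \<open>C\<close> has modulus at least \<open>M / 2\<close>, so they never point in opposite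
    directions.\<close>
  define C where "C = (cdet v S + cdet v \<xi>) * (of_real k * Y ^ n)"
  define M where "M = norm v * norm S * k * y"
  have M: "M > 0" using norm_v_pos b k y by (simp add: M_def)
  have as: "norm (F Y - Y ^ n *s v) \<le> norm v / 16 * y"
    unfolding y_def using \<eta> by (intro order_trans[OF asym[OF Y(1)]] mult_right_mono) auto
  have hx: "cmod (of_real k * Y ^ n - herm v (F Y)) \<le> k * y / 16"
  proof -
    have "herm v (F Y - Y ^ n *s v) = herm v (F Y) - of_real k * Y ^ n"
      by (simp add: herm_simps herm_self k_def mult.commute)
    then have "cmod (of_real k * Y ^ n - herm v (F Y)) \<le> norm v * norm (F Y - Y ^ n *s v)"
      by (metis norm_herm_le norm_minus_commute)
    also have "\<dots> \<le> norm v * (norm v / 16 * y)" using as by (intro mult_left_mono) auto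
    finally show ?thesis by (simp add: k_def power2_eq_square)
  qed
  have dx: "cmod (cdet v (F Y)) \<le> k * y / 16"
  proof -
    have "cdet v (F Y - Y ^ n *s v) = cdet v (F Y)" by (simp add: cdet_simps)
    then have "cmod (cdet v (F Y)) \<le> norm v * norm (F Y - Y ^ n *s v)" by (metis norm_cdet_le)
    also have "\<dots> \<le> norm v * (norm v / 16 * y)" using as by (intro mult_left_mono) auto
    finally show ?thesis by (simp add: k_def power2_eq_square)
  qed
  have CQ: "C - Q = cdet v S * (of_real k * Y ^ n - herm v (F Y)) + cdet v \<xi> * (of_real k * Y ^ n) + cdet v (F Y) * herm v S"
    by (simp add: C_def Q algebra_simps)
  have "cmod (C - Q) \<le> cmod (cdet v S * (of_real k * Y ^ n - herm v (F Y))) + cmod (cdet v \<xi> * (of_real k * Y ^ n)) + cmod (cdet v (F Y) * herm v S)"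
    unfolding CQ by (intro order_trans[OF norm_triangle_ineq] add_right_mono norm_triangle_ineq)
  also have "\<dots> \<le> M / 16 + M / 20 + M / 60"
  proof (intro add_mono)
    have "cmod (cdet v S * (of_real k * Y ^ n - herm v (F Y))) \<le> (norm v * norm S) * (k * y / 16)"
      unfolding norm_mult using hx norm_cdet_le[of v S] by (intro mult_mono) auto
    then show "cmod (cdet v S * (of_real k * Y ^ n - herm v (F Y))) \<le> M / 16" by (simp add: M_def mult.assoc)
    have "cmod (of_real k * Y ^ n) = k * y" using k by (simp add: norm_mult norm_power y_def)
    then have "cmod (cdet v \<xi> * (of_real k * Y ^ n)) = cmod (cdet v \<xi>) * (k * y)" by (simp only: norm_mult)
    also have "\<dots> \<le> (norm v * norm S / 20) * (k * y)" using b(5) k y by (intro mult_right_mono) auto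
    finally show "cmod (cdet v \<xi> * (of_real k * Y ^ n)) \<le> M / 20" by (simp add: M_def mult.assoc)
    have "cmod (cdet v (F Y) * herm v S) \<le> (k * y / 16) * (4/15 * norm v * norm S)"
      unfolding norm_mult using dx b(3) k y by (intro mult_mono) auto
    then show "cmod (cdet v (F Y) * herm v S) \<le> M / 60" by (simp add: M_def ac_simps)
  qed
  finally have R: "cmod (C - Q) \<le> M / 5" using M by simp
  have "cmod C = cmod (cdet v S + cdet v \<xi>) * (k * y)" using k by (simp add: C_def norm_mult norm_power y_def)
  moreover have "cmod (cdet v S + cdet v \<xi>) \<ge> norm v * norm S / 2"
  proof -
    have "cmod (cdet v S) - cmod (cdet v \<xi>) \<le> cmod (cdet v S + cdet v \<xi>)" by (rule norm_diff_ineq)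
    moreover have "norm v * norm S \<ge> 0" by simp
    ultimately show ?thesis using b(4,5) unfolding mult.assoc by linarith
  qed
  then have "cmod (cdet v S + cdet v \<xi>) * (k * y) \<ge> norm v * norm S / 2 * (k * y)" using k y by (intro mult_right_mono) auto
  ultimately have C: "cmod C \<ge> M / 2" by (simp add: M_def mult.assoc)
  have Qn: "cmod Q > cmod (C - Q)" using C R M norm_triangle_sub[of C Q] by simp
  have dp: "cdet v (F Y - push r \<epsilon> s (F Y)) = - (of_real b * (cdet v S + cdet v \<xi>))"
  proof -
    have "F Y - push r \<epsilon> s (F Y) = - 1 *\<^sub>R (b *\<^sub>R (S + \<xi>))" unfolding b(2)[symmetric] by simp
    then show ?thesis by (simp only: cdet_simps) simp
  qed
  have YY: "Y ^ n * cnj Y ^ n = of_real (y\<^sup>2)"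
    by (simp add: y_def power_mult_distrib[symmetric] complex_norm_square[symmetric] power_mult[symmetric] mult.commute)
  have "0 = - (of_real k * Y ^ n) * ((1 - of_real t) * (- (of_real b * (cdet v S + cdet v \<xi>))) + of_real t * (- (cnj Y ^ n * cdet (F Y) S)))"
    using 0 unfolding dp S_def[symmetric] by simp
  also have "\<dots> = of_real ((1 - t) * b) * C + of_real t * ((Y ^ n * cnj Y ^ n) * Q)"
    by (simp add: C_def Q_def algebra_simps)
  also have "\<dots> = of_real ((1 - t) * b + t * y\<^sup>2) * Q + of_real ((1 - t) * b) * (C - Q)"
    unfolding YY by (simp add: algebra_simps)
  finally have "of_real ((1 - t) * b + t * y\<^sup>2) * Q = - (of_real ((1 - t) * b) * (C - Q))"
    by (simp add: add_eq_0_iff2)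
  then have "cmod (of_real ((1 - t) * b + t * y\<^sup>2) * Q) = cmod (of_real ((1 - t) * b) * (C - Q))"
    by (metis norm_minus_cancel)
  then have e: "\<bar>(1 - t) * b + t * y\<^sup>2\<bar> * cmod Q = \<bar>(1 - t) * b\<bar> * cmod (C - Q)"
    by (simp only: norm_mult norm_of_real)
  have n: "(1 - t) * b \<ge> 0" "t * y\<^sup>2 \<ge> 0" "(1 - t) * b + t * y\<^sup>2 > 0"
    using t b y by (cases "t = 1"; auto intro: add_pos_nonneg)+
  have "((1 - t) * b + t * y\<^sup>2) * cmod Q \<le> ((1 - t) * b + t * y\<^sup>2) * cmod (C - Q)"
    using e n mult_right_mono[of "(1 - t) * b" "(1 - t) * b + t * y\<^sup>2" "cmod (C - Q)"] by simp
  then have "cmod Q \<le> cmod (C - Q)" using n(3) by simp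
  with Qn show False by simp
qed

text \<open>\<sigma> rescales the rays such that the norm of the branch becomes proportional to the
  radius. Then the cones over the two curves can be replaced by the branch and its push-off
  themselves, whose difference is evaluated root by root.\<close>

lemma linking_number_pushed:
  fixes \<sigma> :: "complex \<Rightarrow> complex" and \<gamma> :: "complex \<Rightarrow> complex^2"
  assumes r: "0 < r" "r < e" and s: "nonvanishing_section J r s"
    and \<sigma>c: "continuous_on (cball 0 1) \<sigma>"
    and \<sigma>: "\<And>z. cmod z \<le> 1 \<Longrightarrow> cmod (\<sigma> z) < \<delta> \<and> norm (F (\<sigma> z)) = r * cmod z \<and> (\<exists>l>0. \<sigma> z = of_real l * z)"
    and \<gamma>: "\<And>z. cmod z = 1 \<Longrightarrow> \<gamma> z = F (\<sigma> z)"
    and \<omega>: "0 < \<omega>" "\<And>Z. cmod Z < \<delta> \<Longrightarrow> norm (F Z) = r \<Longrightarrow> \<omega> \<le> cmod Z"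
    and \<epsilon>: "\<epsilon> > 0" and small: "\<And>x. norm x = r \<Longrightarrow> \<epsilon> * norm (s x) \<le> r / 10"
    and small2: "\<And>x \<zeta>. norm x = r \<Longrightarrow> \<zeta> ^ n = 1 \<Longrightarrow> \<zeta> \<noteq> 1 \<Longrightarrow> 2 * \<epsilon> * norm (s x) \<le> \<eta> * (\<omega> / 3) ^ q \<zeta>"
  shows "\<And>z w. cmod z = 1 \<Longrightarrow> cmod w = 1 \<Longrightarrow> \<gamma> z \<noteq> pushed r \<epsilon> s (\<gamma> w)"
    and "\<And>x. x \<in> S3 \<Longrightarrow> radial 1 \<gamma> (x $ 1) \<noteq> radial 1 (pushed r \<epsilon> s \<circ> \<gamma>) (x $ 2)"
    and "continuous_on (sphere 0 1) \<gamma>" "continuous_on (sphere 0 1) (pushed r \<epsilon> s \<circ> \<gamma>)"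
    and "linking_number \<gamma> (pushed r \<epsilon> s \<circ> \<gamma>) = (\<Sum>\<zeta>\<in>{\<zeta>. \<zeta> ^ n = 1} - {1}. int (q \<zeta>)) - int n"
proof -
  let ?P = "pushed r \<epsilon> s"
  have n\<gamma>: "norm (\<gamma> z) = r" if "cmod z = 1" for z using \<sigma>[of z] \<gamma>[OF that] that by simp
  have push\<gamma>: "push r \<epsilon> s (\<gamma> z) = ?P (\<gamma> z)" if "cmod z = 1" for z
    using n\<gamma>[OF that] r by (simp add: push_def radial_sphere)
  have nz0: "F (\<sigma> z) - push r \<epsilon> s (F (\<sigma> w)) \<noteq> 0" if zw: "cmod z \<le> 1" "cmod w \<le> 1" "max (cmod z) (cmod w) = 1" for z w
  proof
    assume 0: "F (\<sigma> z) - push r \<epsilon> s (F (\<sigma> w)) = 0"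
    show False
    proof (rule pushed_difference_nonzero[OF r s, of "\<sigma> z" "\<sigma> w" 0 \<epsilon> \<omega>])
      show "max (norm (F (\<sigma> z))) (norm (F (\<sigma> w))) = r"
        using \<sigma>[OF zw(1)] \<sigma>[OF zw(2)] zw(3) r by (auto simp: max_def split: if_splits)
    qed (use 0 \<sigma>[OF zw(1)] \<sigma>[OF zw(2)] \<epsilon> small small2 \<omega> in \<open>simp_all add: herm_simps cdet_simps\<close>)
  qed
  show disj: "\<gamma> z \<noteq> ?P (\<gamma> w)" if "cmod z = 1" "cmod w = 1" for z w
    using nz0[of z w] that push\<gamma>[OF that(2)] \<gamma>[OF that(1)] \<gamma>[OF that(2)] by auto
  have F\<sigma>c: "continuous_on (cball 0 1) (\<lambda>z. F (\<sigma> z))"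
    by (rule continuous_on_compose2[OF contF \<sigma>c]) (use \<sigma> in auto)
  have "continuous_on (sphere 0 1) (\<lambda>z. F (\<sigma> z))"
    by (rule continuous_on_subset[OF F\<sigma>c]) auto
  then show \<gamma>c: "continuous_on (sphere 0 1) \<gamma>"
    by (rule continuous_on_eq) (simp add: \<gamma>)
  have "continuous_on (sphere 0 1) (\<lambda>z. ?P (\<gamma> z))"
    by (rule continuous_on_compose2[OF continuous_on_pushed[OF r s \<epsilon>] \<gamma>c]) (auto simp: n\<gamma>)
  then show P\<gamma>c: "continuous_on (sphere 0 1) (?P \<circ> \<gamma>)" by (simp add: o_def)
  have nP: "norm (?P (\<gamma> z)) = r" if "cmod z = 1" for z
    by (rule pushed_norm(2)[OF r s n\<gamma>[OF that] \<epsilon>])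
  have nr: "norm (radial 1 \<gamma> z) = r * cmod z" "norm (radial 1 (?P \<circ> \<gamma>) z) = r * cmod z" for z
    using n\<gamma>[of "sgn z"] nP[of "sgn z"] by (cases "z = 0"; simp add: radial_def norm_sgn)+
  show nz1: "radial 1 \<gamma> (x $ 1) \<noteq> radial 1 (?P \<circ> \<gamma>) (x $ 2)" if x: "x \<in> S3" for x
  proof
    assume eq: "radial 1 \<gamma> (x $ 1) = radial 1 (?P \<circ> \<gamma>) (x $ 2)"
    then have "r * cmod (x $ 1) = r * cmod (x $ 2)" using nr by metis
    then have c: "cmod (x $ 1) = cmod (x $ 2)" using r by simp
    then have n0: "x $ 1 \<noteq> 0" "x $ 2 \<noteq> 0" using S3_nonzero[OF x] by auto
    then have "\<gamma> (sgn (x $ 1)) = ?P (\<gamma> (sgn (x $ 2)))" using eq c by (simp add: radial_def)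
    then show False using disj[of "sgn (x $ 1)" "sgn (x $ 2)"] n0 by (simp add: norm_sgn)
  qed
  \<comment> \<open>The 3-sphere is moved to the boundary of the bidisc: both coordinates lie in the
    closed unit disc, where \<sigma> is controlled, and at least one lies on the circle.\<close>
  define m where "m x = max (cmod (x $ 1)) (cmod (x $ 2))" for x :: "complex^2"
  have m: "m x > 0" if "x \<in> S3" for x using S3_nonzero[OF that] by (auto simp: m_def less_max_iff_disj)
  have mc: "continuous_on S3 m" unfolding m_def by (intro continuous_intros)
  define a where "a x = x $ 1 / of_real (m x)" for x
  define b where "b x = x $ 2 / of_real (m x)" for x
  have ab: "cmod (a x) \<le> 1" "cmod (b x) \<le> 1" "max (cmod (a x)) (cmod (b x)) = 1"
    "x $ 1 = of_real (m x) * a x" "x $ 2 = of_real (m x) * b x" if "x \<in> S3" for x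
  proof -
    note mx = m[OF that]
    have "cmod (a x) = cmod (x $ 1) / m x" "cmod (b x) = cmod (x $ 2) / m x" using mx by (simp_all add: a_def b_def norm_divide)
    moreover have "cmod (x $ 1) \<le> m x" "cmod (x $ 2) \<le> m x" by (auto simp: m_def)
    moreover have "cmod (x $ 1) = m x \<or> cmod (x $ 2) = m x" by (auto simp: m_def max_def)
    ultimately show "cmod (a x) \<le> 1" "cmod (b x) \<le> 1" "max (cmod (a x)) (cmod (b x)) = 1" using mx by (auto simp: max_def)
    show "x $ 1 = of_real (m x) * a x" "x $ 2 = of_real (m x) * b x" using mx by (simp_all add: a_def b_def)
  qed
  define X where "X x = \<sigma> (a x)" for x
  define Y where "Y x = \<sigma> (b x)" for x
  have abc: "continuous_on S3 a" "continuous_on S3 b"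
    unfolding a_def b_def using m by (intro continuous_intros mc; force)+
  have XYc: "continuous_on S3 X" "continuous_on S3 Y"
    unfolding X_def Y_def by (rule continuous_on_compose2[OF \<sigma>c abc(1)] continuous_on_compose2[OF \<sigma>c abc(2)]; use ab in auto)+
  have XY: "cmod (X x) < \<delta>" "cmod (Y x) < \<delta>" "max (norm (F (X x))) (norm (F (Y x))) = r" if "x \<in> S3" for x
  proof -
    show "cmod (X x) < \<delta>" "cmod (Y x) < \<delta>" using \<sigma> ab[OF that] by (auto simp: X_def Y_def)
    have "norm (F (X x)) = r * cmod (a x)" "norm (F (Y x)) = r * cmod (b x)" using \<sigma> ab[OF that] by (auto simp: X_def Y_def)
    then show "max (norm (F (X x))) (norm (F (Y x))) = r" using ab(3)[OF that] r by (auto simp: max_def split: if_splits)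
  qed
  have Xl: "\<exists>l>0. X x = of_real l * x $ 1" and Yl: "\<exists>l>0. Y x = of_real l * x $ 2" if x: "x \<in> S3" for x
  proof -
    obtain l l' where l: "l > 0" "X x = of_real l * a x" "l' > 0" "Y x = of_real l' * b x"
      using \<sigma>[OF ab(1)[OF x]] \<sigma>[OF ab(2)[OF x]] unfolding X_def Y_def by blast
    show "\<exists>l>0. X x = of_real l * x $ 1" using l m[OF x] by (intro exI[of _ "l / m x"]) (simp add: a_def)
    show "\<exists>l>0. Y x = of_real l * x $ 2" using l m[OF x] by (intro exI[of _ "l' / m x"]) (simp add: b_def)
  qed
  define \<Phi>0 where "\<Phi>0 x = radial 1 \<gamma> (x $ 1) - radial 1 (?P \<circ> \<gamma>) (x $ 2)" for x :: "complex^2"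
  define \<Phi> where "\<Phi> x = F (X x) - push r \<epsilon> s (F (Y x))" for x :: "complex^2"
  have FXc: "continuous_on S3 (\<lambda>x. F (X x))" "continuous_on S3 (\<lambda>x. F (Y x))"
    by (rule continuous_on_compose2[OF contF XYc(1)] continuous_on_compose2[OF contF XYc(2)]; use XY in auto)+
  have pushc: "continuous_on UNIV (push r \<epsilon> s)"
    unfolding push_def by (rule continuous_on_radial[OF r(1) continuous_on_pushed[OF r s \<epsilon>]])
  have \<Phi>c: "continuous_on S3 \<Phi>"
    unfolding \<Phi>_def by (intro continuous_intros FXc continuous_on_compose2[OF pushc FXc(2)]) auto
  have \<Phi>0c: "continuous_on S3 \<Phi>0"
    unfolding \<Phi>0_def
    by (intro continuous_intros continuous_on_compose2[OF continuous_on_radial[OF _ \<gamma>c, of UNIV]]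
        continuous_on_compose2[OF continuous_on_radial[OF _ P\<gamma>c, of UNIV]]) auto
  \<comment> \<open>A zero is excluded by norms: a coordinate on the circle gives norm exactly
    \<open>C * r\<close>, a coordinate inside the disc a smaller one. If both lie on the circle, the
    deformation only rescales, and the two curves are disjoint.\<close>
  have step1: "deg2 (\<lambda>x. \<Phi>0 x $ 1) (\<lambda>x. \<Phi>0 x $ 2) = deg2 (\<lambda>x. \<Phi> x $ 1) (\<lambda>x. \<Phi> x $ 2)"
  proof (rule deg2_linear_vec[OF \<Phi>0c \<Phi>c])
    fix t :: real and x assume t: "0 \<le> t" "t \<le> 1" and x: "x \<in> S3"
    note abx = ab[OF x] and mx = m[OF x]
    define C where "C = (1 - t) * m x + t"
    have C: "C > 0" using t mx unfolding C_def by (cases "t = 0") (auto intro: add_nonneg_pos)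
    have sgnu: "sgn (x $ 1) = a x" if "cmod (a x) = 1"
      unfolding abx(4) sgn_mult using that mx by (simp add: sgn_of_real sgn_div_norm[of "a x"])
    have sgnv: "sgn (x $ 2) = b x" if "cmod (b x) = 1"
      unfolding abx(5) sgn_mult using that mx by (simp add: sgn_of_real sgn_div_norm[of "b x"])
    define L1 where "L1 = (1 - t) *\<^sub>R radial 1 \<gamma> (x $ 1) + t *\<^sub>R F (X x)"
    define L2 where "L2 = (1 - t) *\<^sub>R radial 1 (?P \<circ> \<gamma>) (x $ 2) + t *\<^sub>R push r \<epsilon> s (F (Y x))"
    have L1: "L1 = C *\<^sub>R \<gamma> (a x)" if "cmod (a x) = 1"
    proof -
      have "cmod (x $ 1) = m x" using that mx by (simp add: abx(4) norm_mult)
      then show ?thesis using that unfolding L1_def C_def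
        by (simp add: radial_def sgnu[OF that] X_def \<gamma>[OF that, symmetric] scaleR_add_left)
    qed
    have L2: "L2 = C *\<^sub>R ?P (\<gamma> (b x))" if "cmod (b x) = 1"
    proof -
      have "cmod (x $ 2) = m x" using that mx by (simp add: abx(5) norm_mult)
      then show ?thesis using that unfolding L2_def C_def
        by (simp add: radial_def sgnv[OF that] Y_def \<gamma>[OF that, symmetric] push\<gamma> scaleR_add_left)
    qed
    have L1_le: "norm L1 \<le> C * r * cmod (a x)"
    proof -
      have "norm L1 \<le> (1 - t) * (r * cmod (x $ 1)) + t * (r * cmod (a x))"
        using t \<sigma>[OF abx(1)] unfolding L1_def by (intro order_trans[OF norm_triangle_ineq]) (simp add: nr X_def)
      also have "\<dots> = C * r * cmod (a x)" using mx by (simp add: abx(4) norm_mult C_def algebra_simps)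
      finally show ?thesis .
    qed
    have L2_le: "norm L2 \<le> C * r * cmod (b x)"
    proof -
      have "norm L2 \<le> (1 - t) * (r * cmod (x $ 2)) + t * (r * cmod (b x))"
        using t \<sigma>[OF abx(2)] unfolding L2_def by (intro order_trans[OF norm_triangle_ineq]) (simp add: nr Y_def push_norm[OF r s \<epsilon>])
      also have "\<dots> = C * r * cmod (b x)" using mx by (simp add: abx(5) norm_mult C_def algebra_simps)
      finally show ?thesis .
    qed
    have "L1 \<noteq> L2"
    proof
      assume eq: "L1 = L2"
      have "cmod (a x) = 1 \<or> cmod (b x) = 1" using abx(3) by (auto simp: max_def split: if_splits)
      then consider "cmod (a x) = 1" "cmod (b x) = 1" | "cmod (a x) = 1" "cmod (b x) < 1" | "cmod (a x) < 1" "cmod (b x) = 1"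
        using abx(1,2) by (auto simp: order_le_less)
      then show False
      proof cases
        case 1
        then show False using eq L1 L2 C disj[of "a x" "b x"] by simp
      next
        case 2
        have "norm L1 = C * r" using L1[OF 2(1)] n\<gamma>[OF 2(1)] C by simp
        moreover have "norm L2 < C * r" using order_le_less_trans[OF L2_le mult_strict_left_mono[OF 2(2), of "C * r"]] C r by simp
        ultimately show False using eq by simp
      next
        case 3
        have "norm L2 = C * r" using L2[OF 3(2)] nP[OF 3(2)] C by simp
        moreover have "norm L1 < C * r" using order_le_less_trans[OF L1_le mult_strict_left_mono[OF 3(1), of "C * r"]] C r by simp
        ultimately show False using eq by simp
      qed
    qed
    moreover have "(1 - t) *\<^sub>R \<Phi>0 x + t *\<^sub>R \<Phi> x = L1 - L2"
      by (simp add: \<Phi>0_def \<Phi>_def L1_def L2_def algebra_simps)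
    ultimately show "(1 - t) *\<^sub>R \<Phi>0 x + t *\<^sub>R \<Phi> x \<noteq> 0" by simp
  qed
  have \<Phi>nz: "\<Phi> x \<noteq> 0" if "x \<in> S3" for x
    unfolding \<Phi>_def X_def Y_def by (rule nz0[OF ab(1-3)[OF that]])
  have step2: "deg2 (\<lambda>x. \<Phi> x $ 1) (\<lambda>x. \<Phi> x $ 2) = deg2 (\<lambda>x. herm v (\<Phi> x)) (\<lambda>x. cdet v (\<Phi> x))"
    by (rule deg2_herm_cdet[symmetric, OF v \<Phi>c \<Phi>nz])
  define C where "C x = cdet v (\<Phi> x)" for x
  have Cc: "continuous_on S3 C" unfolding C_def by (intro continuous_intros \<Phi>c)
  define A where "A x = X x ^ n - Y x ^ n" for x
  have Ac: "continuous_on S3 A" unfolding A_def by (intro continuous_intros XYc)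
  \<comment> \<open>For all \<open>t\<close> this admits the deformation of the first component;
    \<open>t = 1\<close> shows that the second has no zero where the difference of the powers
    vanishes.\<close>
  have nzt: "C x \<noteq> 0" if x: "x \<in> S3" and t: "0 \<le> t" "t \<le> 1"
    and 0: "(1 - of_real t) * herm v (\<Phi> x) + of_real t * (of_real ((norm v)\<^sup>2) * A x) = 0" for x t
    using pushed_difference_nonzero[OF r s XY[OF x] t \<epsilon> small \<omega> small2] 0 unfolding C_def \<Phi>_def A_def by blast
  have step3: "deg2 (\<lambda>x. herm v (\<Phi> x)) C = deg2 (\<lambda>x. of_real ((norm v)\<^sup>2) * A x) C"
  proof (rule deg2_linear)
    show "(1 - of_real t) * C x + of_real t * C x \<noteq> 0" if "0 \<le> t" "t \<le> 1" "x \<in> S3"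
      "(1 - of_real t) * herm v (\<Phi> x) + of_real t * (of_real ((norm v)\<^sup>2) * A x) = 0" for t x
      using nzt[OF that(3,1,2,4)] by (simp add: algebra_simps)
  qed (intro continuous_intros \<Phi>c Cc Ac)+
  have nzA: "C x \<noteq> 0" if "x \<in> S3" "A x = 0" for x using nzt[OF that(1), of 1] that(2) by simp
  have step4: "deg2 (\<lambda>x. of_real ((norm v)\<^sup>2) * A x) C = deg2 A C"
  proof (rule deg2_linear)
    fix t :: real and x assume t: "0 \<le> t" "t \<le> 1" and x: "x \<in> S3" and 0: "(1 - of_real t) * (of_real ((norm v)\<^sup>2) * A x) + of_real t * A x = 0"
    have "of_real ((1 - t) * (norm v)\<^sup>2 + t) * A x = 0" using 0 by (simp add: algebra_simps)
    moreover have "(1 - t) * (norm v)\<^sup>2 + t > 0" using t norm_v_pos by (cases "t = 0") (auto intro: add_nonneg_pos)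
    ultimately have "A x = 0" by (metis mult_eq_0_iff of_real_eq_0_iff less_irrefl)
    then show "(1 - of_real t) * C x + of_real t * C x \<noteq> 0" using nzA[OF x] by (simp add: algebra_simps)
  qed (intro continuous_intros Cc Ac)+
  let ?R = "{\<zeta>::complex. \<zeta> ^ n = 1}"
  have Aprod: "A x = (\<Prod>\<zeta>\<in>?R. X x - \<zeta> * Y x)" for x
    unfolding A_def by (rule prod_roots_of_unity[OF n_ge_1, symmetric])
  have fin: "finite ?R" by (rule finite_roots_unity[OF n_ge_1])
  have nzr: "C x \<noteq> 0" if "\<zeta> \<in> ?R" "x \<in> S3" "X x - \<zeta> * Y x = 0" for \<zeta> x
    using nzA[OF that(2)] that fin unfolding Aprod by (auto simp: prod_zero_iff)
  have step5: "deg2 A C = (\<Sum>\<zeta>\<in>?R. deg2 (\<lambda>x. X x - \<zeta> * Y x) C)"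
    unfolding Aprod[abs_def] using fin Cc nzr by (intro deg2_prod continuous_intros XYc) auto
  \<comment> \<open>On the zeros of this factor the second component is
    \<open>c * Y x ^ q \<zeta>\<close> with an error of at most half its modulus: the expansion
    \<open>root\<close> and the displacement contribute a quarter each.\<close>
  have step6: "deg2 (\<lambda>x. X x - \<zeta> * Y x) C = int (q \<zeta>)" if \<zeta>: "\<zeta> ^ n = 1" "\<zeta> \<noteq> 1" for \<zeta>
  proof -
    define c where "c = cdet v (u \<zeta>)"
    have c: "4 * norm v * \<eta> \<le> cmod c" using u[OF \<zeta>] by (simp add: c_def)
    have c0: "c \<noteq> 0" using c norm_v_pos \<eta> by (auto simp: mult_le_0_iff)
    have q0: "q \<zeta> > 0" using q[OF \<zeta>] n by simp
    have "deg2 (\<lambda>x. X x - \<zeta> * Y x) C = deg2 (\<lambda>x. X x - \<zeta> * Y x) (\<lambda>x. c * Y x ^ q \<zeta>)"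
    proof (rule deg2_linear)
      fix t :: real and x assume t: "0 \<le> t" "t \<le> 1" and x: "x \<in> S3"
        and "(1 - of_real t) * (X x - \<zeta> * Y x) + of_real t * (X x - \<zeta> * Y x) = 0"
      then have Xe: "X x = \<zeta> * Y x" by (simp add: algebra_simps)
      note XYx = XY[OF x]
      have n\<zeta>: "cmod \<zeta> = 1" by (rule norm_root_of_unity[OF n_ge_1 \<zeta>(1)])
      have Y\<omega>: "cmod (Y x) \<ge> \<omega>"
      proof (cases "norm (F (Y x)) = r")
        case False
        then have "norm (F (X x)) = r" using XYx(3) by (auto simp: max_def split: if_splits)
        then show ?thesis using \<omega>(2)[OF XYx(1)] Xe n\<zeta> by (simp add: norm_mult)
      qed (use \<omega>(2)[OF XYx(2)] in simp)
      define W where "W = cmod (Y x) ^ q \<zeta>"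
      have W0: "W > 0" unfolding W_def using Y\<omega> \<omega>(1) by (intro zero_less_power) linarith
      define p where "p = push r \<epsilon> s (F (Y x)) - F (Y x)"
      have np: "norm p \<le> \<eta> * W"
      proof (cases "F (Y x) = 0")
        case True
        then show ?thesis using \<eta> W0 by (simp add: p_def push_def)
      next
        case False
        define y where "y = r *\<^sub>R sgn (F (Y x))"
        have y: "norm y = r" using False r by (simp add: y_def norm_sgn)
        obtain b \<xi> where b: "b > 0" "norm \<xi> \<le> norm (s y) / 20" "p = b *\<^sub>R (s y + \<xi>)" "b \<le> norm (F (Y x)) / r * \<epsilon>"
          using push_difference[OF r s XYx(2) False \<epsilon> small] unfolding p_def y_def by metis
        have "norm (F (Y x)) / r \<le> 1" using XYx(3) r by simp
        then have "b \<le> \<epsilon>" using b(4) \<epsilon> mult_right_mono[of "norm (F (Y x)) / r" 1 \<epsilon>] by simp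
        then have "norm p \<le> \<epsilon> * (norm (s y) + norm \<xi>)"
          using b by (simp add: mult_mono norm_triangle_ineq)
        also have "\<dots> \<le> \<epsilon> * (2 * norm (s y))" using b(2) \<epsilon> by (intro mult_left_mono) (use norm_ge_zero[of "s y"] in linarith)+
        also have "\<dots> \<le> \<eta> * (\<omega> / 3) ^ q \<zeta>" using small2[OF y \<zeta>] by simp
        also have "\<dots> \<le> \<eta> * W" unfolding W_def using \<eta> \<omega> Y\<omega> by (intro mult_left_mono power_mono) auto
        finally show ?thesis .
      qed
      define B where "B = F (\<zeta> * Y x) - F (Y x) - Y x ^ q \<zeta> *s u \<zeta>"
      have nB: "norm B \<le> \<eta> * W" using root[OF \<zeta> XYx(2)] by (simp add: B_def W_def)
      have "C x = c * Y x ^ q \<zeta> + cdet v (B - p)"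
        unfolding C_def \<Phi>_def Xe B_def p_def c_def cdet_simps by simp
      then have eq: "(1 - of_real t) * C x + of_real t * (c * Y x ^ q \<zeta>) = c * Y x ^ q \<zeta> + (1 - of_real t) * cdet v (B - p)"
        by (simp add: algebra_simps)
      have "norm (B - p) \<le> 2 * \<eta> * W" using norm_triangle_ineq4[of B p] nB np by simp
      then have "cmod (cdet v (B - p)) \<le> norm v * (2 * \<eta> * W)" by (intro order_trans[OF norm_cdet_le] mult_left_mono) auto
      moreover have "cmod (1 - of_real t) \<le> 1"
      proof -
        have "1 - complex_of_real t = of_real (1 - t)" by simp
        then show ?thesis using t by (simp only: norm_of_real)
      qed
      ultimately have "cmod ((1 - of_real t) * cdet v (B - p)) \<le> 1 * (norm v * (2 * \<eta> * W))"
        unfolding norm_mult by (intro mult_mono) auto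
      moreover have "(4 * norm v * \<eta>) * W \<le> cmod (c * Y x ^ q \<zeta>)"
        unfolding norm_mult norm_power W_def[symmetric] using c W0 by (intro mult_right_mono) auto
      moreover have "norm v * \<eta> * W > 0" using norm_v_pos \<eta> W0 by simp
      ultimately have "cmod ((1 - of_real t) * cdet v (B - p)) < cmod (c * Y x ^ q \<zeta>)" by (simp add: algebra_simps)
      then show "(1 - of_real t) * C x + of_real t * (c * Y x ^ q \<zeta>) \<noteq> 0"
        unfolding eq by (metis add_eq_0_iff less_irrefl norm_minus_cancel)
    qed (intro continuous_intros XYc Cc)+
    also have "\<dots> = deg2 (\<lambda>x. x $ 1) (\<lambda>x. c * (x $ 2) ^ q \<zeta>)"
      using exp_scale_nonzero[OF c0]
      by (intro deg2_rescale[where f = "\<lambda>y. c * y ^ q \<zeta>"] XYc Xl Yl continuous_intros) auto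
    also have "\<dots> = deg2 (\<lambda>x. x $ 1) (\<lambda>x. (x $ 2) ^ q \<zeta>)"
      using S3_nonzero by (intro deg2_const_mult_right c0 continuous_intros) auto
    finally show ?thesis by (simp add: deg2_fst_power)
  qed
  \<comment> \<open>Here the two branch values cancel and only the displacement is left.
    \<open>root_degree_1\<close> replaces it by a conjugate power times the determinant, and the
    logarithm removes the determinant.\<close>
  have step7: "deg2 (\<lambda>x. X x - 1 * Y x) C = - int n"
  proof -
    obtain l where l: "continuous_on UNIV l" "\<And>x. norm x = r \<Longrightarrow> exp (l x) = cdet x (s x)"
      using section_log[OF r s] by blast
    have lc: "continuous_on S3 (\<lambda>x. l (F (Y x)))" by (rule continuous_on_compose2[OF l(1) FXc(2)]) auto
    have Yr: "norm (F (Y x)) = r" if "x \<in> S3" "X x = Y x" for x using XY(3)[OF that(1)] that(2) by simp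
    have "deg2 (\<lambda>x. X x - 1 * Y x) C = deg2 (\<lambda>x. X x - 1 * Y x) (\<lambda>x. - (cnj (Y x) ^ n * exp (l (F (Y x)))))"
    proof (rule deg2_linear)
      fix t :: real and x assume t: "0 \<le> t" "t \<le> 1" and x: "x \<in> S3"
        and "(1 - of_real t) * (X x - 1 * Y x) + of_real t * (X x - 1 * Y x) = 0"
      then have Xe: "X x = Y x" by (simp add: algebra_simps)
      show "(1 - of_real t) * C x + of_real t * (- (cnj (Y x) ^ n * exp (l (F (Y x))))) \<noteq> 0"
        using root_degree_1[OF r s \<epsilon> small XY(2)[OF x] Yr[OF x Xe] t] l(2)[OF Yr[OF x Xe]]
        by (simp add: C_def \<Phi>_def Xe)
    qed (intro continuous_intros XYc Cc lc)+
    also have "\<dots> = deg2 (\<lambda>x. X x - 1 * Y x) (\<lambda>x. - 1 * cnj (Y x) ^ n)"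
    proof -
      have "deg2 (\<lambda>x. X x - 1 * Y x) (\<lambda>x. - (cnj (Y x) ^ n * exp ((1 - of_real 0) * l (F (Y x))))) =
        deg2 (\<lambda>x. X x - 1 * Y x) (\<lambda>x. - (cnj (Y x) ^ n * exp ((1 - of_real 1) * l (F (Y x)))))"
      proof (rule deg2_homotopy)
        show "X x - 1 * Y x \<noteq> 0 \<or> - (cnj (Y x) ^ n * exp ((1 - of_real t) * l (F (Y x)))) \<noteq> 0" if "x \<in> S3" for t x
          using Yr[OF that] F_0 r by auto
      qed (intro continuous_intros continuous_on_compose2[OF XYc(1)] continuous_on_compose2[OF XYc(2)] continuous_on_compose2[OF lc]; auto)+
      then show ?thesis by simp
    qed
    also have "\<dots> = deg2 (\<lambda>x. x $ 1) (\<lambda>x. - 1 * cnj (x $ 2) ^ n)"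
    proof (rule deg2_rescale[where f = "\<lambda>y. - 1 * cnj y ^ n"])
      show "(1 - of_real t) * (- 1 * cnj (of_real l * y) ^ n) + of_real t * (- 1 * cnj y ^ n) \<noteq> 0"
        if "y \<noteq> 0" "l > 0" "0 \<le> t" "t \<le> 1" for y l t
        using exp_scale_nonzero[of "-1" "cnj y" l t n] that by simp
    qed (intro XYc Xl Yl continuous_intros; assumption)+
    also have "\<dots> = deg2 (\<lambda>x. x $ 1) (\<lambda>x. cnj (x $ 2) ^ n)"
      using S3_nonzero by (intro deg2_const_mult_right continuous_intros) auto
    finally show ?thesis by (simp add: deg2_fst_cnj_power)
  qed
  have "linking_number \<gamma> (?P \<circ> \<gamma>) = deg2 A C"
    using step1 step2 step3 step4 by (simp add: linking_number_deg2 \<Phi>0_def C_def[abs_def])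
  also have "\<dots> = deg2 (\<lambda>x. X x - 1 * Y x) C + (\<Sum>\<zeta>\<in>?R - {1}. deg2 (\<lambda>x. X x - \<zeta> * Y x) C)"
    unfolding step5 by (rule sum.remove[OF fin]) simp
  also have "(\<Sum>\<zeta>\<in>?R - {1}. deg2 (\<lambda>x. X x - \<zeta> * Y x) C) = (\<Sum>\<zeta>\<in>?R - {1}. int (q \<zeta>))"
    by (intro sum.cong) (auto simp: step6)
  finally show "linking_number \<gamma> (?P \<circ> \<gamma>) = (\<Sum>\<zeta>\<in>?R - {1}. int (q \<zeta>)) - int n"
    unfolding step7 by linarith
qed

section \<open>The branch inside small balls: rays, polar coordinates, transversality\<close>

lemma norm_F_strict_mono:
  assumes z: "cmod z = 1" and \<rho>: "0 \<le> a" "a < b" "b < \<delta>"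
  shows "norm (F (of_real a * z)) < norm (F (of_real b * z))"
proof -
  define g where "g t = F (of_real t * z) \<bullet> F (of_real t * z)" for t
  have d: "(g has_real_derivative 2 * (F (of_real t * z) \<bullet> F' (of_real t * z) z)) (at t)" if t: "0 \<le> t" "t < \<delta>" for t
  proof -
    have tz: "cmod (of_real t * z) < \<delta>" using t z by (simp add: norm_mult)
    have "((\<lambda>t. of_real t * z) has_derivative (\<lambda>h. of_real h * z)) (at t)"
      by (auto intro!: derivative_eq_intros)
    from diff_chain_at[OF this der[OF tz]]
    have "((\<lambda>t. F (of_real t * z)) has_derivative (\<lambda>h. h *\<^sub>R F' (of_real t * z) z)) (at t)"
      by (simp add: o_def scaleR_conv_of_real[of _ z, symmetric] blinfun.scaleR_right)
    from has_derivative_inner[OF this this] show ?thesis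
      unfolding g_def has_field_derivative_def
      by (rule has_derivative_eq_rhs) (simp add: fun_eq_iff inner_commute)
  qed
  have "g a < g b"
  proof (rule DERIV_pos_imp_increasing_open[OF \<rho>(2)])
    fix t assume t: "a < t" "t < b"
    have "sgn (of_real t * z) = z" using t \<rho> z by (simp add: sgn_mult sgn_of_real sgn_div_norm[of z])
    moreover have "F (of_real t * z) \<bullet> F' (of_real t * z) (sgn (of_real t * z)) > 0"
      using t \<rho> z by (intro radial_derivative_pos) (auto simp: norm_mult)
    ultimately show "\<exists>y. (g has_real_derivative y) (at t) \<and> 0 < y"
      using d[of t] t \<rho> by (intro exI[of _ "2 * (F (of_real t * z) \<bullet> F' (of_real t * z) z)"]) auto
  next
    show "continuous_on {a..b} g"
      using \<rho> by (intro continuous_at_imp_continuous_on ballI) (auto intro!: DERIV_isCont[OF d])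
  qed
  then show ?thesis by (simp add: g_def norm_lt)
qed

lemma same_ray_eq:
  assumes "cmod z < \<delta>" "cmod w < \<delta>" "sgn z = sgn w" "z \<noteq> 0" "norm (F z) = norm (F w)"
  shows "z = w"
proof -
  have polar: "a = of_real (cmod a) * sgn a" for a :: complex
    by (cases "a = 0") (simp_all add: sgn_div_norm scaleR_conv_of_real)
  have z: "of_real (cmod z) * sgn z = z" and w: "of_real (cmod w) * sgn z = w"
    using polar[of z] polar[of w] assms(3) by simp_all
  have s: "cmod (sgn z) = 1" using assms(4) by (simp add: norm_sgn)
  have "\<not> cmod z < cmod w" "\<not> cmod w < cmod z"
    using norm_F_strict_mono[OF s norm_ge_zero, of z "cmod w"] norm_F_strict_mono[OF s norm_ge_zero, of w "cmod z"] assms(1,2,5)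
    unfolding z w by auto
  then have eq: "cmod z = cmod w" by simp
  show ?thesis using z w unfolding eq by (rule trans[OF sym])
qed

text \<open>\<open>\<Psi>\<close> preserves rays and takes the norm of the branch as the new radius.
  It is injective because this norm grows along rays, hence a homeomorphism from a compact disc onto
  its image; \<sigma> is its inverse after scaling by \<open>r\<close>. The bound on
  \<open>r\<close> puts the disc of radius \<open>r\<close> inside the image.\<close>

lemma polar_reparametrization:
  assumes r: "0 < r" "r < 15/16 * norm v * (\<delta> / 2) ^ n"
  obtains \<sigma> where "continuous_on (cball 0 1) \<sigma>"
    "\<And>z. cmod z \<le> 1 \<Longrightarrow> cmod (\<sigma> z) < \<delta> \<and> norm (F (\<sigma> z)) = r * cmod z \<and> (\<exists>l>0. \<sigma> z = of_real l * z)"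
    "\<And>Z. cmod Z < \<delta> \<Longrightarrow> norm (F Z) = r \<Longrightarrow> Z = \<sigma> (sgn Z)"
proof -
  define \<Psi> where "\<Psi> z = norm (F z) *\<^sub>R sgn z" for z
  let ?B = "cball (0::complex) (\<delta> / 2)"
  have F0: "F z = 0 \<longleftrightarrow> z = 0" if "cmod z < \<delta>" for z
    using F_injective[OF that, of 0] \<delta> F_0 by auto
  have n\<Psi>: "norm (\<Psi> z) = norm (F z)" for z
    by (cases "z = 0") (simp_all add: \<Psi>_def norm_sgn F_0)
  have iF: "isCont F z" if "cmod z < \<delta>" for z using has_derivative_continuous[OF der[OF that]] .
  have "isCont \<Psi> z" if z: "cmod z < \<delta>" for z
  proof (cases "z = 0")
    case True
    have "((\<lambda>z. norm (F z)) \<longlongrightarrow> norm (F 0)) (at 0)" using iF[of 0] \<delta> by (intro tendsto_norm) (simp add: isCont_def)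
    then have "((\<lambda>z. norm (\<Psi> z)) \<longlongrightarrow> 0) (at 0)" by (simp add: n\<Psi> F_0)
    then have "(\<Psi> \<longlongrightarrow> 0) (at 0)" by (rule tendsto_norm_zero_cancel)
    then show ?thesis using True by (simp add: isCont_def \<Psi>_def)
  next
    case False
    then show ?thesis unfolding \<Psi>_def using iF[OF z] by (intro continuous_intros) auto
  qed
  then have \<Psi>c: "continuous_on ?B \<Psi>" using \<delta> by (intro continuous_at_imp_continuous_on) auto
  have \<Psi>i: "z = w" if zw: "cmod z < \<delta>" "cmod w < \<delta>" "\<Psi> z = \<Psi> w" for z w
  proof -
    have nF: "norm (F z) = norm (F w)" using zw(3) n\<Psi> by metis
    show ?thesis
    proof (cases "z = 0")
      case True
      then show ?thesis using nF F0[OF zw(2)] F_0 by simp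
    next
      case False
      then have "sgn z = sgn w" using zw(3) nF F0[OF zw(1)] by (auto simp: \<Psi>_def)
      then show ?thesis using same_ray_eq zw False nF by blast
    qed
  qed
  then have "inj_on \<Psi> ?B" using \<delta> by (intro inj_onI) auto
  from homeomorphism_compact[OF compact_cball \<Psi>c refl this]
  obtain \<Psi>' where \<Psi>': "homeomorphism ?B (\<Psi> ` ?B) \<Psi> \<Psi>'" by blast
  have sub: "y \<in> \<Psi> ` ?B" if y: "cmod y \<le> r" for y
  proof (cases "y = 0")
    case True
    then show ?thesis using \<delta> by (intro image_eqI[of _ _ 0]) (auto simp: \<Psi>_def)
  next
    case False
    have c: "continuous_on {0..\<delta>/2} (\<lambda>t. norm (F (of_real t * sgn y)))"
      using False \<delta> by (intro continuous_intros continuous_on_compose2[OF contF]) (auto simp: norm_mult norm_sgn)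
    have "cmod (of_real (\<delta>/2) * sgn y) = \<delta> / 2" using False \<delta> by (simp only: norm_mult norm_of_real norm_sgn) simp
    then have "norm (F (of_real (\<delta>/2) * sgn y)) \<ge> cmod y"
      using norm_F_lower[of "of_real (\<delta>/2) * sgn y"] \<delta> r y by simp
    then obtain t where t: "0 \<le> t" "t \<le> \<delta>/2" "norm (F (of_real t * sgn y)) = cmod y"
      using IVT'[of "\<lambda>t. norm (F (of_real t * sgn y))" 0 "cmod y" "\<delta>/2"] c \<delta> F_0 by auto
    have "t \<noteq> 0" using t(3) False F_0 by auto
    then have "\<Psi> (of_real t * sgn y) = y" using t False by (simp add: \<Psi>_def sgn_mult sgn_of_real sgn_sgn) (simp add: sgn_div_norm)
    moreover have "of_real t * sgn y \<in> ?B" using t False by (simp add: norm_mult norm_sgn)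
    ultimately show ?thesis by force
  qed
  define \<sigma> where "\<sigma> z = \<Psi>' (r *\<^sub>R z)" for z
  have \<sigma>: "\<sigma> z \<in> ?B" "\<Psi> (\<sigma> z) = r *\<^sub>R z" if "cmod z \<le> 1" for z
  proof -
    have "r *\<^sub>R z \<in> \<Psi> ` ?B" using r that by (intro sub) simp
    then show "\<sigma> z \<in> ?B" "\<Psi> (\<sigma> z) = r *\<^sub>R z" using \<Psi>' unfolding \<sigma>_def homeomorphism_def by auto
  qed
  have \<sigma>\<delta>: "cmod (\<sigma> z) < \<delta>" if "cmod z \<le> 1" for z using \<sigma>(1)[OF that] \<delta> by simp
  have n\<sigma>: "norm (F (\<sigma> z)) = r * cmod z" if "cmod z \<le> 1" for z
    using n\<Psi>[of "\<sigma> z"] \<sigma>(2)[OF that] r by simp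
  have sg: "sgn (\<sigma> z) = sgn z" if "cmod z \<le> 1" for z
  proof -
    have "F (\<sigma> z) = 0 \<longleftrightarrow> z = 0" using n\<sigma>[OF that] r by auto
    moreover have "sgn (r *\<^sub>R z) = sgn (\<Psi> (\<sigma> z))" using \<sigma>(2)[OF that] by simp
    ultimately show ?thesis using r F0[OF \<sigma>\<delta>[OF that]] by (cases "z = 0") (auto simp: \<Psi>_def sgn_scaleR sgn_sgn)
  qed
  show thesis
  proof (rule that)
    have "continuous_on (\<Psi> ` ?B) \<Psi>'" using \<Psi>' by (simp add: homeomorphism_def)
    then show "continuous_on (cball 0 1) \<sigma>"
      unfolding \<sigma>_def
    proof (rule continuous_on_compose2)
      show "(\<lambda>z. r *\<^sub>R z) ` cball 0 1 \<subseteq> \<Psi> ` ?B"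
      proof (rule image_subsetI)
        fix z :: complex assume "z \<in> cball 0 1"
        then show "r *\<^sub>R z \<in> \<Psi> ` ?B" using r by (intro sub) simp
      qed
    qed (intro continuous_intros)
    show "cmod (\<sigma> z) < \<delta> \<and> norm (F (\<sigma> z)) = r * cmod z \<and> (\<exists>l>0. \<sigma> z = of_real l * z)" if z: "cmod z \<le> 1" for z
    proof (intro conjI \<sigma>\<delta>[OF z] n\<sigma>[OF z])
      show "\<exists>l>0. \<sigma> z = of_real l * z"
      proof (cases "z = 0")
        case True
        then have "\<sigma> z = 0" using n\<sigma>[OF z] F0[OF \<sigma>\<delta>[OF z]] by simp
        then show ?thesis using True by (intro exI[of _ 1]) simp
      next
        case False
        then have s0: "\<sigma> z \<noteq> 0" using sg[OF z] by (metis sgn_zero_iff)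
        have "\<sigma> z = of_real (cmod (\<sigma> z)) * sgn (\<sigma> z)" using s0 by (simp add: sgn_div_norm scaleR_conv_of_real)
        then have "\<sigma> z = of_real (cmod (\<sigma> z) / cmod z) * z"
          unfolding sg[OF z] by (simp add: sgn_div_norm scaleR_conv_of_real divide_inverse mult.assoc)
        then show ?thesis using s0 False by (intro exI[of _ "cmod (\<sigma> z) / cmod z"]) simp
      qed
    qed
    show "Z = \<sigma> (sgn Z)" if Z: "cmod Z < \<delta>" "norm (F Z) = r" for Z
    proof -
      have Z0: "Z \<noteq> 0" using Z r F_0 by auto
      then have s1: "cmod (sgn Z) = 1" by (simp add: norm_sgn)
      then show ?thesis
        using same_ray_eq[OF Z(1) \<sigma>\<delta>[of "sgn Z"]] sg[of "sgn Z"] n\<sigma>[of "sgn Z"] Z Z0 by (simp add: sgn_sgn)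
    qed
  qed
qed

lemma F'_J: "cmod z < \<delta> \<Longrightarrow> J (F z) (F' z h) = F' z (\<i> * h)"
proof -
  assume z: "cmod z < \<delta>"
  have 1: "F' z 1 = - J (F z) (F' z \<i>)" using hol[OF z] by (simp add: add_eq_0_iff)
  then have J1: "J (F z) (F' z 1) = F' z \<i>" using J2[OF z] by (simp add: blinfun.minus_right)
  have "h = Re h *\<^sub>R 1 + Im h *\<^sub>R \<i>" by (simp add: complex_eq_iff)
  then have "J (F z) (F' z h) = Re h *\<^sub>R F' z \<i> + Im h *\<^sub>R (- F' z 1)"
    using J1 1 by (metis blinfun.add_right blinfun.scaleR_right minus_minus)
  also have "\<dots> = F' z (Re h *\<^sub>R \<i> + Im h *\<^sub>R (- 1))"
    by (simp only: blinfun.add_right blinfun.scaleR_right blinfun.minus_right)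
  also have "Re h *\<^sub>R \<i> + Im h *\<^sub>R (- 1) = \<i> * h" by (simp add: complex_eq_iff)
  finally show ?thesis .
qed

text \<open>Otherwise this tangent vector and its image under \<open>J\<close> would both be tangent
  to the sphere. They span the image of the differential, so the radial derivative would be
  orthogonal to \<open>F z\<close>.\<close>

lemma not_in_plane_field:
  assumes z: "cmod z < \<delta>" "z \<noteq> 0" and h: "h \<noteq> 0"
  shows "F' z h \<notin> plane_field J (F z)"
proof
  assume "F' z h \<in> plane_field J (F z)"
  then obtain \<xi> where \<xi>: "F' z h \<bullet> F z = 0" "\<xi> \<bullet> F z = 0" "F' z h = J (F z) \<xi>"
    by (auto simp: plane_field_def sphere_tangent_def)
  have "F' z (\<i> * h) = - \<xi>" using F'_J[OF z(1), of h] J2[OF z(1)] \<xi>(3) by simp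
  then have 2: "F' z (\<i> * h) \<bullet> F z = 0" using \<xi>(2) by simp
  define k where "k = sgn z / h"
  have "sgn z = Re k *\<^sub>R h + Im k *\<^sub>R (\<i> * h)"
  proof -
    have "sgn z = k * h" using h by (simp add: k_def)
    then show ?thesis by (simp add: complex_eq_iff)
  qed
  then have "F' z (sgn z) = Re k *\<^sub>R F' z h + Im k *\<^sub>R F' z (\<i> * h)"
    by (simp add: blinfun.add_right blinfun.scaleR_right)
  then have "F z \<bullet> F' z (sgn z) = 0" using \<xi>(1) 2 by (simp add: inner_add_right inner_commute)
  then show False using radial_derivative_pos[OF z] by simp
qed

text \<open>\<sigma> is only given as continuous. On the circle it is
  \<open>\<rho> t * cis t\<close>, where the radius solves
  \<open>norm (F (\<rho> t * cis t)) = r\<close>, and the implicit function lemma makes this radius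
  continuously differentiable.\<close>

lemma transverse_boundary_curve:
  assumes r: "r > 0" and \<sigma>c: "continuous_on (cball 0 1) \<sigma>"
    and \<sigma>: "\<And>z. cmod z \<le> 1 \<Longrightarrow> cmod (\<sigma> z) < \<delta> \<and> norm (F (\<sigma> z)) = r * cmod z \<and> (\<exists>l>0. \<sigma> z = of_real l * z)"
    and \<sigma>s: "\<And>Z. cmod Z < \<delta> \<Longrightarrow> norm (F Z) = r \<Longrightarrow> Z = \<sigma> (sgn Z)"
  shows "transverse_parametrization J (F ` {z. cmod z < \<delta> \<and> norm (F z) = r}) (F \<circ> \<sigma>)"
  unfolding transverse_parametrization_def
proof (intro conjI)
  show "(F \<circ> \<sigma>) ` sphere 0 1 = F ` {z. cmod z < \<delta> \<and> norm (F z) = r}"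
  proof
    show "(F \<circ> \<sigma>) ` sphere 0 1 \<subseteq> F ` {z. cmod z < \<delta> \<and> norm (F z) = r}" using \<sigma> by auto
    show "F ` {z. cmod z < \<delta> \<and> norm (F z) = r} \<subseteq> (F \<circ> \<sigma>) ` sphere 0 1"
    proof clarify
      fix z assume z: "cmod z < \<delta>" "r = norm (F z)"
      then have "z \<noteq> 0" using r F_0 by auto
      then have "sgn z \<in> sphere 0 1" by (simp add: norm_sgn)
      moreover have "F z = (F \<circ> \<sigma>) (sgn z)" using \<sigma>s[OF z(1)] z(2) by simp
      ultimately show "F z \<in> (F \<circ> \<sigma>) ` sphere 0 1" by blast
    qed
  qed
  show "inj_on (F \<circ> \<sigma>) (sphere 0 1)"
  proof (rule inj_onI)
    fix z w :: complex assume zw: "z \<in> sphere 0 1" "w \<in> sphere 0 1" "(F \<circ> \<sigma>) z = (F \<circ> \<sigma>) w"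
    then have n: "cmod z = 1" "cmod w = 1" by auto
    then have "\<sigma> z = \<sigma> w" using zw(3) \<sigma>[of z] \<sigma>[of w] by (intro F_injective) auto
    moreover obtain l l' where "l > 0" "\<sigma> z = of_real l * z" "l' > 0" "\<sigma> w = of_real l' * w"
      using \<sigma>[of z] \<sigma>[of w] n by auto
    ultimately have "of_real l * z = of_real l' * w" by simp
    then have "sgn (of_real l * z) = sgn (of_real l' * w)" by simp
    then show "z = w" using \<open>l > 0\<close> \<open>l' > 0\<close> n by (simp add: sgn_mult sgn_of_real sgn_div_norm[of z] sgn_div_norm[of w])
  qed
  define \<rho> where "\<rho> t = cmod (\<sigma> (cis t))" for t
  have \<rho>: "\<sigma> (cis t) = of_real (\<rho> t) * cis t" "\<rho> t > 0" for t
  proof -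
    obtain l where "l > 0" "\<sigma> (cis t) = of_real l * cis t" using \<sigma>[of "cis t"] by auto
    then show "\<sigma> (cis t) = of_real (\<rho> t) * cis t" "\<rho> t > 0" by (simp_all add: \<rho>_def norm_mult)
  qed
  have \<sigma>\<delta>: "cmod (\<sigma> (cis t)) < \<delta>" for t using \<sigma>[of "cis t"] by simp
  have \<sigma>n: "norm (F (\<sigma> (cis t))) = r" for t using \<sigma>[of "cis t"] by simp
  have c\<sigma>: "continuous_on UNIV (\<lambda>t. \<sigma> (cis t))"
    by (rule continuous_on_compose2[OF \<sigma>c]) (auto intro!: continuous_intros)
  then have c\<rho>: "continuous_on UNIV \<rho>" unfolding \<rho>_def by (intro continuous_intros)
  \<comment> \<open>The partial derivatives of the squared norm of the branch with respect to the
    angle and to the radius.\<close>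
  define a where "a t = 2 * (F (\<sigma> (cis t)) \<bullet> F' (\<sigma> (cis t)) (\<i> * \<sigma> (cis t)))" for t
  define b where "b t = 2 * (F (\<sigma> (cis t)) \<bullet> F' (\<sigma> (cis t)) (cis t))" for t
  have b: "b t > 0" for t
  proof -
    have "sgn (\<sigma> (cis t)) = cis t" using \<rho>[of t] by (simp add: sgn_mult sgn_of_real sgn_div_norm[of "cis t"])
    moreover have "\<sigma> (cis t) \<noteq> 0" using \<rho>[of t] by simp
    ultimately show ?thesis using radial_derivative_pos[OF \<sigma>\<delta>[of t]] by (simp add: b_def)
  qed
  have cF: "continuous_on UNIV (\<lambda>t. F (\<sigma> (cis t)))" "continuous_on UNIV (\<lambda>t. F' (\<sigma> (cis t)))"
    using \<sigma>\<delta> by (auto intro!: continuous_on_compose2[OF contF c\<sigma>] continuous_on_compose2[OF cont c\<sigma>])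
  have cab: "continuous_on UNIV a" "continuous_on UNIV b"
    unfolding a_def b_def by (intro continuous_intros cF c\<sigma>)+
  have d\<rho>: "(\<rho> has_real_derivative - a t / b t) (at t)" for t
  proof (rule implicit_function_derivative)
    let ?p = "\<lambda>x::real \<times> real. of_real (snd x) * cis (fst x)"
    let ?N = "\<lambda>x. F (?p x) \<bullet> F (?p x)"
    have "(?p has_derivative (\<lambda>h. of_real (\<rho> t) * (fst h *\<^sub>R (\<i> * cis t)) + of_real (snd h) * cis t)) (at (t, \<rho> t))"
      by (auto intro!: derivative_eq_intros has_derivative_compose[OF _ has_derivative_cis] simp: fun_eq_iff)
    moreover have "?p (t, \<rho> t) = \<sigma> (cis t)" by (simp add: \<rho>)
    ultimately have "((\<lambda>x. F (?p x)) has_derivative (\<lambda>h. F' (\<sigma> (cis t)) (of_real (\<rho> t) * (fst h *\<^sub>R (\<i> * cis t)) + of_real (snd h) * cis t))) (at (t, \<rho> t))"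
      using has_derivative_compose[of ?p _ "(t, \<rho> t)" UNIV F "blinfun_apply (F' (\<sigma> (cis t)))"] der[OF \<sigma>\<delta>[of t]] by simp
    moreover have "of_real (\<rho> t) * (x *\<^sub>R (\<i> * cis t)) + of_real y * cis t = x *\<^sub>R (\<i> * \<sigma> (cis t)) + y *\<^sub>R cis t" for x y
      by (simp add: \<rho>(1) scaleR_conv_of_real[of _ "_ :: complex"])
    ultimately have D: "((\<lambda>x. F (?p x)) has_derivative (\<lambda>h. fst h *\<^sub>R F' (\<sigma> (cis t)) (\<i> * \<sigma> (cis t)) + snd h *\<^sub>R F' (\<sigma> (cis t)) (cis t))) (at (t, \<rho> t))"
      by (simp only: blinfun.add_right blinfun.scaleR_right)
    from has_derivative_inner[OF D D]
    show "(?N has_derivative (\<lambda>h. a t * fst h + b t * snd h)) (at (t, \<rho> t))"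
      by (rule has_derivative_eq_rhs)
        (simp add: fun_eq_iff a_def b_def \<rho>(1)[symmetric] inner_add_left inner_add_right inner_commute[of _ "F (\<sigma> (cis t))"])
    show "b t \<noteq> 0" using b[of t] by simp
    show "isCont \<rho> t" using c\<rho> by (simp add: continuous_on_eq_continuous_at)
    show "?N (x, \<rho> x) = r\<^sup>2" for x using \<sigma>n[of x] by (simp add: \<rho>(1)[symmetric] power2_norm_eq_inner[symmetric])
  qed
  \<comment> \<open>The velocity of \<open>\<sigma> (cis t)\<close>. Divided by \<open>cis t\<close>
    it has imaginary part \<open>\<rho> t\<close>, so it does not vanish.\<close>
  define h where "h t = of_real (- a t / b t) * cis t + \<i> * \<sigma> (cis t)" for t
  have h: "h t \<noteq> 0" for t
  proof -
    have "h t = cis t * Complex (- a t / b t) (\<rho> t)"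
      unfolding h_def \<rho>(1) by (simp add: complex_eq_iff)
    moreover have "Complex (- a t / b t) (\<rho> t) \<noteq> 0" using \<rho>(2)[of t] by (simp add: complex_eq_iff)
    ultimately show ?thesis by simp
  qed
  show "\<exists>\<gamma>'. continuous_on UNIV \<gamma>' \<and> (\<forall>t. ((\<lambda>t. (F \<circ> \<sigma>) (cis t)) has_vector_derivative \<gamma>' t) (at t) \<and>
      \<gamma>' t \<noteq> 0 \<and> \<gamma>' t \<notin> plane_field J ((F \<circ> \<sigma>) (cis t)))"
  proof (intro exI[of _ "\<lambda>t. F' (\<sigma> (cis t)) (h t)"] conjI allI)
    show "continuous_on UNIV (\<lambda>t. F' (\<sigma> (cis t)) (h t))"
      unfolding h_def using b by (intro continuous_intros cF c\<sigma> cab) (metis less_irrefl)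
    fix t
    have "((\<lambda>t. of_real (\<rho> t) * cis t) has_vector_derivative h t) (at t)"
      unfolding has_vector_derivative_def
      by (rule derivative_eq_intros has_derivative_compose[OF d\<rho>[unfolded has_field_derivative_def]] has_derivative_cis refl has_derivative_ident |
          simp add: fun_eq_iff h_def \<rho>(1) scaleR_conv_of_real[of _ "_ :: complex"] algebra_simps)+
    then have "((\<lambda>t. \<sigma> (cis t)) has_derivative (\<lambda>x. x *\<^sub>R h t)) (at t)"
      unfolding has_vector_derivative_def \<rho>(1)[symmetric] .
    from diff_chain_at[OF this der[OF \<sigma>\<delta>]]
    show "((\<lambda>t. (F \<circ> \<sigma>) (cis t)) has_vector_derivative F' (\<sigma> (cis t)) (h t)) (at t)"
      unfolding has_vector_derivative_def by (simp add: o_def blinfun.scaleR_right)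
    have "\<sigma> (cis t) \<noteq> 0" using \<rho>[of t] by simp
    from not_in_plane_field[OF \<sigma>\<delta> this h]
    show n: "F' (\<sigma> (cis t)) (h t) \<notin> plane_field J ((F \<circ> \<sigma>) (cis t))" by simp
    have "0 = J (F (\<sigma> (cis t))) 0" by simp
    then have "0 \<in> plane_field J ((F \<circ> \<sigma>) (cis t))" unfolding plane_field_def sphere_tangent_def by (auto intro!: image_eqI[of _ _ 0])
    with n show "F' (\<sigma> (cis t)) (h t) \<noteq> 0" by metis
  qed
qed

text \<open>The plane field at \<open>w\<close> is the kernel of the \<open>J\<close>-complex linear functional \<open>\<alpha> w\<close>. Subtracting a \<open>J\<close>-complex
  multiple of \<open>w\<close> moves the field \<open>s0\<close>, which lies in the plane field of the standard structure, into this kernel.\<close>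

lemma section_exists:
  assumes r: "0 < r" "r < e"
  shows "\<exists>s. nonvanishing_section J r s"
proof -
  define s0 :: "complex^2 \<Rightarrow> complex^2" where "s0 w = vector [- cnj (w $ 2), cnj (w $ 1)]" for w
  define \<alpha> where "\<alpha> w x = Complex (x \<bullet> w) (- (J w x \<bullet> w))" for w x
  define c where "c w = \<alpha> w (s0 w) / \<alpha> w w" for w
  define s where "s w = s0 w - (Re (c w) *\<^sub>R w + Im (c w) *\<^sub>R J w w)" for w
  have cJ: "continuous_on (sphere 0 r) J" by (rule continuous_on_subset[OF contJ]) (use r in auto)
  have cs0: "continuous_on (sphere 0 r) s0"
    unfolding s0_def by (intro continuous_on_vector2 continuous_intros)
  have c\<alpha>: "continuous_on (sphere 0 r) (\<lambda>w. \<alpha> w (f w))" if "continuous_on (sphere 0 r) f" for f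
    unfolding \<alpha>_def Complex_eq by (intro continuous_intros cJ that)
  have w: "\<alpha> w w \<noteq> 0" "s w \<noteq> 0" "s w \<in> plane_field J w" if "norm w = r" for w
  proof -
    have we: "norm w < e" using that r by simp
    have \<alpha>w: "Re (\<alpha> w w) = r\<^sup>2" using that by (simp add: \<alpha>_def power2_norm_eq_inner[symmetric])
    then show w0: "\<alpha> w w \<noteq> 0" using r by auto
    have le: "L * r \<le> 1/8" using e(2) L r mult_left_mono[of r e L] by simp
    have Jd: "norm ((J w - smult_blinfun \<i>) x) \<le> 1/8 * norm x" for x
    proof -
      have "norm ((J w - smult_blinfun \<i>) x) \<le> L * r * norm x"
        using Je[OF we] that by (intro order_trans[OF norm_blinfun] mult_right_mono) auto
      also have "\<dots> \<le> 1/8 * norm x" by (intro mult_right_mono le) simp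
      finally show ?thesis .
    qed
    have ns0: "norm (s0 w) = r"
      using that by (simp add: s0_def norm_vec_def L2_set_def sum_2 add.commute)
    have s0w: "s0 w \<bullet> w = 0" "(\<i> *s s0 w) \<bullet> w = 0"
      by (simp_all add: s0_def inner_vec_def sum_2 inner_complex_def algebra_simps)
    have "J w (s0 w) \<bullet> w = ((J w - smult_blinfun \<i>) (s0 w)) \<bullet> w"
      using s0w(2) by (simp add: blinfun.diff_left inner_diff_left)
    then have "\<bar>J w (s0 w) \<bullet> w\<bar> \<le> norm ((J w - smult_blinfun \<i>) (s0 w)) * norm w"
      using Cauchy_Schwarz_ineq2 by simp
    also have "\<dots> \<le> (1/8 * r) * r" using Jd[of "s0 w"] that ns0 r by (intro mult_mono) auto
    finally have "cmod (\<alpha> w (s0 w)) \<le> r\<^sup>2 / 8" using s0w(1) by (simp add: \<alpha>_def cmod_eq_Im power2_eq_square)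
    moreover have "r\<^sup>2 \<le> cmod (\<alpha> w w)" using complex_Re_le_cmod[of "\<alpha> w w"] \<alpha>w by simp
    ultimately have "cmod (\<alpha> w (s0 w)) \<le> 1/8 * cmod (\<alpha> w w)" by linarith
    then have c: "cmod (c w) \<le> 1/8" using w0 by (simp add: c_def norm_divide divide_simps)
    have "norm (J w w) \<le> norm (\<i> *s w) + norm ((J w - smult_blinfun \<i>) w)"
      using norm_triangle_ineq[of "\<i> *s w" "(J w - smult_blinfun \<i>) w"] by (simp add: blinfun.diff_left)
    then have JW: "norm (J w w) \<le> 9/8 * r" using Jd[of w] that by simp
    \<comment> \<open>The correction has norm at most \<open>(1/8 + 9/64) * r\<close>, whereas
      \<open>s0 w\<close> has norm \<open>r\<close>.\<close>
    show "s w \<noteq> 0"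
    proof
      assume "s w = 0"
      then have "s0 w = Re (c w) *\<^sub>R w + Im (c w) *\<^sub>R J w w" by (simp add: s_def)
      then have "r \<le> norm (Re (c w) *\<^sub>R w) + norm (Im (c w) *\<^sub>R J w w)"
        using ns0 norm_triangle_ineq by metis
      also have "\<dots> \<le> 1/8 * r + 1/8 * (9/8 * r)"
        unfolding norm_scaleR using that JW c abs_Re_le_cmod[of "c w"] abs_Im_le_cmod[of "c w"] r
        by (intro add_mono mult_mono) auto
      finally show False using r by simp
    qed
    have lin: "\<alpha> w (x - y) = \<alpha> w x - \<alpha> w y" "\<alpha> w (a *\<^sub>R x + b *\<^sub>R J w x) = Complex a b * \<alpha> w x" for x y a b
      by (simp_all add: \<alpha>_def blinfun.diff_right blinfun.add_right blinfun.scaleR_right Je2[OF we] inner_diff_left inner_add_left complex_eq_iff)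
    have "\<alpha> w (s w) = \<alpha> w (s0 w) - c w * \<alpha> w w" unfolding s_def lin by simp
    also have "\<dots> = 0" using w0 by (simp add: c_def)
    finally have "s w \<bullet> w = 0" "J w (s w) \<bullet> w = 0" by (simp_all add: \<alpha>_def complex_eq_iff)
    moreover have "s w = J w (- J w (s w))" by (simp add: blinfun.minus_right Je2[OF we])
    ultimately show "s w \<in> plane_field J w" by (auto simp: plane_field_def sphere_tangent_def)
  qed
  have "continuous_on (sphere 0 r) s"
    unfolding s_def c_def using w(1) by (intro continuous_intros cs0 c\<alpha> cJ) auto
  then show ?thesis using w by (intro exI[of _ s]) (simp add: nonvanishing_section_def)
qed

text \<open>Any parametrization of the curve differs from \<open>F \<circ> \<sigma>\<close> by a
  homeomorphism of the circle, which leaves the linking number unchanged.\<close>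

lemma bennequin_small_radius:
  assumes r: "0 < r" "r < e" "r < 15/16 * norm v * (\<delta> / 2) ^ n"
  defines "K \<equiv> F ` {z. cmod z < \<delta> \<and> norm (F z) = r}"
  shows "\<exists>\<gamma>. transverse_parametrization J K \<gamma>"
    and "\<exists>s. nonvanishing_section J r s"
    and "transverse_parametrization J K \<gamma> \<Longrightarrow> nonvanishing_section J r s \<Longrightarrow>
      \<exists>\<epsilon>\<^sub>0>0. \<forall>\<epsilon>. 0 < \<epsilon> \<and> \<epsilon> < \<epsilon>\<^sub>0 \<longrightarrow>
        \<gamma> ` sphere 0 1 \<inter> (pushed r \<epsilon> s \<circ> \<gamma>) ` sphere 0 1 = {} \<and>
        linking_number \<gamma> (pushed r \<epsilon> s \<circ> \<gamma>) = (\<Sum>\<zeta>\<in>{\<zeta>. \<zeta> ^ n = 1} - {1}. int (q \<zeta>)) - int n"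
proof -
  obtain \<sigma> where \<sigma>c: "continuous_on (cball 0 1) \<sigma>" and
    \<sigma>: "\<And>z. cmod z \<le> 1 \<Longrightarrow> cmod (\<sigma> z) < \<delta> \<and> norm (F (\<sigma> z)) = r * cmod z \<and> (\<exists>l>0. \<sigma> z = of_real l * z)" and
    \<sigma>s: "\<And>Z. cmod Z < \<delta> \<Longrightarrow> norm (F Z) = r \<Longrightarrow> Z = \<sigma> (sgn Z)"
    using polar_reparametrization[OF r(1,3)] by blast
  have tr: "transverse_parametrization J K (F \<circ> \<sigma>)"
    unfolding K_def by (rule transverse_boundary_curve[OF r(1) \<sigma>c \<sigma> \<sigma>s])
  then show "\<exists>\<gamma>. transverse_parametrization J K \<gamma>" by blast
  show "\<exists>s. nonvanishing_section J r s" by (rule section_exists[OF r(1,2)])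
  have circle: "continuous_on (sphere 0 1) \<gamma>" "inj_on \<gamma> (sphere 0 1)" "\<gamma> ` sphere 0 1 = K"
    if "transverse_parametrization J K \<gamma>" for \<gamma>
  proof -
    obtain \<gamma>' where "\<And>t. ((\<lambda>t. \<gamma> (cis t)) has_vector_derivative \<gamma>' t) (at t)"
      using \<open>transverse_parametrization J K \<gamma>\<close> unfolding transverse_parametrization_def by blast
    then have "continuous_on UNIV (\<lambda>t. \<gamma> (cis t))"
      by (intro continuous_at_imp_continuous_on ballI has_vector_derivative_continuous)
    then show "continuous_on (sphere 0 1) \<gamma>" by (rule continuous_on_circle_cis)
    show "inj_on \<gamma> (sphere 0 1)" "\<gamma> ` sphere 0 1 = K"
      using \<open>transverse_parametrization J K \<gamma>\<close> by (simp_all add: transverse_parametrization_def)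
  qed
  assume \<gamma>: "transverse_parametrization J K \<gamma>" and s: "nonvanishing_section J r s"
  note c0 = circle[OF tr] and c1 = circle[OF \<gamma>]
  obtain \<gamma>0' where h0: "homeomorphism (sphere 0 1) K (F \<circ> \<sigma>) \<gamma>0'"
    using homeomorphism_compact[OF compact_sphere c0(1) c0(3) c0(2)] by blast
  obtain \<gamma>' where h1: "homeomorphism (sphere 0 1) K \<gamma> \<gamma>'"
    using homeomorphism_compact[OF compact_sphere c1(1) c1(3) c1(2)] by blast
  define \<tau> where "\<tau> = \<gamma>0' \<circ> \<gamma>"
  have \<tau>: "homeomorphism (sphere 0 1) (sphere 0 1) \<tau> (\<gamma>' \<circ> (F \<circ> \<sigma>))"
    unfolding \<tau>_def by (rule homeomorphism_compose[OF h1 homeomorphism_symD[OF h0]])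
  have \<gamma>\<tau>: "(F \<circ> \<sigma>) (\<tau> z) = \<gamma> z" if "cmod z = 1" for z
  proof -
    have "\<gamma> z \<in> K" using c1(3) that by auto
    then show ?thesis using homeomorphism_apply2[OF h0] by (simp add: \<tau>_def)
  qed
  have \<tau>S: "cmod (\<tau> z) = 1" if "cmod z = 1" for z
    using \<tau> that unfolding homeomorphism_def by auto
  \<comment> \<open>A lower bound for the parameters of points on the sphere, obtained from
    \<open>norm_F_upper\<close> and \<open>cmod Z ^ n \<le> cmod Z\<close>.\<close>
  define \<omega> where "\<omega> = r / (2 * norm v)"
  have \<omega>0: "\<omega> > 0" using r norm_v_pos by (simp add: \<omega>_def)
  have \<omega>: "\<omega> \<le> cmod Z" if Z: "cmod Z < \<delta>" "norm (F Z) = r" for Z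
  proof -
    have "cmod Z ^ n \<le> cmod Z ^ 1" using Z \<delta>1 n by (intro power_decreasing) auto
    then have "norm v * cmod Z ^ n \<le> norm v * cmod Z" by (intro mult_left_mono) auto
    moreover have "r \<le> 17/16 * (norm v * cmod Z ^ n)" using norm_F_upper[OF Z(1)] Z(2) by (simp add: mult.assoc)
    moreover have "0 \<le> norm v * cmod Z" by simp
    ultimately have "r \<le> 2 * (norm v * cmod Z)" by linarith
    then show ?thesis using norm_v_pos by (simp add: \<omega>_def pos_divide_le_eq mult.commute mult.left_commute)
  qed
  have "compact (s ` sphere 0 r)"
    using s by (intro compact_continuous_image) (auto simp: nonvanishing_section_def)
  then obtain B where B: "B > 0" "\<And>x. norm x = r \<Longrightarrow> norm (s x) \<le> B"
    using bounded_pos[of "s ` sphere 0 r"] compact_imp_bounded by auto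
  \<comment> \<open>One threshold for the expansion of the push-off and one for each root of unity.
    Division by the bound \<open>B\<close> of the section turns their minimum into a bound for
    \<epsilon>.\<close>
  define E where "E = insert (r / 10) ((\<lambda>\<zeta>. \<eta> * (\<omega> / 3) ^ q \<zeta> / 2) ` {\<zeta>. \<zeta> ^ n = 1})"
  have E: "finite E" "E \<noteq> {}" "\<And>x. x \<in> E \<Longrightarrow> x > 0"
    using finite_roots_unity[OF n_ge_1] r \<eta> \<omega>0 by (auto simp: E_def)
  define \<epsilon>0 where "\<epsilon>0 = Min E / B"
  show "\<exists>\<epsilon>\<^sub>0>0. \<forall>\<epsilon>. 0 < \<epsilon> \<and> \<epsilon> < \<epsilon>\<^sub>0 \<longrightarrow>
        \<gamma> ` sphere 0 1 \<inter> (pushed r \<epsilon> s \<circ> \<gamma>) ` sphere 0 1 = {} \<and>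
        linking_number \<gamma> (pushed r \<epsilon> s \<circ> \<gamma>) = (\<Sum>\<zeta>\<in>{\<zeta>. \<zeta> ^ n = 1} - {1}. int (q \<zeta>)) - int n"
  proof (intro exI[of _ \<epsilon>0] conjI allI impI; (elim conjE)?)
    show "\<epsilon>0 > 0" using E B by (simp add: \<epsilon>0_def)
    fix \<epsilon> assume \<epsilon>: "0 < \<epsilon>" "\<epsilon> < \<epsilon>0"
    have small: "\<epsilon> * norm (s x) \<le> a" if "a \<in> E" "norm x = r" for a x
    proof -
      have "\<epsilon> * norm (s x) \<le> \<epsilon>0 * B" using \<epsilon> B(2)[OF that(2)] by (intro mult_mono) auto
      also have "\<dots> = Min E" using B(1) by (simp add: \<epsilon>0_def)
      also have "\<dots> \<le> a" using E that by simp
      finally show ?thesis .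
    qed
    have small1: "\<epsilon> * norm (s x) \<le> r / 10" if "norm x = r" for x
      by (rule small[OF _ that]) (simp add: E_def)
    have small2: "2 * \<epsilon> * norm (s x) \<le> \<eta> * (\<omega> / 3) ^ q \<zeta>" if "norm x = r" "\<zeta> ^ n = 1" "\<zeta> \<noteq> 1" for x \<zeta>
    proof -
      have "\<eta> * (\<omega> / 3) ^ q \<zeta> / 2 \<in> E" using that(2) by (auto simp: E_def)
      from small[OF this that(1)] show ?thesis by simp
    qed
    have comp: "(F \<circ> \<sigma>) z = F (\<sigma> z)" for z by simp
    have lc1: "(F \<circ> \<sigma>) z \<noteq> pushed r \<epsilon> s ((F \<circ> \<sigma>) w)" if "cmod z = 1" "cmod w = 1" for z w
      by (rule linking_number_pushed(1)[where \<gamma> = "F \<circ> \<sigma>" and \<sigma> = \<sigma> and \<omega> = \<omega>, OF r(1,2) s \<sigma>c])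
        (assumption | rule \<sigma> comp \<omega>0 \<omega> \<epsilon>(1) small1 small2 that)+
    have lc2: "radial 1 (F \<circ> \<sigma>) (x $ 1) \<noteq> radial 1 (pushed r \<epsilon> s \<circ> (F \<circ> \<sigma>)) (x $ 2)" if "x \<in> S3" for x
      by (rule linking_number_pushed(2)[where \<gamma> = "F \<circ> \<sigma>" and \<sigma> = \<sigma> and \<omega> = \<omega>, OF r(1,2) s \<sigma>c])
        (assumption | rule \<sigma> comp \<omega>0 \<omega> \<epsilon>(1) small1 small2 that)+
    have lc4: "continuous_on (sphere 0 1) (pushed r \<epsilon> s \<circ> (F \<circ> \<sigma>))"
      by (rule linking_number_pushed(4)[where \<gamma> = "F \<circ> \<sigma>" and \<sigma> = \<sigma> and \<omega> = \<omega>, OF r(1,2) s \<sigma>c])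
        (assumption | rule \<sigma> comp \<omega>0 \<omega> \<epsilon>(1) small1 small2)+
    have lc5: "linking_number (F \<circ> \<sigma>) (pushed r \<epsilon> s \<circ> (F \<circ> \<sigma>)) = (\<Sum>\<zeta>\<in>{\<zeta>. \<zeta> ^ n = 1} - {1}. int (q \<zeta>)) - int n"
      by (rule linking_number_pushed(5)[where \<gamma> = "F \<circ> \<sigma>" and \<sigma> = \<sigma> and \<omega> = \<omega>, OF r(1,2) s \<sigma>c])
        (assumption | rule \<sigma> comp \<omega>0 \<omega> \<epsilon>(1) small1 small2)+
    have disj: "\<gamma> z \<noteq> pushed r \<epsilon> s (\<gamma> w)" if "cmod z = 1" "cmod w = 1" for z w
      using lc1[of "\<tau> z" "\<tau> w"] \<tau>S that \<gamma>\<tau>[OF that(1)] \<gamma>\<tau>[OF that(2)] by simp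
    then show "\<gamma> ` sphere 0 1 \<inter> (pushed r \<epsilon> s \<circ> \<gamma>) ` sphere 0 1 = {}" by auto
    have "linking_number \<gamma> (pushed r \<epsilon> s \<circ> \<gamma>) = linking_number ((F \<circ> \<sigma>) \<circ> \<tau>) ((pushed r \<epsilon> s \<circ> (F \<circ> \<sigma>)) \<circ> \<tau>)"
      using \<gamma>\<tau> by (intro linking_number_cong) auto
    also have "\<dots> = linking_number (F \<circ> \<sigma>) (pushed r \<epsilon> s \<circ> (F \<circ> \<sigma>))"
      by (rule linking_number_reparametrize[OF \<tau> c0(1) lc4 lc2]) simp_all
    finally show "linking_number \<gamma> (pushed r \<epsilon> s \<circ> \<gamma>) = (\<Sum>\<zeta>\<in>{\<zeta>. \<zeta> ^ n = 1} - {1}. int (q \<zeta>)) - int n"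
      using lc5 by simp
  qed
qed

text \<open>The sublevel set \<open>D\<close> is starlike, as the norm grows along rays, so its
  image under \<phi> is connected. This image is compact, and by invariance of domain it is
  relatively open in the preimage of the closed ball, so it is the whole component of 0.\<close>

lemma branch_curve_eq:
  fixes U :: "complex \<Rightarrow> 'a" and c :: "'a chart"
  assumes \<phi>: "continuous_on (ball 0 \<delta>) \<phi>" "inj_on \<phi> (ball 0 \<delta>)" "\<phi> 0 = 0"
    and U: "\<And>z. cmod z < \<delta> \<Longrightarrow> \<phi> z \<in> ball 0 1 \<and> U (\<phi> z) \<in> fst c \<and> F z = snd c (U (\<phi> z))"
    and r: "0 < r" "r < 15/16 * norm v * (\<delta> / 2) ^ n"
  shows "branch_curve U c r = F ` {z. cmod z < \<delta> \<and> norm (F z) = r}"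
proof -
  define A where "A = {z \<in> ball 0 1. U z \<in> fst c \<and> snd c (U z) \<in> cball 0 r}"
  define D where "D = {z. cmod z < \<delta> \<and> norm (F z) \<le> r}"
  \<comment> \<open>The bound on \<open>r\<close> keeps \<open>D\<close> inside the closed disc of
    radius \<open>\<delta> / 2\<close>, which makes it compact.\<close>
  have D2: "D = cball 0 (\<delta> / 2) \<inter> {z. cmod z < \<delta> \<and> norm (F z) \<le> r}"
  proof -
    have "cmod z \<le> \<delta> / 2" if z: "cmod z < \<delta>" "norm (F z) \<le> r" for z
    proof (rule ccontr)
      assume "\<not> ?thesis"
      then have "(\<delta> / 2) ^ n \<le> cmod z ^ n" using \<delta> by (intro power_mono) auto
      then have "15/16 * norm v * (\<delta> / 2) ^ n \<le> 15/16 * norm v * cmod z ^ n" by (intro mult_left_mono) auto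
      then show False using norm_F_lower[OF z(1)] z(2) r by linarith
    qed
    then show ?thesis by (auto simp: D_def)
  qed
  have D3: "D = {z \<in> cball 0 (\<delta> / 2). norm (F z) \<le> r}" unfolding D2 using \<delta> by auto
  have cF: "continuous_on (cball 0 (\<delta> / 2)) F" by (rule continuous_on_subset[OF contF]) (use \<delta> in auto)
  have "closed D" unfolding D3
    using continuous_closed_preimage[OF cF closed_cball closed_cball[of 0 r]] by (simp add: vimage_def Int_def)
  then have "compact D" using D3 by (metis (lifting) bounded_cball bounded_subset compact_eq_bounded_closed mem_Collect_eq subsetI)
  have D\<delta>: "D \<subseteq> ball 0 \<delta>" by (auto simp: D_def)
  have c\<phi>: "continuous_on D \<phi>" by (rule continuous_on_subset[OF \<phi>(1) D\<delta>])
  have "compact (\<phi> ` D)" by (rule compact_continuous_image[OF c\<phi> \<open>compact D\<close>])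
  then have clo: "closed (\<phi> ` D)" by (rule compact_imp_closed)
  have D0: "0 \<in> D" using \<delta> r by (simp add: D_def F_0)
  have "starlike D" unfolding starlike_def
  proof (intro bexI[OF _ D0] ballI subsetI)
    fix z y assume z: "z \<in> D" and y: "y \<in> closed_segment 0 z"
    then obtain t where t: "0 \<le> t" "t \<le> 1" "y = t *\<^sub>R z" by (auto simp: in_segment)
    show "y \<in> D"
    proof (cases "z = 0 \<or> t = 1")
      case False
      then have s: "cmod (sgn z) = 1" by (simp add: norm_sgn)
      have zz: "of_real (cmod z) * sgn z = z" using False by (simp add: sgn_div_norm scaleR_conv_of_real)
      then have yy: "of_real (t * cmod z) * sgn z = y" unfolding t(3) scaleR_conv_of_real of_real_mult mult.assoc by simp
      have lt: "t * cmod z < cmod z" using t False by simp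
      moreover have "cmod z < \<delta>" using z by (simp add: D_def)
      ultimately have "norm (F y) < norm (F z)"
        using norm_F_strict_mono[OF s, of "t * cmod z" "cmod z"] t unfolding zz yy by simp
      moreover have "cmod y < \<delta>" using lt \<open>cmod z < \<delta>\<close> t by simp
      ultimately show ?thesis using z by (simp add: D_def)
    qed (use z t D0 in auto)
  qed
  then have "connected D" by (rule starlike_imp_connected)
  then have con: "connected (\<phi> ` D)" by (rule connected_continuous_image[OF c\<phi>])
  have ope: "open (\<phi> ` ball 0 \<delta>)" by (rule invariance_of_domain[OF \<phi>(1) open_ball \<phi>(2)])
  have AD: "\<phi> ` D = A \<inter> \<phi> ` ball 0 \<delta>"
    using U by (auto simp: A_def D_def)
  have 0: "0 \<in> \<phi> ` D" using D0 \<phi>(3) by (metis imageI)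
  have "connected_component_set A 0 = \<phi> ` D"
  proof
    show "\<phi> ` D \<subseteq> connected_component_set A 0"
      by (rule connected_component_maximal[OF 0 con]) (use AD in auto)
    let ?C = "connected_component_set A 0"
    have CA: "?C \<subseteq> A" by (rule connected_component_subset)
    have "openin (top_of_set ?C) (?C \<inter> \<phi> ` D)"
    proof -
      have "?C \<inter> \<phi> ` D = ?C \<inter> \<phi> ` ball 0 \<delta>" using CA AD by auto
      then show ?thesis using ope by (auto simp: openin_open)
    qed
    moreover have "closedin (top_of_set ?C) (?C \<inter> \<phi> ` D)" using clo by (rule closedin_closed_Int)
    moreover have "0 \<in> ?C \<inter> \<phi> ` D" using 0 AD by (auto intro: connected_component_refl)
    ultimately have "?C \<inter> \<phi> ` D = ?C" using connected_connected_component[of A 0] unfolding connected_clopen by blast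
    then show "?C \<subseteq> \<phi> ` D" by blast
  qed
  then have "branch_curve U c r = (snd c \<circ> U) ` \<phi> ` D \<inter> sphere 0 r" unfolding branch_curve_def A_def by simp
  also have "(snd c \<circ> U) ` \<phi> ` D = F ` D" unfolding image_image using U D\<delta> by (intro image_cong) auto
  also have "F ` D \<inter> sphere 0 r = F ` {z. cmod z < \<delta> \<and> norm (F z) = r}" by (auto simp: D_def)
  finally show ?thesis .
qed

end

section \<open>Singularity types\<close>

text \<open>With \<alpha> = 1/2 the surplus factor \<open>sqrt (cmod z)\<close> falls below any
  positive constant near 0.\<close>

lemma O_orderD:
  assumes g: "O_order g k" and \<eta>: "\<eta> > 0"
  obtains d where "d > 0" "\<And>z. z \<noteq> 0 \<Longrightarrow> cmod z < d \<Longrightarrow> norm (g z) \<le> \<eta> * cmod z ^ k"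
proof -
  have "(\<lambda>z. norm (g z)) \<in> O[at 0](\<lambda>z. norm z powr (real k + 1/2))" using g unfolding O_order_def by simp
  then obtain c where c: "c > 0" "\<forall>\<^sub>F z in at 0. norm (norm (g z)) \<le> c * norm (norm z powr (real k + 1/2))"
    by (rule landau_o.bigE)
  then obtain d where d: "d > 0" "\<And>z. z \<noteq> 0 \<Longrightarrow> cmod z < d \<Longrightarrow> norm (g z) \<le> c * cmod z powr (real k + 1/2)"
    unfolding eventually_at by auto
  show thesis
  proof (rule that)
    show "min d ((\<eta> / c)\<^sup>2) > 0" using d \<eta> c by simp
    fix z :: complex assume z: "z \<noteq> 0" "cmod z < min d ((\<eta> / c)\<^sup>2)"
    have "sqrt (cmod z) \<le> sqrt ((\<eta> / c)\<^sup>2)" using z by (intro real_sqrt_le_mono) auto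
    then have s: "sqrt (cmod z) \<le> \<eta> / c" using \<eta> c by simp
    have "norm (g z) \<le> c * cmod z powr (real k + 1/2)" using z by (intro d(2)) auto
    also have "cmod z powr (real k + 1/2) = cmod z ^ k * sqrt (cmod z)"
      using z by (simp add: powr_add powr_realpow powr_half_sqrt)
    also have "c * (cmod z ^ k * sqrt (cmod z)) \<le> c * (cmod z ^ k * (\<eta> / c))"
      using c s by (intro mult_left_mono) auto
    also have "\<dots> = \<eta> * cmod z ^ k" using c by simp
    finally show "norm (g z) \<le> \<eta> * cmod z ^ k" .
  qed
qed

section \<open>Arithmetic of the gcds and roots of unity\<close>

lemma gcd_upto_0: "gcd_upto p 0 = p 0"
  by (simp add: gcd_upto_def)

lemma gcd_upto_Suc: "gcd_upto p (Suc i) = gcd (p (Suc i)) (gcd_upto p i)"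
  by (simp add: gcd_upto_def atMost_Suc)

lemma gcd_upto_dvd: "i \<le> j \<Longrightarrow> gcd_upto p j dvd gcd_upto p i"
proof (induction rule: dec_induct)
  case (step j)
  then show ?case by (simp add: gcd_upto_Suc) (metis dvd_trans gcd_dvd2)
qed simp

text \<open>The index \<open>i\<close> of the term \<open>z ^ p i\<close> in which the branches at \<open>z\<close> and at \<open>\<zeta> * z\<close> first differ.\<close>

definition root_index :: "(nat \<Rightarrow> nat) \<Rightarrow> complex \<Rightarrow> nat" where
  "root_index p \<zeta> = (LEAST j. \<zeta> ^ gcd_upto p j \<noteq> 1)"

text \<open>The last claim holds because \<zeta> would otherwise be a root of unity for both
  \<open>p i\<close> and the preceding gcd, hence for the gcd of the two.\<close>

lemma root_index:
  assumes \<zeta>: "\<zeta> ^ p 0 = 1" "\<zeta> \<noteq> 1" and l: "gcd_upto p l = 1"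
  shows "1 \<le> root_index p \<zeta>" "root_index p \<zeta> \<le> l"
    "\<zeta> ^ gcd_upto p (root_index p \<zeta> - 1) = 1" "\<zeta> ^ gcd_upto p (root_index p \<zeta>) \<noteq> 1" "\<zeta> ^ p (root_index p \<zeta>) \<noteq> 1"
proof -
  have l1: "\<zeta> ^ gcd_upto p l \<noteq> 1" using l \<zeta> by simp
  show 1: "\<zeta> ^ gcd_upto p (root_index p \<zeta>) \<noteq> 1"
    unfolding root_index_def by (rule LeastI[of "\<lambda>j. \<zeta> ^ gcd_upto p j \<noteq> 1", OF l1])
  show "root_index p \<zeta> \<le> l"
    unfolding root_index_def by (rule Least_le[of "\<lambda>j. \<zeta> ^ gcd_upto p j \<noteq> 1", OF l1])
  show 2: "1 \<le> root_index p \<zeta>"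
  proof (rule ccontr)
    assume "\<not> ?thesis"
    then have "root_index p \<zeta> = 0" by simp
    with 1 \<zeta> show False by (simp add: gcd_upto_0)
  qed
  show 3: "\<zeta> ^ gcd_upto p (root_index p \<zeta> - 1) = 1"
    using not_less_Least[of "root_index p \<zeta> - 1" "\<lambda>j. \<zeta> ^ gcd_upto p j \<noteq> 1"] 2 unfolding root_index_def[symmetric] by simp
  show "\<zeta> ^ p (root_index p \<zeta>) \<noteq> 1"
  proof
    assume "\<zeta> ^ p (root_index p \<zeta>) = 1"
    from root_of_unity_gcd[OF this 3] 1 2 show False
      using gcd_upto_Suc[of p "root_index p \<zeta> - 1"] by simp
  qed
qed

text \<open>The roots of index \<open>i\<close> are those whose order divides
  \<open>gcd_upto p (i - 1)\<close> but not \<open>gcd_upto p i\<close>; their number is the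
  difference of the two gcds.\<close>

lemma sum_root_index:
  assumes p0: "p 0 \<ge> 1" and l: "gcd_upto p l = 1"
  shows "(\<Sum>\<zeta>\<in>{\<zeta>. \<zeta> ^ p 0 = 1} - {1}. int (p (root_index p \<zeta>))) =
    (\<Sum>i=1..l. (int (gcd_upto p (i - 1)) - int (gcd_upto p i)) * int (p i))"
proof -
  define R where "R k = {\<zeta>::complex. \<zeta> ^ gcd_upto p k = 1}" for k
  have d0: "gcd_upto p k \<ge> 1" for k
    using gcd_upto_dvd[of 0 k p] p0 by (auto simp: gcd_upto_0 Suc_le_eq intro: dvd_pos_nat)
  have R: "finite (R k)" "card (R k) = gcd_upto p k" for k
    unfolding R_def using d0[of k] finite_roots_unity by (auto intro!: card_roots_unity_eq simp: Suc_le_eq)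
  let ?S = "{\<zeta>::complex. \<zeta> ^ p 0 = 1} - {1}"
  have S: "?S = R 0 - {1}" by (simp add: R_def gcd_upto_0)
  have "finite ?S" unfolding S using R by simp
  moreover have "root_index p ` ?S \<subseteq> {1..l}"
  proof (rule image_subsetI)
    fix \<zeta> assume "\<zeta> \<in> ?S"
    then show "root_index p \<zeta> \<in> {1..l}" using root_index(1,2)[of \<zeta> p l] l by simp
  qed
  ultimately have "(\<Sum>\<zeta>\<in>?S. int (p (root_index p \<zeta>))) = (\<Sum>i=1..l. \<Sum>\<zeta>\<in>{\<zeta> \<in> ?S. root_index p \<zeta> = i}. int (p (root_index p \<zeta>)))"
    by (intro sum.group[symmetric]) auto
  also have "\<dots> = (\<Sum>i=1..l. (int (gcd_upto p (i - 1)) - int (gcd_upto p i)) * int (p i))"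
  proof (rule sum.cong[OF refl])
    fix i assume i: "i \<in> {1..l}"
    have "{\<zeta> \<in> ?S. root_index p \<zeta> = i} = R (i - 1) - R i"
    proof (intro equalityI subsetI)
      fix \<zeta> assume "\<zeta> \<in> {\<zeta> \<in> ?S. root_index p \<zeta> = i}"
      then show "\<zeta> \<in> R (i - 1) - R i" using root_index(3,4)[of \<zeta> p l] l by (auto simp: R_def)
    next
      fix \<zeta> assume \<zeta>: "\<zeta> \<in> R (i - 1) - R i"
      then have a: "\<zeta> ^ gcd_upto p (i - 1) = 1" "\<zeta> ^ gcd_upto p i \<noteq> 1" by (simp_all add: R_def)
      have lt: "\<zeta> ^ gcd_upto p j = 1" if "j \<le> i - 1" for j
        by (rule root_of_unity_dvd[OF gcd_upto_dvd[OF that] a(1)])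
      have "root_index p \<zeta> = i" unfolding root_index_def
      proof (rule Least_equality[of "\<lambda>j. \<zeta> ^ gcd_upto p j \<noteq> 1"])
        show "i \<le> j" if "\<zeta> ^ gcd_upto p j \<noteq> 1" for j using lt[of j] that by (cases "j \<le> i - 1") simp_all
      qed (rule a(2))
      moreover have "\<zeta> ^ p 0 = 1" using lt[of 0] by (simp add: gcd_upto_0)
      moreover have "\<zeta> \<noteq> 1" using a(2) by auto
      ultimately show "\<zeta> \<in> {\<zeta> \<in> ?S. root_index p \<zeta> = i}" by simp
    qed
    moreover have sub: "R i \<subseteq> R (i - 1)"
      unfolding R_def using root_of_unity_dvd[OF gcd_upto_dvd[of "i - 1" i p]] by auto
    ultimately have "int (card {\<zeta> \<in> ?S. root_index p \<zeta> = i}) = int (gcd_upto p (i - 1)) - int (gcd_upto p i)"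
      using card_mono[OF R(1) sub] R by (simp add: card_Diff_subset of_nat_diff)
    then show "(\<Sum>\<zeta>\<in>{\<zeta> \<in> ?S. root_index p \<zeta> = i}. int (p (root_index p \<zeta>))) = (int (gcd_upto p (i - 1)) - int (gcd_upto p i)) * int (p i)"
      by simp
  qed
  finally show ?thesis .
qed

text \<open>The differences of the gcds telescope to \<open>p 0 - 1\<close>, which matches the
  \<open>- 1\<close> in every factor with the terms \<open>- p 0\<close> and \<open>+ 1\<close> on
  the right.\<close>

lemma sum_gcd_upto_formula:
  assumes p0: "p 0 \<ge> 1" and l: "gcd_upto p l = 1"
  shows "(\<Sum>i=1..l. (real (gcd_upto p (i - 1)) - real (gcd_upto p i)) * (real (p i) - 1)) =
    of_int ((\<Sum>\<zeta>\<in>{\<zeta>. \<zeta> ^ p 0 = 1} - {1}. int (p (root_index p \<zeta>))) - int (p 0)) + 1"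
proof -
  have "(\<Sum>i=1..l. real (gcd_upto p (i - 1)) - real (gcd_upto p i)) = real (p 0) - 1"
  proof -
    have "(\<Sum>i=1..m. real (gcd_upto p (i - 1)) - real (gcd_upto p i)) = real (gcd_upto p 0) - real (gcd_upto p m)" for m
      by (induction m) auto
    then show ?thesis by (simp add: l gcd_upto_0)
  qed
  then show ?thesis
    unfolding sum_root_index[OF assms] by (simp add: algebra_simps sum_subtractf sum.distrib)
qed

text \<open>The part \<open>w (i - 1)\<close> depends on a power of \<open>z\<close> that is the
  same for \<open>z\<close> and \<open>\<zeta> * z\<close>, so it cancels; the next term acquires
  the factor \<open>\<zeta> ^ p i - 1\<close>.\<close>

lemma branch_root_difference:
  fixes f :: "complex \<Rightarrow> complex^2"
  assumes \<zeta>: "\<zeta> ^ p 0 = 1" "\<zeta> \<noteq> 1" and p0: "p 0 \<ge> 1" and l: "gcd_upto p l = 1" and pos: "\<And>i. i \<le> l \<Longrightarrow> p i > 0"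
    and f: "\<And>i. i < l \<Longrightarrow> O_order (\<lambda>z. f z - w i (z ^ gcd_upto p i) - (z ^ p (Suc i)) *s v (Suc i)) (p (Suc i))"
    and \<eta>: "\<eta> > 0"
  defines "i \<equiv> root_index p \<zeta>"
  shows "\<exists>d>0. \<forall>z. cmod z < d \<longrightarrow> norm (f (\<zeta> * z) - f z - z ^ p i *s ((\<zeta> ^ p i - 1) *s v i)) \<le> \<eta> * cmod z ^ p i"
proof -
  note ix = root_index[OF \<zeta> l, folded i_def]
  define g where "g z = f z - w (i - 1) (z ^ gcd_upto p (i - 1)) - (z ^ p i) *s v i" for z
  have gO: "O_order g (p i)" using f[of "i - 1"] ix(1,2) unfolding g_def by simp
  have \<eta>2: "\<eta> / 2 > 0" using \<eta> by simp
  obtain d where d: "d > 0" "\<And>z. z \<noteq> 0 \<Longrightarrow> cmod z < d \<Longrightarrow> norm (g z) \<le> \<eta> / 2 * cmod z ^ p i"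
    using O_orderD[OF gO \<eta>2] by blast
  have n\<zeta>: "cmod \<zeta> = 1" by (rule norm_root_of_unity[OF p0 \<zeta>(1)])
  show ?thesis
  proof (intro exI[of _ d] conjI d(1) allI impI)
    fix z :: complex assume z: "cmod z < d"
    show "norm (f (\<zeta> * z) - f z - z ^ p i *s ((\<zeta> ^ p i - 1) *s v i)) \<le> \<eta> * cmod z ^ p i"
    proof (cases "z = 0")
      case True
      then show ?thesis using pos[OF ix(2)] by (simp add: power_0_left)
    next
      case False
      have pw: "(\<zeta> * z) ^ gcd_upto p (i - 1) = z ^ gcd_upto p (i - 1)" unfolding power_mult_distrib ix(3) by simp
      have "f (\<zeta> * z) - f z - z ^ p i *s ((\<zeta> ^ p i - 1) *s v i) = g (\<zeta> * z) - g z"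
        unfolding g_def pw by (simp add: vec_eq_iff power_mult_distrib algebra_simps)
      also have "norm \<dots> \<le> norm (g (\<zeta> * z)) + norm (g z)" by (rule norm_triangle_ineq4)
      also have "\<dots> \<le> \<eta> / 2 * cmod (\<zeta> * z) ^ p i + \<eta> / 2 * cmod z ^ p i"
        using z False n\<zeta> \<zeta> p0 by (intro add_mono d(2)) (auto simp: norm_mult)
      also have "\<dots> = \<eta> * cmod z ^ p i" using n\<zeta> by (simp add: norm_mult)
      finally show ?thesis .
    qed
  qed
qed

text \<open>The error of \<open>w0\<close>, the error of \<open>f\<close> and the term of order
  \<open>m\<close> each receive a third of \<eta>; the last one is small because
  \<open>m > n\<close>.\<close>

lemma branch_asymptotics:
  fixes f w0 :: "complex \<Rightarrow> complex^2"
  assumes n: "n \<ge> 1" "n < m" and w0: "O_order (\<lambda>z. w0 z - z *s v0) 1"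
    and f: "O_order (\<lambda>z. f z - w0 (z ^ n) - (z ^ m) *s v1) m" "f 0 = 0" and \<eta>: "\<eta> > 0"
  shows "\<exists>d>0. \<forall>z. cmod z < d \<longrightarrow> norm (f z - z ^ n *s v0) \<le> \<eta> * cmod z ^ n"
proof -
  have \<eta>3: "\<eta> / 3 > 0" using \<eta> by simp
  obtain a where a: "a > 0" "\<And>z. z \<noteq> 0 \<Longrightarrow> cmod z < a \<Longrightarrow> norm (w0 z - z *s v0) \<le> \<eta> / 3 * cmod z ^ 1"
    using O_orderD[OF w0 \<eta>3] by blast
  obtain b where b: "b > 0" "\<And>z. z \<noteq> 0 \<Longrightarrow> cmod z < b \<Longrightarrow> norm (f z - w0 (z ^ n) - (z ^ m) *s v1) \<le> \<eta> / 3 * cmod z ^ m"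
    using O_orderD[OF f(1) \<eta>3] by blast
  define c where "c = \<eta> / 3 / (norm v1 + 1)"
  have c: "c > 0" using \<eta> by (simp add: c_def add_nonneg_pos)
  show ?thesis
  proof (intro exI[of _ "min (min a b) (min 1 c)"] conjI allI impI)
    show "min (min a b) (min 1 c) > 0" using a b c by simp
    fix z :: complex assume z: "cmod z < min (min a b) (min 1 c)"
    show "norm (f z - z ^ n *s v0) \<le> \<eta> * cmod z ^ n"
    proof (cases "z = 0")
      case True
      then show ?thesis using f(2) n by (simp add: power_0_left)
    next
      case False
      have zn: "cmod z ^ n \<le> cmod z" using z n(1) power_decreasing[of 1 n "cmod z"] by simp
      have zm: "cmod z ^ m \<le> cmod z ^ n" using z n by (intro power_decreasing) auto
      have zm1: "cmod z ^ m \<le> cmod z * cmod z ^ n" using z n power_decreasing[of "Suc n" m "cmod z"] by simp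
      have 1: "norm (w0 (z ^ n) - z ^ n *s v0) \<le> \<eta> / 3 * cmod z ^ n"
        using a(2)[of "z ^ n"] False z zn by (simp add: norm_power)
      have 2: "norm (f z - w0 (z ^ n) - (z ^ m) *s v1) \<le> \<eta> / 3 * cmod z ^ n"
      proof -
        have "norm (f z - w0 (z ^ n) - (z ^ m) *s v1) \<le> \<eta> / 3 * cmod z ^ m" using b(2)[OF False] z by simp
        also have "\<dots> \<le> \<eta> / 3 * cmod z ^ n" using zm \<eta> by (intro mult_left_mono) auto
        finally show ?thesis .
      qed
      have 3: "norm ((z ^ m) *s v1) \<le> \<eta> / 3 * cmod z ^ n"
      proof -
        have "norm ((z ^ m) *s v1) = cmod z ^ m * norm v1" by (simp add: norm_power)
        also have "\<dots> \<le> (c * cmod z ^ n) * (norm v1 + 1)"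
        proof (rule mult_mono)
          have "cmod z * cmod z ^ n \<le> c * cmod z ^ n" using z by (intro mult_right_mono) auto
          then show "cmod z ^ m \<le> c * cmod z ^ n" using zm1 by simp
        qed (use c in auto)
        also have "\<dots> = (c * (norm v1 + 1)) * cmod z ^ n" by simp
        also have "c * (norm v1 + 1) = \<eta> / 3" using norm_ge_zero[of v1] unfolding c_def by (subst nonzero_eq_divide_eq[symmetric]) linarith+
        finally show ?thesis .
      qed
      have eq: "f z - z ^ n *s v0 = (f z - w0 (z ^ n) - (z ^ m) *s v1) + (w0 (z ^ n) - z ^ n *s v0) + (z ^ m) *s v1" by simp
      have "norm (f z - z ^ n *s v0) \<le> norm (f z - w0 (z ^ n) - (z ^ m) *s v1) + norm (w0 (z ^ n) - z ^ n *s v0) + norm ((z ^ m) *s v1)"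
        unfolding eq
        using norm_triangle_ineq[of "(f z - w0 (z ^ n) - (z ^ m) *s v1) + (w0 (z ^ n) - z ^ n *s v0)" "(z ^ m) *s v1"]
          norm_triangle_ineq[of "f z - w0 (z ^ n) - (z ^ m) *s v1" "w0 (z ^ n) - z ^ n *s v0"] by linarith
      then show ?thesis using 1 2 3 by linarith
    qed
  qed
qed

lemma poly_locally_injective:
  fixes \<phi> :: "complex poly"
  assumes "Polynomial.coeff \<phi> 1 = 1"
  obtains \<rho> where "\<rho> > 0" "inj_on (poly \<phi>) (ball 0 \<rho>)"
proof -
  have d: "(poly \<phi> has_derivative (\<lambda>h. poly (pderiv \<phi>) x * h)) (at x)" for x
    using poly_DERIV[of \<phi> x] by (simp add: has_field_derivative_def)
  have d0: "poly (pderiv \<phi>) 0 = 1" using assms by (simp add: poly_0_coeff_0 coeff_pderiv)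
  have small: "\<exists>d>0. \<forall>x. dist 0 x < d \<longrightarrow> onorm (\<lambda>h. poly (pderiv \<phi>) x * h - poly (pderiv \<phi>) 0 * h) < e" if "e > 0" for e
  proof -
    have "isCont (poly (pderiv \<phi>)) 0" by simp
    then obtain d where d: "d > 0" "\<And>x. dist x 0 < d \<Longrightarrow> dist (poly (pderiv \<phi>) x) (poly (pderiv \<phi>) 0) < e / 2"
      using \<open>e > 0\<close> unfolding continuous_at_eps_delta by (metis half_gt_zero)
    have "onorm (\<lambda>h. poly (pderiv \<phi>) x * h - poly (pderiv \<phi>) 0 * h) < e" if "dist 0 x < d" for x
    proof -
      have c: "cmod (poly (pderiv \<phi>) x - poly (pderiv \<phi>) 0) < e / 2" using d(2)[of x] that by (simp add: dist_norm)
      have "onorm (\<lambda>h. poly (pderiv \<phi>) x * h - poly (pderiv \<phi>) 0 * h) \<le> e / 2"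
      proof (rule onorm_le)
        fix h
        have "cmod (poly (pderiv \<phi>) x * h - poly (pderiv \<phi>) 0 * h) = cmod (poly (pderiv \<phi>) x - poly (pderiv \<phi>) 0) * cmod h"
          by (simp only: left_diff_distrib[symmetric] norm_mult)
        also have "\<dots> \<le> e / 2 * cmod h" using c by (intro mult_right_mono) auto
        finally show "cmod (poly (pderiv \<phi>) x * h - poly (pderiv \<phi>) 0 * h) \<le> e / 2 * cmod h" .
      qed
      then show ?thesis using \<open>e > 0\<close> by simp
    qed
    then show ?thesis using d(1) by blast
  qed
  show thesis
  proof (rule has_derivative_locally_injective[where a = 0 and S = UNIV and f = "poly \<phi>" and f' = "\<lambda>x h. poly (pderiv \<phi>) x * h" and g' = "\<lambda>h. h"])
    show "(\<lambda>h. h) \<circ> (\<lambda>h. poly (pderiv \<phi>) 0 * h) = id" by (simp add: d0 fun_eq_iff)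
  qed (rule open_UNIV UNIV_I d bounded_linear_ident small that; assumption)+
qed

text \<open>The constants are chosen in an order that avoids circularity: \<kappa> depends on
  \<open>n\<close> only, \<eta> on \<open>v\<close>, \<kappa> and the finitely many vectors
  \<open>u \<zeta>\<close>, and \<delta> comes last, after \<eta> and \<open>e\<close>.\<close>

lemma cusp_exists:
  fixes J :: "complex^2 \<Rightarrow> (complex^2) \<Rightarrow>\<^sub>L (complex^2)" and F :: "complex \<Rightarrow> complex^2"
  assumes Jlip: "L-lipschitz_on (ball 0 e1) J" "e1 > 0"
    and J2: "\<And>y \<xi>. norm y < e1 \<Longrightarrow> J y (J y \<xi>) = - \<xi>" and J0: "J 0 = smult_blinfun \<i>"
    and hol: "J_holomorphic_on J F (ball 0 r0)" "r0 > 0" "F 0 = 0"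
    and v: "v \<noteq> 0" and n: "n \<ge> 2"
    and asym: "\<And>\<eta>. \<eta> > 0 \<Longrightarrow> \<exists>\<delta>>0. \<forall>z. cmod z < \<delta> \<longrightarrow> norm (F z - z ^ n *s v) \<le> \<eta> * cmod z ^ n"
    and root: "\<And>\<zeta> \<eta>. \<zeta> ^ n = 1 \<Longrightarrow> \<zeta> \<noteq> 1 \<Longrightarrow> \<eta> > 0 \<Longrightarrow>
       \<exists>\<delta>>0. \<forall>z. cmod z < \<delta> \<longrightarrow> norm (F (\<zeta> * z) - F z - z ^ q \<zeta> *s u \<zeta>) \<le> \<eta> * cmod z ^ q \<zeta>"
    and u: "\<And>\<zeta>. \<zeta> ^ n = 1 \<Longrightarrow> \<zeta> \<noteq> 1 \<Longrightarrow> herm v (u \<zeta>) = 0 \<and> u \<zeta> \<noteq> 0 \<and> q \<zeta> \<ge> n"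
    and \<delta>m: "\<delta>m > 0"
  obtains F' \<delta> L' \<eta> \<kappa> e where "0 < \<delta>" "\<delta> \<le> \<delta>m" "cusp J F F' \<delta> L' v n u q \<eta> \<kappa> e"
proof -
  have n_ge_1: "n \<ge> 1" and norm_v_pos: "norm v > 0" using n v by auto
  let ?R = "{\<zeta>::complex. \<zeta> ^ n = 1}"
  have fin: "finite ?R" by (rule finite_roots_unity[OF n_ge_1])
  have L: "L \<ge> 0" using Jlip(1) by (simp add: lipschitz_on_def)
  obtain F' where F': "continuous_on (ball 0 r0) F'"
    "\<And>z. cmod z < r0 \<Longrightarrow> (F has_derivative blinfun_apply (F' z)) (at z) \<and> F' z 1 + J (F z) (F' z \<i>) = 0"
    using hol(1) unfolding J_holomorphic_on_def by auto
  have Flim: "\<exists>\<delta>>0. \<forall>z. cmod z < \<delta> \<longrightarrow> norm (F z) < c" if "c > 0" for c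
  proof -
    have "isCont F 0" using F'(2)[of 0] hol(2) by (auto intro: has_derivative_continuous)
    then show ?thesis using that hol(3) unfolding continuous_at_eps_delta by (auto simp: dist_norm)
  qed
  have Lipn: "norm (J y - J y') \<le> L * norm (y - y')" if "norm y < e1" "norm y' < e1" for y y'
    using lipschitz_onD[OF Jlip(1), of y y'] that by (simp add: dist_norm)
  obtain \<delta>1 where \<delta>1: "\<delta>1 > 0" "\<And>z. cmod z < \<delta>1 \<Longrightarrow> norm (F z) < e1" using Flim[OF Jlip(2)] by blast
  have curve: "J_curve J F F' \<delta> L" if "0 < \<delta>" "\<delta> \<le> r0" "\<delta> \<le> \<delta>1" for \<delta>
  proof
    show "\<delta> > 0" "L \<ge> 0" by (rule that L)+
    show "continuous_on (ball 0 \<delta>) F'" by (rule continuous_on_subset[OF F'(1)]) (use that in auto)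
    fix z :: complex assume z: "cmod z < \<delta>"
    then have z': "norm (F z) < e1" "cmod z < r0" using \<delta>1(2) that by auto
    show "(F has_derivative blinfun_apply (F' z)) (at z)" "F' z 1 + J (F z) (F' z \<i>) = 0" using F'(2) z' by auto
    show "J (F z) (J (F z) \<xi>) = - \<xi>" for \<xi> by (rule J2[OF z'(1)])
    show "norm (J (F z) - smult_blinfun \<i>) \<le> L * norm (F z)" using Lipn[OF z'(1), of 0] Jlip(2) by (simp add: J0)
    fix z'' assume "cmod z'' < \<delta>"
    then show "norm (J (F z) - J (F z'')) \<le> L * norm (F z - F z'')" using z' \<delta>1(2) that by (intro Lipn) auto
  qed
  define \<delta>0 where "\<delta>0 = min r0 \<delta>1"
  interpret c0: J_curve J F F' \<delta>0 L by (rule curve) (use hol(2) \<delta>1 in \<open>auto simp: \<delta>0_def\<close>)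
  obtain \<kappa> :: real where \<kappa>: "\<kappa> > 0" "\<And>z w \<zeta>. \<zeta> ^ n = 1 \<Longrightarrow> (\<And>\<zeta>'. \<zeta>' ^ n = 1 \<Longrightarrow> cmod (z - \<zeta> * w) \<le> cmod (z - \<zeta>' * w)) \<Longrightarrow>
       \<kappa> * max (cmod z) (cmod w) ^ (n - 1) * cmod (z - \<zeta> * w) \<le> cmod (z ^ n - w ^ n)"
    using power_diff_lower_bound[OF n_ge_1] by blast
  have ucd: "cmod (cdet v (u \<zeta>)) > 0" if "\<zeta> ^ n = 1" "\<zeta> \<noteq> 1" for \<zeta>
  proof -
    have "herm v (u \<zeta>) = 0" "u \<zeta> \<noteq> 0" using u[OF that] by auto
    then show ?thesis using herm_cdet_eq_0 v by auto
  qed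
  define E where "E = {norm v / 16, norm v * \<kappa> / 4} \<union> (\<lambda>\<zeta>. cmod (cdet v (u \<zeta>)) / (4 * norm v)) ` (?R - {1})"
  have "cmod (cdet v (u \<zeta>)) / (4 * norm v) > 0" if "\<zeta> \<in> ?R - {1}" for \<zeta>
    using ucd[of \<zeta>] that norm_v_pos by (intro divide_pos_pos) auto
  then have pos: "\<forall>x\<in>E. x > 0" using norm_v_pos \<kappa>(1) unfolding E_def ball_Un ball_simps by simp
  have E: "finite E" "E \<noteq> {}" using fin by (simp_all add: E_def)
  define \<eta> where "\<eta> = Min E"
  have \<eta>: "\<eta> > 0" "\<And>x. x \<in> E \<Longrightarrow> \<eta> \<le> x" using E pos by (auto simp: \<eta>_def)
  have \<eta>v: "\<eta> \<le> norm v / 16" "4 * \<eta> \<le> norm v * \<kappa>"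
    using \<eta>(2)[of "norm v / 16"] \<eta>(2)[of "norm v * \<kappa> / 4"] by (simp_all add: E_def)
  have \<eta>u: "4 * norm v * \<eta> \<le> cmod (cdet v (u \<zeta>))" if "\<zeta> ^ n = 1" "\<zeta> \<noteq> 1" for \<zeta>
  proof -
    have "cmod (cdet v (u \<zeta>)) / (4 * norm v) \<in> E" using that by (auto simp: E_def)
    from \<eta>(2)[OF this] show ?thesis using norm_v_pos by (simp add: pos_le_divide_eq mult.commute)
  qed
  define e where "e = min e1 (1 / (8 * (L + 1)))"
  have e: "e > 0" "e \<le> e1" "L * e \<le> 1/8"
  proof -
    show "e > 0" "e \<le> e1" using Jlip(2) L by (auto simp: e_def)
    have "L * e \<le> L * (1 / (8 * (L + 1)))" using L by (intro mult_left_mono) (auto simp: e_def)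
    also have "\<dots> \<le> 1/8" using L by (simp add: field_simps)
    finally show "L * e \<le> 1/8" .
  qed
  obtain \<delta>2 where \<delta>2: "\<delta>2 > 0" "\<And>z. cmod z < \<delta>2 \<Longrightarrow> norm (F z) < e" using Flim[OF e(1)] by blast
  obtain \<delta>3 where \<delta>3: "\<delta>3 > 0" "\<And>z. cmod z < \<delta>3 \<Longrightarrow> norm (F z - z ^ n *s v) \<le> \<eta> * cmod z ^ n" using asym[OF \<eta>(1)] by blast
  obtain \<delta>4 where \<delta>4: "\<delta>4 > 0" "\<And>z h. cmod z < \<delta>4 \<Longrightarrow> z \<noteq> 0 \<Longrightarrow> norm (F' z h - (of_nat n * z ^ (n - 1) * h) *s v) \<le> \<eta> * cmod z ^ (n - 1) * cmod h"
    using c0.derivative_asymptotics[OF n_ge_1 asym \<eta>(1)] by blast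
  have "\<forall>\<zeta>\<in>?R - {1}. \<exists>\<delta>>0. \<forall>z. cmod z < \<delta> \<longrightarrow> norm (F (\<zeta> * z) - F z - z ^ q \<zeta> *s u \<zeta>) \<le> \<eta> * cmod z ^ q \<zeta>"
    using root \<eta>(1) by blast
  then obtain d where d: "\<And>\<zeta>. \<zeta> \<in> ?R - {1} \<Longrightarrow> d \<zeta> > 0 \<and> (\<forall>z. cmod z < d \<zeta> \<longrightarrow> norm (F (\<zeta> * z) - F z - z ^ q \<zeta> *s u \<zeta>) \<le> \<eta> * cmod z ^ q \<zeta>)"
    by metis
  define D where "D = {\<delta>0, \<delta>2, \<delta>3, \<delta>4, \<delta>m, 1} \<union> d ` (?R - {1})"
  have D: "finite D" "D \<noteq> {}" "\<And>x. x \<in> D \<Longrightarrow> x > 0"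
    using fin d \<delta>m c0.\<delta> \<delta>2(1) \<delta>3(1) \<delta>4(1) by (auto simp: D_def)
  define \<delta> where "\<delta> = Min D"
  have \<delta>: "\<delta> > 0" "\<And>x. x \<in> D \<Longrightarrow> \<delta> \<le> x" using D by (auto simp: \<delta>_def)
  have \<delta>': "\<delta> \<le> \<delta>0" "\<delta> \<le> \<delta>2" "\<delta> \<le> \<delta>3" "\<delta> \<le> \<delta>4" "\<delta> \<le> \<delta>m" "\<delta> \<le> 1"
    by (rule \<delta>(2); simp add: D_def)+
  have \<delta>d: "\<delta> \<le> d \<zeta>" if "\<zeta> \<in> ?R - {1}" for \<zeta> by (rule \<delta>(2)) (use that in \<open>auto simp: D_def\<close>)
  \<comment> \<open>\<open>derivative_asymptotics\<close> speaks about \<open>z \<noteq> 0\<close>.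
    At 0 the differential vanishes by continuity, because \<open>n - 1 > 0\<close>.\<close>
  have F'0: "F' 0 h = 0" for h
  proof -
    have "((\<lambda>z. F' z h) \<longlongrightarrow> F' 0 h) (at 0)"
    proof -
      have "isCont F' 0" using F'(1) hol(2) by (simp add: continuous_on_eq_continuous_at)
      then have "(F' \<longlongrightarrow> F' 0) (at 0)" by (simp add: isCont_def)
      then show ?thesis by (intro tendsto_intros)
    qed
    moreover have "((\<lambda>z. F' z h) \<longlongrightarrow> 0) (at 0)"
    proof (rule Lim_null_comparison)
      show "\<forall>\<^sub>F z in at 0. norm (F' z h) \<le> (\<eta> * cmod h + real n * cmod h * norm v) * cmod z ^ (n - 1)"
        unfolding eventually_at
      proof (intro exI[of _ \<delta>4] conjI ballI impI \<delta>4(1))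
        fix z :: complex assume "z \<noteq> 0 \<and> dist z 0 < \<delta>4"
        then have "norm (F' z h - (of_nat n * z ^ (n - 1) * h) *s v) \<le> \<eta> * cmod z ^ (n - 1) * cmod h" by (intro \<delta>4(2)) auto
        moreover have "norm ((of_nat n * z ^ (n - 1) * h) *s v) = real n * cmod z ^ (n - 1) * cmod h * norm v"
          by (simp add: norm_mult norm_power)
        ultimately have "norm (F' z h) \<le> \<eta> * cmod z ^ (n - 1) * cmod h + real n * cmod z ^ (n - 1) * cmod h * norm v"
          using norm_triangle_sub[of "F' z h" "(of_nat n * z ^ (n - 1) * h) *s v"] by linarith
        then show "norm (F' z h) \<le> (\<eta> * cmod h + real n * cmod h * norm v) * cmod z ^ (n - 1)" by (simp add: algebra_simps)
      qed
      have "((\<lambda>z::complex. (\<eta> * cmod h + real n * cmod h * norm v) * cmod z ^ (n - 1)) \<longlongrightarrow> (\<eta> * cmod h + real n * cmod h * norm v) * cmod 0 ^ (n - 1)) (at 0)"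
        by (intro tendsto_intros)
      then show "((\<lambda>z::complex. (\<eta> * cmod h + real n * cmod h * norm v) * cmod z ^ (n - 1)) \<longlongrightarrow> 0) (at 0)"
        using n by (simp add: power_0_left)
    qed
    ultimately show ?thesis by (intro tendsto_unique[of "at 0"]) auto
  qed
  have "cusp J F F' \<delta> L v n u q \<eta> \<kappa> e"
  proof (intro cusp.intro cusp_axioms.intro)
    show "J_curve J F F' \<delta> L" by (rule curve) (use \<delta>(1) \<delta>'(1) in \<open>auto simp: \<delta>0_def\<close>)
    show "continuous_on (ball 0 e) J"
      by (rule continuous_on_subset[OF lipschitz_on_continuous_on[OF Jlip(1)]]) (use e in auto)
    show "norm (J y - smult_blinfun \<i>) \<le> L * norm y" if "norm y < e" for y
      using Lipn[of y 0] that e Jlip(2) by (simp add: J0)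
    show "J y (J y \<xi>) = - \<xi>" if "norm y < e" for y \<xi> using that e by (intro J2) simp
    fix z :: complex
    show "norm (F z) < e" if "cmod z < \<delta>" using that \<delta>' by (intro \<delta>2(2)) simp
    show "norm (F z - z ^ n *s v) \<le> \<eta> * cmod z ^ n" if "cmod z < \<delta>" using that \<delta>' by (intro \<delta>3(2)) simp
    show "norm (F' z h - (of_nat n * z ^ (n - 1) * h) *s v) \<le> \<eta> * cmod z ^ (n - 1) * cmod h" if "cmod z < \<delta>" for h
    proof (cases "z = 0")
      case True
      then show ?thesis using n \<eta>(1) by (simp add: F'0 power_0_left)
    next
      case False
      then show ?thesis using that \<delta>' by (intro \<delta>4(2)) simp_all
    qed
    show "norm (F (\<zeta> * z) - F z - z ^ q \<zeta> *s u \<zeta>) \<le> \<eta> * cmod z ^ q \<zeta>" if "\<zeta> ^ n = 1" "\<zeta> \<noteq> 1" "cmod z < \<delta>" for \<zeta>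
      using d[of \<zeta>] \<delta>d[of \<zeta>] that by auto
    show "herm v (u \<zeta>) = 0 \<and> 4 * norm v * \<eta> \<le> cmod (cdet v (u \<zeta>))" "q \<zeta> \<ge> n" if "\<zeta> ^ n = 1" "\<zeta> \<noteq> 1" for \<zeta>
      using u[OF that] \<eta>u[OF that] by simp_all
  qed (rule v n \<delta>' \<eta>(1) \<eta>v \<kappa> e; assumption)+
  with \<delta>(1) \<delta>'(5) that show thesis by blast
qed

theorem proposition8p3:
  fixes A :: "'a::{t2_space,second_countable_topology} chart set"
    and J :: "'a endo_field"
    and u :: "complex \<Rightarrow> 'a"
    and c :: "'a chart"
    and p :: "nat \<Rightarrow> nat" and l :: nat
  assumes "Lipschitz_almost_complex_surface A J"
    and "pseudoholomorphic_on A J u (ball 0 1)"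
    and "primitive_on u (ball 0 1)"
    and "adapted_coordinates A J (u 0) c"
    and "has_singularity_type J u c p l"
  shows "has_cusp_index J u c
    (1 / 2 * (\<Sum>i=1..l. (real (gcd_upto p (i - 1)) - real (gcd_upto p i)) * (real (p i) - 1)))"
proof -
  let ?J = "coord_J J c"
  have c: "c \<in> A" "u 0 \<in> fst c" "snd c (u 0) = 0" "snd c ` fst c = ball 0 1" "\<And>\<xi>. J c (u 0) \<xi> = \<i> *s \<xi>"
    using assms(4) by (auto simp: adapted_coordinates_def)
  have A: "smooth_structure A" "almost_complex A J" "lipschitz_field A J"
    using assms(1) by (auto simp: Lipschitz_almost_complex_surface_def)
  have "is_chart c" using A(1) c(1) by (simp add: smooth_structure_def)
  then have "homeomorphism (fst c) (snd c ` fst c) (snd c) (chart_inv c)" by (simp add: is_chart_def)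
  then have inv: "chart_inv c 0 = u 0" using homeomorphism_apply1[OF _ c(2)] c(3) by metis
  have "0 \<in> snd c ` fst c" by (simp add: c(4))
  then obtain e1 L where e1: "e1 > 0" "ball 0 e1 \<subseteq> snd c ` fst c" "L-lipschitz_on (ball 0 e1) ?J"
    using A(3) c(1) unfolding lipschitz_field_def by blast
  have J2: "?J y (?J y \<xi>) = - \<xi>" if "norm y < e1" for y \<xi>
  proof -
    have "y \<in> snd c ` fst c" using that e1(2) by auto
    then have "chart_inv c y \<in> fst c" unfolding chart_inv_def by (rule inv_into_into)
    then show ?thesis using A(2) c(1) unfolding almost_complex_def coord_J_def by blast
  qed
  have J0: "?J 0 = smult_blinfun \<i>"
    by (rule blinfun_eqI) (simp add: coord_J_def inv c(5))
  obtain v w \<phi> r0 where type: "p 0 \<ge> 2" "\<forall>i<l. p i < p (Suc i)" "gcd_upto p l = 1" "v 0 \<noteq> 0"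
    "\<forall>i\<in>{1..l}. v i \<noteq> 0 \<and> hermitian_orthogonal (v i) (v 0)" "r0 > 0"
    "\<forall>i\<le>l. w i ` ball 0 r0 \<subseteq> ball 0 1 \<and> J_holomorphic_on ?J (w i) (ball 0 r0) \<and> primitive_on (w i) (ball 0 r0)"
    "Polynomial.coeff \<phi> 0 = 0" "Polynomial.coeff \<phi> 1 = 1" "O_order (\<lambda>z. w 0 z - z *s v 0) 1"
    "\<forall>i<l. O_order (\<lambda>z. snd c (u (poly \<phi> z)) - w i (z ^ gcd_upto p i) - (z ^ p (Suc i)) *s v (Suc i)) (p (Suc i))"
    "\<forall>z\<in>ball 0 r0. poly \<phi> z \<in> ball 0 1 \<and> u (poly \<phi> z) \<in> fst c \<and> w l z = snd c (u (poly \<phi> z))"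
    using assms(5) unfolding has_singularity_type_def by (elim conjE exE) (rule that; assumption)
  \<comment> \<open>The branch in the chart after the polynomial change of parameter. Near 0 it
    coincides with \<open>w l\<close>, from which it inherits holomorphicity.\<close>
  define F where "F z = snd c (u (poly \<phi> z))" for z
  have F0: "F 0 = 0" using type(8) c(3) by (simp add: F_def poly_0_coeff_0)
  define n where "n = p 0"
  have n: "n \<ge> 2" "n \<ge> 1" using type(1) by (simp_all add: n_def)
  have mono: "p i \<ge> n" if "i \<le> l" for i
    using that
  proof (induction i)
    case (Suc i)
    then show ?case using type(2) by (metis Suc_le_eq less_imp_le_nat order.trans)
  qed (simp add: n_def)
  \<comment> \<open>For \<open>l = 0\<close> the gcd would be \<open>p 0 \<ge> 2\<close> instead of
    1.\<close>
  have l: "l > 0"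
  proof (rule ccontr)
    assume "\<not> l > 0"
    then show False using type(3) n by (simp add: gcd_upto_0 n_def)
  qed
  have hol: "J_holomorphic_on ?J F (ball 0 r0)"
  proof -
    obtain f' where f': "continuous_on (ball 0 r0) f'"
      "\<forall>z\<in>ball 0 r0. (w l has_derivative blinfun_apply (f' z)) (at z) \<and> f' z 1 + ?J (w l z) (f' z \<i>) = 0"
      using type(7) unfolding J_holomorphic_on_def by blast
    have eq: "w l z = F z" if "z \<in> ball 0 r0" for z using type(12) that by (simp add: F_def)
    show ?thesis unfolding J_holomorphic_on_def
    proof (intro exI[of _ f'] conjI f'(1) ballI)
      fix z :: complex assume z: "z \<in> ball 0 r0"
      show "(F has_derivative blinfun_apply (f' z)) (at z)"
        by (rule has_derivative_transform_within_open[OF _ open_ball z eq]) (use f'(2) z in auto)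
      show "f' z 1 + ?J (F z) (f' z \<i>) = 0" using f'(2) z eq[OF z] by metis
    qed
  qed
  define q where "q \<zeta> = p (root_index p \<zeta>)" for \<zeta>
  define U where "U \<zeta> = (\<zeta> ^ q \<zeta> - 1) *s v (root_index p \<zeta>)" for \<zeta>
  have asym: "\<exists>d>0. \<forall>z. cmod z < d \<longrightarrow> norm (F z - z ^ n *s v 0) \<le> \<eta> * cmod z ^ n" if "\<eta> > 0" for \<eta>
  proof (rule branch_asymptotics[where f = F and ?w0.0 = "w 0" and ?v0.0 = "v 0" and ?v1.0 = "v (Suc 0)" and m = "p (Suc 0)",
        OF n(2) _ type(10) _ F0 that])
    show "n < p (Suc 0)" using type(2) l by (simp add: n_def)
    show "O_order (\<lambda>z. F z - w 0 (z ^ n) - (z ^ p (Suc 0)) *s v (Suc 0)) (p (Suc 0))"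
      using type(11) l by (auto simp: F_def n_def gcd_upto_0)
  qed
  have root: "\<exists>d>0. \<forall>z. cmod z < d \<longrightarrow> norm (F (\<zeta> * z) - F z - z ^ q \<zeta> *s U \<zeta>) \<le> \<eta> * cmod z ^ q \<zeta>"
    if "\<zeta> ^ n = 1" "\<zeta> \<noteq> 1" "\<eta> > 0" for \<zeta> \<eta>
    unfolding q_def U_def
  proof (rule branch_root_difference[where f = F and w = w and l = l])
    show "\<zeta> ^ p 0 = 1" "\<zeta> \<noteq> 1" "gcd_upto p l = 1" "\<eta> > 0" using that type(3) by (simp_all add: n_def)
    show "1 \<le> p 0" using n by (simp add: n_def)
    show "0 < p i" if "i \<le> l" for i using mono[OF that] n by simp
    show "O_order (\<lambda>z. F z - w i (z ^ gcd_upto p i) - (z ^ p (Suc i)) *s v (Suc i)) (p (Suc i))" if "i < l" for i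
      using type(11) that by (simp add: F_def)
  qed
  have U: "herm (v 0) (U \<zeta>) = 0 \<and> U \<zeta> \<noteq> 0 \<and> q \<zeta> \<ge> n" if \<zeta>: "\<zeta> ^ n = 1" "\<zeta> \<noteq> 1" for \<zeta>
  proof -
    note ix = root_index[OF \<zeta>(1)[unfolded n_def] \<zeta>(2) type(3)]
    have vi: "v (root_index p \<zeta>) \<noteq> 0" "hermitian_orthogonal (v (root_index p \<zeta>)) (v 0)" using type(5) ix(1,2) by auto
    have "herm (v 0) (v (root_index p \<zeta>)) = 0"
      using vi(2) by (simp add: hermitian_orthogonal_def herm_def sum_2)
    then show ?thesis unfolding U_def q_def herm_simps(3) vector_mul_eq_0 using vi(1) ix(5) mono[OF ix(2)] by simp
  qed
  \<comment> \<open>The cusp index refers to \<open>u\<close>, the expansions to its composition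
    with \<phi>. As \<phi> is injective near 0, both give the same curve in small spheres.\<close>
  obtain \<rho> where \<rho>: "\<rho> > 0" "inj_on (poly \<phi>) (ball 0 \<rho>)" using poly_locally_injective[OF type(9)] by blast
  have \<rho>0: "min r0 \<rho> > 0" using \<rho>(1) type(6) by simp
  obtain F' \<delta> L' \<eta> \<kappa> e where \<delta>r: "0 < \<delta>" "\<delta> \<le> min r0 \<rho>" and cusp: "cusp ?J F F' \<delta> L' (v 0) n U q \<eta> \<kappa> e"
    by (rule cusp_exists[where J = ?J and F = F and q = q and u = U and n = n and v = "v 0", OF e1(3,1)])
      (assumption | rule J2 J0 hol type(6) F0 type(4) n(1) asym root U \<rho>0 that)+
  interpret cusp ?J F F' \<delta> L' "v 0" n U q \<eta> \<kappa> e by (rule cusp)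
  define b where "b = (\<Sum>\<zeta>\<in>{\<zeta>. \<zeta> ^ n = 1} - {1}. int (q \<zeta>)) - int n"
  have "has_bennequin_index J u c b"
    unfolding has_bennequin_index_def
  proof (rule exI[of _ "min 1 (min e (15/16 * norm (v 0) * (\<delta> / 2) ^ n))"], intro conjI allI impI)
    show "0 < min 1 (min e (15/16 * norm (v 0) * (\<delta> / 2) ^ n))" using \<delta>r(1) norm_v_pos e(1) by simp
    show "min 1 (min e (15/16 * norm (v 0) * (\<delta> / 2) ^ n)) \<le> 1" by simp
    fix r assume "0 < r \<and> r < min 1 (min e (15/16 * norm (v 0) * (\<delta> / 2) ^ n))"
    then have r: "0 < r" "r < e" "r < 15/16 * norm (v 0) * (\<delta> / 2) ^ n" by auto
    have K: "branch_curve u c r = F ` {z. cmod z < \<delta> \<and> norm (F z) = r}"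
    proof (rule branch_curve_eq[OF _ _ _ _ r(1,3)])
      show "continuous_on (ball 0 \<delta>) (poly \<phi>)" by (intro continuous_intros)
      show "inj_on (poly \<phi>) (ball 0 \<delta>)" by (rule inj_on_subset[OF \<rho>(2)]) (use \<delta>r(2) in auto)
      show "poly \<phi> 0 = 0" using type(8) by (simp add: poly_0_coeff_0)
      show "poly \<phi> z \<in> ball 0 1 \<and> u (poly \<phi> z) \<in> fst c \<and> F z = snd c (u (poly \<phi> z))" if "cmod z < \<delta>" for z
        using type(12) \<delta>r(2) that by (simp add: F_def)
    qed
    note bs = bennequin_small_radius[OF r, folded K]
    show "\<exists>\<gamma>. transverse_parametrization ?J (branch_curve u c r) \<gamma>" by (rule bs(1))
    show "\<exists>s. nonvanishing_section ?J r s" by (rule bs(2))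
    fix \<gamma> s assume "transverse_parametrization ?J (branch_curve u c r) \<gamma> \<and> nonvanishing_section ?J r s"
    then show "\<exists>\<epsilon>\<^sub>0>0. \<forall>\<epsilon>. 0 < \<epsilon> \<and> \<epsilon> < \<epsilon>\<^sub>0 \<longrightarrow>
        \<gamma> ` sphere 0 1 \<inter> (pushed r \<epsilon> s \<circ> \<gamma>) ` sphere 0 1 = {} \<and> linking_number \<gamma> (pushed r \<epsilon> s \<circ> \<gamma>) = b"
      unfolding b_def by (intro bs(3)) simp_all
  qed
  moreover have "1 / 2 * (\<Sum>i=1..l. (real (gcd_upto p (i - 1)) - real (gcd_upto p i)) * (real (p i) - 1)) = (real_of_int b + 1) / 2"
    using sum_gcd_upto_formula[of p l] n type(3) unfolding b_def q_def n_def by simp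
  ultimately show ?thesis unfolding has_cusp_index_def by blast
qed

end
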